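(* Let $\mathbb{F}$ be an algebraically closed field of characteristic zero, $\Gamma$ an additive (abelian) group, $\epsilon$ a skew-symmetric bicharacter of $\Gamma$, and let $W=W(\underline k,G)=\mathcal{A}\otimes\mathcal{D}$, $\mathcal{W}=\mathcal{W}(\underline k,G)=\mathcal{A}\otimes\mathbb{F}[\mathcal{D}]$, $\widetilde{\mathcal{W}}=\mathcal{W}/\mathbb{F}$ and $\overline{\mathcal{W}}=[\widetilde{\mathcal{W}},\widetilde{\mathcal{W}}]$ be the $(\epsilon,\Gamma)$-Lie color algebras constructed in the context. Then the Lie color algebras $\overline{\mathcal{W}}$ and $W$ are simple if $k_1+k_2+k_3>0$ or $k_4>1$. Furthermore, $\overline{\mathcal{W}}=\widetilde{\mathcal{W}}$ if $k_1+k_2+k_3>0$; otherwise (i.e. if $k_1+k_2+k_3=0$), $\widetilde{\mathcal{W}}=\overline{\mathcal{W}}+\mathbb{F}\,t^{\underline n}\partial^{\lambda}$, where $\underline n$ and $\lambda$ are the largest elements of $\mathcal{J}$ and of $\mathcal{M}$, respectively (and $t^{\underline n}\partial^\lambda$ denotes its image in $\widetilde{\mathcal{W}}$).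
   Context: **Color notions.** A skew-symmetric bicharacter is a map $\epsilon:\Gamma\times\Gamma\to\mathbb{F}^\times=\mathbb{F}\setminus\{0\}$ with $\epsilon(\lambda,\mu)=\epsilon(\mu,\lambda)^{-1}$ and $\epsilon(\lambda,\mu+\nu)=\epsilon(\lambda,\mu)\epsilon(\lambda,\nu)$. A nonzero homogeneous element $a$ of degree $\lambda\in\Gamma$ in a $\Gamma$-graded space has color $\bar a=\lambda$. An $(\epsilon,\Gamma)$-Lie color algebra is a $\Gamma$-graded space $L$ with a graded bilinear bracket satisfying $[a,b]=-\epsilon(\bar a,\bar b)[b,a]$ and $[a,[b,c]]=[[a,b],c]+\epsilon(\bar a,\bar b)[b,[a,c]]$ for homogeneous $a,b,c$. Any $\Gamma$-graded associative algebra is one via $[x,y]=xy-\epsilon(\bar x,\bar y)yx$ for homogeneous $x,y$. A Lie color ideal is a $\Gamma$-graded subspace $U$ of $L$ with $[L,U]\subset U$; a Lie color algebra is simple if its bracket is nonzero and it has no Lie color ideals other than $0$ and itself. A $\Gamma$-graded associative algebra is $(\epsilon,\Gamma)$-commutative if $xy=\epsilon(\bar x,\bar y)yx$ for homogeneous $x,y$. Here $\mathbb{N}=\{0,1,2,\dots\}$, $\Gamma_+=\{\lambda\mid\epsilon(\lambda,\lambda)=1\}$, $\Gamma_-=\{\lambda\mid\epsilon(\lambda,\lambda)=-1\}$. **The pair $(\mathcal{A},\mathcal{D})$.** Let $\underline k=(k_1,k_2,k_3,k_4)\in\mathbb{N}^4$ with $k=k_1+k_2+k_3+k_4>0$, and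 $k_4=0$ if $\Gamma_-=\emptyset$. Let $G$ be an additive subgroup of $\mathbb{F}^{k_1+k_2}$ containing an $\mathbb{F}$-basis of $\mathbb{F}^{k_1+k_2}$ ($G=\{0\}$ if $k_1+k_2=0$); its elements are written $\underline a=(a_1,\dots,a_k)$ with $a_p=0$ for $p>k_1+k_2$. Let $\widehat{\ }:G\to\Gamma_+$, $\underline a\mapsto\widehat{\underline a}$, be a group homomorphism and $f:G\times G\to\mathbb{F}^\times$ a map with $f(\underline a,\underline b)=\epsilon(\widehat{\underline a},\widehat{\underline b})f(\underline b,\underline a)$, $f(\underline a,0)=1$ and $f(\underline a,\underline b)f(\underline a+\underline b,\underline c)=f(\underline b,\underline c)f(\underline a,\underline b+\underline c)$ for all $\underline a,\underline b,\underline c\in G$. Let $t_{k_1+1},\dots,t_k$ be variables with colors $\bar t_p\in\Gamma$: $\bar t_p=0$ for $k_1<p\le k_1+k_2$, $\bar t_p\in\Gamma_+$ for $k_1+k_2<p\le k_1+k_2+k_3$, $\bar t_p\in\Gamma_-$ for $p>k_1+k_2+k_3$; put $\bar t_p=0$ for $p\le k_1$. Let $\mathcal{J}$ be the set of $\underline i=(i_1,\dots,i_k)$ with $i_p=0$ for $p\le k_1$, $i_p\in\mathbb{N}$ for $k_1<p\le k_1+k_2+k_3$, and $i_p\in\{0,1\}$ for $p>k_1+k_2+k_3$. $\mathcal{A}$ is the $(\epsilon,\Gamma)$-commutative associative algebra with $\mathbb{F}$-basis $x^{\underline a,\underline i}=x^{\underline a}t^{\underline i}$, $(\underline a,\underline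 i)\in G\times\mathcal{J}$, where $t^{\underline i}=t_{k_1+1}^{i_{k_1+1}}\cdots t_k^{i_k}$, where $x^{\underline a,\underline i}$ has color $\widehat{\underline a}+\sum_{p>k_1}i_p\bar t_p$, with identity $x^0=1$ and multiplication $$x^{\underline a,\underline i}\cdot x^{\underline b,\underline j}=\Big(\prod_{p=k_1+1}^k\epsilon(\bar t_p,\widehat{\underline b})^{i_p}\Big)\Big(\prod_{k_1<p<q\le k}\epsilon(\bar t_q,\bar t_p)^{i_qj_p}\Big)f(\underline a,\underline b)\,x^{\underline a+\underline b,\underline i+\underline j},$$ with integer addition in $\underline i+\underline j$ and $x^{\underline a,\underline i}=0$ if $\underline i\notin\mathcal{J}$. For $p=1,\dots,k$ let $\partial_p$ be the color-derivation of $\mathcal{A}$ of color $-\bar t_p$ given by $$\partial_p(x^{\underline a,\underline i})=a_p\,x^{\underline a,\underline i}+\epsilon(-\bar t_p,\widehat{\underline a})\prod_{q=1}^{p-1}\epsilon(-\bar t_p,\bar t_q)^{i_q}\;i_p\,x^{\underline a,\underline i-1_{[p]}},$$ where $1_{[p]}$ is the $k$-tuple with $1$ in position $p$ and $0$ elsewhere, and let $\mathcal{D}=\mathrm{span}_{\mathbb{F}}\{\partial_1,\dots,\partial_k\}$. One has $\partial\partial'=\epsilon(\bar\partial,\bar\partial')\partial'\partial$ for homogeneous $\partial,\partial'\in\mathcal{D}$, and $\{u\in\mathcal{A}\mid\mathcal{D}(u)=0\}=\mathbb{F}$. **The Lie color algebras.** Let $\mathcal{M}=\mathbb{N}^{k_1+k_2+k_3}\times\{0,1\}^{k_4}$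 and let $\mathbb{F}[\mathcal{D}]$ be the $(\epsilon,\Gamma)$-commutative associative algebra with basis $\{\partial^\mu=\partial_1^{\mu_1}\cdots\partial_k^{\mu_k}\mid\mu=(\mu_1,\dots,\mu_k)\in\mathcal{M}\}$ (with $\partial^\mu=0$ if $\mu\notin\mathcal{M}$). Set $$W=\mathcal{A}\otimes\mathcal{D}=\mathrm{span}\{x^{\underline a,\underline i}\partial_p\},\qquad \mathcal{W}=\mathcal{A}\otimes\mathbb{F}[\mathcal{D}]=\mathrm{span}\{x^{\underline a,\underline i}\partial^\mu\mid(\underline a,\underline i,\mu)\in G\times\mathcal{J}\times\mathcal{M}\}.$$ Regarding elements of $\mathcal{W}$ as operators on $\mathcal{A}$ (elements of $\mathcal{A}$ acting by left multiplication), $\mathcal{W}$ is a $\Gamma$-graded associative algebra under composition, hence an $(\epsilon,\Gamma)$-Lie color algebra under $[x,y]=xy-\epsilon(\bar x,\bar y)yx$ (Lie color algebra of generalized Weyl type), with center $\mathbb{F}$; $W$ is a Lie color subalgebra (Lie color algebra of generalized Witt type). Put $\widetilde{\mathcal{W}}=\mathcal{W}/\mathbb{F}$, and let $\overline{\mathcal{W}}=[\widetilde{\mathcal{W}},\widetilde{\mathcal{W}}]$ be its derived algebra. When $k_1+k_2+k_3=0$, $\mathcal{J}=\mathcal{M}=\{0,1\}^{k_4}$ are finite, and their largest elements are $(1,\dots,1)$. *)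

theory Defs
  imports
    "HOL-Algebra.QuotRing"
    "HOL-Algebra.Module"
    "HOL-Algebra.Algebraic_Closure_Type"
    "HOL-Library.Function_Algebras"
    "HOL-Library.Poly_Mapping"
begin

section \<open>Lie color algebras\<close>

text \<open>
  The ground field is a type \<open>'f\<close>, turned into a structure by \<^const>\<open>ring_of_type_algebra\<close>; the
  grading group is a type \<open>'g\<close>. The record field \<^const>\<open>monoid.mult\<close> holds the product of an arbitrary, not
  necessarily associative, algebra; for Lie color algebras it is the bracket, and then
  the record field \<^const>\<open>one\<close> inherited from \<^typ>\<open>('f, 'v) module\<close> has no meaning.
\<close>

record ('f, 'g, 'v) graded_algebra = "('f, 'v) module" +
  homog :: "'g \<Rightarrow> 'v set"

abbreviation subspace_of ::
    "('f::field, 'v, 'm) module_scheme \<Rightarrow> 'v set \<Rightarrow> bool" where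
  "subspace_of M H \<equiv> submodule H ring_of_type_algebra M"

definition span_in :: "('f::field, 'v, 'm) module_scheme \<Rightarrow> 'v set \<Rightarrow> 'v set" where
  "span_in M S = subspace_of M hull S"

definition color_decomp ::
    "('f, 'g, 'v, 'm) graded_algebra_scheme \<Rightarrow> 'v \<Rightarrow> ('g \<Rightarrow> 'v) \<Rightarrow> bool" where
  "color_decomp M x c \<longleftrightarrow>
     (\<forall>\<kappa>. c \<kappa> \<in> homog M \<kappa>) \<and> finite {\<kappa>. c \<kappa> \<noteq> \<zero>\<^bsub>M\<^esub>} \<and>
     x = (\<Oplus>\<^bsub>M\<^esub>\<kappa>\<in>{\<kappa>. c \<kappa> \<noteq> \<zero>\<^bsub>M\<^esub>}. c \<kappa>)"

definition color_component ::
    "('f, 'g, 'v, 'm) graded_algebra_scheme \<Rightarrow> 'v \<Rightarrow> 'g \<Rightarrow> 'v" where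
  "color_component M x = (THE c. color_decomp M x c)"

locale skew_bicharacter =
  fixes \<epsilon> :: "'g::ab_group_add \<Rightarrow> 'g \<Rightarrow> 'f::field"
  assumes eps_nonzero: "\<epsilon> \<kappa> \<mu> \<noteq> 0"
    and eps_skew: "\<epsilon> \<kappa> \<mu> = inverse (\<epsilon> \<mu> \<kappa>)"
    and eps_add: "\<epsilon> \<kappa> (\<mu> + \<nu>) = \<epsilon> \<kappa> \<mu> * \<epsilon> \<kappa> \<nu>"

locale graded_space = Module.module "ring_of_type_algebra :: 'f ring" M
  for M :: "('f::field, 'g::ab_group_add, 'v, 'm) graded_algebra_scheme" (structure) +
  assumes homog_subspace: "subspace_of M (homog M \<kappa>)"
    and homog_direct_sum: "x \<in> carrier M \<Longrightarrow> \<exists>!c. color_decomp M x c"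

locale color_graded_algebra = graded_space M
  for M :: "('f::field, 'g::ab_group_add, 'v, 'm) graded_algebra_scheme" (structure) +
  assumes prod_closed: "\<lbrakk>x \<in> carrier M; y \<in> carrier M\<rbrakk> \<Longrightarrow> x \<otimes> y \<in> carrier M"
    and prod_add_left:
      "\<lbrakk>x \<in> carrier M; y \<in> carrier M; z \<in> carrier M\<rbrakk> \<Longrightarrow> (x \<oplus> y) \<otimes> z = (x \<otimes> z) \<oplus> (y \<otimes> z)"
    and prod_add_right:
      "\<lbrakk>x \<in> carrier M; y \<in> carrier M; z \<in> carrier M\<rbrakk> \<Longrightarrow> z \<otimes> (x \<oplus> y) = (z \<otimes> x) \<oplus> (z \<otimes> y)"
    and prod_smult_left:
      "\<lbrakk>x \<in> carrier M; y \<in> carrier M\<rbrakk> \<Longrightarrow> (r \<odot>\<^bsub>M\<^esub> x) \<otimes> y = r \<odot>\<^bsub>M\<^esub> (x \<otimes> y)"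
    and prod_smult_right:
      "\<lbrakk>x \<in> carrier M; y \<in> carrier M\<rbrakk> \<Longrightarrow> x \<otimes> (r \<odot>\<^bsub>M\<^esub> y) = r \<odot>\<^bsub>M\<^esub> (x \<otimes> y)"
    and prod_homog: "\<lbrakk>x \<in> homog M \<kappa>; y \<in> homog M \<mu>\<rbrakk> \<Longrightarrow> x \<otimes> y \<in> homog M (\<kappa> + \<mu>)"

locale lie_color_algebra = skew_bicharacter \<epsilon> + color_graded_algebra L
  for \<epsilon> :: "'g::ab_group_add \<Rightarrow> 'g \<Rightarrow> 'f::field"
    and L :: "('f, 'g, 'v, 'm) graded_algebra_scheme" (structure) +
  assumes bracket_skew:
      "\<lbrakk>a \<in> homog L \<alpha>; b \<in> homog L \<beta>\<rbrakk> \<Longrightarrow> a \<otimes> b = \<ominus> (\<epsilon> \<alpha> \<beta> \<odot>\<^bsub>L\<^esub> (b \<otimes> a))"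
    and bracket_Jacobi:
      "\<lbrakk>a \<in> homog L \<alpha>; b \<in> homog L \<beta>; c \<in> homog L \<gamma>\<rbrakk> \<Longrightarrow>
        a \<otimes> (b \<otimes> c) = ((a \<otimes> b) \<otimes> c) \<oplus> (\<epsilon> \<alpha> \<beta> \<odot>\<^bsub>L\<^esub> (b \<otimes> (a \<otimes> c)))"

definition graded_subspace ::
    "('f::field, 'g, 'v, 'm) graded_algebra_scheme \<Rightarrow> 'v set \<Rightarrow> bool" where
  "graded_subspace M U \<longleftrightarrow>
     subspace_of M U \<and> (\<forall>x\<in>U. \<forall>\<kappa>. color_component M x \<kappa> \<in> U)"

definition lie_color_ideal ::
    "('f::field, 'g, 'v, 'm) graded_algebra_scheme \<Rightarrow> 'v set \<Rightarrow> bool" where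
  "lie_color_ideal L U \<longleftrightarrow>
     graded_subspace L U \<and> (\<forall>x\<in>carrier L. \<forall>u\<in>U. x \<otimes>\<^bsub>L\<^esub> u \<in> U)"

definition simple_lie_color_algebra ::
    "('g::ab_group_add \<Rightarrow> 'g \<Rightarrow> 'f::field) \<Rightarrow>
     ('f, 'g, 'v, 'm) graded_algebra_scheme \<Rightarrow> bool" where
  "simple_lie_color_algebra \<epsilon> L \<longleftrightarrow>
     lie_color_algebra \<epsilon> L \<and>
     (\<exists>x\<in>carrier L. \<exists>y\<in>carrier L. x \<otimes>\<^bsub>L\<^esub> y \<noteq> \<zero>\<^bsub>L\<^esub>) \<and>
     (\<forall>U. lie_color_ideal L U \<longrightarrow> U = {\<zero>\<^bsub>L\<^esub>} \<or> U = carrier L)"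

text \<open>
  The bilinear extension of \<open>[x, y] = x y - \<epsilon>(\<kappa>, \<mu>) y x\<close> for \<open>x\<close> of color \<open>\<kappa>\<close> and \<open>y\<close> of color \<open>\<mu>\<close>.
\<close>
definition color_commutator ::
    "('g \<Rightarrow> 'g \<Rightarrow> 'f) \<Rightarrow> ('f, 'g, 'v, 'm) graded_algebra_scheme \<Rightarrow> 'v \<Rightarrow> 'v \<Rightarrow> 'v" where
  "color_commutator \<epsilon> M x y =
     (let c = color_component M x; d = color_component M y in
       \<Oplus>\<^bsub>M\<^esub>\<kappa>\<in>{\<kappa>. c \<kappa> \<noteq> \<zero>\<^bsub>M\<^esub>}. \<Oplus>\<^bsub>M\<^esub>\<mu>\<in>{\<mu>. d \<mu> \<noteq> \<zero>\<^bsub>M\<^esub>}.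
         (c \<kappa> \<otimes>\<^bsub>M\<^esub> d \<mu>) \<ominus>\<^bsub>M\<^esub> (\<epsilon> \<kappa> \<mu> \<odot>\<^bsub>M\<^esub> (d \<mu> \<otimes>\<^bsub>M\<^esub> c \<kappa>)))"

definition commutator_algebra ::
    "('g \<Rightarrow> 'g \<Rightarrow> 'f) \<Rightarrow> ('f, 'g, 'v) graded_algebra \<Rightarrow> ('f, 'g, 'v) graded_algebra" where
  "commutator_algebra \<epsilon> M = M\<lparr>monoid.mult := color_commutator \<epsilon> M\<rparr>"

definition restrict_algebra ::
    "('f, 'g, 'v) graded_algebra \<Rightarrow> 'v set \<Rightarrow> ('f, 'g, 'v) graded_algebra" where
  "restrict_algebra M S = M\<lparr>carrier := S, homog := (\<lambda>\<kappa>. homog M \<kappa> \<inter> S)\<rparr>"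

definition derived_algebra ::
    "('f::field, 'g, 'v) graded_algebra \<Rightarrow> ('f, 'g, 'v) graded_algebra" where
  "derived_algebra L =
     restrict_algebra L (span_in L {x \<otimes>\<^bsub>L\<^esub> y |x y. x \<in> carrier L \<and> y \<in> carrier L})"

text \<open>The counterpart of \<^const>\<open>FactRing\<close>: the elements are the cosets \<open>I + x\<close>.\<close>
definition quotient_algebra ::
    "('f, 'g, 'v) graded_algebra \<Rightarrow> 'v set \<Rightarrow> ('f, 'g, 'v set) graded_algebra" where
  "quotient_algebra M I =
     \<lparr>carrier = a_rcosets\<^bsub>M\<^esub> I, monoid.mult = rcoset_mult M I, one = I +>\<^bsub>M\<^esub> \<one>\<^bsub>M\<^esub>,
      zero = I, add = set_add M,
      module.smult = (\<lambda>r Y. \<Union>x\<in>Y. I +>\<^bsub>M\<^esub> (r \<odot>\<^bsub>M\<^esub> x)),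
      homog = (\<lambda>\<kappa>. {I +>\<^bsub>M\<^esub> x |x. x \<in> homog M \<kappa>})\<rparr>"


section \<open>The data of the construction\<close>

text \<open>
  A \<open>k\<close>-tuple is a function on \<^typ>\<open>nat\<close> that vanishes outside \<open>{1..k}\<close>. In particular an element of
  \<open>G\<close> is already written as \<open>(a\<^sub>1, \<dots>, a\<^sub>k)\<close> with \<open>a\<^sub>p = 0\<close> for \<open>p > k\<^sub>1 + k\<^sub>2\<close>.
  The functions \<open>hat\<close> and \<open>cocyc\<close> (the map \<open>f\<close>) matter only on \<open>G\<close>.
\<close>

record ('f, 'g) weyl_data =
  eps :: "'g \<Rightarrow> 'g \<Rightarrow> 'f"
  k1 :: nat
  k2 :: nat
  k3 :: nat
  k4 :: nat
  Grp :: "(nat \<Rightarrow> 'f) set"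
  hat :: "(nat \<Rightarrow> 'f) \<Rightarrow> 'g"
  cocyc :: "(nat \<Rightarrow> 'f) \<Rightarrow> (nat \<Rightarrow> 'f) \<Rightarrow> 'f"
  tcol :: "nat \<Rightarrow> 'g"

definition ktot :: "('f, 'g) weyl_data \<Rightarrow> nat" where
  "ktot D = k1 D + k2 D + k3 D + k4 D"

definition Gamma_plus :: "('f::field, 'g) weyl_data \<Rightarrow> 'g set" where
  "Gamma_plus D = {\<kappa>. eps D \<kappa> \<kappa> = 1}"

definition Gamma_minus :: "('f::field, 'g) weyl_data \<Rightarrow> 'g set" where
  "Gamma_minus D = {\<kappa>. eps D \<kappa> \<kappa> = - 1}"

interpretation tuples: vector_space "\<lambda>(c::'f::field) (v::nat \<Rightarrow> 'f) p. c * v p"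
  by unfold_locales (auto simp: fun_eq_iff algebra_simps)

locale weyl_setup =
  fixes D :: "('f::field, 'g::ab_group_add) weyl_data"
  assumes bichar: "skew_bicharacter (eps D)"
    and k_pos: "ktot D > 0"
    and k4_zero: "Gamma_minus D = {} \<Longrightarrow> k4 D = 0"
    and G_zero: "0 \<in> Grp D"
    and G_add: "\<lbrakk>a \<in> Grp D; b \<in> Grp D\<rbrakk> \<Longrightarrow> a + b \<in> Grp D"
    and G_uminus: "a \<in> Grp D \<Longrightarrow> - a \<in> Grp D"
    and G_tuples: "Grp D \<subseteq> {v. \<forall>p. p \<notin> {1..k1 D + k2 D} \<longrightarrow> v p = 0}"
    and G_basis: "\<exists>B\<subseteq>Grp D. tuples.independent B \<and>
          tuples.span B = {v. \<forall>p. p \<notin> {1..k1 D + k2 D} \<longrightarrow> v p = 0}"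
    and hat_Gamma_plus: "a \<in> Grp D \<Longrightarrow> hat D a \<in> Gamma_plus D"
    and hat_add: "\<lbrakk>a \<in> Grp D; b \<in> Grp D\<rbrakk> \<Longrightarrow> hat D (a + b) = hat D a + hat D b"
    and cocyc_nonzero: "\<lbrakk>a \<in> Grp D; b \<in> Grp D\<rbrakk> \<Longrightarrow> cocyc D a b \<noteq> 0"
    and cocyc_comm: "\<lbrakk>a \<in> Grp D; b \<in> Grp D\<rbrakk> \<Longrightarrow>
          cocyc D a b = eps D (hat D a) (hat D b) * cocyc D b a"
    and cocyc_zero: "a \<in> Grp D \<Longrightarrow> cocyc D a 0 = 1"
    and cocyc_assoc: "\<lbrakk>a \<in> Grp D; b \<in> Grp D; c \<in> Grp D\<rbrakk> \<Longrightarrow>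
          cocyc D a b * cocyc D (a + b) c = cocyc D b c * cocyc D a (b + c)"
    and tcol_zero: "p \<in> {1..k1 D + k2 D} \<Longrightarrow> tcol D p = 0"
    and tcol_plus: "p \<in> {k1 D + k2 D + 1..k1 D + k2 D + k3 D} \<Longrightarrow> tcol D p \<in> Gamma_plus D"
    and tcol_minus: "p \<in> {k1 D + k2 D + k3 D + 1..ktot D} \<Longrightarrow> tcol D p \<in> Gamma_minus D"

definition Jset :: "('f, 'g) weyl_data \<Rightarrow> (nat \<Rightarrow> nat) set" where
  "Jset D = {i. (\<forall>p. p \<notin> {k1 D + 1..ktot D} \<longrightarrow> i p = 0) \<and>
                (\<forall>p>k1 D + k2 D + k3 D. i p \<le> 1)}"

definition Mset :: "('f, 'g) weyl_data \<Rightarrow> (nat \<Rightarrow> nat) set" where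
  "Mset D = {\<mu>. (\<forall>p. p \<notin> {1..ktot D} \<longrightarrow> \<mu> p = 0) \<and>
                (\<forall>p>k1 D + k2 D + k3 D. \<mu> p \<le> 1)}"


section \<open>The algebra \<open>\<A>\<close> and its color derivations\<close>

type_synonym 'f expo = "(nat \<Rightarrow> 'f) \<times> (nat \<Rightarrow> nat)"

text \<open>
  An element of \<open>\<A>\<close> is a finitely supported family of coefficients on \<open>G \<times> \<J>\<close>. The convention
  that \<open>x\<^bsup>a,i\<^esup> = 0\<close> for \<open>i \<notin> \<J>\<close> is part of \<open>xmon\<close>.
\<close>

definition xmon :: "('f::field, 'g) weyl_data \<Rightarrow> (nat \<Rightarrow> 'f) \<Rightarrow> (nat \<Rightarrow> nat) \<Rightarrow> 'f expo \<Rightarrow>\<^sub>0 'f" where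
  "xmon D a i = (if a \<in> Grp D \<and> i \<in> Jset D then Poly_Mapping.single (a, i) 1 else 0)"

definition scale :: "'f::field \<Rightarrow> ('x \<Rightarrow>\<^sub>0 'f) \<Rightarrow> ('x \<Rightarrow>\<^sub>0 'f)" where
  "scale r u = Poly_Mapping.map ((*) r) u"

definition nmult :: "nat \<Rightarrow> 'g::ab_group_add \<Rightarrow> 'g" where
  "nmult n \<kappa> = (\<Sum>_<n. \<kappa>)"

definition xcolor ::
    "('f, 'g::ab_group_add) weyl_data \<Rightarrow> (nat \<Rightarrow> 'f) \<Rightarrow> (nat \<Rightarrow> nat) \<Rightarrow> 'g" where
  "xcolor D a i = hat D a + (\<Sum>p = k1 D + 1..ktot D. nmult (i p) (tcol D p))"

definition mult_coeff ::
    "('f::field, 'g) weyl_data \<Rightarrow> 'f expo \<Rightarrow> 'f expo \<Rightarrow> 'f" where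
  "mult_coeff D = (\<lambda>(a, i) (b, j).
     (\<Prod>p = k1 D + 1..ktot D. eps D (tcol D p) (hat D b) ^ i p) *
     (\<Prod>q = k1 D + 1..ktot D. \<Prod>p = k1 D + 1..<q. eps D (tcol D q) (tcol D p) ^ (i q * j p)) *
     cocyc D a b)"

definition A_mult ::
    "('f::field, 'g) weyl_data \<Rightarrow> ('f expo \<Rightarrow>\<^sub>0 'f) \<Rightarrow> ('f expo \<Rightarrow>\<^sub>0 'f) \<Rightarrow> ('f expo \<Rightarrow>\<^sub>0 'f)" where
  "A_mult D u v =
     (\<Sum>(a, i)\<in>Poly_Mapping.keys u. \<Sum>(b, j)\<in>Poly_Mapping.keys v.
        scale (Poly_Mapping.lookup u (a, i) * Poly_Mapping.lookup v (b, j) * mult_coeff D (a, i) (b, j))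
              (xmon D (a + b) (i + j)))"

definition A_alg ::
    "('f::field, 'g::ab_group_add) weyl_data \<Rightarrow> ('f, 'g, 'f expo \<Rightarrow>\<^sub>0 'f) graded_algebra" where
  "A_alg D =
     \<lparr>carrier = {u. Poly_Mapping.keys u \<subseteq> Grp D \<times> Jset D}, monoid.mult = A_mult D, one = xmon D 0 0,
      zero = 0, add = (+), module.smult = scale,
      homog = (\<lambda>\<kappa>. {u. Poly_Mapping.keys u \<subseteq> {(a, i). a \<in> Grp D \<and> i \<in> Jset D \<and> xcolor D a i = \<kappa>}})\<rparr>"

text \<open>
  In the second summand the truncated subtraction for \<open>i\<^sub>p = 0\<close> does no harm, because of the
  factor \<open>i\<^sub>p\<close>.
\<close>
definition deriv_mon ::
    "('f::field, 'g::ab_group_add) weyl_data \<Rightarrow> nat \<Rightarrow> 'f expo \<Rightarrow> ('f expo \<Rightarrow>\<^sub>0 'f)" where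
  "deriv_mon D p = (\<lambda>(a, i).
     scale (a p) (xmon D a i) +
     scale (eps D (- tcol D p) (hat D a) *
            (\<Prod>q = 1..<p. eps D (- tcol D p) (tcol D q) ^ i q) * of_nat (i p))
           (xmon D a (i(p := i p - 1))))"

definition deriv ::
    "('f::field, 'g::ab_group_add) weyl_data \<Rightarrow> nat \<Rightarrow> ('f expo \<Rightarrow>\<^sub>0 'f) \<Rightarrow> ('f expo \<Rightarrow>\<^sub>0 'f)" where
  "deriv D p u = (\<Sum>(a, i)\<in>Poly_Mapping.keys u. scale (Poly_Mapping.lookup u (a, i)) (deriv_mon D p (a, i)))"


section \<open>The Lie color algebras of generalized Weyl and Witt type\<close>

text \<open>Endomorphisms are represented by functions that are \<^const>\<open>undefined\<close> off the carrier.\<close>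
definition end_alg :: "('f, 'v, 'm) module_scheme \<Rightarrow> ('f, 'v \<Rightarrow> 'v) module" where
  "end_alg A =
     \<lparr>carrier = {T \<in> carrier A \<rightarrow>\<^sub>E carrier A.
        (\<forall>u\<in>carrier A. \<forall>v\<in>carrier A. T (u \<oplus>\<^bsub>A\<^esub> v) = T u \<oplus>\<^bsub>A\<^esub> T v) \<and>
        (\<forall>r. \<forall>u\<in>carrier A. T (r \<odot>\<^bsub>A\<^esub> u) = r \<odot>\<^bsub>A\<^esub> T u)},
      monoid.mult = compose (carrier A), one = (\<lambda>u\<in>carrier A. u),
      zero = (\<lambda>u\<in>carrier A. \<zero>\<^bsub>A\<^esub>), add = (\<lambda>S T. \<lambda>u\<in>carrier A. S u \<oplus>\<^bsub>A\<^esub> T u),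
      module.smult = (\<lambda>r T. \<lambda>u\<in>carrier A. r \<odot>\<^bsub>A\<^esub> T u)\<rparr>"

type_synonym 'f oper = "('f expo \<Rightarrow>\<^sub>0 'f) \<Rightarrow> ('f expo \<Rightarrow>\<^sub>0 'f)"

abbreviation End_A :: "('f::field, 'g::ab_group_add) weyl_data \<Rightarrow> ('f, 'f oper) module" where
  "End_A D \<equiv> end_alg (A_alg D)"

definition x_op ::
    "('f::field, 'g::ab_group_add) weyl_data \<Rightarrow> (nat \<Rightarrow> 'f) \<Rightarrow> (nat \<Rightarrow> nat) \<Rightarrow> 'f oper" where
  "x_op D a i = (\<lambda>u\<in>carrier (A_alg D). xmon D a i \<otimes>\<^bsub>A_alg D\<^esub> u)"

definition del_op :: "('f::field, 'g::ab_group_add) weyl_data \<Rightarrow> nat \<Rightarrow> 'f oper" where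
  "del_op D p = (\<lambda>u\<in>carrier (A_alg D). deriv D p u)"

text \<open>\<open>\<partial>\<^sup>\<mu> = \<partial>\<^sub>1\<^bsup>\<mu>\<^sub>1\<^esup> \<cdots> \<partial>\<^sub>k\<^bsup>\<mu>\<^sub>k\<^esup>\<close>, in this order.\<close>
definition del_pow :: "('f::field, 'g::ab_group_add) weyl_data \<Rightarrow> (nat \<Rightarrow> nat) \<Rightarrow> 'f oper" where
  "del_pow D \<mu> =
     foldr (\<lambda>p T. (del_op D p [^]\<^bsub>End_A D\<^esub> \<mu> p) \<otimes>\<^bsub>End_A D\<^esub> T) [1..<ktot D + 1] \<one>\<^bsub>End_A D\<^esub>"

definition weyl_mon ::
    "('f::field, 'g::ab_group_add) weyl_data \<Rightarrow>
     (nat \<Rightarrow> 'f) \<Rightarrow> (nat \<Rightarrow> nat) \<Rightarrow> (nat \<Rightarrow> nat) \<Rightarrow> 'f oper" where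
  "weyl_mon D a i \<mu> = x_op D a i \<otimes>\<^bsub>End_A D\<^esub> del_pow D \<mu>"

definition weyl_color ::
    "('f, 'g::ab_group_add) weyl_data \<Rightarrow>
     (nat \<Rightarrow> 'f) \<Rightarrow> (nat \<Rightarrow> nat) \<Rightarrow> (nat \<Rightarrow> nat) \<Rightarrow> 'g" where
  "weyl_color D a i \<mu> = xcolor D a i - (\<Sum>p = 1..ktot D. nmult (\<mu> p) (tcol D p))"

text \<open>
  The associative algebra \<open>\<A> \<otimes> \<F>[\<D>]\<close>, as the algebra of operators on \<open>\<A>\<close> spanned by the
  \<open>x\<^bsup>a,i\<^esup> \<partial>\<^sup>\<mu>\<close>; these operators are linearly independent because the field has characteristic 0 and
  \<open>G\<close> spans.
\<close>
definition weyl_assoc ::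
    "('f::field, 'g::ab_group_add) weyl_data \<Rightarrow> ('f, 'g, 'f oper) graded_algebra" where
  "weyl_assoc D =
     \<lparr>carrier = span_in (End_A D)
        {weyl_mon D a i \<mu> |a i \<mu>. a \<in> Grp D \<and> i \<in> Jset D \<and> \<mu> \<in> Mset D},
      monoid.mult = monoid.mult (End_A D), one = one (End_A D),
      zero = zero (End_A D), add = add (End_A D),
      module.smult = module.smult (End_A D),
      homog = (\<lambda>\<kappa>. span_in (End_A D)
        {weyl_mon D a i \<mu> |a i \<mu>. a \<in> Grp D \<and> i \<in> Jset D \<and> \<mu> \<in> Mset D \<and>
                                weyl_color D a i \<mu> = \<kappa>})\<rparr>"

definition weyl_lie ::
    "('f::field, 'g::ab_group_add) weyl_data \<Rightarrow> ('f, 'g, 'f oper) graded_algebra" where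
  "weyl_lie D = commutator_algebra (eps D) (weyl_assoc D)"

definition witt_lie ::
    "('f::field, 'g::ab_group_add) weyl_data \<Rightarrow> ('f, 'g, 'f oper) graded_algebra" where
  "witt_lie D = restrict_algebra (weyl_lie D) (span_in (weyl_lie D)
     {x_op D a i \<otimes>\<^bsub>End_A D\<^esub> del_op D p |a i p. a \<in> Grp D \<and> i \<in> Jset D \<and> p \<in> {1..ktot D}})"

definition scalars :: "('f::field, 'g::ab_group_add) weyl_data \<Rightarrow> 'f oper set" where
  "scalars D = {r \<odot>\<^bsub>End_A D\<^esub> \<one>\<^bsub>End_A D\<^esub> |r. True}"

definition weyl_tilde ::
    "('f::field, 'g::ab_group_add) weyl_data \<Rightarrow> ('f, 'g, 'f oper set) graded_algebra" where
  "weyl_tilde D = quotient_algebra (weyl_lie D) (scalars D)"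

definition weyl_bar ::
    "('f::field, 'g::ab_group_add) weyl_data \<Rightarrow> ('f, 'g, 'f oper set) graded_algebra" where
  "weyl_bar D = derived_algebra (weyl_tilde D)"

end

theory Submission
  imports Defs "HOL-Library.Product_Plus"
begin

text \<open>
  Everything happens among the operators on \<open>\<A>\<close>. Write \<open>\<W>\<close> for the operators spanned by the
  \<open>x\<^bsup>a,i\<^esup> \<partial>\<^sup>\<mu>\<close>, and \<open>[S, T]\<close> for the color commutator. Two filtrations on \<open>\<W>\<close> drive the proof:
  commutators with multiplications lower the order of a differential operator, and the operators
  \<open>ad \<partial>\<^sub>p - a\<^sub>p\<close> lower the degree in \<open>t\<close> of the terms of weight \<open>a\<close>. Both are locally nilpotent, in the sense
  that suitable finite chains of such operators kill any given element.

  Simplicity of the Weyl algebra modulo scalars. Let \<open>U\<close> be a color ideal that contains the scalars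
  and something else. An element of least order in \<open>U\<close> outside the scalars lies in \<open>\<A>\<close>
  (\<open>order_reduction\<close>): otherwise all its commutators with \<open>\<A>\<close> would be scalars, and the Leibniz rule
  would make the basis of \<open>\<A>\<close> too small. Inside \<open>\<A> \<inter> U\<close> the weight filtration then produces an element
  \<open>x\<^sup>a\<close> with \<open>a \<noteq> 0\<close>, or an element \<open>w\<close> with \<open>\<partial>\<^sub>p w = 1\<close> for some \<open>p\<close> and scalar \<open>\<partial>\<^sub>q w\<close> for all \<open>q\<close>
  (\<open>ideal_to_A\<close>). If there is an even index, brackets with these give homogeneous \<open>u\<close>, \<open>v\<close> in \<open>U\<close> such that
  \<open>[u, v]\<close> is left invertible, and Herstein's argument on Lie ideals of associative rings (\<open>herstein\<close>)
  shows that \<open>U\<close> contains \<open>[\<W>, \<W>]\<close>. If all indices are odd, the Euler operators \<open>t\<^sub>p \<partial>\<^sub>p\<close> lie in \<open>U\<close>; their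
  nonzero eigenvalues on monomials, and brackets with the \<open>t\<^sub>p\<close>, catch every \<open>t\<^sup>i \<partial>\<^sup>\<mu>\<close> except \<open>t\<^sup>n \<partial>\<^sup>\<lambda>\<close> with both exponents maximal
  (\<open>weyl_simple_odd\<close>).

  Size of the derived algebra. If some even \<open>t\<^sub>p\<close> carries no weight, \<open>ad \<partial>\<^sub>p\<close> is surjective, because
  polynomials can be integrated (\<open>W_CC_integrate\<close>). If \<open>G \<noteq> 0\<close>, conjugation by \<open>x\<^sup>a\<close> is trivial modulo
  commutators but acts on polynomials in \<open>\<partial>\<^sub>p\<close> as a shift, so that difference quotients take
  the place of derivatives (\<open>W_CC_difference\<close>). With odd indices only, all monomials but the top one are
  brackets with some \<open>t\<^sub>p\<close> or \<open>\<partial>\<^sub>p\<close> (\<open>nontop_CC\<close>).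

  Simplicity of the Witt algebra. The weight filtration yields an element \<open>x\<^sup>a \<delta>\<close> with \<open>\<delta>\<close> in the span of the
  \<open>\<partial>\<^sub>p\<close>; brackets with \<open>x\<^bsup>-a\<^esup> \<partial>\<^sub>p\<close> remove \<open>x\<^sup>a\<close> (\<open>WT_ideal_nonzero_derivation\<close>), and a nonzero \<open>\<delta>\<close> in the ideal generates first
  all \<open>\<partial>\<^sub>r\<close> (\<open>WT_ideal_derivations\<close>) and then all \<open>x\<^bsup>a,i\<^esup> \<partial>\<^sub>r\<close> (\<open>witt_simple\<close>).

  These arguments take place in a ring of linear operators that is a type. The structures of the
  theorem, which are records, are images of subspaces of this ring modulo
  a subspace; the locale \<open>presentation\<close> carries ideals, gradings, quotients and derived algebras across.
\<close>

section \<open>Linear operators on a free vector space\<close>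

lemma lookup_scale [simp]: "Poly_Mapping.lookup (scale r u) x = r * Poly_Mapping.lookup u x"
  unfolding scale_def by (simp add: Poly_Mapping.map.rep_eq when_def)

global_interpretation free_space: vector_space "scale :: 'f::field \<Rightarrow> ('b \<Rightarrow>\<^sub>0 'f) \<Rightarrow> _"
  by unfold_locales (auto intro!: poly_mapping_eqI simp: lookup_add algebra_simps)

lemma scale_single: "scale r (Poly_Mapping.single x s) = Poly_Mapping.single x (r * s)"
  by (rule poly_mapping_eqI) (simp add: lookup_single when_def)

lemma keys_scale_subset: "Poly_Mapping.keys (scale r u) \<subseteq> Poly_Mapping.keys u"
  by (auto simp: in_keys_iff)

lemma sum_single_coeffs:
  fixes u :: "'b \<Rightarrow>\<^sub>0 'f::field"
  shows "u = (\<Sum>x\<in>Poly_Mapping.keys u. scale (Poly_Mapping.lookup u x) (Poly_Mapping.single x 1))"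
  by (rule poly_mapping_eqI)
    (auto simp: lookup_sum lookup_single when_def in_keys_iff if_distrib sum.delta cong: if_cong)

text \<open>A type of operators, in contrast to a set of functions, is an instance of the class \<open>ring\<close>; identities
  between operators are then accessible to the simplifier.\<close>
typedef (overloaded) ('b, 'f) lop =
  "{T :: ('b \<Rightarrow>\<^sub>0 'f::field) \<Rightarrow> ('b \<Rightarrow>\<^sub>0 'f).
      (\<forall>u v. T (u + v) = T u + T v) \<and> (\<forall>r u. T (scale r u) = scale r (T u))}"
  morphisms app Lop
  by (rule exI[of _ "\<lambda>_. 0"]) simp

setup_lifting type_definition_lop

instantiation lop :: (type, field) ring
begin
lift_definition zero_lop :: "('a, 'b) lop" is "\<lambda>_. 0" by simp
lift_definition plus_lop :: "('a, 'b) lop \<Rightarrow> ('a, 'b) lop \<Rightarrow> ('a, 'b) lop" is "\<lambda>S T u. S u + T u"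
  by (simp add: free_space.scale_right_distrib)
lift_definition uminus_lop :: "('a, 'b) lop \<Rightarrow> ('a, 'b) lop" is "\<lambda>T u. - T u" by simp
lift_definition minus_lop :: "('a, 'b) lop \<Rightarrow> ('a, 'b) lop \<Rightarrow> ('a, 'b) lop" is "\<lambda>S T u. S u - T u"
  by (simp add: free_space.scale_right_diff_distrib)
lift_definition times_lop :: "('a, 'b) lop \<Rightarrow> ('a, 'b) lop \<Rightarrow> ('a, 'b) lop" is "\<lambda>S T u. S (T u)"
  by simp
instance by standard (transfer; simp add: fun_eq_iff)+
end

lift_definition smul :: "'f::field \<Rightarrow> ('b, 'f) lop \<Rightarrow> ('b, 'f) lop" (infixr "\<star>" 75) is "\<lambda>r T u. scale r (T u)"
  by (simp add: free_space.scale_right_distrib mult.commute)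

lemma app_zero_left [simp]: "app 0 u = 0" by transfer simp
lemma app_add_left [simp]: "app (S + T) u = app S u + app T u" by transfer simp
lemma app_diff_left [simp]: "app (S - T) u = app S u - app T u" by transfer simp
lemma app_uminus_left [simp]: "app (- T) u = - app T u" by transfer simp
lemma app_times [simp]: "app (S * T) u = app S (app T u)" by transfer simp
lemma app_smul [simp]: "app (r \<star> T) u = scale r (app T u)" by transfer simp
lemma app_add: "app T (u + v) = app T u + app T v" by transfer simp
lemma app_scale: "app T (scale r u) = scale r (app T u)" by transfer simp

lemma app_zero [simp]: "app T 0 = 0"
  using app_add[of T 0 0] by simp

lemma app_sum: "app T (\<Sum>x\<in>S. g x) = (\<Sum>x\<in>S. app T (g x))"
  by (induction S rule: infinite_finite_induct) (auto simp: app_add)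

lemma app_sum_left: "app (\<Sum>x\<in>S. g x) u = (\<Sum>x\<in>S. app (g x) u)"
  by (induction S rule: infinite_finite_induct) auto

lemma app_expand:
  "app T u = (\<Sum>x\<in>Poly_Mapping.keys u. scale (Poly_Mapping.lookup u x) (app T (Poly_Mapping.single x 1)))"
  by (subst (1) sum_single_coeffs[of u]) (simp only: app_sum app_scale)

lemma lop_eqI:
  assumes "\<And>x. app S (Poly_Mapping.single x 1) = app T (Poly_Mapping.single x 1)"
  shows "S = T"
proof -
  have "app S u = app T u" for u
    by (subst (1 2) app_expand) (simp add: assms)
  then show ?thesis by (simp add: app_inject[symmetric] fun_eq_iff)
qed

global_interpretation ops: vector_space "(\<star>) :: 'f::field \<Rightarrow> ('b, 'f) lop \<Rightarrow> _"
  by unfold_locales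
    (transfer; simp add: fun_eq_iff free_space.scale_right_distrib free_space.scale_left_distrib)+

lemma smul_mult_left [simp]: "(r \<star> S) * T = r \<star> (S * T)"
  by transfer simp
lemma smul_mult_right [simp]: "S * (r \<star> T) = r \<star> (S * T)"
  by transfer (simp add: fun_eq_iff)

lift_definition of_cols :: "('b \<Rightarrow> ('b \<Rightarrow>\<^sub>0 'f)) \<Rightarrow> ('b, 'f::field) lop" is
  "\<lambda>g u. \<Sum>x\<in>Poly_Mapping.keys u. scale (Poly_Mapping.lookup u x) (g x)"
proof (intro conjI allI)
  fix g :: "'b \<Rightarrow> ('b \<Rightarrow>\<^sub>0 'f)" and u v :: "'b \<Rightarrow>\<^sub>0 'f" and r
  let ?f = "\<lambda>u S. \<Sum>x\<in>S. scale (Poly_Mapping.lookup u x) (g x)"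
  have ext: "?f w (Poly_Mapping.keys w) = ?f w S" if "finite S" "Poly_Mapping.keys w \<subseteq> S" for w S
    using that by (intro sum.mono_neutral_left) (auto simp: in_keys_iff)
  let ?S = "Poly_Mapping.keys u \<union> Poly_Mapping.keys v"
  show "?f (u + v) (Poly_Mapping.keys (u + v)) = ?f u (Poly_Mapping.keys u) + ?f v (Poly_Mapping.keys v)"
    by (subst (1 2 3) ext[of ?S])
      (auto simp: lookup_add free_space.scale_left_distrib sum.distrib in_keys_iff)
  show "?f (scale r u) (Poly_Mapping.keys (scale r u)) = scale r (?f u (Poly_Mapping.keys u))"
    using keys_scale_subset[of r u]
    by (subst ext[of "Poly_Mapping.keys u"]) (auto simp: free_space.scale_sum_right)
qed

lemma app_of_cols_single [simp]: "app (of_cols g) (Poly_Mapping.single x 1) = g x"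
  by transfer simp

lemma app_of_cols:
  "app (of_cols g) u = (\<Sum>x\<in>Poly_Mapping.keys u. scale (Poly_Mapping.lookup u x) (g x))"
  by transfer simp

section \<open>Multiplicativity of the structure constants\<close>

lemma (in skew_bicharacter) eps_zero_right [simp]: "\<epsilon> \<kappa> 0 = 1"
  using eps_add[of \<kappa> 0 0] eps_nonzero[of \<kappa> 0] by simp

lemma (in skew_bicharacter) eps_zero_left [simp]: "\<epsilon> 0 \<kappa> = 1"
  using eps_skew[of 0 \<kappa>] by simp

lemma (in skew_bicharacter) eps_add_left: "\<epsilon> (\<kappa> + \<mu>) \<nu> = \<epsilon> \<kappa> \<nu> * \<epsilon> \<mu> \<nu>"
  by (metis eps_add eps_skew inverse_mult_distrib)

lemma (in skew_bicharacter) eps_swap [simp]: "\<epsilon> \<kappa> \<mu> * \<epsilon> \<mu> \<kappa> = 1"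
  using eps_skew[of \<kappa> \<mu>] eps_nonzero[of \<mu> \<kappa>] by simp

lemma (in skew_bicharacter) eps_uminus_right: "\<epsilon> \<kappa> (- \<mu>) = inverse (\<epsilon> \<kappa> \<mu>)"
  by (metis eps_add eps_zero_right inverse_unique add.right_inverse)

lemma (in skew_bicharacter) eps_uminus_left: "\<epsilon> (- \<kappa>) \<mu> = inverse (\<epsilon> \<kappa> \<mu>)"
  by (metis eps_add_left eps_zero_left inverse_unique add.right_inverse)

lemma (in skew_bicharacter) eps_self_inverse [simp]: "inverse (\<epsilon> \<kappa> \<kappa>) = \<epsilon> \<kappa> \<kappa>"
  by (metis eps_skew)

lemma (in skew_bicharacter) eps_sum_right: "\<epsilon> \<kappa> (\<Sum>p\<in>S. g p) = (\<Prod>p\<in>S. \<epsilon> \<kappa> (g p))"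
  by (induction S rule: infinite_finite_induct) (auto simp: eps_add)

lemma (in skew_bicharacter) eps_sum_left: "\<epsilon> (\<Sum>p\<in>S. g p) \<kappa> = (\<Prod>p\<in>S. \<epsilon> (g p) \<kappa>)"
  by (induction S rule: infinite_finite_induct) (auto simp: eps_add_left)

lemma nmult_Suc: "nmult (Suc n) \<kappa> = nmult n \<kappa> + \<kappa>"
  by (simp add: nmult_def add.commute)

lemma nmult_0 [simp]: "nmult 0 \<kappa> = 0"
  by (simp add: nmult_def)

lemma nmult_add: "nmult (m + n) \<kappa> = nmult m \<kappa> + nmult n \<kappa>"
  by (induction n) (simp_all add: nmult_Suc add.assoc)

lemma (in skew_bicharacter) eps_nmult_right: "\<epsilon> \<kappa> (nmult n \<mu>) = \<epsilon> \<kappa> \<mu> ^ n"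
  by (simp add: nmult_def eps_sum_right)

lemma (in skew_bicharacter) eps_nmult_left: "\<epsilon> (nmult n \<kappa>) \<mu> = \<epsilon> \<kappa> \<mu> ^ n"
  by (simp add: nmult_def eps_sum_left)

text \<open>Passing from the strictly lower triangle for \<open>(i, j)\<close> to the one for \<open>(j, i)\<close> costs the whole square: its
  lower part is what is exchanged, its upper part cancels by \<open>e p q * e q p = 1\<close>, and its diagonal is trivial.\<close>
lemma prod_triangle_swap:
  fixes e :: "nat \<Rightarrow> nat \<Rightarrow> 'f::field"
  assumes "\<And>p q. e p q * e q p = 1" and "\<And>p. p \<in> {m..<n} \<Longrightarrow> e p p ^ (i p * j p) = 1"
  shows "(\<Prod>q = m..<n. \<Prod>p = m..<q. e q p ^ (i q * j p)) =
         (\<Prod>p = m..<n. \<Prod>q = m..<n. e p q ^ (i p * j q)) *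
         (\<Prod>q = m..<n. \<Prod>p = m..<q. e q p ^ (j q * i p))"
  using assms(2)
proof (induction n)
  case 0
  then show ?case by simp
next
  case (Suc n)
  show ?case
  proof (cases "m \<le> n")
    case False
    then show ?thesis by simp
  next
    case True
    have cancel: "(\<Prod>p = m..<n. e p n ^ (i p * j n)) * (\<Prod>p = m..<n. e n p ^ (j n * i p)) = 1"
      by (simp add: prod.distrib[symmetric] mult.commute[of "j n"] power_mult_distrib[symmetric] assms(1))
    have "(\<Prod>p = m..<Suc n. \<Prod>q = m..<Suc n. e p q ^ (i p * j q)) =
      (\<Prod>p = m..<n. \<Prod>q = m..<n. e p q ^ (i p * j q)) * (\<Prod>p = m..<n. e p n ^ (i p * j n)) *
      ((\<Prod>q = m..<n. e n q ^ (i n * j q)) * e n n ^ (i n * j n))"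
      using True by (simp add: prod.distrib)
    moreover have "(\<Prod>q = m..<Suc n. \<Prod>p = m..<q. e q p ^ (i q * j p)) =
      (\<Prod>q = m..<n. \<Prod>p = m..<q. e q p ^ (i q * j p)) * (\<Prod>p = m..<n. e n p ^ (i n * j p))"
      "(\<Prod>q = m..<Suc n. \<Prod>p = m..<q. e q p ^ (j q * i p)) =
      (\<Prod>q = m..<n. \<Prod>p = m..<q. e q p ^ (j q * i p)) * (\<Prod>p = m..<n. e n p ^ (j n * i p))"
      using True by simp_all
    moreover have "e n n ^ (i n * j n) = 1" using Suc.prems[of n] True by simp
    moreover note Suc.IH[OF Suc.prems] cancel
    ultimately show ?thesis by (simp only: mult.assoc mult.left_commute mult_1_right) simp
  qed
qed

lemma prod_power_only:
  fixes g :: "nat \<Rightarrow> 'f::comm_monoid_mult"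
  assumes "finite S"
  shows "(\<Prod>q\<in>S. g q ^ (if q = p then n else 0)) = (if p \<in> S then g p ^ n else 1)"
proof -
  have "(\<Prod>q\<in>S. g q ^ (if q = p then n else 0)) = (\<Prod>q\<in>S. if p = q then g q ^ n else 1)"
    by (intro prod.cong) simp_all
  also have "\<dots> = (if p \<in> S then g p ^ n else 1)"
    using assms by (rule prod.delta')
  finally show ?thesis .
qed

context weyl_setup
begin

sublocale skew_bicharacter "eps D" by (rule bichar)

abbreviation (input) k where "k \<equiv> ktot D"
abbreviation (input) kev where "kev \<equiv> k1 D + k2 D + k3 D"

text \<open>The exponents \<open>(a, i)\<close> of the basis of \<open>\<A>\<close>. Pairs are added componentwise, so \<open>x + y\<close> is the exponent of
  a product, if it stays in \<open>Bset\<close>.\<close>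
definition Bset where "Bset = Grp D \<times> Jset D"
definition bvec where "bvec y = xmon D (fst y) (snd y)"
definition xcol where "xcol y = xcolor D (fst y) (snd y)"
abbreviation dcol where "dcol p \<equiv> - tcol D p"
text \<open>The factor that arises when \<open>t\<^sup>i\<close> is sorted into the monomial \<open>y\<close> from the left. Together with the cocycle
  it makes up \<open>mult_coeff\<close>.\<close>
definition tfac where
  "tfac i y = (\<Prod>p = k1 D + 1..ktot D. eps D (tcol D p) (hat D (fst y)) ^ i p) *
     (\<Prod>q = k1 D + 1..ktot D. \<Prod>p = k1 D + 1..<q. eps D (tcol D q) (tcol D p) ^ (i q * snd y p))"
text \<open>The factor that arises when \<open>\<partial>\<^sub>p\<close> moves to the right past \<open>x\<^sup>b\<close> and the variables before \<open>t\<^sub>p\<close>.\<close>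
definition tau where
  "tau p y = eps D (- tcol D p) (hat D (fst y)) * (\<Prod>q = 1..<p. eps D (- tcol D p) (tcol D q) ^ snd y q)"
definition un :: "nat \<Rightarrow> nat \<Rightarrow> nat" where "un p = (\<lambda>q. if q = p then 1 else 0)"
definition down :: "nat \<Rightarrow> 'f expo \<Rightarrow> 'f expo" where "down p y = (fst y, (snd y)(p := snd y p - 1))"

lemma bvec_in: "y \<in> Bset \<Longrightarrow> bvec y = Poly_Mapping.single y 1"
  and bvec_out: "y \<notin> Bset \<Longrightarrow> bvec y = 0"
  by (auto simp: bvec_def Bset_def xmon_def mem_Times_iff)

lemma G_diff: "a \<in> Grp D \<Longrightarrow> b \<in> Grp D \<Longrightarrow> a - b \<in> Grp D"
  using G_add[of a "- b"] G_uminus[of b] by simp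

lemma hat_zero [simp]: "hat D 0 = 0"
  by (metis G_zero add.right_neutral add_cancel_left_right hat_add)

lemma eps_tcol_even: "p \<in> {1..k} \<Longrightarrow> p \<le> kev \<Longrightarrow> eps D (tcol D p) (tcol D p) = 1"
  using tcol_zero[of p] tcol_plus[of p] by (cases "p \<le> k1 D + k2 D") (auto simp: Gamma_plus_def)

lemma eps_tcol_odd: "p \<in> {1..k} \<Longrightarrow> \<not> p \<le> kev \<Longrightarrow> eps D (tcol D p) (tcol D p) = - 1"
  using tcol_minus[of p] by (auto simp: Gamma_minus_def)

lemma G_out: "a \<in> Grp D \<Longrightarrow> a p \<noteq> 0 \<Longrightarrow> p \<in> {1..k1 D + k2 D}"
  using subsetD[OF G_tuples, of a] unfolding mem_Collect_eq by metis

lemma tcol_G: "a \<in> Grp D \<Longrightarrow> a p \<noteq> 0 \<Longrightarrow> tcol D p = 0"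
  using G_out[of a p] tcol_zero[of p] by simp

lemma J_range: "i \<in> Jset D \<Longrightarrow> i p \<noteq> 0 \<Longrightarrow> p \<in> {k1 D + 1..k}"
  unfolding Jset_def mem_Collect_eq by metis

lemma B_low: "y \<in> Bset \<Longrightarrow> q \<le> k1 D \<Longrightarrow> snd y q = 0"
  unfolding Bset_def using J_range[of "snd y" q] by (cases "snd y q = 0") (auto simp: mem_Times_iff)

lemma J_odd: "i \<in> Jset D \<Longrightarrow> \<not> p \<le> kev \<Longrightarrow> i p \<le> 1"
  unfolding Jset_def by (simp add: not_le)

lemma J_zero [simp]: "0 \<in> Jset D" by (simp add: Jset_def)

lemma J_mono: "j \<in> Jset D \<Longrightarrow> (\<And>p. i p \<le> j p) \<Longrightarrow> i \<in> Jset D"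
  unfolding Jset_def mem_Collect_eq by (metis le_zero_eq le_trans)

lemma B_zero [simp]: "0 \<in> Bset" using G_zero by (simp add: Bset_def zero_prod_def)

lemma B_add_cancel: "x \<in> Bset \<Longrightarrow> x + y \<in> Bset \<Longrightarrow> y \<in> Bset"
  using G_diff[of "fst x + fst y" "fst x"] J_mono[of "snd x + snd y" "snd y"]
  by (auto simp: Bset_def plus_prod_def mem_Times_iff)

lemma B_add_J: "x \<in> Bset \<Longrightarrow> y \<in> Bset \<Longrightarrow> x + y \<in> Bset \<longleftrightarrow> snd x + snd y \<in> Jset D"
  using G_add by (auto simp: Bset_def plus_prod_def mem_Times_iff)

lemma B_add_iff:
  assumes "x \<in> Bset" "y \<in> Bset"
  shows "x + y \<in> Bset \<longleftrightarrow> (\<forall>p > kev. snd x p + snd y p \<le> 1)"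
  using assms unfolding B_add_J[OF assms] by (auto simp: Bset_def Jset_def)

lemma B_down: "y \<in> Bset \<Longrightarrow> down p y \<in> Bset"
  using J_mono[of "snd y" "(snd y)(p := snd y p - 1)"] by (auto simp: Bset_def down_def)

lemma tfac_zero [simp]: "tfac 0 y = 1" by (simp add: tfac_def)

lemma tfac_zero_right [simp]: "tfac i 0 = 1" by (simp add: tfac_def)

lemma tfac_add: "tfac (i + i') y = tfac i y * tfac i' y"
  by (simp add: tfac_def power_add add_mult_distrib prod.distrib)

lemma tfac_add_right:
  "fst y \<in> Grp D \<Longrightarrow> fst z \<in> Grp D \<Longrightarrow> tfac i (y + z) = tfac i y * tfac i z"
  by (simp add: tfac_def power_add add_mult_distrib2 prod.distrib hat_add eps_add power_mult_distrib)

lemma tau_add: "fst y \<in> Grp D \<Longrightarrow> fst z \<in> Grp D \<Longrightarrow> tau p (y + z) = tau p y * tau p z"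
  by (simp add: tau_def power_add prod.distrib hat_add eps_add)

lemma mult_coeff_tfac: "mult_coeff D x y = tfac (snd x) y * cocyc D (fst x) (fst y)"
  by (cases x; cases y) (simp add: mult_coeff_def tfac_def)

lemma tfac_nonzero [simp]: "tfac i y \<noteq> 0" by (simp add: tfac_def eps_nonzero)
lemma tau_nonzero [simp]: "tau p y \<noteq> 0" by (simp add: tau_def eps_nonzero)

lemma mult_coeff_nonzero: "x \<in> Bset \<Longrightarrow> y \<in> Bset \<Longrightarrow> mult_coeff D x y \<noteq> 0"
  by (auto simp: mult_coeff_tfac Bset_def cocyc_nonzero)

lemma xcol_add:
  assumes "fst x \<in> Grp D" "fst y \<in> Grp D"
  shows "xcol (x + y) = xcol x + xcol y"
  using assms by (simp add: xcol_def xcolor_def hat_add nmult_add sum.distrib algebra_simps)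

lemma xcol_zero [simp]: "xcol 0 = 0"
  by (simp add: xcol_def xcolor_def)

lemma mult_coeff_assoc:
  assumes "x \<in> Bset" "y \<in> Bset" "z \<in> Bset"
  shows "mult_coeff D y z * mult_coeff D x (y + z) = mult_coeff D x y * mult_coeff D (x + y) z"
proof -
  have g: "fst x \<in> Grp D" "fst y \<in> Grp D" "fst z \<in> Grp D" using assms by (auto simp: Bset_def)
  show ?thesis
    using cocyc_assoc[OF g] by (simp add: mult_coeff_tfac tfac_add tfac_add_right g mult_ac)
qed

lemma un_J:
  assumes "p \<in> {k1 D + 1..k}"
  shows "un p \<in> Jset D"
  using assms by (auto simp: Jset_def un_def)

lemma un_B: "p \<in> {k1 D + 1..k} \<Longrightarrow> (0, un p) \<in> Bset"
  using un_J G_zero by (auto simp: Bset_def)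

text \<open>Bringing \<open>t\<^sub>p\<close> into its place from the left and taking it out again by \<open>\<partial>\<^sub>p\<close> are inverse to each other.\<close>
lemma tfac_un_tau:
  assumes p: "p \<in> {k1 D + 1..k}" and y: "y \<in> Bset"
  shows "tfac (un p) y * tau p y = 1"
proof -
  have "(\<Prod>q = k1 D + 1..k. \<Prod>p' = k1 D + 1..<q. eps D (tcol D q) (tcol D p') ^ (un p q * snd y p')) =
        (\<Prod>q = k1 D + 1..k. (\<Prod>p' = k1 D + 1..<q. eps D (tcol D q) (tcol D p') ^ snd y p') ^ (if q = p then 1 else 0))"
    by (intro prod.cong) (auto simp: un_def)
  also have "\<dots> = (\<Prod>p' = k1 D + 1..<p. eps D (tcol D p) (tcol D p') ^ snd y p')"
    using p by (simp only: prod_power_only finite_atLeastAtMost) simp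
  also have "\<dots> = (\<Prod>p' = 1..<p. eps D (tcol D p) (tcol D p') ^ snd y p')"
  proof (rule prod.mono_neutral_left)
    have "snd y q = 0" if "q \<le> k1 D" for q
      by (rule B_low[OF y that])
    then show "\<forall>i\<in>{1..<p} - {k1 D + 1..<p}. eps D (tcol D p) (tcol D i) ^ snd y i = 1"
      by auto
  qed auto
  finally have 1: "tfac (un p) y = eps D (tcol D p) (hat D (fst y)) *
      (\<Prod>p' = 1..<p. eps D (tcol D p) (tcol D p') ^ snd y p')"
    using p by (simp add: tfac_def un_def[of p, THEN fun_cong] prod_power_only[where n = 1])
  have "(\<Prod>p' = 1..<p. eps D (tcol D p) (tcol D p') ^ snd y p') *
     (\<Prod>p' = 1..<p. eps D (- tcol D p) (tcol D p') ^ snd y p') = 1"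
    by (simp add: prod.distrib[symmetric] power_mult_distrib[symmetric] eps_uminus_left eps_nonzero)
  then show ?thesis
    unfolding 1 tau_def by (simp add: eps_uminus_left eps_nonzero field_simps)
qed

text \<open>Moving \<open>\<partial>\<^sub>p\<close> past all of \<open>x\<close> is moving it past the variables before \<open>t\<^sub>p\<close>, past \<open>t\<^sub>p\<close> itself, and past the
  variables after it; the factor for the latter is the one of the product \<open>x t\<^sub>p\<close>.\<close>
lemma eps_dcol_xcol:
  assumes p: "p \<in> {k1 D + 1..k}" and x: "x \<in> Bset"
  shows "eps D (dcol p) (xcol x) = tau p x * tfac (snd x) (0, un p) * eps D (tcol D p) (tcol D p) ^ snd x p"
proof -
  have z: "snd x q = 0" if "q \<le> k1 D" for q
    by (rule B_low[OF x that])
  let ?e = "\<lambda>q. eps D (dcol p) (tcol D q) ^ snd x q"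
  have "(\<Prod>p' = k1 D + 1..<q. eps D (tcol D q) (tcol D p') ^ (snd x q * un p p')) =
        (if p < q then ?e q else 1)" for q
  proof -
    have "(\<Prod>p' = k1 D + 1..<q. eps D (tcol D q) (tcol D p') ^ (snd x q * un p p')) =
       (\<Prod>p' = k1 D + 1..<q. eps D (tcol D q) (tcol D p') ^ (if p' = p then snd x q else 0))"
      by (intro prod.cong) (auto simp: un_def)
    also have "\<dots> = (if p < q then eps D (tcol D q) (tcol D p) ^ snd x q else 1)"
      using p by (simp add: prod_power_only)
    finally show ?thesis using eps_skew[of "tcol D q" "tcol D p"] by (simp add: eps_uminus_left)
  qed
  then have "tfac (snd x) (0, un p) = (\<Prod>q = k1 D + 1..k. if p < q then ?e q else 1)"
    by (simp add: tfac_def)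
  also have "\<dots> = (\<Prod>q = Suc p..k. ?e q)"
    using p by (intro prod.mono_neutral_cong_right) auto
  finally have 1: "tfac (snd x) (0, un p) = (\<Prod>q = Suc p..k. ?e q)" .
  have 2: "(\<Prod>q = k1 D + 1..<p. ?e q) = (\<Prod>q = 1..<p. ?e q)"
    using z by (intro prod.mono_neutral_left) auto
  have "{k1 D + 1..k} = {k1 D + 1..<p} \<union> insert p {Suc p..k}" using p by auto
  then have "(\<Prod>q = k1 D + 1..k. ?e q) = (\<Prod>q = k1 D + 1..<p. ?e q) * (?e p * (\<Prod>q = Suc p..k. ?e q))"
    by (simp add: prod.union_disjoint disjoint_iff)
  moreover have "?e p = eps D (tcol D p) (tcol D p) ^ snd x p"
    by (simp add: eps_uminus_left)
  ultimately show ?thesis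
    unfolding 2 by (simp add: xcol_def xcolor_def eps_add eps_sum_right eps_nmult_right tau_def 1 mult_ac)
qed

text \<open>\<open>\<A>\<close> is color commutative. The product \<open>x + y\<close> must stay in the basis: otherwise some odd \<open>t\<^sub>p\<close> occurs in
  both factors, and \<open>\<epsilon>(t\<^sub>p, t\<^sub>p) = -1\<close> leaves a sign on the diagonal.\<close>
lemma mult_coeff_comm:
  assumes x: "x \<in> Bset" and y: "y \<in> Bset" and xy: "x + y \<in> Bset"
  shows "mult_coeff D x y = eps D (xcol x) (xcol y) * mult_coeff D y x"
proof -
  obtain a i where [simp]: "x = (a, i)" by (cases x)
  obtain b j where [simp]: "y = (b, j)" by (cases y)
  have ab: "a \<in> Grp D" "b \<in> Grp D" using x y by (auto simp: Bset_def)
  define I where "I = {k1 D + 1..<Suc k}"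
  let ?T = "\<lambda>i j. \<Prod>q\<in>I. \<Prod>p = k1 D + 1..<q. eps D (tcol D q) (tcol D p) ^ (i q * j p)"
  have I: "{k1 D + 1..k} = I" by (auto simp: I_def)
  have diag: "eps D (tcol D p) (tcol D p) ^ (i p * j p) = 1" if "p \<in> I" for p
  proof (cases "p \<le> kev")
    case True
    then show ?thesis using that eps_tcol_even[of p] by (simp add: I_def)
  next
    case False
    then have "i p + j p \<le> 1" using B_add_iff[OF x y] xy by simp
    then have "i p * j p = 0" by auto
    then show ?thesis by (metis power_0)
  qed
  have T: "?T i j = (\<Prod>p\<in>I. \<Prod>q\<in>I. eps D (tcol D p) (tcol D q) ^ (i p * j q)) * ?T j i"
    using diag unfolding I_def by (intro prod_triangle_swap) simp_all
  have c: "(\<Prod>p\<in>I. eps D (hat D a) (tcol D p) ^ j p) * (\<Prod>p\<in>I. eps D (tcol D p) (hat D a) ^ j p) = 1"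
    unfolding prod.distrib[symmetric] power_mult_distrib[symmetric] eps_swap by simp
  have e: "eps D (xcol x) (xcol y) = eps D (hat D a) (hat D b) *
      (\<Prod>p\<in>I. eps D (hat D a) (tcol D p) ^ j p) * (\<Prod>p\<in>I. eps D (tcol D p) (hat D b) ^ i p) *
      (\<Prod>p\<in>I. \<Prod>q\<in>I. eps D (tcol D p) (tcol D q) ^ (i p * j q))"
  proof -
    have 1: "eps D \<kappa> (xcol y) = eps D \<kappa> (hat D b) * (\<Prod>q\<in>I. eps D \<kappa> (tcol D q) ^ j q)" for \<kappa>
      unfolding xcol_def xcolor_def I by (simp add: eps_add eps_sum_right eps_nmult_right)
    have 2: "eps D (xcol x) \<mu> = eps D (hat D a) \<mu> * (\<Prod>p\<in>I. eps D (tcol D p) \<mu> ^ i p)" for \<mu>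
      unfolding xcol_def xcolor_def I by (simp add: eps_add_left eps_sum_left eps_nmult_left)
    have 3: "(\<Prod>p\<in>I. \<Prod>q\<in>I. eps D (tcol D p) (tcol D q) ^ (i p * j q)) =
        (\<Prod>q\<in>I. (\<Prod>p\<in>I. eps D (tcol D p) (tcol D q) ^ i p) ^ j q)"
      by (subst prod.swap) (simp add: prod_power_distrib power_mult)
    show ?thesis
      unfolding 2 1 3 by (simp add: power_mult_distrib prod.distrib mult_ac)
  qed
  have "mult_coeff D x y = (\<Prod>p\<in>I. eps D (tcol D p) (hat D b) ^ i p) * ?T i j * cocyc D a b"
    unfolding mult_coeff_def I by simp
  moreover have "mult_coeff D y x = (\<Prod>p\<in>I. eps D (tcol D p) (hat D a) ^ j p) * ?T j i * cocyc D b a"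
    unfolding mult_coeff_def I by simp
  ultimately show ?thesis
    unfolding T e using c cocyc_comm[OF ab] by (simp add: mult.assoc mult.left_commute)
qed

end

section \<open>Homogeneous operators\<close>

declare split_paired_All [simp del] split_paired_Ex [simp del]

context weyl_setup
begin

text \<open>Operators on \<open>\<A>\<close> are represented by operators on the free space on all pairs that vanish on the pairs
  outside \<open>Bset\<close>; the second conjunct makes this representative unique.\<close>
definition homg :: "'g \<Rightarrow> ('f expo, 'f) lop \<Rightarrow> bool" where
  "homg \<kappa> T \<longleftrightarrow>
     (\<forall>y\<in>Bset. Poly_Mapping.keys (app T (bvec y)) \<subseteq> {z\<in>Bset. xcol z = xcol y + \<kappa>}) \<and>
     (\<forall>y. y \<notin> Bset \<longrightarrow> app T (Poly_Mapping.single y 1) = 0)"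

definition cpt :: "'g \<Rightarrow> ('f expo, 'f) lop \<Rightarrow> ('f expo, 'f) lop" where
  "cpt \<kappa> T = of_cols (\<lambda>y. if y \<in> Bset
     then Poly_Mapping.mapp (\<lambda>z c. if z \<in> Bset \<and> xcol z = xcol y + \<kappa> then c else 0) (app T (bvec y)) else 0)"

text \<open>The diagonal operators through which the factors \<open>\<epsilon>\<close> act: conjugation by \<open>Q \<kappa>\<close> multiplies a
  homogeneous operator of color \<open>\<mu>\<close> by \<open>\<epsilon> \<kappa> \<mu>\<close>.\<close>
definition Q :: "'g \<Rightarrow> ('f expo, 'f) lop" where
  "Q \<kappa> = of_cols (\<lambda>y. if y \<in> Bset then Poly_Mapping.single y (eps D \<kappa> (xcol y)) else 0)"

definition sig :: "'g \<Rightarrow> ('f expo, 'f) lop \<Rightarrow> ('f expo, 'f) lop" where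
  "sig \<kappa> T = Q \<kappa> * T * Q (- \<kappa>)"

text \<open>The color adjoint action of an operator \<open>S\<close> of color \<open>\<kappa>\<close>. Expressing \<open>\<epsilon>\<close> through \<open>sig\<close> makes it linear in \<open>T\<close>
  without a decomposition of \<open>T\<close> into homogeneous components.\<close>
definition cad :: "'g \<Rightarrow> ('f expo, 'f) lop \<Rightarrow> ('f expo, 'f) lop \<Rightarrow> ('f expo, 'f) lop" where
  "cad \<kappa> S T = S * T - sig \<kappa> T * S"

text \<open>The identity of \<open>\<A>\<close>, extended by zero; it is the unit only for the graded operators.\<close>
definition idop :: "('f expo, 'f) lop" where "idop = Q 0"

lemma lop_eq_on_B:
  assumes "\<And>y. y \<notin> Bset \<Longrightarrow> app S (Poly_Mapping.single y 1) = 0"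
    and "\<And>y. y \<notin> Bset \<Longrightarrow> app T (Poly_Mapping.single y 1) = 0"
    and "\<And>y. y \<in> Bset \<Longrightarrow> app S (bvec y) = app T (bvec y)"
  shows "S = T"
proof (rule lop_eqI)
  fix y show "app S (Poly_Mapping.single y 1) = app T (Poly_Mapping.single y 1)"
    using assms[of y] by (cases "y \<in> Bset") (auto simp: bvec_in)
qed

lemma homI:
  assumes "\<And>y z. y \<in> Bset \<Longrightarrow> Poly_Mapping.lookup (app T (bvec y)) z \<noteq> 0 \<Longrightarrow> z \<in> Bset \<and> xcol z = xcol y + \<kappa>"
    and "\<And>y. y \<notin> Bset \<Longrightarrow> app T (Poly_Mapping.single y 1) = 0"
  shows "homg \<kappa> T"
  unfolding homg_def subset_iff in_keys_iff mem_Collect_eq using assms by metis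

lemma homD:
  "homg \<kappa> T \<Longrightarrow> y \<in> Bset \<Longrightarrow> Poly_Mapping.lookup (app T (bvec y)) z \<noteq> 0 \<Longrightarrow> z \<in> Bset \<and> xcol z = xcol y + \<kappa>"
  unfolding homg_def subset_iff in_keys_iff mem_Collect_eq by metis

lemma lookup_bvec: "Poly_Mapping.lookup (bvec y) z = (if y \<in> Bset \<and> y = z then 1 else 0)"
  by (cases "y \<in> Bset") (auto simp: bvec_in bvec_out lookup_single when_def)

lemma lookup_app_comp:
  assumes "y \<in> Bset"
  shows "Poly_Mapping.lookup (app (cpt \<kappa> T) (bvec y)) z =
    (if z \<in> Bset \<and> xcol z = xcol y + \<kappa> then Poly_Mapping.lookup (app T (bvec y)) z else 0)"
  using assms unfolding bvec_in[OF assms] cpt_def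
  by (auto simp: bvec_in lookup_mapp when_def in_keys_iff)

lemma app_comp_out: "y \<notin> Bset \<Longrightarrow> app (cpt \<kappa> T) (Poly_Mapping.single y 1) = 0"
  by (simp add: cpt_def)

lemma hom_comp [simp]: "homg \<kappa> (cpt \<kappa> T)"
proof (rule homI)
  show "z \<in> Bset \<and> xcol z = xcol y + \<kappa>"
    if "y \<in> Bset" "Poly_Mapping.lookup (app (cpt \<kappa> T) (bvec y)) z \<noteq> 0" for y z
    using that by (simp add: lookup_app_comp split: if_splits)
qed (rule app_comp_out)

lemma hom_lookup:
  assumes "homg \<kappa> T" "y \<in> Bset" "\<not> (z \<in> Bset \<and> xcol z = xcol y + \<kappa>)"
  shows "Poly_Mapping.lookup (app T (bvec y)) z = 0"
  using homD[OF assms(1,2), of z] assms(3) by metis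

lemma hom_out: "homg \<kappa> T \<Longrightarrow> y \<notin> Bset \<Longrightarrow> app T (Poly_Mapping.single y 1) = 0"
  by (simp add: homg_def)

lemma comp_hom: "homg \<mu> T \<Longrightarrow> cpt \<kappa> T = (if \<kappa> = \<mu> then T else 0)"
proof (rule lop_eq_on_B)
  assume T: "homg \<mu> T"
  show "app (if \<kappa> = \<mu> then T else 0) (Poly_Mapping.single y 1) = 0" if "y \<notin> Bset" for y
    using hom_out[OF T that] by simp
  show "app (cpt \<kappa> T) (bvec y) = app (if \<kappa> = \<mu> then T else 0) (bvec y)" if "y \<in> Bset" for y
  proof (rule poly_mapping_eqI)
    fix z show "Poly_Mapping.lookup (app (cpt \<kappa> T) (bvec y)) z =
        Poly_Mapping.lookup (app (if \<kappa> = \<mu> then T else 0) (bvec y)) z"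
      using hom_lookup[OF T that, of z] that by (cases "\<kappa> = \<mu>") (auto simp: lookup_app_comp)
  qed
qed (rule app_comp_out)

lemma hom_iff_comp: "homg \<kappa> T \<longleftrightarrow> cpt \<kappa> T = T"
  using comp_hom[of \<kappa> T \<kappa>] hom_comp[of \<kappa> T] by metis

lemma comp_add: "cpt \<kappa> (S + T) = cpt \<kappa> S + cpt \<kappa> T"
  by (rule lop_eq_on_B) (simp_all add: app_comp_out poly_mapping_eq_iff fun_eq_iff lookup_app_comp lookup_add)

lemma comp_smul: "cpt \<kappa> (r \<star> T) = r \<star> cpt \<kappa> T"
  by (rule lop_eq_on_B) (simp_all add: app_comp_out poly_mapping_eq_iff fun_eq_iff lookup_app_comp)

lemma comp_zero [simp]: "cpt \<kappa> 0 = 0"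
  using comp_smul[of \<kappa> 0 0] by simp

lemma comp_diff: "cpt \<kappa> (S - T) = cpt \<kappa> S - cpt \<kappa> T"
  using comp_add[of \<kappa> "S - T" T] by simp

lemma comp_sum: "cpt \<kappa> (\<Sum>x\<in>S. g x) = (\<Sum>x\<in>S. cpt \<kappa> (g x))"
  by (induction S rule: infinite_finite_induct) (auto simp: comp_add)

lemma comp_comp: "cpt \<kappa> (cpt \<mu> T) = (if \<kappa> = \<mu> then cpt \<mu> T else 0)"
  by (rule comp_hom) simp

lemma hom_add: "homg \<kappa> S \<Longrightarrow> homg \<kappa> T \<Longrightarrow> homg \<kappa> (S + T)"
  and hom_diff: "homg \<kappa> S \<Longrightarrow> homg \<kappa> T \<Longrightarrow> homg \<kappa> (S - T)"
  and hom_smul: "homg \<kappa> T \<Longrightarrow> homg \<kappa> (r \<star> T)"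
  and hom_zero [simp]: "homg \<kappa> 0"
  by (auto simp: hom_iff_comp comp_add comp_diff comp_smul)

lemma hom_sum: "(\<And>x. x \<in> S \<Longrightarrow> homg \<kappa> (g x)) \<Longrightarrow> homg \<kappa> (\<Sum>x\<in>S. g x)"
  by (induction S rule: infinite_finite_induct) (auto intro: hom_add)

lemma hom_unique: "homg \<kappa> T \<Longrightarrow> homg \<mu> T \<Longrightarrow> T \<noteq> 0 \<Longrightarrow> \<kappa> = \<mu>"
  using comp_hom[of \<mu> T \<kappa>] by (auto simp: hom_iff_comp split: if_splits)

lemma app_in_B:
  assumes "Poly_Mapping.keys u \<subseteq> Bset"
  shows "app T u = (\<Sum>y\<in>Poly_Mapping.keys u. scale (Poly_Mapping.lookup u y) (app T (bvec y)))"
  using assms by (subst app_expand) (auto intro!: sum.cong simp: bvec_in)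

lemma hom_keys:
  assumes T: "homg \<kappa> T" and u: "Poly_Mapping.keys u \<subseteq> {z\<in>Bset. xcol z = \<mu>}"
  shows "Poly_Mapping.keys (app T u) \<subseteq> {z\<in>Bset. xcol z = \<mu> + \<kappa>}"
proof
  fix z assume z: "z \<in> Poly_Mapping.keys (app T u)"
  have "Poly_Mapping.lookup (app T u) z =
      (\<Sum>y\<in>Poly_Mapping.keys u. Poly_Mapping.lookup u y * Poly_Mapping.lookup (app T (bvec y)) z)"
    using u by (subst app_in_B) (auto simp: lookup_sum)
  moreover have "Poly_Mapping.lookup (app T u) z \<noteq> 0" using z by (simp add: in_keys_iff)
  ultimately obtain y where y: "y \<in> Poly_Mapping.keys u" "Poly_Mapping.lookup (app T (bvec y)) z \<noteq> 0"
    by (metis (no_types, lifting) mult_zero_right sum.neutral)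
  have "y \<in> Bset" "xcol y = \<mu>" using y(1) u by blast+
  then show "z \<in> {z\<in>Bset. xcol z = \<mu> + \<kappa>}"
    using homD[OF T _ y(2)] by simp
qed

lemma hom_image: "homg \<kappa> T \<Longrightarrow> y \<in> Bset \<Longrightarrow> Poly_Mapping.keys (app T (bvec y)) \<subseteq> {z\<in>Bset. xcol z = xcol y + \<kappa>}"
  by (simp add: homg_def)

lemma hom_mult: assumes S: "homg \<kappa> S" and T: "homg \<mu> T" shows "homg (\<kappa> + \<mu>) (S * T)"
proof -
  have "Poly_Mapping.keys (app S (app T (bvec y))) \<subseteq> {z\<in>Bset. xcol z = (xcol y + \<mu>) + \<kappa>}" if "y \<in> Bset" for y
    by (rule hom_keys[OF S hom_image[OF T that]])
  then show ?thesis
    unfolding homg_def using hom_out[OF T] by (simp add: add_ac)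
qed

lemma app_Q: "y \<in> Bset \<Longrightarrow> app (Q \<kappa>) (bvec y) = scale (eps D \<kappa> (xcol y)) (bvec y)"
  by (simp add: Q_def bvec_in scale_single)

lemma hom_Q: "homg 0 (Q \<kappa>)"
proof (rule homI)
  show "z \<in> Bset \<and> xcol z = xcol y + 0"
    if "y \<in> Bset" "Poly_Mapping.lookup (app (Q \<kappa>) (bvec y)) z \<noteq> 0" for y z
    using that by (simp add: app_Q lookup_bvec split: if_splits)
qed (simp add: Q_def)

lemma app_Q_hom:
  assumes "Poly_Mapping.keys u \<subseteq> {z\<in>Bset. xcol z = \<mu>}"
  shows "app (Q \<kappa>) u = scale (eps D \<kappa> \<mu>) u"
proof -
  have "app (Q \<kappa>) u = (\<Sum>y\<in>Poly_Mapping.keys u. scale (eps D \<kappa> \<mu>) (scale (Poly_Mapping.lookup u y) (bvec y)))"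
    using assms by (subst app_in_B) (auto intro!: sum.cong simp: app_Q mult.commute)
  also have "\<dots> = scale (eps D \<kappa> \<mu>) (\<Sum>y\<in>Poly_Mapping.keys u. scale (Poly_Mapping.lookup u y) (Poly_Mapping.single y 1))"
    unfolding free_space.scale_sum_right using assms by (intro sum.cong) (auto simp: bvec_in)
  finally show ?thesis by (simp only: sum_single_coeffs[symmetric])
qed

lemma Q_mult: "Q \<kappa> * Q \<mu> = Q (\<kappa> + \<mu>)"
proof (rule lop_eq_on_B)
  show "app (Q \<kappa> * Q \<mu>) (bvec y) = app (Q (\<kappa> + \<mu>)) (bvec y)" if "y \<in> Bset" for y
    using that by (simp add: app_Q app_scale eps_add_left mult.commute)
qed (simp_all add: hom_out[OF hom_Q])

lemma Q_hom_commute: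
  assumes T: "homg \<mu> T"
  shows "Q \<kappa> * T = eps D \<kappa> \<mu> \<star> (T * Q \<kappa>)"
proof (rule lop_eq_on_B)
  fix y assume y: "y \<in> Bset"
  from app_Q_hom[OF hom_image[OF T y]] show "app (Q \<kappa> * T) (bvec y) = app (eps D \<kappa> \<mu> \<star> (T * Q \<kappa>)) (bvec y)"
    using y by (simp add: app_Q app_scale eps_add mult.commute)
qed (simp_all add: hom_out[OF hom_Q] hom_out[OF T])

lemma unit_left: "homg \<mu> T \<Longrightarrow> idop * T = T"
  and unit_right: "homg \<mu> T \<Longrightarrow> T * idop = T"
proof -
  show 1: "T * idop = T" if T: "homg \<mu> T" for T
  proof (rule lop_eq_on_B)
    show "app (T * idop) (bvec y) = app T (bvec y)" if "y \<in> Bset" for y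
      using that by (simp add: idop_def app_Q)
  qed (simp_all add: hom_out[OF hom_Q] hom_out[OF T] idop_def)
  show "homg \<mu> T \<Longrightarrow> idop * T = T"
    using Q_hom_commute[of \<mu> T 0] 1 by (simp add: idop_def)
qed

lemma hom_unit: "homg 0 idop" by (simp add: idop_def hom_Q)

lemma unit_unit [simp]: "idop * idop = idop" by (simp add: idop_def Q_mult)
lemma Q_inv: "Q \<kappa> * Q (- \<kappa>) = idop" "Q (- \<kappa>) * Q \<kappa> = idop" by (simp_all add: idop_def Q_mult)

lemma sig_hom: "homg \<mu> T \<Longrightarrow> sig \<kappa> T = eps D \<kappa> \<mu> \<star> T"
  by (simp add: sig_def Q_hom_commute mult.assoc Q_inv unit_right)

lemma sig_add: "sig \<kappa> (S + T) = sig \<kappa> S + sig \<kappa> T" by (simp add: sig_def algebra_simps)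
lemma sig_diff: "sig \<kappa> (S - T) = sig \<kappa> S - sig \<kappa> T" by (simp add: sig_def algebra_simps)
lemma sig_smul: "sig \<kappa> (r \<star> T) = r \<star> sig \<kappa> T" by (simp add: sig_def)
lemma sig_zero [simp]: "sig \<kappa> 0 = 0" by (simp add: sig_def)
lemma cad_add: "cad \<kappa> R (S + T) = cad \<kappa> R S + cad \<kappa> R T" by (simp add: cad_def sig_add algebra_simps)
lemma cad_diff: "cad \<kappa> R (S - T) = cad \<kappa> R S - cad \<kappa> R T" by (simp add: cad_def sig_diff algebra_simps)
lemma cad_smul: "cad \<kappa> R (r \<star> T) = r \<star> cad \<kappa> R T"
  by (simp add: cad_def sig_smul ops.scale_right_diff_distrib)
lemma cad_zero [simp]: "cad \<kappa> R 0 = 0" by (simp add: cad_def)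
lemma cad_sum: "cad \<kappa> R (\<Sum>x\<in>S. g x) = (\<Sum>x\<in>S. cad \<kappa> R (g x))"
  by (induction S rule: infinite_finite_induct) (auto simp: cad_add)
lemma cad_add_left: "cad \<kappa> (R + R') T = cad \<kappa> R T + cad \<kappa> R' T" by (simp add: cad_def algebra_simps)
lemma cad_smul_left: "cad \<kappa> (r \<star> R) T = r \<star> cad \<kappa> R T"
  by (simp add: cad_def ops.scale_right_diff_distrib)
lemma cad_zero_left [simp]: "cad \<kappa> 0 T = 0" by (simp add: cad_def)
lemma cad_sum_left: "cad \<kappa> (\<Sum>x\<in>S. g x) T = (\<Sum>x\<in>S. cad \<kappa> (g x) T)"
  by (induction S rule: infinite_finite_induct) (auto simp: cad_add_left)

lemma cad_hom: "homg \<mu> T \<Longrightarrow> cad \<kappa> S T = S * T - eps D \<kappa> \<mu> \<star> (T * S)"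
  by (simp add: cad_def sig_hom)

lemma hom_cad: "homg \<kappa> S \<Longrightarrow> homg \<mu> T \<Longrightarrow> homg (\<kappa> + \<mu>) (cad \<kappa> S T)"
  using hom_mult[of \<kappa> S \<mu> T] hom_mult[of \<mu> T \<kappa> S]
  by (auto simp: cad_hom add.commute intro!: hom_diff hom_smul)

lemma cad_skew:
  assumes "homg \<kappa> S" "homg \<mu> T"
  shows "cad \<kappa> S T = - (eps D \<kappa> \<mu> \<star> cad \<mu> T S)"
  by (simp add: cad_hom[OF assms(1)] cad_hom[OF assms(2)] ops.scale_right_diff_distrib)

definition graded_ops :: "('f expo, 'f) lop set" where
  "graded_ops = ops.span {T. \<exists>\<kappa>. homg \<kappa> T}"

lemma graded_ops_hom: "homg \<kappa> T \<Longrightarrow> T \<in> graded_ops"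
  by (auto simp: graded_ops_def intro: ops.span_base)

lemma graded_ops_decomp:
  assumes "T \<in> graded_ops"
  shows "finite {\<kappa>. cpt \<kappa> T \<noteq> 0} \<and> T = (\<Sum>\<kappa> | cpt \<kappa> T \<noteq> 0. cpt \<kappa> T)"
proof -
  have "\<exists>S. finite S \<and> T = (\<Sum>\<kappa>\<in>S. cpt \<kappa> T) \<and> (\<forall>\<kappa>. \<kappa> \<notin> S \<longrightarrow> cpt \<kappa> T = 0)"
    using assms unfolding graded_ops_def
  proof (induction T rule: ops.span_induct_alt)
    case base
    then show ?case by (auto intro: exI[of _ "{}"])
  next
    case (step c x y)
    then obtain \<mu> S where x: "homg \<mu> x" and S: "finite S" "y = (\<Sum>\<kappa>\<in>S. cpt \<kappa> y)" "\<forall>\<kappa>. \<kappa> \<notin> S \<longrightarrow> cpt \<kappa> y = 0"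
      by blast
    have "(\<Sum>\<kappa>\<in>insert \<mu> S. cpt \<kappa> y) = y"
      using S by (simp add: sum.insert_if)
    moreover have "(\<Sum>\<kappa>\<in>insert \<mu> S. cpt \<kappa> (c \<star> x)) = c \<star> x"
      using S(1) by (simp add: comp_smul comp_hom[OF x] if_distrib cong: if_cong)
    ultimately have "c \<star> x + y = (\<Sum>\<kappa>\<in>insert \<mu> S. cpt \<kappa> (c \<star> x + y))"
      by (simp only: comp_add sum.distrib)
    moreover have "\<forall>\<kappa>. \<kappa> \<notin> insert \<mu> S \<longrightarrow> cpt \<kappa> (c \<star> x + y) = 0"
      using S(3) by (simp add: comp_add comp_smul comp_hom[OF x])
    ultimately show ?case using S(1) by (intro exI[of _ "insert \<mu> S"]) simp
  qed
  then obtain S where S: "finite S" "T = (\<Sum>\<kappa>\<in>S. cpt \<kappa> T)" "\<forall>\<kappa>. \<kappa> \<notin> S \<longrightarrow> cpt \<kappa> T = 0" by blast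
  then have sub: "{\<kappa>. cpt \<kappa> T \<noteq> 0} \<subseteq> S" by auto
  then have "(\<Sum>\<kappa> | cpt \<kappa> T \<noteq> 0. cpt \<kappa> T) = (\<Sum>\<kappa>\<in>S. cpt \<kappa> T)"
    using S(1) by (intro sum.mono_neutral_left) auto
  then show ?thesis using S sub finite_subset by auto
qed

lemma graded_ops_unit:
  assumes "T \<in> graded_ops"
  shows "idop * T = T" "T * idop = T"
  using assms unfolding graded_ops_def
  by (induction T rule: ops.span_induct_alt; auto simp: algebra_simps unit_left unit_right)+

lemma sig_mult: "T \<in> graded_ops \<Longrightarrow> sig \<kappa> (S * T) = sig \<kappa> S * sig \<kappa> T"
proof -
  assume T: "T \<in> graded_ops"
  have "sig \<kappa> S * sig \<kappa> T = Q \<kappa> * S * (Q (- \<kappa>) * Q \<kappa>) * T * Q (- \<kappa>)"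
    by (simp add: sig_def mult.assoc)
  then show ?thesis using graded_ops_unit(1)[OF T] by (simp add: Q_inv sig_def mult.assoc)
qed

lemma cad_mult: "T \<in> graded_ops \<Longrightarrow> cad \<kappa> R (S * T) = cad \<kappa> R S * T + sig \<kappa> S * cad \<kappa> R T"
  by (simp add: cad_def sig_mult algebra_simps)

section \<open>Multiplications and color derivations\<close>

definition Mx :: "'f expo \<Rightarrow> ('f expo, 'f) lop" where
  "Mx x = of_cols (\<lambda>y. if x \<in> Bset \<and> y \<in> Bset then scale (mult_coeff D x y) (bvec (x + y)) else 0)"

definition dl :: "nat \<Rightarrow> ('f expo, 'f) lop" where
  "dl p = of_cols (\<lambda>y. if y \<in> Bset then deriv_mon D p y else 0)"

lemma app_Mx: "x \<in> Bset \<Longrightarrow> y \<in> Bset \<Longrightarrow> app (Mx x) (bvec y) = scale (mult_coeff D x y) (bvec (x + y))"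
  by (simp add: Mx_def bvec_in[of y])

lemma app_Mx_out: "y \<notin> Bset \<Longrightarrow> app (Mx x) (Poly_Mapping.single y 1) = 0" by (simp add: Mx_def)

lemma Mx_out: "x \<notin> Bset \<Longrightarrow> Mx x = 0" by (rule lop_eqI) (simp add: Mx_def)

lemma app_dl: "y \<in> Bset \<Longrightarrow> app (dl p) (bvec y) =
    scale (fst y p) (bvec y) + scale (tau p y * of_nat (snd y p)) (bvec (down p y))"
  by (cases y) (simp add: dl_def bvec_in, simp add: deriv_mon_def bvec_def down_def tau_def Bset_def xmon_def)

lemma app_dl_out: "y \<notin> Bset \<Longrightarrow> app (dl p) (Poly_Mapping.single y 1) = 0" by (simp add: dl_def)

lemma bvec_add_out: "x \<in> Bset \<Longrightarrow> y \<notin> Bset \<Longrightarrow> bvec (x + y) = 0"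
  using B_add_cancel bvec_out by blast

lemma app_Mx': "x \<in> Bset \<Longrightarrow> app (Mx x) (bvec y) = scale (mult_coeff D x y) (bvec (x + y))"
  by (cases "y \<in> Bset") (simp_all add: app_Mx bvec_add_out bvec_out)

lemma bvec_out_add: "z \<in> Bset \<Longrightarrow> bvec (x + z) \<noteq> 0 \<Longrightarrow> x \<in> Bset"
  using B_add_cancel[of z x] bvec_out[of "x + z"] by (auto simp: add.commute)

lemma Mx_mult:
  assumes x: "x \<in> Bset" and y: "y \<in> Bset"
  shows "Mx x * Mx y = mult_coeff D x y \<star> Mx (x + y)"
proof (rule lop_eq_on_B)
  fix z assume z: "z \<in> Bset"
  show "app (Mx x * Mx y) (bvec z) = app (mult_coeff D x y \<star> Mx (x + y)) (bvec z)"
  proof (cases "x + y \<in> Bset")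
    case True
    then show ?thesis
      using x y z mult_coeff_assoc[OF x y z] by (simp add: app_Mx' app_scale add.assoc)
  next
    case False
    then have "bvec (x + y + z) = 0" using bvec_out_add[OF z] by blast
    then show ?thesis using x y z False by (simp add: app_Mx' app_scale Mx_out add.assoc)
  qed
qed (simp_all add: app_Mx_out)

lemma Mx_zero: "Mx 0 = idop"
proof (rule lop_eq_on_B)
  fix y assume y: "y \<in> Bset"
  then have "fst y \<in> Grp D" by (auto simp: Bset_def)
  then have "mult_coeff D 0 y = 1"
    using cocyc_comm[of 0 "fst y"] G_zero cocyc_zero[of "fst y"] by (simp add: mult_coeff_tfac)
  then show "app (Mx 0) (bvec y) = app idop (bvec y)"
    using y by (simp add: app_Mx idop_def app_Q)
qed (simp_all add: app_Mx_out hom_out[OF hom_unit])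

lemma xcol_add_B: "x \<in> Bset \<Longrightarrow> y \<in> Bset \<Longrightarrow> xcol (x + y) = xcol x + xcol y"
  by (rule xcol_add) (auto simp: Bset_def)

lemma hom_Mx: "homg (xcol x) (Mx x)"
proof (cases "x \<in> Bset")
  case True
  show ?thesis
  proof (rule homI)
    show "z \<in> Bset \<and> xcol z = xcol y + xcol x"
      if "y \<in> Bset" "Poly_Mapping.lookup (app (Mx x) (bvec y)) z \<noteq> 0" for y z
      using that True xcol_add_B[OF True that(1)]
      by (simp add: app_Mx lookup_bvec add.commute split: if_splits)
  qed (rule app_Mx_out)
qed (simp add: Mx_out)

lemma Mx_comm:
  assumes x: "x \<in> Bset" and y: "y \<in> Bset"
  shows "Mx x * Mx y = eps D (xcol x) (xcol y) \<star> (Mx y * Mx x)"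
proof (cases "x + y \<in> Bset")
  case True
  then show ?thesis
    using mult_coeff_comm[OF x y] by (simp add: Mx_mult x y add.commute[of y])
next
  case False
  then show ?thesis by (simp add: Mx_mult x y Mx_out add.commute[of y])
qed

lemma down_un: "snd y p > 0 \<Longrightarrow> y = down p y + (0, un p)"
proof (rule prod_eqI)
  assume p: "snd y p > 0"
  show "fst y = fst (down p y + (0, un p))" by (simp add: down_def)
  show "snd y = snd (down p y + (0, un p))"
  proof (rule ext)
    fix q show "snd y q = snd (down p y + (0, un p)) q"
      using p by (cases "q = p") (simp_all add: down_def un_def)
  qed
qed

lemma xcol_un: "p \<in> {k1 D + 1..k} \<Longrightarrow> xcol (0, un p) = tcol D p"
proof -
  assume p: "p \<in> {k1 D + 1..k}"
  have "(\<Sum>q = k1 D + 1..k. nmult (un p q) (tcol D q)) = (\<Sum>q = k1 D + 1..k. if p = q then tcol D q else 0)"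
    by (intro sum.cong) (auto simp: un_def nmult_Suc[of 0, simplified])
  then show ?thesis using p by (simp add: xcol_def xcolor_def)
qed

lemma B_range: "y \<in> Bset \<Longrightarrow> snd y p > 0 \<Longrightarrow> p \<in> {k1 D + 1..k}"
  using J_range[of "snd y" p] by (auto simp: Bset_def)

lemma xcol_down:
  assumes "y \<in> Bset" "snd y p > 0"
  shows "xcol (down p y) = xcol y - tcol D p"
proof -
  have "xcol (down p y + (0, un p)) = xcol (down p y) + xcol (0, un p)"
    by (rule xcol_add_B[OF B_down[OF assms(1)] un_B[OF B_range[OF assms]]])
  then have "xcol y = xcol (down p y) + xcol (0, un p)"
    by (simp only: down_un[OF assms(2), symmetric])
  then show ?thesis using xcol_un[OF B_range[OF assms]] by simp
qed

lemma hom_dl: "p \<in> {1..k} \<Longrightarrow> homg (dcol p) (dl p)"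
proof -
  assume p: "p \<in> {1..k}"
  have "z \<in> Bset \<and> xcol z = xcol y - tcol D p"
    if y: "y \<in> Bset" and z: "Poly_Mapping.lookup (app (dl p) (bvec y)) z \<noteq> 0" for y z
  proof -
    have "fst y p \<noteq> 0 \<and> y = z \<or> snd y p \<noteq> 0 \<and> down p y = z"
    proof (rule ccontr)
      assume "\<not> ?thesis"
      then have "fst y p = 0 \<or> y \<noteq> z" "snd y p = 0 \<or> down p y \<noteq> z" by blast+
      then have "Poly_Mapping.lookup (app (dl p) (bvec y)) z = 0"
        unfolding app_dl[OF y] lookup_add lookup_scale lookup_bvec by (elim disjE) simp_all
      then show False using z by simp
    qed
    then consider "fst y p \<noteq> 0" "z = y" | "snd y p \<noteq> 0" "z = down p y" by metis
    then show ?thesis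
    proof cases
      case 1
      then have "tcol D p = 0" using y tcol_G[of "fst y" p] by (simp add: Bset_def mem_Times_iff)
      then show ?thesis using 1 y by simp
    next
      case 2
      then show ?thesis using y B_down xcol_down by simp
    qed
  qed
  then show ?thesis by (intro homI) (simp_all add: app_dl_out)
qed

lemma mult_coeff_down_left:
  assumes x: "x \<in> Bset" and y: "y \<in> Bset" and p: "snd x p > 0"
  shows "mult_coeff D (down p x) y = tau p y * mult_coeff D x y"
proof -
  have "tau p y * mult_coeff D x y = tau p y * (tfac (un p) y * mult_coeff D (down p x) y)"
    by (subst (1) down_un[OF p]) (simp add: mult_coeff_tfac tfac_add)
  also have "\<dots> = (tfac (un p) y * tau p y) * mult_coeff D (down p x) y"
    by (simp only: mult.assoc mult.left_commute)
  finally show ?thesis by (simp only: tfac_un_tau[OF B_range[OF x p] y] mult_1_left)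
qed

lemma mult_coeff_down_right:
  assumes x: "x \<in> Bset" and y: "y \<in> Bset" and p: "snd y p > 0"
  shows "eps D (dcol p) (xcol x) * mult_coeff D x (down p y) =
     tau p x * eps D (tcol D p) (tcol D p) ^ snd x p * mult_coeff D x y"
proof -
  have "fst (down p y) \<in> Grp D" using B_down[OF y, of p] by (simp add: Bset_def mem_Times_iff)
  then have "mult_coeff D x y = tfac (snd x) (0, un p) * mult_coeff D x (down p y)"
    by (subst (1) down_un[OF p]) (simp add: mult_coeff_tfac tfac_add_right G_zero)
  then have "tau p x * eps D (tcol D p) (tcol D p) ^ snd x p * mult_coeff D x y =
     (tau p x * tfac (snd x) (0, un p) * eps D (tcol D p) (tcol D p) ^ snd x p) * mult_coeff D x (down p y)"
    by (simp only: mult.assoc mult.left_commute)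
  then show ?thesis by (simp only: eps_dcol_xcol[OF B_range[OF y p] x])
qed

lemma down_add_left: "snd x p > 0 \<Longrightarrow> down p x + y = down p (x + y)"
  and down_add_right: "snd y p > 0 \<Longrightarrow> x + down p y = down p (x + y)"
  unfolding down_def by (rule prod_eqI; simp add: fun_eq_iff)+

lemma eps_dcol_fst: "x \<in> Bset \<Longrightarrow> fst x p \<noteq> 0 \<Longrightarrow> eps D (dcol p) \<mu> = 1"
  using tcol_G[of "fst x" p] by (auto simp: Bset_def)

text \<open>When \<open>x + y\<close> leaves the basis but \<open>down p (x + y)\<close> does not, \<open>p\<close> is an odd index with exponent 1 in
  both, and the two terms of the Leibniz rule cancel because \<open>\<epsilon>\<close> is \<open>-1\<close> on the color of \<open>t\<^sub>p\<close>.\<close>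
lemma dl_Mx:
  assumes p: "p \<in> {1..k}" and x: "x \<in> Bset"
  shows "dl p * Mx x = fst x p \<star> Mx x + (tau p x * of_nat (snd x p)) \<star> Mx (down p x) +
           eps D (dcol p) (xcol x) \<star> (Mx x * dl p)"
proof (rule lop_eq_on_B)
  fix y assume y: "y \<in> Bset"
  let ?c = "mult_coeff D x y" and ?w = "bvec (down p (x + y))" and ?e = "eps D (dcol p) (xcol x)"
  have L: "app (dl p * Mx x) (bvec y) = scale ?c (app (dl p) (bvec (x + y)))"
    by (simp add: app_Mx x y app_scale)
  have d1: "scale (of_nat (snd x p)) (app (Mx (down p x)) (bvec y)) =
      scale (of_nat (snd x p) * (tau p y * ?c)) ?w"
    using mult_coeff_down_left[OF x y, of p] down_add_left[of x p y] y B_down[OF x, of p]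
    by (cases "snd x p = 0") (auto simp: app_Mx)
  have d2: "scale (?e * of_nat (snd y p)) (app (Mx x) (bvec (down p y))) =
      scale (of_nat (snd y p) * (tau p x * eps D (tcol D p) (tcol D p) ^ snd x p * ?c)) ?w"
    using mult_coeff_down_right[OF x y, of p] down_add_right[of y p x] x B_down[OF y, of p]
    by (cases "snd y p = 0") (auto simp: app_Mx mult_ac)
  have ey: "?e * fst y p = fst y p" using eps_dcol_fst[OF y, of p] by (cases "fst y p = 0") auto
  have R: "app (fst x p \<star> Mx x + (tau p x * of_nat (snd x p)) \<star> Mx (down p x) + ?e \<star> (Mx x * dl p)) (bvec y) =
     scale ((fst x p + fst y p) * ?c) (bvec (x + y)) +
     scale (?c * (tau p x * tau p y) * (of_nat (snd x p) + of_nat (snd y p) * eps D (tcol D p) (tcol D p) ^ snd x p)) ?w"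
  proof -
    have "app (fst x p \<star> Mx x + (tau p x * of_nat (snd x p)) \<star> Mx (down p x) + ?e \<star> (Mx x * dl p)) (bvec y) =
      scale (fst x p * ?c + ?e * fst y p * ?c) (bvec (x + y)) +
      scale (tau p x) (scale (of_nat (snd x p)) (app (Mx (down p x)) (bvec y))) +
      scale (tau p y) (scale (?e * of_nat (snd y p)) (app (Mx x) (bvec (down p y))))"
      by (simp add: app_Mx x y app_dl app_add app_scale free_space.scale_left_distrib
          free_space.scale_right_distrib mult_ac)
    then show ?thesis
      unfolding d1 d2 ey by (simp add: free_space.scale_left_distrib algebra_simps)
  qed
  have t: "tau p (x + y) = tau p x * tau p y" using x y by (intro tau_add) (auto simp: Bset_def)
  show "app (dl p * Mx x) (bvec y) = app (fst x p \<star> Mx x + (tau p x * of_nat (snd x p)) \<star> Mx (down p x) +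
           ?e \<star> (Mx x * dl p)) (bvec y)"
  proof (cases "x + y \<in> Bset")
    case True
    have "of_nat (snd x p) + of_nat (snd y p) * eps D (tcol D p) (tcol D p) ^ snd x p =
      (of_nat (snd x p + snd y p) :: 'f)"
    proof (cases "p \<le> kev")
      case True
      then show ?thesis using eps_tcol_even[OF p] by simp
    next
      case False
      then have "snd x p + snd y p \<le> 1" using B_add_iff[OF x y] \<open>x + y \<in> Bset\<close> by simp
      then have "snd x p = 0 \<or> snd y p = 0" by linarith
      then show ?thesis by auto
    qed
    then show ?thesis
      unfolding L R using True by (simp add: app_dl t free_space.scale_right_distrib mult_ac)
  next
    case False
    then have b0: "bvec (x + y) = 0" by (rule bvec_out)
    have "?w = 0 \<or> of_nat (snd x p) + of_nat (snd y p) * eps D (tcol D p) (tcol D p) ^ snd x p = (0 :: 'f)"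
    proof (cases "?w = 0")
      case w: False
      then have wB: "down p (x + y) \<in> Bset" using bvec_out by blast
      from False obtain q where q: "\<not> q \<le> kev" "\<not> snd x q + snd y q \<le> 1" using B_add_iff[OF x y] by (meson not_le)
      have "q = p"
        using J_odd[of "snd (down p (x + y))" q] wB q
        by (cases "q = p") (simp_all add: Bset_def down_def mem_Times_iff)
      moreover have "snd x q \<le> 1" "snd y q \<le> 1" using J_odd[OF _ q(1)] x y by (auto simp: Bset_def)
      ultimately have "snd x p = 1" "snd y p = 1" "\<not> p \<le> kev" using q by auto
      then show ?thesis using eps_tcol_odd[OF p] by simp
    qed simp
    then show ?thesis unfolding L R b0 by auto
  qed
qed (simp_all add: app_Mx_out app_dl_out)

text \<open>Both sides agree on a basis vector up to the sign of \<open>tau\<close>: applying \<open>\<partial>\<^sub>p\<close> first with \<open>p < q\<close> removes one \<open>t\<^sub>p\<close>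
  that \<open>\<partial>\<^sub>q\<close> would have to pass.\<close>
lemma dl_comm_lt:
  assumes p: "p \<in> {1..k}" and q: "q \<in> {1..k}" and pq: "p < q"
  shows "dl p * dl q = eps D (tcol D p) (tcol D q) \<star> (dl q * dl p)"
proof (rule lop_eq_on_B)
  fix y assume y: "y \<in> Bset"
  let ?E = "eps D (tcol D p) (tcol D q)"
  have 1: "tau p (down q y) = tau p y"
    using pq by (simp add: tau_def down_def cong: prod.cong_simp)
  have 2: "?E * tau q (down p y) = tau q y" if "snd y p > 0"
  proof -
    have "tau q y = tau q (down p y) * tau q (0, un p)"
      using B_down[OF y, of p] G_zero
      by (subst (1) down_un[OF that]) (rule tau_add, auto simp: Bset_def)
    also have "tau q (0, un p) = ?E"
      using pq p by (simp add: tau_def un_def prod_power_only eps_uminus_left eps_skew[of "tcol D p"])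
    finally show ?thesis by (simp add: mult.commute)
  qed
  have dd: "down p (down q y) = down q (down p y)" using pq by (auto simp: down_def)
  have E1: "fst y p \<noteq> 0 \<or> fst y q \<noteq> 0 \<Longrightarrow> ?E = 1"
    using tcol_G[of "fst y" p] tcol_G[of "fst y" q] y by (auto simp: Bset_def)
  have f: "fst (down r y) = fst y" for r by (simp add: down_def)
  have s: "snd (down q y) p = snd y p" "snd (down p y) q = snd y q" using pq by (auto simp: down_def)
  have "scale ?E (scale (tau p y * of_nat (snd y p)) (scale (tau q (down p y) * of_nat (snd y q)) (bvec (down q (down p y)))))
     = scale (tau p y * tau q y * of_nat (snd y p) * of_nat (snd y q)) (bvec (down q (down p y)))"
  proof (cases "snd y p = 0")
    case False
    then have "tau q y = ?E * tau q (down p y)" using 2 by simp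
    then show ?thesis by (simp add: mult_ac)
  qed simp
  then show "app (dl p * dl q) (bvec y) = app (?E \<star> (dl q * dl p)) (bvec y)"
    using y E1 by (cases "fst y p = 0 \<and> fst y q = 0")
     (auto simp: app_dl app_add app_scale B_down 1 dd f s free_space.scale_right_distrib mult_ac)
qed (simp_all add: app_dl_out)

lemma dl_comm:
  assumes p: "p \<in> {1..k}" and q: "q \<in> {1..k}"
  shows "dl p * dl q = eps D (dcol p) (dcol q) \<star> (dl q * dl p)"
proof -
  have e: "eps D (dcol p) (dcol q) = eps D (tcol D p) (tcol D q)"
    by (simp add: eps_uminus_left eps_uminus_right)
  consider "p < q" | "q < p" | "p = q" by linarith
  then show ?thesis
  proof cases
    case 1
    then show ?thesis using dl_comm_lt[OF p q] e by simp
  next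
    case 2
    then show ?thesis using dl_comm_lt[OF q p] e by simp
  next
    case 3
    show ?thesis
    proof (cases "p \<le> kev")
      case True
      then show ?thesis using 3 e eps_tcol_even[OF p] by simp
    next
      case False
      have "dl p * dl p = 0"
      proof (rule lop_eq_on_B)
        fix y assume y: "y \<in> Bset"
        then have "fst y p = 0" "snd y p \<le> 1"
          using G_out[of "fst y" p] J_odd[of "snd y" p] False
          by (cases "fst y p = 0"; simp add: Bset_def mem_Times_iff)+
        then show "app (dl p * dl p) (bvec y) = app 0 (bvec y)"
          using y by (simp add: app_dl app_scale B_down) (auto simp: down_def)
      qed (simp_all add: app_dl_out)
      then show ?thesis using 3 by simp
    qed
  qed
qed

end

section \<open>The algebra of differential operators\<close>

context weyl_setup
begin

definition Aset :: "('f expo, 'f) lop set" where "Aset = ops.span (Mx ` Bset)"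

primrec epow :: "('f expo, 'f) lop \<Rightarrow> nat \<Rightarrow> ('f expo, 'f) lop" where
  "epow T 0 = idop"
| "epow T (Suc n) = epow T n * T"

definition dprod :: "(nat \<Rightarrow> nat) \<Rightarrow> nat list \<Rightarrow> ('f expo, 'f) lop" where
  "dprod \<mu> ps = foldr (\<lambda>p T. epow (dl p) (\<mu> p) * T) ps idop"

definition dpow :: "(nat \<Rightarrow> nat) \<Rightarrow> ('f expo, 'f) lop" where "dpow \<mu> = dprod \<mu> [1..<k + 1]"

definition mono :: "'f expo \<Rightarrow> (nat \<Rightarrow> nat) \<Rightarrow> ('f expo, 'f) lop" where "mono x \<mu> = Mx x * dpow \<mu>"

definition mcol where "mcol x \<mu> = xcol x - (\<Sum>p = 1..k. nmult (\<mu> p) (tcol D p))"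

definition Wset :: "('f expo, 'f) lop set" where
  "Wset = ops.span {mono x \<mu> |x \<mu>. x \<in> Bset \<and> \<mu> \<in> Mset D}"

lemma nmult_uminus: "nmult n (- \<kappa>) = - nmult n (\<kappa> :: 'g)"
  by (induction n) (simp_all add: nmult_Suc)

lemma hom_epow: "homg \<kappa> T \<Longrightarrow> homg (nmult n \<kappa>) (epow T n)"
  by (induction n) (simp_all add: hom_unit nmult_Suc hom_mult)

lemma dprod_Nil [simp]: "dprod \<mu> [] = idop"
  and dprod_Cons [simp]: "dprod \<mu> (p # ps) = epow (dl p) (\<mu> p) * dprod \<mu> ps"
  by (simp_all add: dprod_def)

lemma hom_dprod: "set ps \<subseteq> {1..k} \<Longrightarrow> distinct ps \<Longrightarrow>
    homg (\<Sum>p\<in>set ps. nmult (\<mu> p) (dcol p)) (dprod \<mu> ps)"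
  by (induction ps) (auto simp: hom_unit intro!: hom_mult hom_epow hom_dl)

lemma hom_dpow: "homg (- (\<Sum>p = 1..k. nmult (\<mu> p) (tcol D p))) (dpow \<mu>)"
proof -
  have s: "set [1..<k + 1] = {1..k}" by auto
  show ?thesis
    using hom_dprod[of "[1..<k + 1]" \<mu>] unfolding s dpow_def by (simp add: nmult_uminus sum_negf)
qed

lemma hom_mono: "homg (mcol x \<mu>) (mono x \<mu>)"
  using hom_mult[OF hom_Mx hom_dpow, of x \<mu>] by (simp add: mcol_def mono_def)

lemma comp_mono: "cpt \<kappa> (mono x \<mu>) = (if \<kappa> = mcol x \<mu> then mono x \<mu> else 0)"
  by (rule comp_hom[OF hom_mono])

lemma sig_mono: "sig \<kappa> (mono x \<mu>) = eps D \<kappa> (mcol x \<mu>) \<star> mono x \<mu>"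
  by (rule sig_hom[OF hom_mono])

lemma dpow_zero [simp]: "dpow 0 = idop"
proof -
  have "dprod 0 ps = idop" for ps by (induction ps) simp_all
  then show ?thesis by (simp add: dpow_def)
qed

lemma M_zero [simp]: "0 \<in> Mset D" by (simp add: Mset_def)

lemma epow_Suc_left: "homg \<kappa> T \<Longrightarrow> epow T (Suc n) = T * epow T n"
proof (induction n)
  case 0
  then show ?case by (simp add: unit_left[of \<kappa>] unit_right[of \<kappa>])
next
  case (Suc n)
  then show ?case by (metis epow.simps(2) mult.assoc)
qed

lemma dl_epow_comm:
  assumes "p \<in> {1..k}" "q \<in> {1..k}"
  shows "\<exists>c. c \<noteq> 0 \<and> dl p * epow (dl q) n = c \<star> (epow (dl q) n * dl p)"
proof (induction n)
  case 0
  then show ?case using unit_left[OF hom_dl[OF assms(1)]] unit_right[OF hom_dl[OF assms(1)]]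
    by (auto intro!: exI[of _ 1])
next
  case (Suc n)
  then obtain c where c: "c \<noteq> 0" "dl p * epow (dl q) n = c \<star> (epow (dl q) n * dl p)" by blast
  have "dl p * epow (dl q) (Suc n) = dl p * epow (dl q) n * dl q" by (simp add: mult.assoc)
  also have "\<dots> = c \<star> (epow (dl q) n * (dl p * dl q))" by (simp add: c mult.assoc)
  also have "dl p * dl q = eps D (dcol p) (dcol q) \<star> (dl q * dl p)" by (rule dl_comm[OF assms])
  finally show ?case using c(1) eps_nonzero
    by (intro exI[of _ "c * eps D (dcol p) (dcol q)"]) (simp add: mult.assoc)
qed

lemma dprod_cong: "(\<And>p. p \<in> set ps \<Longrightarrow> \<mu> p = \<nu> p) \<Longrightarrow> dprod \<mu> ps = dprod \<nu> ps"
  by (induction ps) auto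

text \<open>Color commutation carries \<open>\<partial>\<^sub>p\<close> to its place among the factors; the sign picked up on the way is only
  needed to be nonzero.\<close>
lemma dl_dprod:
  assumes p: "p \<in> {1..k}"
  shows "set ps \<subseteq> {1..k} \<Longrightarrow> distinct ps \<Longrightarrow> p \<in> set ps \<Longrightarrow>
    \<exists>c. c \<noteq> 0 \<and> dl p * dprod \<mu> ps = c \<star> dprod (\<mu>(p := Suc (\<mu> p))) ps"
proof (induction ps)
  case (Cons q ps)
  show ?case
  proof (cases "q = p")
    case True
    then have "dprod \<mu> ps = dprod (\<mu>(p := Suc (\<mu> p))) ps"
      using Cons.prems by (intro dprod_cong) auto
    moreover have "(\<mu>(p := Suc (\<mu> p))) p = Suc (\<mu> p)" by simp
    ultimately have "dl p * dprod \<mu> (q # ps) = 1 \<star> dprod (\<mu>(p := Suc (\<mu> p))) (q # ps)"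
      unfolding dprod_Cons True ops.scale_one using epow_Suc_left[OF hom_dl[OF p], of "\<mu> p"]
      by (simp only: mult.assoc[symmetric])
    then show ?thesis using one_neq_zero by blast
  next
    case False
    have "set ps \<subseteq> {1..k}" "distinct ps" "p \<in> set ps" using Cons.prems False by simp_all
    from Cons.IH[OF this] obtain c
      where c: "c \<noteq> 0" "dl p * dprod \<mu> ps = c \<star> dprod (\<mu>(p := Suc (\<mu> p))) ps" by (elim exE conjE)
    obtain d where d: "d \<noteq> 0" "dl p * epow (dl q) (\<mu> q) = d \<star> (epow (dl q) (\<mu> q) * dl p)"
      using dl_epow_comm[OF p, of q] Cons.prems by auto
    have "dl p * dprod \<mu> (q # ps) = (dl p * epow (dl q) (\<mu> q)) * dprod \<mu> ps" by (simp add: mult.assoc)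
    also have "\<dots> = d \<star> (epow (dl q) (\<mu> q) * (dl p * dprod \<mu> ps))" unfolding d(2) by (simp add: mult.assoc)
    also have "\<dots> = (d * c) \<star> (epow (dl q) (\<mu> q) * dprod (\<mu>(p := Suc (\<mu> p))) ps)" unfolding c(2) by simp
    also have "epow (dl q) (\<mu> q) * dprod (\<mu>(p := Suc (\<mu> p))) ps = dprod (\<mu>(p := Suc (\<mu> p))) (q # ps)"
      unfolding dprod_Cons fun_upd_other[OF False] ..
    finally show ?thesis using c(1) d(1) by (metis mult_eq_0_iff)
  qed
qed simp

lemma dl_dpow:
  assumes p: "p \<in> {1..k}"
  shows "\<exists>c. c \<noteq> 0 \<and> dl p * dpow \<mu> = c \<star> dpow (\<mu>(p := Suc (\<mu> p)))"
  unfolding dpow_def using p by (intro dl_dprod) auto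

end

locale weyl_char0 = weyl_setup D
  for D :: "('f::field_char_0, 'g::ab_group_add) weyl_data"
begin

text \<open>\<open>\<partial>\<^sub>p\<close> color-commutes with itself with the sign \<open>-1\<close>, so \<open>2 \<partial>\<^sub>p\<^sup>2 = 0\<close>.\<close>
lemma dl_sq: "p \<in> {1..k} \<Longrightarrow> \<not> p \<le> kev \<Longrightarrow> dl p * dl p = 0"
proof -
  assume p: "p \<in> {1..k}" "\<not> p \<le> kev"
  have e: "eps D (dcol p) (dcol p) = - 1"
    using eps_tcol_odd[OF p] by (simp add: eps_uminus_left eps_uminus_right)
  have "dl p * dl p = - (dl p * dl p)" using dl_comm[OF p(1) p(1)] unfolding e by simp
  then have "(2 :: 'f) \<star> (dl p * dl p) = 0"
    by (metis add.right_inverse ops.scale_left_distrib ops.scale_one one_add_one)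
  then show ?thesis by simp
qed

lemma dprod_epow_zero: "p \<in> set ps \<Longrightarrow> epow (dl p) (\<mu> p) = 0 \<Longrightarrow> dprod \<mu> ps = 0"
  by (induction ps) auto

lemma dpow_vanish:
  assumes p: "p \<in> {1..k}" "\<not> p \<le> kev" and \<mu>: "\<mu> p \<ge> 2"
  shows "dpow \<mu> = 0"
proof -
  obtain n where "\<mu> p = Suc (Suc n)" using \<mu> by (metis add_2_eq_Suc le_Suc_ex)
  then have "epow (dl p) (\<mu> p) = 0" by (simp add: mult.assoc dl_sq[OF p])
  then show ?thesis unfolding dpow_def using p(1) by (intro dprod_epow_zero[of p]) auto
qed

lemma M_upd: "\<mu> \<in> Mset D \<Longrightarrow> p \<in> {1..k} \<Longrightarrow> (p \<le> kev \<or> n \<le> 1) \<Longrightarrow> \<mu>(p := n) \<in> Mset D"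
  unfolding Mset_def by auto

lemma W_mono: "x \<in> Bset \<Longrightarrow> \<mu> \<in> Mset D \<Longrightarrow> mono x \<mu> \<in> Wset"
  unfolding Wset_def by (rule ops.span_base) blast

lemma W_subspace: "ops.subspace Wset" by (simp add: Wset_def)
lemma W_add: "S \<in> Wset \<Longrightarrow> T \<in> Wset \<Longrightarrow> S + T \<in> Wset" by (simp add: Wset_def ops.span_add)
lemma W_diff: "S \<in> Wset \<Longrightarrow> T \<in> Wset \<Longrightarrow> S - T \<in> Wset" by (simp add: Wset_def ops.span_diff)
lemma W_smul: "T \<in> Wset \<Longrightarrow> r \<star> T \<in> Wset" by (simp add: Wset_def ops.span_scale)
lemma W_zero [simp]: "0 \<in> Wset" by (simp add: Wset_def ops.span_zero)

lemma W_subset_graded: "Wset \<subseteq> graded_ops"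
  unfolding Wset_def graded_ops_def by (rule ops.span_mono) (auto intro: hom_mono)

lemma W_graded: "T \<in> Wset \<Longrightarrow> T \<in> graded_ops" using W_subset_graded by blast

text \<open>If raising the \<open>p\<close>-th exponent leaves \<open>Mset\<close>, then \<open>p\<close> is odd and \<open>\<partial>\<^sup>\<mu>\<close> contains \<open>\<partial>\<^sub>p\<^sup>2 = 0\<close>.\<close>
lemma mono_step:
  assumes p: "p \<in> {1..k}" and x: "x \<in> Bset" and \<mu>: "\<mu> \<in> Mset D"
  shows "Mx x * (dl p * dpow \<mu>) \<in> Wset"
proof -
  obtain c where c: "dl p * dpow \<mu> = c \<star> dpow (\<mu>(p := Suc (\<mu> p)))" using dl_dpow[OF p] by blast
  show ?thesis
  proof (cases "p \<le> kev \<or> \<mu> p = 0")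
    case True
    then have "\<mu>(p := Suc (\<mu> p)) \<in> Mset D" by (intro M_upd[OF \<mu> p]) auto
    then show ?thesis unfolding c using W_mono[OF x] by (simp add: mono_def W_smul)
  next
    case False
    then have "dpow (\<mu>(p := Suc (\<mu> p))) = 0" using p by (intro dpow_vanish[of p]) auto
    then show ?thesis unfolding c by simp
  qed
qed

lemma W_Mx_left:
  assumes T: "T \<in> Wset"
  shows "Mx x * T \<in> Wset"
proof (cases "x \<in> Bset")
  case True
  show ?thesis using T unfolding Wset_def
  proof (induction T rule: ops.span_induct_alt)
    case (step c S T)
    then obtain y \<mu> where y: "S = mono y \<mu>" "y \<in> Bset" "\<mu> \<in> Mset D" by blast
    have "Mx x * S = mult_coeff D x y \<star> mono (x + y) \<mu>"
      by (simp add: y mono_def mult.assoc[symmetric] Mx_mult[OF True y(2)])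
    also have "mono (x + y) \<mu> \<in> Wset"
      using W_mono[OF _ y(3), of "x + y"] by (cases "x + y \<in> Bset") (simp_all add: mono_def Mx_out)
    then have "mult_coeff D x y \<star> mono (x + y) \<mu> \<in> Wset" by (rule W_smul)
    finally show ?case using step(2) unfolding Wset_def[symmetric]
      by (simp add: distrib_left W_add W_smul)
  qed (simp add: ops.span_zero)
qed (simp add: Mx_out)

lemma W_dl_left:
  assumes T: "T \<in> Wset" and p: "p \<in> {1..k}"
  shows "dl p * T \<in> Wset"
  using T unfolding Wset_def
proof (induction T rule: ops.span_induct_alt)
  case (step c S T)
  then obtain y \<mu> where y: "S = mono y \<mu>" "y \<in> Bset" "\<mu> \<in> Mset D" by blast
  have "dl p * S = fst y p \<star> mono y \<mu> + (tau p y * of_nat (snd y p)) \<star> mono (down p y) \<mu> +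
     eps D (dcol p) (xcol y) \<star> (Mx y * (dl p * dpow \<mu>))"
    unfolding y mono_def mult.assoc[symmetric] dl_Mx[OF p y(2)] by (simp add: distrib_right mult.assoc)
  also have "\<dots> \<in> Wset"
    by (intro W_add W_smul W_mono B_down y mono_step p)
  finally show ?case using step(2) unfolding Wset_def[symmetric] by (simp add: distrib_left W_add W_smul)
qed (simp add: ops.span_zero)

lemma unit_W [simp]: "idop \<in> Wset"
  using W_mono[OF B_zero M_zero] by (simp add: mono_def Mx_zero)

lemma dprod_W_left: "set ps \<subseteq> {1..k} \<Longrightarrow> T \<in> Wset \<Longrightarrow> dprod \<mu> ps * T \<in> Wset"
proof (induction ps arbitrary: T)
  case Nil
  then show ?case using graded_ops_unit(1)[OF W_graded] by simp
next
  case (Cons p ps)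
  have "epow (dl p) n * S \<in> Wset" if "S \<in> Wset" for n S
    using that
  proof (induction n arbitrary: S)
    case 0
    then show ?case using graded_ops_unit(1)[OF W_graded] by simp
  next
    case (Suc n)
    then show ?case using W_dl_left[of S p] Cons.prems by (simp add: mult.assoc)
  qed
  then show ?case using Cons by (simp add: mult.assoc)
qed

lemma W_mult:
  assumes "S \<in> Wset" "T \<in> Wset"
  shows "S * T \<in> Wset"
  using assms(1) unfolding Wset_def
proof (induction S rule: ops.span_induct_alt)
  case (step c R S)
  then obtain y \<mu> where y: "R = mono y \<mu>" by blast
  have "R * T \<in> Wset"
    unfolding y mono_def dpow_def mult.assoc by (intro W_Mx_left dprod_W_left assms(2)) auto
  then show ?case using step(2) unfolding Wset_def[symmetric] by (simp add: distrib_right W_add W_smul)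
qed (simp add: ops.span_zero)

lemma W_Mx [simp]: "Mx x \<in> Wset"
  using W_Mx_left[OF unit_W, of x] unit_right[OF hom_Mx, of x] by simp

lemma W_dl: "p \<in> {1..k} \<Longrightarrow> dl p \<in> Wset"
  using W_dl_left[OF unit_W] unit_right[OF hom_dl] by simp

lemma W_comp: "T \<in> Wset \<Longrightarrow> cpt \<kappa> T \<in> Wset"
  unfolding Wset_def
proof (induction T rule: ops.span_induct_alt)
  case (step c S T)
  then obtain y \<mu> where y: "S = mono y \<mu>" "y \<in> Bset" "\<mu> \<in> Mset D" by blast
  then have "cpt \<kappa> S \<in> Wset" using W_mono comp_mono[of \<kappa> y \<mu>] by simp
  then show ?case using step(2) unfolding Wset_def[symmetric] by (simp add: comp_add comp_smul W_add W_smul)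
qed (simp add: ops.span_zero)

lemma W_sig: "T \<in> Wset \<Longrightarrow> sig \<kappa> T \<in> Wset"
  unfolding Wset_def
proof (induction T rule: ops.span_induct_alt)
  case (step c S T)
  then obtain y \<mu> where y: "S = mono y \<mu>" "y \<in> Bset" "\<mu> \<in> Mset D" by blast
  then have "sig \<kappa> S \<in> Wset" using W_mono sig_mono[of \<kappa> y \<mu>] W_smul by simp
  then show ?case using step(2) unfolding Wset_def[symmetric] by (simp add: sig_add sig_smul W_add W_smul)
qed (simp add: ops.span_zero)

lemma W_cad: "S \<in> Wset \<Longrightarrow> T \<in> Wset \<Longrightarrow> cad \<kappa> S T \<in> Wset"
  by (simp add: cad_def W_diff W_mult W_sig)

text \<open>The component of color \<open>\<kappa>\<close> of a combination of monomials is the combination of those of color \<open>\<kappa>\<close>.\<close>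
lemma W_homog_span:
  "{T \<in> Wset. homg \<kappa> T} = ops.span {mono x \<mu> |x \<mu>. x \<in> Bset \<and> \<mu> \<in> Mset D \<and> mcol x \<mu> = \<kappa>}"
    (is "_ = ops.span ?S")
proof
  have c: "cpt \<kappa> T \<in> ops.span ?S" if "T \<in> Wset" for T
    using that unfolding Wset_def
  proof (induction T rule: ops.span_induct_alt)
    case (step c S T)
    then obtain y \<mu> where y: "S = mono y \<mu>" "y \<in> Bset" "\<mu> \<in> Mset D" by blast
    then have "cpt \<kappa> S \<in> ops.span ?S"
      unfolding y(1) comp_mono using y(2,3) by (cases "\<kappa> = mcol y \<mu>") (auto intro: ops.span_base simp: ops.span_zero)
    then show ?case using step(2) by (simp add: comp_add comp_smul ops.span_add ops.span_scale)
  qed (simp only: comp_zero ops.span_zero)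
  have "T \<in> ops.span ?S" if "T \<in> Wset" "homg \<kappa> T" for T
    using that(2) c[OF that(1)] by (simp only: hom_iff_comp)
  then show "{T \<in> Wset. homg \<kappa> T} \<subseteq> ops.span ?S" by blast
  have "ops.subspace {T \<in> Wset. homg \<kappa> T}"
    by (simp add: ops.subspace_def W_add W_smul hom_add hom_smul)
  moreover have "?S \<subseteq> {T \<in> Wset. homg \<kappa> T}"
  proof
    fix T assume "T \<in> ?S"
    then obtain x \<mu> where "T = mono x \<mu>" "x \<in> Bset" "\<mu> \<in> Mset D" "mcol x \<mu> = \<kappa>" by blast
    then show "T \<in> {T \<in> Wset. homg \<kappa> T}" using W_mono hom_mono[of x \<mu>] by simp
  qed
  ultimately show "ops.span ?S \<subseteq> {T \<in> Wset. homg \<kappa> T}" by (rule ops.span_minimal[rotated])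
qed

text \<open>Every property that is linear and inherited by left multiplication with the generators holds on
  the whole algebra.\<close>
lemma W_gen_induct [consumes 1, case_names add smul unit Mx dl]:
  assumes T: "T \<in> Wset"
    and add: "\<And>S T. S \<in> Wset \<Longrightarrow> T \<in> Wset \<Longrightarrow> P S \<Longrightarrow> P T \<Longrightarrow> P (S + T)"
    and smul: "\<And>r T. T \<in> Wset \<Longrightarrow> P T \<Longrightarrow> P (r \<star> T)"
    and unit: "P idop"
    and Mx: "\<And>x T. x \<in> Bset \<Longrightarrow> T \<in> Wset \<Longrightarrow> P T \<Longrightarrow> P (Mx x * T)"
    and dl: "\<And>p T. p \<in> {1..k} \<Longrightarrow> T \<in> Wset \<Longrightarrow> P T \<Longrightarrow> P (dl p * T)"
  shows "P T"
proof -
  have ep: "P (epow (dl p) n * S)" if "S \<in> Wset" "P S" "p \<in> {1..k}" for n S p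
    using that(1,2)
  proof (induction n arbitrary: S)
    case 0
    then show ?case using graded_ops_unit(1)[OF W_graded] by simp
  next
    case (Suc n)
    then show ?case using W_dl_left[of S p] dl[of p S] that(3) by (simp add: mult.assoc)
  qed
  have dp: "P (dprod \<mu> ps) \<and> dprod \<mu> ps \<in> Wset" if "set ps \<subseteq> {1..k}" for \<mu> ps
    using that
  proof (induction ps)
    case (Cons p ps)
    have "dprod \<mu> (p # ps) * idop \<in> Wset" using Cons.prems by (intro dprod_W_left unit_W)
    moreover have "dprod \<mu> (p # ps) * idop = dprod \<mu> (p # ps)"
      using graded_ops_unit(2)[OF W_graded, of "dprod \<mu> ps"] Cons by (simp add: mult.assoc)
    ultimately show ?case using Cons ep by simp
  qed (simp add: unit)
  have d: "P (dpow \<mu>)" "dpow \<mu> \<in> Wset" for \<mu>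
  proof -
    have "set [1..<k + 1] \<subseteq> {1..k}" by auto
    note * = dp[OF this, of \<mu>, folded dpow_def]
    show "P (dpow \<mu>)" using * by (rule conjunct1)
    show "dpow \<mu> \<in> Wset" using * by (rule conjunct2)
  qed
  have "P T \<and> T \<in> Wset"
    using T unfolding Wset_def
  proof (induction T rule: ops.span_induct_alt)
    case base
    then show ?case using smul[OF unit_W unit, of 0] by (simp add: ops.span_zero)
  next
    case (step c R S)
    then obtain y \<mu> where y: "R = mono y \<mu>" "y \<in> Bset" "\<mu> \<in> Mset D" by blast
    then have "R \<in> Wset" "P R" using Mx[OF _ d(2) d(1)] W_mono by (auto simp: mono_def)
    then show ?case using step(2) unfolding Wset_def[symmetric] by (auto intro: add smul W_add W_smul)
  qed
  then show ?thesis ..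
qed

section \<open>The commutative subalgebra and its constants\<close>

lemma A_Mx [simp]: "Mx x \<in> Aset"
  by (cases "x \<in> Bset") (auto simp: Aset_def Mx_out ops.span_zero intro: ops.span_base)

lemma A_add: "S \<in> Aset \<Longrightarrow> T \<in> Aset \<Longrightarrow> S + T \<in> Aset" by (simp add: Aset_def ops.span_add)
lemma A_diff: "S \<in> Aset \<Longrightarrow> T \<in> Aset \<Longrightarrow> S - T \<in> Aset" by (simp add: Aset_def ops.span_diff)
lemma A_smul: "T \<in> Aset \<Longrightarrow> r \<star> T \<in> Aset" by (simp add: Aset_def ops.span_scale)
lemma A_zero [simp]: "0 \<in> Aset" by (simp add: Aset_def ops.span_zero)
lemma A_sub_W: "Aset \<subseteq> Wset"
  unfolding Aset_def by (rule ops.span_minimal) (auto simp: W_subspace)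

lemma A_W: "u \<in> Aset \<Longrightarrow> u \<in> Wset" using A_sub_W by blast

lemma A_induct [consumes 1, case_names zero step]:
  assumes "u \<in> Aset" "P 0" "\<And>r x u. x \<in> Bset \<Longrightarrow> u \<in> Aset \<Longrightarrow> P u \<Longrightarrow> P (r \<star> Mx x + u)"
  shows "P u"
proof -
  have "P u \<and> u \<in> Aset"
    using assms(1) unfolding Aset_def
  proof (induction u rule: ops.span_induct_alt)
    case base
    then show ?case using assms(2) by (simp add: ops.span_zero)
  next
    case (step c S T)
    then obtain x where "S = Mx x" "x \<in> Bset" by blast
    then show ?case using step(2) assms(3) unfolding Aset_def[symmetric] by (simp add: A_add A_smul)
  qed
  then show ?thesis ..
qed

lemma A_mult: "u \<in> Aset \<Longrightarrow> v \<in> Aset \<Longrightarrow> u * v \<in> Aset"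
proof (induction u rule: A_induct)
  case (step r x u)
  have "Mx x * v \<in> Aset" using \<open>v \<in> Aset\<close>
    by (induction v rule: A_induct) (simp_all add: distrib_left A_add A_smul Mx_mult step(1))
  then show ?case using step by (simp add: distrib_right A_add A_smul)
qed simp

lemma A_comp: "u \<in> Aset \<Longrightarrow> cpt \<kappa> u \<in> Aset"
  by (induction u rule: A_induct) (simp_all add: comp_add comp_smul A_add A_smul comp_hom[OF hom_Mx])

lemma A_sig: "u \<in> Aset \<Longrightarrow> sig \<kappa> u \<in> Aset"
  by (induction u rule: A_induct) (simp_all add: sig_add sig_smul A_add A_smul sig_hom[OF hom_Mx])

lemma cad_Mx_Mx: "x \<in> Bset \<Longrightarrow> y \<in> Bset \<Longrightarrow> cad (xcol x) (Mx x) (Mx y) = 0"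
  by (simp add: cad_hom[OF hom_Mx] Mx_comm[of x y])

lemma cad_Mx_A: "x \<in> Bset \<Longrightarrow> u \<in> Aset \<Longrightarrow> cad (xcol x) (Mx x) u = 0"
  by (rotate_tac 1, induction u rule: A_induct) (simp_all add: cad_add cad_smul cad_Mx_Mx)

lemma cad_dl_Mx:
  assumes "p \<in> {1..k}" "x \<in> Bset"
  shows "cad (dcol p) (dl p) (Mx x) = fst x p \<star> Mx x + (tau p x * of_nat (snd x p)) \<star> Mx (down p x)"
  by (simp add: cad_hom[OF hom_Mx] dl_Mx[OF assms])

lemma cad_dl_dl: "p \<in> {1..k} \<Longrightarrow> q \<in> {1..k} \<Longrightarrow> cad (dcol p) (dl p) (dl q) = 0"
  by (simp add: cad_hom[OF hom_dl] dl_comm[of p q])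

lemma A_cad_dl: "u \<in> Aset \<Longrightarrow> p \<in> {1..k} \<Longrightarrow> cad (dcol p) (dl p) u \<in> Aset"
  by (induction u rule: A_induct) (simp_all add: cad_add cad_smul A_add A_smul cad_dl_Mx)

lemma cad_unit: "homg \<kappa> S \<Longrightarrow> cad \<kappa> S idop = 0"
  by (simp add: cad_hom[OF hom_unit] unit_left unit_right)

lemma cad_dl_epow:
  assumes p: "p \<in> {1..k}" and q: "q \<in> {1..k}"
  shows "cad (dcol p) (dl p) (epow (dl q) n) = 0"
proof (induction n)
  case (Suc n)
  then show ?case
    by (simp add: cad_mult[OF graded_ops_hom[OF hom_dl[OF q]]] cad_dl_dl[OF p q])
qed (simp add: cad_unit[OF hom_dl[OF p]])

lemma cad_dl_dpow:
  assumes p: "p \<in> {1..k}"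
  shows "cad (dcol p) (dl p) (dpow \<mu>) = 0"
proof -
  have "cad (dcol p) (dl p) (dprod \<mu> ps) = 0" if "set ps \<subseteq> {1..k}" "distinct ps" for ps
    using that
  proof (induction ps)
    case (Cons q ps)
    have "dprod \<mu> ps \<in> graded_ops" using hom_dprod[of ps \<mu>] Cons.prems graded_ops_hom by simp
    then show ?case using Cons cad_dl_epow[OF p, of q "\<mu> q"] by (simp add: cad_mult)
  qed (simp add: cad_unit[OF hom_dl[OF p]])
  moreover have "set [1..<k + 1] \<subseteq> {1..k}" by auto
  ultimately show ?thesis unfolding dpow_def using distinct_upt by metis
qed

lemma graded_ops_out: "T \<in> graded_ops \<Longrightarrow> y \<notin> Bset \<Longrightarrow> app T (Poly_Mapping.single y 1) = 0"
  by (metis app_times app_zero graded_ops_unit(2) hom_out hom_unit)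

lemma graded_ops_eqI:
  assumes "S \<in> graded_ops" "T \<in> graded_ops" "\<And>y. y \<in> Bset \<Longrightarrow> app S (bvec y) = app T (bvec y)"
  shows "S = T"
  by (rule lop_eq_on_B[OF graded_ops_out[OF assms(1)] graded_ops_out[OF assms(2)] assms(3)])

lemma graded_ops_keys:
  assumes "T \<in> graded_ops" "y \<in> Bset"
  shows "Poly_Mapping.keys (app T (bvec y)) \<subseteq> Bset"
  using assms(1) unfolding graded_ops_def
proof (induction T rule: ops.span_induct_alt)
  case (step c S T)
  then obtain \<kappa> where "homg \<kappa> S" by blast
  then have "Poly_Mapping.keys (app S (bvec y)) \<subseteq> Bset" using hom_image[OF _ assms(2)] by blast
  then show ?case
    using step(2) keys_add[of "scale c (app S (bvec y))" "app T (bvec y)"] keys_scale_subset[of c "app S (bvec y)"]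
    by (simp only: app_add_left app_smul) blast
qed simp

text \<open>The identity \<open>1\<close> of \<open>\<A>\<close>, regarded as the vector on which operators are evaluated.\<close>
abbreviation vac where "vac \<equiv> bvec 0"

lemma app_Mx_vac: "x \<in> Bset \<Longrightarrow> app (Mx x) vac = bvec x"
proof -
  assume x: "x \<in> Bset"
  then have "fst x \<in> Grp D" by (simp add: Bset_def mem_Times_iff)
  then have "mult_coeff D x 0 = 1" by (simp add: mult_coeff_tfac cocyc_zero)
  then show ?thesis using app_Mx[OF x B_zero] by simp
qed

lemma app_dl_vac [simp]: "app (dl p) vac = 0"
  by (simp add: app_dl)

lemma A_from_vac:
  assumes "Poly_Mapping.keys v \<subseteq> Bset"
  obtains u where "u \<in> Aset" "app u vac = v"
proof
  let ?u = "\<Sum>x\<in>Poly_Mapping.keys v. Poly_Mapping.lookup v x \<star> Mx x"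
  show "?u \<in> Aset"
    unfolding Aset_def using assms by (intro ops.span_sum ops.span_scale ops.span_base) blast
  have "app ?u vac = (\<Sum>x\<in>Poly_Mapping.keys v. scale (Poly_Mapping.lookup v x) (Poly_Mapping.single x 1))"
    unfolding app_sum_left app_smul
  proof (rule sum.cong[OF refl])
    fix x assume "x \<in> Poly_Mapping.keys v"
    then have "x \<in> Bset" using assms by blast
    then show "scale (Poly_Mapping.lookup v x) (app (Mx x) vac) =
        scale (Poly_Mapping.lookup v x) (Poly_Mapping.single x 1)"
      by (simp only: app_Mx_vac bvec_in[of x])
  qed
  then show "app ?u vac = v" by (simp only: sum_single_coeffs[symmetric])
qed

text \<open>An operator that color-commutes with all multiplications is determined by its value at \<open>1\<close>,
  so it is the multiplication by that value.\<close>

lemma commutant_zero: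
  assumes Z: "Z \<in> graded_ops" and c: "\<And>x. x \<in> Bset \<Longrightarrow> cad (xcol x) (Mx x) Z = 0" and v: "app Z vac = 0"
  shows "Z = 0"
proof (rule graded_ops_eqI[OF Z])
  show "0 \<in> graded_ops" by (simp add: graded_ops_def ops.span_zero)
  fix y assume y: "y \<in> Bset"
  let ?\<kappa> = "xcol y"
  have "app (sig ?\<kappa> Z * Mx y) vac = app (Mx y * Z) vac" using c[OF y] by (simp add: cad_def)
  then have "app (Q ?\<kappa>) (app Z (app (Q (- ?\<kappa>)) (bvec y))) = 0"
    using v by (simp add: sig_def app_Mx_vac[OF y])
  then have "scale (eps D (- ?\<kappa>) ?\<kappa>) (app (Q ?\<kappa>) (app Z (bvec y))) = 0"
    by (simp only: app_Q[OF y] app_scale)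
  then have "app (Q ?\<kappa>) (app Z (bvec y)) = 0" using eps_nonzero by simp
  then have "app (Q (- ?\<kappa>) * Q ?\<kappa> * Z) (bvec y) = 0" by simp
  then show "app Z (bvec y) = app 0 (bvec y)" using graded_ops_unit(1)[OF Z] by (simp add: Q_inv)
qed

lemma A_eqI: "u \<in> Aset \<Longrightarrow> v \<in> Aset \<Longrightarrow> app u vac = app v vac \<Longrightarrow> u = v"
  using commutant_zero[of "u - v"] A_diff[of u v] cad_Mx_A W_graded[OF A_W] by simp

lemma commutant_A:
  assumes Z: "Z \<in> graded_ops" and c: "\<And>x. x \<in> Bset \<Longrightarrow> cad (xcol x) (Mx x) Z = 0"
  shows "Z \<in> Aset"
proof -
  obtain u where u: "u \<in> Aset" "app u vac = app Z vac"
    using A_from_vac[OF graded_ops_keys[OF Z B_zero]] by blast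
  have "Z - u = 0"
  proof (rule commutant_zero)
    show "Z - u \<in> graded_ops"
      using Z W_graded[OF A_W[OF u(1)]] by (simp add: graded_ops_def ops.span_diff)
  qed (use u c cad_Mx_A in \<open>simp_all add: cad_diff\<close>)
  then show ?thesis using u by simp
qed

text \<open>The coefficient of \<open>\<partial>\<^sub>p v\<close> at \<open>z\<close> has two sources in \<open>v\<close>: the term at \<open>z\<close> itself, through the weight, and the
  term with one more \<open>t\<^sub>p\<close>.\<close>
lemma lookup_dl:
  assumes v: "Poly_Mapping.keys v \<subseteq> Bset" and z: "z \<in> Bset" and p: "p \<in> {1..k}"
  shows "Poly_Mapping.lookup (app (dl p) v) z = fst z p * Poly_Mapping.lookup v z +
    tau p (z + (0, un p)) * of_nat (Suc (snd z p)) * Poly_Mapping.lookup v (z + (0, un p))"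
proof -
  define w where "w = z + (0, un p)"
  let ?l = "Poly_Mapping.lookup v"
  have dz: "down p y = z \<and> snd y p > 0 \<longleftrightarrow> y = w" for y
  proof
    assume "down p y = z \<and> snd y p > 0"
    then show "y = w" using down_un[of y p] by (simp add: w_def)
  next
    assume y: "y = w"
    have "down p y = z" unfolding y down_def w_def
      by (rule prod_eqI) (simp_all add: fun_eq_iff un_def)
    then show "down p y = z \<and> snd y p > 0" using y by (simp add: un_def w_def)
  qed
  have "Poly_Mapping.lookup (app (dl p) v) z =
      (\<Sum>y\<in>Poly_Mapping.keys v. ?l y * Poly_Mapping.lookup (app (dl p) (bvec y)) z)"
    by (simp add: app_in_B[OF v] lookup_sum)
  also have "\<dots> = (\<Sum>y\<in>Poly_Mapping.keys v. (if y = z then fst z p * ?l z else 0) +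
      (if y = w then tau p w * of_nat (snd w p) * ?l w else 0))"
  proof (rule sum.cong[OF refl])
    fix y assume "y \<in> Poly_Mapping.keys v"
    then have y: "y \<in> Bset" using v by blast
    have H: "of_nat (snd y p) * Poly_Mapping.lookup (bvec (down p y)) z = (if y = w then of_nat (snd w p) else 0)"
    proof (cases "y = w")
      case True
      then have "down p y = z" using dz by blast
      then show ?thesis using True z by (simp add: lookup_bvec)
    next
      case False
      then have "snd y p = 0 \<or> down p y \<noteq> z" using dz[of y] by auto
      then show ?thesis using False by (auto simp: lookup_bvec)
    qed
    have "?l y * Poly_Mapping.lookup (app (dl p) (bvec y)) z =
        ?l y * (fst y p * Poly_Mapping.lookup (bvec y) z) +
        ?l y * (tau p y * (of_nat (snd y p) * Poly_Mapping.lookup (bvec (down p y)) z))"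
      by (simp add: app_dl[OF y] lookup_add distrib_left mult.assoc)
    also have "\<dots> = (if y = z then fst z p * ?l z else 0) +
      (if y = w then tau p w * of_nat (snd w p) * ?l w else 0)"
      unfolding H using y by (auto simp: lookup_bvec)
    finally show "?l y * Poly_Mapping.lookup (app (dl p) (bvec y)) z = (if y = z then fst z p * ?l z else 0) +
      (if y = w then tau p w * of_nat (snd w p) * ?l w else 0)" .
  qed
  also have "\<dots> = fst z p * ?l z + tau p w * of_nat (snd w p) * ?l w"
    by (simp add: sum.distrib in_keys_iff)
  finally show ?thesis by (simp add: un_def w_def)
qed

text \<open>Comparing coefficients at \<open>z\<close> expresses the coefficient at \<open>z\<close> through the one at \<open>z\<close> with the
  \<open>p\<close>-th exponent raised; finiteness of the support kills the weights other than \<open>a\<close>, and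
  within the weight \<open>a\<close> only the coefficients not reached from a nonzero \<open>z\<close> survive.\<close>
lemma weight_vector_support:
  assumes v: "Poly_Mapping.keys v \<subseteq> Bset"
    and eig: "\<And>z p. z \<in> Bset \<Longrightarrow> z \<noteq> 0 \<Longrightarrow> p \<in> {1..k} \<Longrightarrow>
        Poly_Mapping.lookup (app (dl p) v) z = a p * Poly_Mapping.lookup v z"
    and a: "a \<in> Grp D" and z: "z \<in> Poly_Mapping.keys v"
  shows "z = 0 \<or> z = (a, 0) \<or> a = 0 \<and> (\<exists>p\<in>{k1 D + 1..k}. z = (0, un p))"
proof -
  have rec: "(fst z p - a p) * Poly_Mapping.lookup v z +
      tau p (z + (0, un p)) * of_nat (Suc (snd z p)) * Poly_Mapping.lookup v (z + (0, un p)) = 0"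
    if "z \<in> Bset" "z \<noteq> 0" "p \<in> {1..k}" for z p
    using eig[OF that] lookup_dl[OF v that(1,3)] by (simp add: algebra_simps)
  have zB: "z \<in> Bset" using z v by blast
  show ?thesis
  proof (cases "fst z = a")
    case False
    then obtain p where p: "fst z p \<noteq> a p" by (auto simp: fun_eq_iff)
    have "a p \<noteq> 0 \<or> fst z p \<noteq> 0" using p by auto
    then have "p \<in> {1..k1 D + k2 D}"
      using G_out[OF a, of p] G_out[of "fst z" p] zB by (auto simp: Bset_def mem_Times_iff)
    then have pk: "p \<in> {1..k}" by (simp add: ktot_def)
    show ?thesis
    proof (cases "z = 0")
      case z0: False
      define S where "S = {y \<in> Poly_Mapping.keys v. fst y = fst z \<and> y \<noteq> 0}"
      have S: "finite S" "z \<in> S" using z z0 by (simp_all add: S_def)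
      then have "Max ((\<lambda>y. snd y p) ` S) \<in> (\<lambda>y. snd y p) ` S" by (intro Max_in) blast+
      then obtain y where y: "Max ((\<lambda>y. snd y p) ` S) = snd y p" "y \<in> S" by (rule imageE)
      have max: "snd w p \<le> snd y p" if "w \<in> S" for w
        unfolding y(1)[symmetric] using S(1) that by (intro Max_ge finite_imageI imageI)
      have yk: "y \<in> Poly_Mapping.keys v" "fst y = fst z" "y \<noteq> 0" using y(2) by (simp_all add: S_def)
      have s: "snd (y + (0, un p)) p = Suc (snd y p)" by (simp add: un_def)
      then have "y + (0, un p) \<notin> S" using max[of "y + (0, un p)"] by linarith
      moreover have "y + (0, un p) \<noteq> 0"
      proof
        assume "y + (0, un p) = 0"
        then show False using s by simp
      qed
      ultimately have "Poly_Mapping.lookup v (y + (0, un p)) = 0"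
        using yk(2) by (simp add: S_def in_keys_iff)
      moreover have "y \<in> Bset" using yk(1) v by blast
      ultimately have "(fst y p - a p) * Poly_Mapping.lookup v y = 0" using rec[of y p] yk(3) pk by simp
      then have False using yk(1,2) p by (simp add: in_keys_iff)
      then show ?thesis ..
    qed simp
  next
    case True
    show ?thesis
    proof (cases "snd z = 0")
      case True
      then show ?thesis using \<open>fst z = a\<close> by (simp add: prod_eq_iff)
    next
      case False
      then obtain p where p: "snd z p > 0" by (auto simp: fun_eq_iff)
      have pk: "p \<in> {k1 D + 1..k}" by (rule B_range[OF zB p])
      have zd: "z = down p z + (0, un p)" by (rule down_un[OF p])
      have "down p z = 0"
      proof (rule ccontr)
        assume d: "down p z \<noteq> 0"
        have "fst (down p z) p = a p" using True by (simp add: down_def)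
        then have "tau p z * of_nat (Suc (snd (down p z) p)) * Poly_Mapping.lookup v z = 0"
          using rec[OF B_down[OF zB] d, of p] pk by (simp add: zd[symmetric])
        then have "Poly_Mapping.lookup v z = 0" by (simp del: of_nat_Suc)
        then show False using z by (simp add: in_keys_iff)
      qed
      then have "z = (0, un p)" using zd by simp
      then show ?thesis using True pk by auto
    qed
  qed
qed

end

section \<open>Color commutators, ideals and reduction to weight vectors\<close>

context weyl_char0
begin

lemma sig_sig: "sig \<kappa> (sig \<mu> T) = sig (\<kappa> + \<mu>) T"
proof -
  have "sig \<kappa> (sig \<mu> T) = (Q \<kappa> * Q \<mu>) * T * (Q (- \<mu>) * Q (- \<kappa>))" by (simp add: sig_def mult.assoc)
  moreover have "- \<mu> + - \<kappa> = - (\<kappa> + \<mu>)" by simp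
  ultimately show ?thesis by (simp only: Q_mult sig_def)
qed

lemma sig_0: "T \<in> graded_ops \<Longrightarrow> sig 0 T = T"
  using graded_ops_unit[of T] by (simp add: sig_def idop_def[symmetric])

lemma cad_jacobi:
  assumes S: "homg \<kappa> S" and R: "homg \<mu> R" and T: "T \<in> graded_ops"
  shows "cad \<kappa> S (cad \<mu> R T) = cad (\<kappa> + \<mu>) (cad \<kappa> S R) T + eps D \<kappa> \<mu> \<star> cad \<mu> R (cad \<kappa> S T)"
proof -
  have 1: "sig \<kappa> (R * T) = eps D \<kappa> \<mu> \<star> (R * sig \<kappa> T)" by (simp add: sig_mult[OF T] sig_hom[OF R])
  have 2: "sig \<kappa> (sig \<mu> T * R) = eps D \<kappa> \<mu> \<star> (sig (\<kappa> + \<mu>) T * R)"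
    by (simp add: sig_mult[OF graded_ops_hom[OF R]] sig_hom[OF R] sig_sig)
  have 3: "sig \<mu> (S * T) = eps D \<mu> \<kappa> \<star> (S * sig \<mu> T)" by (simp add: sig_mult[OF T] sig_hom[OF S])
  have 4: "sig \<mu> (sig \<kappa> T * S) = eps D \<mu> \<kappa> \<star> (sig (\<kappa> + \<mu>) T * S)"
    by (simp add: sig_mult[OF graded_ops_hom[OF S]] sig_hom[OF S] sig_sig add.commute)
  have A: "cad \<kappa> S (cad \<mu> R T) = S * (R * T - sig \<mu> T * R) - (sig \<kappa> (R * T) - sig \<kappa> (sig \<mu> T * R)) * S"
    by (simp only: cad_def sig_diff)
  have B: "cad \<mu> R (cad \<kappa> S T) = R * (S * T - sig \<kappa> T * S) - (sig \<mu> (S * T) - sig \<mu> (sig \<kappa> T * S)) * R"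
    by (simp only: cad_def sig_diff)
  have C: "cad (\<kappa> + \<mu>) (cad \<kappa> S R) T =
      (S * R - eps D \<kappa> \<mu> \<star> (R * S)) * T - sig (\<kappa> + \<mu>) T * (S * R - eps D \<kappa> \<mu> \<star> (R * S))"
    by (simp only: cad_hom[OF R]) (simp only: cad_def)
  show ?thesis
    unfolding A B C 1 2 3 4
    by (simp add: left_diff_distrib right_diff_distrib mult.assoc ops.scale_right_diff_distrib)
qed

lemma cad_mult_left:
  assumes R: "homg \<mu> R" and T: "T \<in> graded_ops"
  shows "cad (\<kappa> + \<mu>) (S * R) T = S * cad \<mu> R T + cad \<kappa> S (sig \<mu> T) * R"
  unfolding cad_def sig_sig by (simp add: left_diff_distrib right_diff_distrib mult.assoc)

text \<open>Bracketing with a homogeneous operator of color \<open>\<kappa>\<close> shifts the grading by \<open>\<kappa>\<close>.\<close>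
lemma comp_cad:
  assumes S: "homg \<kappa> S" and T: "T \<in> graded_ops"
  shows "cpt (\<kappa> + \<mu>) (cad \<kappa> S T) = cad \<kappa> S (cpt \<mu> T)"
  using T unfolding graded_ops_def
proof (induction T rule: ops.span_induct_alt)
  case (step c R T)
  then obtain \<nu> where R: "homg \<nu> R" by blast
  have "cpt (\<kappa> + \<mu>) (cad \<kappa> S R) = cad \<kappa> S (cpt \<mu> R)"
    by (simp add: comp_hom[OF hom_cad[OF S R]] comp_hom[OF R])
  then show ?case using step(2) by (simp add: cad_add cad_smul comp_add comp_smul)
qed simp

text \<open>The scalar operators.\<close>
definition Nset :: "('f expo, 'f) lop set" where "Nset = range (\<lambda>r. r \<star> idop)"

lemma N_iff: "T \<in> Nset \<longleftrightarrow> (\<exists>r. T = r \<star> idop)" by (auto simp: Nset_def)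

lemma N_subspace: "ops.subspace Nset"
proof (rule ops.subspaceI)
  show "0 \<in> Nset" unfolding N_iff by (rule exI[of _ 0]) simp
  show "S + T \<in> Nset" if "S \<in> Nset" "T \<in> Nset" for S T
    using that unfolding N_iff by (elim exE) (simp only: ops.scale_left_distrib[symmetric], blast)
  show "c \<star> T \<in> Nset" if "T \<in> Nset" for c T
    using that unfolding N_iff by (elim exE) (simp only: ops.scale_scale, blast)
qed

lemma N_zero [simp]: "0 \<in> Nset" using N_subspace by (simp add: ops.subspace_0)

lemma N_smul_unit [simp]: "r \<star> idop \<in> Nset" by (auto simp: N_iff)

text \<open>Closure is required under brackets with homogeneous elements of \<open>L\<close> only: for a fixed color \<open>\<kappa>\<close> the action
  is \<open>cad \<kappa>\<close>, and the general bracket is a sum of such terms.\<close>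
definition color_ideal where
  "color_ideal L U \<longleftrightarrow> ops.subspace U \<and> U \<subseteq> L \<and> (\<forall>T\<in>U. \<forall>\<kappa>. cpt \<kappa> T \<in> U) \<and>
     (\<forall>\<kappa> S T. S \<in> L \<longrightarrow> homg \<kappa> S \<longrightarrow> T \<in> U \<longrightarrow> cad \<kappa> S T \<in> U)"

lemma idealD:
  assumes "color_ideal L U"
  shows "ops.subspace U" "U \<subseteq> L" "T \<in> U \<Longrightarrow> cpt \<kappa> T \<in> U"
    "S \<in> L \<Longrightarrow> homg \<kappa> S \<Longrightarrow> T \<in> U \<Longrightarrow> cad \<kappa> S T \<in> U"
  using assms by (simp_all add: color_ideal_def)

lemma ideal_add: "color_ideal L U \<Longrightarrow> S \<in> U \<Longrightarrow> T \<in> U \<Longrightarrow> S + T \<in> U"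
  and ideal_diff: "color_ideal L U \<Longrightarrow> S \<in> U \<Longrightarrow> T \<in> U \<Longrightarrow> S - T \<in> U"
  and ideal_smul: "color_ideal L U \<Longrightarrow> T \<in> U \<Longrightarrow> r \<star> T \<in> U"
  by (simp_all add: idealD(1) ops.subspace_add ops.subspace_diff ops.subspace_scale)

lemma ideal_smul_iff: "color_ideal L U \<Longrightarrow> r \<noteq> 0 \<Longrightarrow> r \<star> T \<in> U \<longleftrightarrow> T \<in> U"
  using ideal_smul[of L U T r] ideal_smul[of L U "r \<star> T" "inverse r"] by auto

lemma ideal_sum: "color_ideal L U \<Longrightarrow> (\<And>x. x \<in> S \<Longrightarrow> g x \<in> U) \<Longrightarrow> (\<Sum>x\<in>S. g x) \<in> U"
  by (rule ops.subspace_sum[OF idealD(1)])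

lemma ideal_skew:
  assumes U: "color_ideal L U" and u: "u \<in> U" "homg \<kappa> u" and S: "S \<in> L" "S \<in> graded_ops" "\<And>\<mu>. cpt \<mu> S \<in> L"
  shows "cad \<kappa> u S \<in> U"
proof -
  have "cad \<kappa> u S = (\<Sum>\<mu> | cpt \<mu> S \<noteq> 0. cad \<kappa> u (cpt \<mu> S))"
    using graded_ops_decomp[OF S(2)] cad_sum by metis
  also have "\<dots> \<in> U"
  proof (rule ideal_sum[OF U])
    fix \<mu>
    have "cad \<kappa> u (cpt \<mu> S) = (- eps D \<kappa> \<mu>) \<star> cad \<mu> (cpt \<mu> S) u"
      using cad_skew[OF u(2) hom_comp, of \<mu> S] by simp
    also have "\<dots> \<in> U" by (intro ideal_smul[OF U] idealD(4)[OF U] S hom_comp u)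
    finally show "cad \<kappa> u (cpt \<mu> S) \<in> U" .
  qed
  finally show ?thesis .
qed

lemma ideal_skew_hom:
  assumes U: "color_ideal L U" and u: "u \<in> U" "homg \<kappa> u" and S: "S \<in> L" "homg \<mu> S"
  shows "cad \<kappa> u S \<in> U"
proof -
  have "cad \<kappa> u S = (- eps D \<kappa> \<mu>) \<star> cad \<mu> S u" using cad_skew[OF u(2) S(2)] by simp
  also have "\<dots> \<in> U" by (intro ideal_smul[OF U] idealD(4)[OF U] S u)
  finally show ?thesis .
qed

text \<open>The derivation \<open>ad \<partial>\<^sub>p\<close>, shifted by the weight \<open>a\<close>.\<close>
definition wt where "wt p a T = cad (dcol p) (dl p) T - a p \<star> T"

lemma wt_add: "wt p a (S + T) = wt p a S + wt p a T"
  and wt_smul: "wt p a (r \<star> T) = r \<star> wt p a T"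
  and wt_zero [simp]: "wt p a 0 = 0"
  by (simp_all add: wt_def cad_add cad_smul ops.scale_right_diff_distrib ops.scale_right_distrib mult.commute)

lemma wt_W: "p \<in> {1..k} \<Longrightarrow> T \<in> Wset \<Longrightarrow> wt p a T \<in> Wset"
  by (simp add: wt_def W_diff W_cad W_dl W_smul)

lemma wt_wt:
  assumes p: "p \<in> {1..k}" and q: "q \<in> {1..k}" and a: "a \<in> Grp D" and b: "b \<in> Grp D" and T: "T \<in> Wset"
  shows "wt p a (wt q b T) = eps D (dcol p) (dcol q) \<star> wt q b (wt p a T)"
proof -
  let ?E = "eps D (dcol p) (dcol q)"
  have c: "cad (dcol p) (dl p) (cad (dcol q) (dl q) T) = ?E \<star> cad (dcol q) (dl q) (cad (dcol p) (dl p) T)"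
    using cad_jacobi[OF hom_dl[OF p] hom_dl[OF q] W_graded[OF T]] by (simp add: cad_dl_dl[OF p q])
  have "a p = 0 \<or> ?E = 1" "b q = 0 \<or> ?E = 1"
    using tcol_G[OF a, of p] tcol_G[OF b, of q] by fastforce+
  then have e: "?E * a p = a p" "?E * b q = b q" by (elim disjE; simp)+
  have e': "?E \<star> (a p \<star> S) = a p \<star> S" "?E \<star> (b q \<star> S) = b q \<star> S" for S :: "('f expo, 'f) lop"
    unfolding ops.scale_scale e by (rule refl)+
  have l: "b q \<star> (a p \<star> T) = a p \<star> (b q \<star> T)" by (rule ops.scale_left_commute)
  show ?thesis
    unfolding wt_def cad_diff cad_smul c ops.scale_right_diff_distrib e' l by (simp only: algebra_simps)
qed

text \<open>The nilpotence of the weight operators: \<open>wn as T\<close> says that any chain of operators \<open>wt p a\<close>, with \<open>a\<close> running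
  through the list and \<open>p\<close> arbitrary at each step, kills \<open>T\<close>.\<close>
primrec wn :: "(nat \<Rightarrow> 'f) list \<Rightarrow> ('f expo, 'f) lop \<Rightarrow> bool" where
  "wn [] T \<longleftrightarrow> T = 0"
| "wn (a # as) T \<longleftrightarrow> (\<forall>p\<in>{1..k}. wn as (wt p a T))"

lemma wn_zero [simp]: "wn as 0" by (induction as) simp_all

lemma wn_add: "wn as S \<Longrightarrow> wn as T \<Longrightarrow> wn as (S + T)"
  by (induction as arbitrary: S T) (simp_all add: wt_add)

lemma wn_smul: "wn as T \<Longrightarrow> wn as (r \<star> T)"
  by (induction as arbitrary: T) (simp_all add: wt_smul)

lemma wn_append: "wn as T \<Longrightarrow> wn (as @ bs) T"
  by (induction as arbitrary: T) simp_all

lemma wn_wt: "wn bs T \<Longrightarrow> set bs \<subseteq> Grp D \<Longrightarrow> p \<in> {1..k} \<Longrightarrow> a \<in> Grp D \<Longrightarrow> T \<in> Wset \<Longrightarrow> wn bs (wt p a T)"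
proof (induction bs arbitrary: T)
  case (Cons b bs)
  show ?case unfolding wn.simps
  proof
    fix q assume q: "q \<in> {1..k}"
    have "wn bs (wt q b T)" using Cons.prems(1) q by simp
    then have "wn bs (wt p a (wt q b T))" using Cons q by (simp add: wt_W)
    moreover have "wt q b (wt p a T) = eps D (dcol q) (dcol p) \<star> wt p a (wt q b T)"
      using Cons.prems q by (intro wt_wt) auto
    ultimately show "wn bs (wt q b (wt p a T))" by (simp add: wn_smul)
  qed
qed simp

lemma wn_prepend: "wn bs T \<Longrightarrow> set bs \<subseteq> Grp D \<Longrightarrow> set as \<subseteq> Grp D \<Longrightarrow> T \<in> Wset \<Longrightarrow> wn (as @ bs) T"
  by (induction as arbitrary: T) (simp_all add: wn_wt wt_W)

lemma wt_mono:
  assumes p: "p \<in> {1..k}" and x: "x \<in> Bset"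
  shows "wt p (fst x) (mono x \<mu>) = (tau p x * of_nat (snd x p)) \<star> mono (down p x) \<mu>"
  using graded_ops_hom[OF hom_dpow, of \<mu>]
  by (simp add: wt_def mono_def cad_mult cad_dl_dpow[OF p] cad_dl_Mx[OF p x] distrib_right)

text \<open>On a monomial of weight \<open>a\<close> the operator \<open>wt p a\<close> acts as differentiation by \<open>t\<^sub>p\<close>, so it lowers the total
  degree in \<open>t\<close>.\<close>
lemma wn_mono: "x \<in> Bset \<Longrightarrow> (\<Sum>p = 1..k. snd x p) \<le> n \<Longrightarrow> wn (replicate (Suc n) (fst x)) (mono x \<mu>)"
proof (induction n arbitrary: x)
  case 0
  then show ?case by (simp add: wt_mono)
next
  case (Suc n)
  have "wn (replicate (Suc n) (fst x)) (wt p (fst x) (mono x \<mu>))" if p: "p \<in> {1..k}" for p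
  proof (cases "snd x p = 0")
    case True
    then show ?thesis using wt_mono[OF p Suc.prems(1), of \<mu>] by (simp del: wn.simps replicate.simps)
  next
    case False
    have "(\<Sum>q = 1..k. snd (down p x) q) < (\<Sum>q = 1..k. snd x q)"
      using p False by (intro sum_strict_mono_ex1) (auto simp: down_def)
    then have "wn (replicate (Suc n) (fst (down p x))) (mono (down p x) \<mu>)"
      using Suc.prems by (intro Suc.IH B_down) auto
    moreover have "fst (down p x) = fst x" by (simp add: down_def)
    ultimately show ?thesis
      unfolding wt_mono[OF p Suc.prems(1)] by (simp only: wn_smul)
  qed
  then show ?case unfolding replicate.simps(2)[of "Suc n"] wn.simps(2) by blast
qed

text \<open>A sum of monomials is killed by the concatenation of their chains, because the operators \<open>wt\<close> commute up
  to nonzero factors.\<close>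
lemma wn_exists: "T \<in> Wset \<Longrightarrow> \<exists>as. set as \<subseteq> Grp D \<and> wn as T"
proof -
  assume "T \<in> Wset"
  then have "T \<in> Wset \<and> (\<exists>as. set as \<subseteq> Grp D \<and> wn as T)"
    unfolding Wset_def
  proof (induction T rule: ops.span_induct_alt)
    case base
    then show ?case by (auto simp: ops.span_zero intro!: exI[of _ "[]"])
  next
    case (step c S T)
    then obtain x \<mu> where x: "S = mono x \<mu>" "x \<in> Bset" "\<mu> \<in> Mset D" by blast
    obtain bs where bs: "set bs \<subseteq> Grp D" "wn bs T" using step(2) by blast
    have T: "T \<in> Wset" using step(2) by (simp add: Wset_def)
    obtain as where as: "set as \<subseteq> Grp D" "wn as S"
    proof
      show "set (replicate (Suc (\<Sum>p = 1..k. snd x p)) (fst x)) \<subseteq> Grp D"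
        using x(2) by (auto simp: Bset_def mem_Times_iff set_replicate_conv_if)
    qed (use wn_mono[OF x(2) order_refl] x(1) in simp)
    have "wn (as @ bs) (c \<star> S + T)"
      by (intro wn_add wn_append wn_smul as(2) wn_prepend bs as(1) T)
    moreover have "c \<star> S + T \<in> Wset" using T W_mono[OF x(2,3)] by (simp add: x(1) W_add W_smul)
    ultimately show ?case using as(1) bs(1)
      by (intro conjI exI[of _ "as @ bs"]) (simp_all add: Wset_def)
  qed
  then show ?thesis by blast
qed

text \<open>Follow a chain of operators \<open>wt\<close> that starts outside \<open>N\<close> and ends at \<open>0 \<in> N\<close>, and stop at the last element
  outside \<open>N\<close>. The set \<open>N\<close> will be the scalars for the Weyl algebra and zero for the Witt algebra.\<close>
lemma weight_reduction:
  assumes T: "T \<in> Wset" "T \<in> U" "T \<notin> N" and N: "0 \<in> N"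
    and U: "\<And>p a S. p \<in> {1..k} \<Longrightarrow> a \<in> Grp D \<Longrightarrow> S \<in> U \<Longrightarrow> wt p a S \<in> U"
  shows "\<exists>v\<in>U. v \<notin> N \<and> (\<exists>a\<in>Grp D. \<forall>p\<in>{1..k}. wt p a v \<in> N)"
proof -
  obtain as where "set as \<subseteq> Grp D" "wn as T" using wn_exists[OF T(1)] by blast
  then show ?thesis
    using T(2,3)
  proof (induction as arbitrary: T)
    case Nil
    then show ?case using N by simp
  next
    case (Cons a as)
    show ?case
    proof (cases "\<forall>p\<in>{1..k}. wt p a T \<in> N")
      case True
      then show ?thesis using Cons.prems by auto
    next
      case False
      then obtain p where p: "p \<in> {1..k}" "wt p a T \<notin> N" by blast
      have "wn as (wt p a T)" "set as \<subseteq> Grp D" "wt p a T \<in> U"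
        using Cons.prems p U by auto
      then show ?thesis using Cons.IH p(2) by blast
    qed
  qed
qed

text \<open>The order filtration: \<open>dn n T\<close> says that \<open>n\<close> successive commutators with multiplications kill \<open>T\<close>.\<close>
primrec dn :: "nat \<Rightarrow> ('f expo, 'f) lop \<Rightarrow> bool" where
  "dn 0 T \<longleftrightarrow> T = 0"
| "dn (Suc n) T \<longleftrightarrow> (\<forall>x\<in>Bset. dn n (cad (xcol x) (Mx x) T))"

lemma dn_zero [simp]: "dn n 0" by (induction n) simp_all
lemma dn_add: "dn n S \<Longrightarrow> dn n T \<Longrightarrow> dn n (S + T)" by (induction n arbitrary: S T) (simp_all add: cad_add)
lemma dn_smul: "dn n T \<Longrightarrow> dn n (r \<star> T)" by (induction n arbitrary: T) (simp_all add: cad_smul)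
lemma dn_Suc: "dn n T \<Longrightarrow> dn (Suc n) T"
proof (induction n arbitrary: T)
  case (Suc n)
  then show ?case using dn.simps(2)[of n T] dn.simps(2)[of "Suc n" T] by blast
qed simp

lemma dn_mono: "dn m T \<Longrightarrow> m \<le> n \<Longrightarrow> dn n T"
  by (induction n) (auto simp: le_Suc_eq simp del: dn.simps intro: dn_Suc)

lemma cad_Mx_mult:
  assumes "x \<in> Bset" "y \<in> Bset" "T \<in> Wset"
  shows "cad (xcol x) (Mx x) (Mx y * T) = eps D (xcol x) (xcol y) \<star> (Mx y * cad (xcol x) (Mx x) T)"
  by (simp add: cad_mult[OF W_graded[OF assms(3)]] cad_Mx_Mx assms sig_hom[OF hom_Mx])

lemma W_cad_Mx: "T \<in> Wset \<Longrightarrow> cad (xcol x) (Mx x) T \<in> Wset" by (rule W_cad[OF W_Mx])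

lemma dn_Mx: "y \<in> Bset \<Longrightarrow> T \<in> Wset \<Longrightarrow> dn n T \<Longrightarrow> dn n (Mx y * T)"
  by (induction n arbitrary: T) (simp_all add: cad_Mx_mult dn_smul W_cad_Mx)

lemma dn_A: "u \<in> Aset \<Longrightarrow> T \<in> Wset \<Longrightarrow> dn n T \<Longrightarrow> dn n (u * T)"
  by (induction u rule: A_induct) (simp_all add: distrib_right dn_add dn_smul dn_Mx)

lemma cad_Mx_dl:
  assumes "x \<in> Bset" "p \<in> {1..k}"
  shows "cad (xcol x) (Mx x) (dl p) = (- eps D (xcol x) (dcol p)) \<star> cad (dcol p) (dl p) (Mx x)"
  using cad_skew[OF hom_Mx[of x] hom_dl[OF assms(2)]] by simp

text \<open>By the Leibniz rule, and since \<open>[x, \<partial>\<^sub>p]\<close> is a multiplication.\<close>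
lemma dn_dl: "p \<in> {1..k} \<Longrightarrow> T \<in> Wset \<Longrightarrow> dn n T \<Longrightarrow> dn (Suc n) (dl p * T)"
proof (induction n arbitrary: T)
  case (Suc n)
  show ?case
    unfolding dn.simps(2)[of "Suc n"]
  proof
    fix x assume x: "x \<in> Bset"
    have "cad (xcol x) (Mx x) (dl p) \<in> Aset"
      using x Suc.prems by (simp only: cad_Mx_dl) (intro A_smul A_cad_dl A_Mx)
    then have 1: "dn (Suc n) (cad (xcol x) (Mx x) (dl p) * T)" using Suc.prems by (intro dn_A)
    have "dn n (cad (xcol x) (Mx x) T)" using Suc.prems(3) x by simp
    then have 2: "dn (Suc n) (dl p * cad (xcol x) (Mx x) T)"
      using Suc.prems by (intro Suc.IH W_cad_Mx)
    have "cad (xcol x) (Mx x) (dl p * T) =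
        cad (xcol x) (Mx x) (dl p) * T + eps D (xcol x) (dcol p) \<star> (dl p * cad (xcol x) (Mx x) T)"
      using Suc.prems by (simp add: cad_mult W_graded sig_hom[OF hom_dl])
    then show "dn (Suc n) (cad (xcol x) (Mx x) (dl p * T))"
      using 1 2 by (simp only: dn_add dn_smul)
  qed
qed simp

lemma dn_exists: "T \<in> Wset \<Longrightarrow> \<exists>n. dn n T"
proof (induction T rule: W_gen_induct)
  case (add S T)
  then obtain m n where "dn m S" "dn n T" by blast
  then have "dn (max m n) (S + T)" by (intro dn_add) (auto intro: dn_mono)
  then show ?case ..
next
  case (smul r T) then show ?case using dn_smul by blast
next
  case unit
  have "dn 1 idop" by (simp add: cad_unit[OF hom_Mx])
  then show ?case ..
next
  case (Mx x T) then show ?case using dn_Mx by blast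
next
  case (dl p T) then show ?case using dn_dl by blast
qed

lemma sig_unit [simp]: "sig \<kappa> idop = idop"
  by (simp add: sig_hom[OF hom_unit])

lemma cad_sig:
  assumes S: "homg \<kappa> S" and T: "T \<in> graded_ops"
  shows "cad \<kappa> S (sig \<mu> T) = eps D \<kappa> \<mu> \<star> sig \<mu> (cad \<kappa> S T)"
  by (simp add: cad_def sig_diff sig_mult[OF T] sig_mult[OF graded_ops_hom[OF S]] sig_hom[OF S] sig_sig
      ops.scale_right_diff_distrib add.commute)

lemma lookup_unit_vac: "Poly_Mapping.lookup (app idop vac) z = (if z = 0 then 1 else 0)"
  using app_Q[OF B_zero, of 0] by (auto simp: idop_def lookup_bvec simp del: bvec_in)

lemma idop_nonzero: "idop \<noteq> 0"
  using lookup_unit_vac[of 0] by auto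

lemma N_Mx: "x \<in> Bset \<Longrightarrow> x \<noteq> 0 \<Longrightarrow> Mx x \<notin> Nset"
proof
  assume x: "x \<in> Bset" "x \<noteq> 0" "Mx x \<in> Nset"
  then obtain r where "Mx x = r \<star> idop" by (auto simp: N_iff)
  then have "Poly_Mapping.lookup (app (Mx x) vac) x = Poly_Mapping.lookup (app (r \<star> idop) vac) x" by simp
  then show False using x by (simp add: app_Mx_vac lookup_bvec lookup_unit_vac)
qed

text \<open>If all commutators of \<open>T\<close> with \<open>\<A>\<close> are scalars and one of them is nonzero, the Leibniz rule
  exhibits every element of \<open>\<A>\<close> as a combination of two fixed ones.\<close>
lemma scalar_commutators:
  assumes T: "T \<in> Wset" and sc: "\<And>x. x \<in> Bset \<Longrightarrow> cad (xcol x) (Mx x) T \<in> Nset"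
    and x: "x \<in> Bset" "cad (xcol x) (Mx x) T \<noteq> 0" and y: "y \<in> Bset"
  shows "y = 0 \<or> y = x"
proof (rule ccontr)
  assume y0: "\<not> (y = 0 \<or> y = x)"
  obtain c where c: "cad (xcol x) (Mx x) T = c \<star> idop" using sc[OF x(1)] by (auto simp: N_iff)
  then have c0: "c \<noteq> 0" using x(2) by auto
  obtain d where d: "cad (xcol y) (Mx y) T = d \<star> idop" using sc[OF y] by (auto simp: N_iff)
  have sum: "\<exists>r. cad (xcol x + xcol y) (Mx x * Mx y) T = r \<star> idop"
  proof (cases "x + y \<in> Bset")
    case True
    then obtain r where "cad (xcol (x + y)) (Mx (x + y)) T = r \<star> idop" using sc[of "x + y"] by (auto simp: N_iff)
    then show ?thesis by (auto simp: Mx_mult x y cad_smul_left xcol_add_B[symmetric])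
  next
    case False
    then show ?thesis by (auto simp: Mx_mult x y Mx_out intro!: exI[of _ 0])
  qed
  then obtain r where r: "cad (xcol x + xcol y) (Mx x * Mx y) T = r \<star> idop" by blast
  have e: "r \<star> idop = d \<star> Mx x + (eps D (xcol x) (xcol y) * c) \<star> Mx y"
    using r unfolding cad_mult_left[OF hom_Mx W_graded[OF T]] cad_sig[OF hom_Mx W_graded[OF T]] c d
    by (simp add: sig_smul unit_left[OF hom_Mx] unit_right[OF hom_Mx])
  have "Poly_Mapping.lookup (app (r \<star> idop) vac) y =
      Poly_Mapping.lookup (app (d \<star> Mx x + (eps D (xcol x) (xcol y) * c) \<star> Mx y) vac) y"
    using e by simp
  then show False
    using y0 c0 x(1) y not_sym[of y x] eps_nonzero by (simp add: app_Mx_vac lookup_bvec lookup_unit_vac lookup_add)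
qed

text \<open>Commutators with \<open>\<A>\<close> lower the order and stay in \<open>U\<close>. If all of them are scalars, then all vanish by
  \<open>scalar_commutators\<close>, as the basis of \<open>\<A>\<close> is large enough, and an operator that color-commutes with \<open>\<A>\<close> lies in \<open>\<A>\<close>.\<close>
lemma order_reduction:
  assumes T: "T \<in> Wset" "T \<in> U" "T \<notin> Nset"
    and U: "\<And>x S. x \<in> Bset \<Longrightarrow> S \<in> U \<Longrightarrow> cad (xcol x) (Mx x) S \<in> U"
    and big: "\<And>x. \<exists>y\<in>Bset. y \<noteq> 0 \<and> y \<noteq> x"
  shows "\<exists>u\<in>Aset \<inter> U. u \<notin> Nset"
proof -
  obtain n where "dn n T" using dn_exists[OF T(1)] by blast
  then show ?thesis using T
  proof (induction n arbitrary: T)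
    case (Suc n)
    consider "T \<in> Aset" | x where "x \<in> Bset" "cad (xcol x) (Mx x) T \<noteq> 0"
      using commutant_A[OF W_graded[OF Suc.prems(2)]] by blast
    then show ?case
    proof cases
      case 1
      then show ?thesis using Suc.prems by blast
    next
      case (2 x)
      obtain y where y: "y \<in> Bset" "y \<noteq> 0" "y \<noteq> x" using big by blast
      have "\<exists>z\<in>Bset. cad (xcol z) (Mx z) T \<notin> Nset"
        using scalar_commutators[OF Suc.prems(2) _ 2 y(1)] y(2,3) by blast
      then obtain z where z: "z \<in> Bset" "cad (xcol z) (Mx z) T \<notin> Nset" by blast
      have "dn n (cad (xcol z) (Mx z) T)" using Suc.prems(1) z(1) by simp
      then show ?thesis by (rule Suc.IH[OF _ W_cad_Mx[OF Suc.prems(2)] U[OF z(1) Suc.prems(3)] z(2)])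
    qed
  qed (use N_zero in auto)
qed

lemma app_cad_dl_vac:
  assumes "u \<in> Aset"
  shows "app (cad (dcol p) (dl p) u) vac = app (dl p) (app u vac)"
proof -
  have "app (Q \<kappa>) vac = vac" for \<kappa> using app_Q[OF B_zero, of \<kappa>] by simp
  then show ?thesis by (simp add: cad_def)
qed

lemma A_keys: "u \<in> Aset \<Longrightarrow> Poly_Mapping.keys (app u vac) \<subseteq> Bset"
  by (rule graded_ops_keys[OF W_graded[OF A_W] B_zero])

lemma A_expand:
  assumes u: "u \<in> Aset"
  shows "u = (\<Sum>x\<in>Poly_Mapping.keys (app u vac). Poly_Mapping.lookup (app u vac) x \<star> Mx x)"
proof (rule A_eqI[OF u])
  let ?v = "app u vac"
  show "(\<Sum>x\<in>Poly_Mapping.keys ?v. Poly_Mapping.lookup ?v x \<star> Mx x) \<in> Aset"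
    unfolding Aset_def using A_keys[OF u] by (intro ops.span_sum ops.span_scale ops.span_base) blast
  have "app (\<Sum>x\<in>Poly_Mapping.keys ?v. Poly_Mapping.lookup ?v x \<star> Mx x) vac =
      (\<Sum>x\<in>Poly_Mapping.keys ?v. scale (Poly_Mapping.lookup ?v x) (Poly_Mapping.single x 1))"
    unfolding app_sum_left app_smul
  proof (rule sum.cong[OF refl])
    fix x assume "x \<in> Poly_Mapping.keys ?v"
    then have "x \<in> Bset" using A_keys[OF u] by blast
    then show "scale (Poly_Mapping.lookup ?v x) (app (Mx x) vac) =
        scale (Poly_Mapping.lookup ?v x) (Poly_Mapping.single x 1)"
      by (simp only: app_Mx_vac bvec_in[of x])
  qed
  then show "?v = app (\<Sum>x\<in>Poly_Mapping.keys ?v. Poly_Mapping.lookup ?v x \<star> Mx x) vac"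
    by (simp only: sum_single_coeffs[symmetric])
qed

text \<open>Modulo scalars, the eigenvalue equation still holds for all coefficients except the constant one, because
  a scalar operator applied to \<open>1\<close> has no other coefficient.\<close>
lemma wt_support:
  assumes u: "u \<in> Aset" and a: "a \<in> Grp D" and wt: "\<And>p. p \<in> {1..k} \<Longrightarrow> wt p a u \<in> Nset"
    and z: "z \<in> Poly_Mapping.keys (app u vac)"
  shows "z = 0 \<or> z = (a, 0) \<or> a = 0 \<and> (\<exists>p\<in>{k1 D + 1..k}. z = (0, un p))"
proof (rule weight_vector_support[OF A_keys[OF u] _ a z])
  fix z p assume z: "z \<in> Bset" "z \<noteq> 0" and p: "p \<in> {1..k}"
  obtain r where "wt p a u = r \<star> idop" using wt[OF p] by (auto simp: N_iff)
  then have "cad (dcol p) (dl p) u = r \<star> idop + a p \<star> u" by (simp add: wt_def algebra_simps)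
  then have "app (dl p) (app u vac) = app (r \<star> idop + a p \<star> u) vac"
    using app_cad_dl_vac[OF u, of p] by simp
  then show "Poly_Mapping.lookup (app (dl p) (app u vac)) z = a p * Poly_Mapping.lookup (app u vac) z"
    using z by (simp add: lookup_add lookup_unit_vac)
qed

text \<open>For a strict weight vector the equation holds for the constant coefficient as well, which excludes the
  exceptional supports of \<open>wt_support\<close>.\<close>
lemma wt_zero_weight:
  assumes u: "u \<in> Aset" and a: "a \<in> Grp D" and wt: "\<And>p. p \<in> {1..k} \<Longrightarrow> wt p a u = 0"
  shows "\<exists>c. u = c \<star> Mx (a, 0)"
proof -
  let ?l = "Poly_Mapping.lookup (app u vac)"
  have sup: "z = 0 \<or> z = (a, 0) \<or> a = 0 \<and> (\<exists>p\<in>{k1 D + 1..k}. z = (0, un p))"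
    if "z \<in> Poly_Mapping.keys (app u vac)" for z
    using wt_support[OF u a _ that] wt by simp
  have z0: "(0 - a p) * ?l 0 + tau p (0, un p) * ?l (0, un p) = 0" if p: "p \<in> {1..k}" for p
  proof -
    have "cad (dcol p) (dl p) u = a p \<star> u" using wt[OF p] by (simp add: wt_def)
    then have "app (dl p) (app u vac) = app (a p \<star> u) vac" using app_cad_dl_vac[OF u, of p] by simp
    then show ?thesis using lookup_dl[OF A_keys[OF u] B_zero p] by (simp add: algebra_simps)
  qed
  have "z = (a, 0)" if z: "z \<in> Poly_Mapping.keys (app u vac)" for z
  proof (cases "a = 0")
    case True
    have "z \<noteq> (0, un p)" if p: "p \<in> {k1 D + 1..k}" for p
      using z0[of p] True z p by (auto simp: in_keys_iff)
    then show ?thesis using sup[OF z] True by (auto simp: zero_prod_def)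
  next
    case False
    then obtain p where p: "a p \<noteq> 0" by (auto simp: fun_eq_iff)
    have pk: "p \<in> {1..k}" using G_out[OF a p] by (simp add: ktot_def)
    have "(0, un p) \<notin> Poly_Mapping.keys (app u vac)"
    proof
      assume "(0, un p) \<in> Poly_Mapping.keys (app u vac)"
      from sup[OF this] have "(0, un p) = (0 :: 'f expo)" using False by auto
      then have "un p p = 0" by (simp add: zero_prod_def)
      then show False by (simp add: un_def)
    qed
    then have "?l (0, un p) = 0" by (simp add: in_keys_iff)
    then have "?l 0 = 0" using z0[OF pk] p by simp
    then have "z \<noteq> 0" using z by (auto simp: in_keys_iff)
    then show ?thesis using sup[OF z] False by blast
  qed
  then have sub: "Poly_Mapping.keys (app u vac) \<subseteq> {(a, 0)}" by blast
  have "u = (\<Sum>x\<in>{(a, 0)}. ?l x \<star> Mx x)"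
    by (subst A_expand[OF u]) (rule sum.mono_neutral_left, use sub in \<open>auto simp: in_keys_iff\<close>)
  then show ?thesis by (intro exI[of _ "?l (a, 0)"]) simp
qed

section \<open>Duality between the lattice and the derivations\<close>

text \<open>A relation that is linear in \<open>b\<close> extends from \<open>G\<close> to its span, which contains the unit vectors.\<close>
lemma G_separates:
  fixes w :: "nat \<Rightarrow> ('f expo, 'f) lop"
  assumes w: "\<And>b. b \<in> Grp D \<Longrightarrow> (\<Sum>q = 1..k1 D + k2 D. b q \<star> w q) = 0" and p: "p \<in> {1..k1 D + k2 D}"
  shows "w p = 0"
proof -
  obtain B where B: "B \<subseteq> Grp D" "tuples.span B = {v. \<forall>p. p \<notin> {1..k1 D + k2 D} \<longrightarrow> v p = 0}"
    using G_basis by blast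
  have "(\<Sum>q = 1..k1 D + k2 D. v q \<star> w q) = 0" if "v \<in> tuples.span B" for v
    using that
  proof (induction v rule: tuples.span_induct_alt)
    case base
    then show ?case by simp
  next
    case (step c x y)
    then have "(\<Sum>q = 1..k1 D + k2 D. x q \<star> w q) = 0" using w B(1) by blast
    then have "(\<Sum>q = 1..k1 D + k2 D. (c * x q) \<star> w q) = 0"
      by (simp only: ops.scale_scale[symmetric] ops.scale_sum_right[symmetric] ops.scale_zero_right)
    then show ?case using step(2) by (simp add: ops.scale_left_distrib sum.distrib)
  qed
  moreover have "(\<lambda>q. if q = p then 1 else 0) \<in> tuples.span B" unfolding B(2) using p by auto
  ultimately have "(\<Sum>q = 1..k1 D + k2 D. (if q = p then 1 else 0) \<star> w q) = 0" by blast
  moreover have "(\<Sum>q = 1..k1 D + k2 D. (if q = p then 1 else 0) \<star> w q) = (\<Sum>q = 1..k1 D + k2 D. if q = p then w q else 0)"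
    by (intro sum.cong) auto
  ultimately show ?thesis using p by simp
qed

lemma G_separates_scalar:
  assumes "c p \<noteq> 0" "p \<in> {1..k1 D + k2 D}"
  shows "\<exists>b\<in>Grp D. (\<Sum>q = 1..k1 D + k2 D. c q * b q) \<noteq> 0"
proof (rule ccontr)
  assume n: "\<not> ?thesis"
  have "(\<Sum>q = 1..k1 D + k2 D. b q \<star> (c q \<star> idop)) = 0" if "b \<in> Grp D" for b
  proof -
    have "(\<Sum>q = 1..k1 D + k2 D. b q \<star> (c q \<star> idop)) = (\<Sum>q = 1..k1 D + k2 D. c q * b q) \<star> idop"
      unfolding ops.scale_sum_left by (intro sum.cong) (simp_all add: mult.commute)
    then show ?thesis using n that by simp
  qed
  from G_separates[OF this assms(2)] show False using assms(1) idop_nonzero by simp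
qed

lemma G_nonzero_at:
  assumes p: "p \<in> {1..k1 D + k2 D}"
  shows "\<exists>b\<in>Grp D. b p \<noteq> 0"
proof -
  obtain b where b: "b \<in> Grp D" "(\<Sum>q = 1..k1 D + k2 D. (if q = p then 1 else 0) * b q) \<noteq> 0"
    using G_separates_scalar[of "\<lambda>q. if q = p then 1 else 0" p] p by auto
  have "(\<Sum>q = 1..k1 D + k2 D. (if q = p then 1 else 0) * b q) = (\<Sum>q = 1..k1 D + k2 D. if q = p then b q else 0)"
    by (intro sum.cong) auto
  then show ?thesis using b p by auto
qed

end

section \<open>The derived algebra of the Weyl algebra\<close>

context weyl_char0
begin

abbreviation tt where "tt p \<equiv> Mx (0, un p)"

lemma un_self [simp]: "un p p = 1" by (simp add: un_def)

lemma down_add_un: "down p (x + (0, un p)) = x"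
  unfolding down_def by (rule prod_eqI) (simp_all add: fun_eq_iff un_def)

lemma hom_tt: "p \<in> {k1 D + 1..k} \<Longrightarrow> homg (tcol D p) (tt p)"
  using hom_Mx[of "(0, un p)"] by (simp add: xcol_un)

lemma k_range: "p \<in> {k1 D + 1..k} \<Longrightarrow> p \<in> {1..k}" by simp

lemma cad_dl_tt:
  assumes p: "p \<in> {k1 D + 1..k}" and q: "q \<in> {1..k}"
  shows "cad (dcol q) (dl q) (tt p) = (if q = p then tau p (0, un p) else 0) \<star> idop"
proof -
  have "down p (0, un p) = 0" using down_add_un[of p 0] by simp
  then show ?thesis
    using cad_dl_Mx[OF q un_B[OF p]] by (auto simp: un_def Mx_zero)
qed

lemma cad_tt_dl:
  assumes p: "p \<in> {k1 D + 1..k}" and q: "q \<in> {1..k}"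
  shows "cad (tcol D p) (tt p) (dl q) =
    (- eps D (tcol D p) (dcol q) * (if q = p then tau p (0, un p) else 0)) \<star> idop"
  using cad_skew[OF hom_tt[OF p] hom_dl[OF q]] cad_dl_tt[OF p q] by simp

lemma x_B: "a \<in> Grp D \<Longrightarrow> (a, 0) \<in> Bset" by (simp add: Bset_def)

lemma cad_dl_x:
  assumes a: "a \<in> Grp D" and q: "q \<in> {1..k}"
  shows "cad (dcol q) (dl q) (Mx (a, 0)) = a q \<star> Mx (a, 0)"
  using cad_dl_Mx[OF q x_B[OF a]] by simp

lemma mono_lift:
  assumes p: "p \<in> {k1 D + 1..k}" and x: "x + (0, un p) \<in> Bset" "fst x p = 0"
  shows "\<exists>c. c \<noteq> 0 \<and> cad (dcol p) (dl p) (mono (x + (0, un p)) \<mu>) = c \<star> mono x \<mu>"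
proof -
  have "cad (dcol p) (dl p) (mono (x + (0, un p)) \<mu>) =
      (tau p (x + (0, un p)) * of_nat (Suc (snd x p))) \<star> mono x \<mu>"
    using wt_mono[OF k_range[OF p] x(1), of \<mu>] x(2) by (simp add: wt_def down_add_un)
  then show ?thesis by (intro exI[of _ "tau p (x + (0, un p)) * of_nat (Suc (snd x p))"]) (simp del: of_nat_Suc)
qed

text \<open>The span \<open>[\<W>, \<W>]\<close> of all brackets.\<close>
definition CC :: "('f expo, 'f) lop set" where
  "CC = ops.span {cad \<kappa> S T |\<kappa> S T. S \<in> Wset \<and> homg \<kappa> S \<and> T \<in> Wset}"

lemma CC_I: "S \<in> Wset \<Longrightarrow> homg \<kappa> S \<Longrightarrow> T \<in> Wset \<Longrightarrow> cad \<kappa> S T \<in> CC"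
  unfolding CC_def by (rule ops.span_base) blast

lemma CC_add: "S \<in> CC \<Longrightarrow> T \<in> CC \<Longrightarrow> S + T \<in> CC" by (simp add: CC_def ops.span_add)
lemma CC_diff: "S \<in> CC \<Longrightarrow> T \<in> CC \<Longrightarrow> S - T \<in> CC" by (simp add: CC_def ops.span_diff)
lemma CC_smul: "T \<in> CC \<Longrightarrow> r \<star> T \<in> CC" by (simp add: CC_def ops.span_scale)
lemma CC_zero [simp]: "0 \<in> CC" by (simp add: CC_def ops.span_zero)
lemma CC_smul_iff: "r \<noteq> 0 \<Longrightarrow> r \<star> T \<in> CC \<longleftrightarrow> T \<in> CC"
  using CC_smul[of T r] CC_smul[of "r \<star> T" "inverse r"] by auto

lemma CC_W: "CC \<subseteq> Wset"
  unfolding CC_def by (rule ops.span_minimal[OF _ W_subspace]) (auto intro: W_cad)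

text \<open>An even variable \<open>t\<^sub>p\<close> on which no weight lives makes \<open>ad \<partial>\<^sub>p\<close> surjective.\<close>
lemma W_CC_integrate:
  assumes p: "p \<in> {k1 D + k2 D + 1..kev}"
  shows "Wset \<subseteq> CC"
  unfolding Wset_def
proof (rule ops.span_minimal)
  show "{mono x \<mu> |x \<mu>. x \<in> Bset \<and> \<mu> \<in> Mset D} \<subseteq> CC"
  proof
    fix T assume "T \<in> {mono x \<mu> |x \<mu>. x \<in> Bset \<and> \<mu> \<in> Mset D}"
    then obtain x \<mu> where T: "T = mono x \<mu>" "x \<in> Bset" "\<mu> \<in> Mset D" by blast
    have pk: "p \<in> {k1 D + 1..k}" using p by (simp add: ktot_def)
    have "fst x \<in> Grp D" using T(2) by (simp add: Bset_def mem_Times_iff)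
    then have f: "fst x p = 0" using G_out[of "fst x" p] p by (cases "fst x p = 0") simp_all
    have "\<forall>q>kev. snd x q + snd (0 :: nat \<Rightarrow> 'f, un p) q \<le> 1"
      using T(2) J_odd[of "snd x"] p by (simp add: un_def Bset_def mem_Times_iff)
    then have xB: "x + (0, un p) \<in> Bset" using B_add_iff[OF T(2) un_B[OF pk]] by blast
    obtain c where c: "c \<noteq> 0" "cad (dcol p) (dl p) (mono (x + (0, un p)) \<mu>) = c \<star> mono x \<mu>"
      using mono_lift[OF pk xB f] by blast
    have "cad (dcol p) (dl p) (mono (x + (0, un p)) \<mu>) \<in> CC"
      using k_range[OF pk] by (intro CC_I W_dl hom_dl W_mono xB T)
    then show "T \<in> CC" using c CC_smul_iff T(1) by simp
  qed
qed (simp add: CC_def)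

text \<open>Left multiplication with the falling factorial \<open>h (h - 1) \<dots> (h - m + 1)\<close> of \<open>h = r \<partial>\<^sub>p\<close>.\<close>
primrec fallf :: "nat \<Rightarrow> 'f \<Rightarrow> nat \<Rightarrow> ('f expo, 'f) lop \<Rightarrow> ('f expo, 'f) lop" where
  "fallf p r 0 T = T"
| "fallf p r (Suc m) T = (r \<star> dl p) * fallf p r m T - of_nat m \<star> fallf p r m T"

lemma fallf_W: "p \<in> {1..k} \<Longrightarrow> T \<in> Wset \<Longrightarrow> fallf p r m T \<in> Wset"
  by (induction m) (simp_all add: W_diff W_smul W_dl_left)

lemma fallf_diff: "fallf p r m (S - T) = fallf p r m S - fallf p r m T"
  by (induction m) (simp_all add: right_diff_distrib ops.scale_right_diff_distrib)

text \<open>Conjugation \<open>\<theta>\<close> by \<open>x\<^sup>a\<close> fixes every operator modulo commutators, and it shifts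
  \<open>h = \<partial>\<^sub>p / a\<^sub>p\<close> to \<open>h + 1\<close>. For the falling factorials of \<open>h\<close> this gives
  \<open>\<theta> (h)\<^sub>m\<^sub>+\<^sub>1 - (h)\<^sub>m\<^sub>+\<^sub>1 = (m + 1) (h)\<^sub>m\<close>; as \<open>T - \<theta> T\<close> has smaller order than \<open>T\<close>, induction on the order
  shows that every \<open>(h)\<^sub>m T\<close> is a sum of commutators.\<close>
lemma W_CC_difference:
  assumes a: "a \<in> Grp D" and ap: "a p \<noteq> 0"
  shows "Wset \<subseteq> CC"
proof -
  have p0: "p \<in> {1..k1 D + k2 D}" by (rule G_out[OF a ap])
  then have p: "p \<in> {1..k}" by (simp add: ktot_def)
  have t0: "tcol D p = 0" by (rule tcol_zero[OF p0])
  have a': "- a \<in> Grp D" by (rule G_uminus[OF a])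
  define Xa where [simp]: "Xa = Mx (a, 0)"
  define Ya where [simp]: "Ya = Mx (- a, 0)"
  define \<alpha> where "\<alpha> = xcol (a, 0)"
  define mc where "mc = mult_coeff D (- a, 0) (a, 0)"
  have mc: "mc \<noteq> 0" unfolding mc_def by (rule mult_coeff_nonzero[OF x_B[OF a'] x_B[OF a]])
  have z: "(- a, 0) + (a, 0) = (0 :: 'f expo)" by (simp add: zero_prod_def)
  have YX: "Ya * Xa = mc \<star> idop"
    unfolding Xa_def Ya_def mc_def Mx_mult[OF x_B[OF a'] x_B[OF a]] z Mx_zero ..
  define E where "E = eps D \<alpha> (xcol (- a, 0))"
  have E: "E \<noteq> 0" by (simp add: E_def eps_nonzero)
  have XY: "Xa * Ya = E \<star> (Ya * Xa)"
    unfolding Xa_def Ya_def E_def \<alpha>_def by (rule Mx_comm[OF x_B[OF a] x_B[OF a']])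
  have sY: "sig \<alpha> Ya = E \<star> Ya" unfolding Ya_def E_def by (rule sig_hom[OF hom_Mx])
  \<comment> \<open>The conjugation \<open>\<theta>\<close>: \<open>Ya\<close> is \<open>x\<^bsup>-a\<^esup>\<close>, and \<open>sig\<close> supplies the color sign of moving \<open>x\<^sup>a\<close> past \<open>T\<close>.\<close>
  define Th where "Th T = inverse mc \<star> (Ya * sig \<alpha> T * Xa)" for T
  have Th_W: "Th T \<in> Wset" if "T \<in> Wset" for T
    using that by (simp add: Th_def W_smul W_mult W_sig)
  have Th_diff: "Th (S - T) = Th S - Th T" for S T
    by (simp add: Th_def sig_diff algebra_simps ops.scale_right_diff_distrib)
  have Th_smul: "Th (r \<star> T) = r \<star> Th T" for r T by (simp add: Th_def sig_smul mult.commute)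
  have Th_CC: "T - Th T \<in> CC" if T: "T \<in> Wset" for T
  proof -
    have "cad \<alpha> Xa (Ya * T) = Xa * Ya * T - (E \<star> Ya) * sig \<alpha> T * Xa"
      by (simp add: cad_def sig_mult[OF W_graded[OF T]] sY[unfolded Ya_def] mult.assoc)
    also have "\<dots> = (E * mc) \<star> (T - Th T)"
      using mc graded_ops_unit(1)[OF W_graded[OF T]]
      by (simp add: XY[unfolded Xa_def Ya_def] YX[unfolded Xa_def Ya_def] Th_def ops.scale_right_diff_distrib mult.assoc)
    finally have "(E * mc) \<star> (T - Th T) \<in> CC"
      using CC_I[of Xa \<alpha> "Ya * T"] hom_Mx[of "(a, 0)"] T by (simp add: \<alpha>_def W_mult)
    then show ?thesis using CC_smul_iff E mc by simp
  qed
  have Yd: "Ya * dl p = dl p * Ya + a p \<star> Ya"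
    using dl_Mx[OF p x_B[OF a']] by (simp add: t0)
  have Th_d: "Th (dl p * T) = dl p * Th T + a p \<star> Th T" if T: "T \<in> Wset" for T
  proof -
    have "sig \<alpha> (dl p * T) = dl p * sig \<alpha> T"
      using sig_hom[OF hom_dl[OF p], of \<alpha>] by (simp add: sig_mult[OF W_graded[OF T]] t0)
    then have "Th (dl p * T) = inverse mc \<star> ((Ya * dl p) * sig \<alpha> T * Xa)" by (simp add: Th_def mult.assoc)
    then show ?thesis unfolding Yd
      by (simp add: Th_def algebra_simps ops.scale_right_distrib)
  qed
  define r where "r = inverse (a p)"
  have ra: "r * a p = 1" using ap by (simp add: r_def)
  define h where "h = r \<star> dl p"
  have Th_h: "Th (h * T) = h * Th T + Th T" if T: "T \<in> Wset" for T
    using Th_d[OF T] ra by (simp add: h_def Th_smul ops.scale_right_distrib)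
  have F_Suc: "fallf p r (Suc m) T = h * fallf p r m T - of_nat m \<star> fallf p r m T" for m T
    by (simp add: h_def)
  have Th_F: "Th (fallf p r (Suc m) T) = fallf p r (Suc m) (Th T) + of_nat (Suc m) \<star> fallf p r m (Th T)"
    if T: "T \<in> Wset" for m T
  proof (induction m)
    case 0
    then show ?case using Th_h[OF T] by (simp add: h_def Th_smul)
  next
    case (Suc m)
    let ?G1 = "fallf p r (Suc m) (Th T)" and ?G0 = "fallf p r m (Th T)"
    let ?S = "fallf p r (Suc m) T"
    have G1: "?G1 = h * ?G0 - of_nat m \<star> ?G0" by (rule F_Suc)
    have "Th (fallf p r (Suc (Suc m)) T) = h * Th ?S + Th ?S - of_nat (Suc m) \<star> Th ?S"
      unfolding F_Suc[of "Suc m" T] Th_diff Th_smul Th_h[OF fallf_W[OF p T]] ..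
    also have "\<dots> = h * Th ?S - of_nat m \<star> Th ?S"
      by (simp add: ops.scale_left_distrib)
    also have "\<dots> = h * ?G1 - of_nat m \<star> ?G1 + of_nat (Suc m) \<star> (h * ?G0 - of_nat m \<star> ?G0)"
      unfolding Suc.IH by (simp add: distrib_left ops.scale_right_distrib ops.scale_right_diff_distrib
          del: of_nat_Suc fallf.simps)
    also have "\<dots> = h * ?G1 - of_nat m \<star> ?G1 + of_nat (Suc m) \<star> ?G1" unfolding G1 ..
    also have "\<dots> = (h * ?G1 - of_nat (Suc m) \<star> ?G1) + of_nat (Suc (Suc m)) \<star> ?G1"
      by (simp only: of_nat_Suc ops.scale_left_distrib) simp
    finally show ?case unfolding F_Suc[of "Suc m" "Th T"] .
  qed
  have main: "dn n T \<Longrightarrow> T \<in> Wset \<Longrightarrow> fallf p r m T \<in> CC" for n m T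
  proof (induction n arbitrary: T m)
    case 0
    have "fallf p r m 0 = 0" by (induction m) simp_all
    then show ?case using 0 by simp
  next
    case (Suc n)
    let ?N = "T - Th T"
    have "Ya * cad \<alpha> Xa T = mc \<star> ?N"
      using mc graded_ops_unit(1)[OF W_graded[OF Suc.prems(2)]] YX[unfolded Xa_def Ya_def]
      by (simp add: cad_def right_diff_distrib mult.assoc[symmetric] Th_def ops.scale_right_diff_distrib)
    moreover have "dn n (Ya * cad \<alpha> Xa T)"
      using Suc.prems x_B[OF a] x_B[OF a'] by (simp add: \<alpha>_def dn_Mx W_cad_Mx)
    ultimately have "dn n (inverse mc \<star> (mc \<star> ?N))" using dn_smul by metis
    then have "dn n ?N" using mc by simp
    moreover have NW: "?N \<in> Wset" using Suc.prems(2) by (intro W_diff Th_W)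
    ultimately have IH: "fallf p r j ?N \<in> CC" for j by (rule Suc.IH)
    let ?S = "fallf p r (Suc m) T"
    have "?S - Th ?S \<in> CC" by (intro Th_CC fallf_W p Suc.prems(2))
    moreover have "of_nat (Suc m) \<star> fallf p r m T =
        fallf p r (Suc m) ?N + of_nat (Suc m) \<star> fallf p r m ?N - (?S - Th ?S)"
      unfolding Th_F[OF Suc.prems(2)] fallf_diff
      by (simp only: algebra_simps ops.scale_right_diff_distrib)
    ultimately have "of_nat (Suc m) \<star> fallf p r m T \<in> CC"
      using IH[of "Suc m"] IH[of m] by (simp only: CC_add CC_diff CC_smul)
    then show ?case using CC_smul_iff[of "of_nat (Suc m)"] of_nat_neq_0 by blast
  qed
  show ?thesis
  proof
    fix T assume T: "T \<in> Wset"
    obtain n where "dn n T" using dn_exists[OF T] by blast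
    from main[OF this T, of 0] show "T \<in> CC" by simp
  qed
qed

lemma W_CC:
  assumes "kev > 0"
  shows "Wset \<subseteq> CC"
proof (cases "k1 D + k2 D > 0")
  case True
  then obtain b where "b \<in> Grp D" "b 1 \<noteq> 0" using G_nonzero_at[of 1] by auto
  then show ?thesis by (rule W_CC_difference)
next
  case False
  then show ?thesis using assms by (intro W_CC_integrate[of 1]) simp
qed

text \<open>The preimage of the derived algebra \<open>[\<W>/\<F>, \<W>/\<F>]\<close> in \<open>\<W>\<close>.\<close>
definition Lset where "Lset = ops.span (CC \<union> Nset)"

lemma L_CC: "CC \<subseteq> Lset" and L_N: "Nset \<subseteq> Lset"
  by (auto simp: Lset_def intro: ops.span_base)

lemma L_add: "S \<in> Lset \<Longrightarrow> T \<in> Lset \<Longrightarrow> S + T \<in> Lset" by (simp add: Lset_def ops.span_add)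
lemma L_diff: "S \<in> Lset \<Longrightarrow> T \<in> Lset \<Longrightarrow> S - T \<in> Lset" by (simp add: Lset_def ops.span_diff)
lemma L_smul: "T \<in> Lset \<Longrightarrow> r \<star> T \<in> Lset" by (simp add: Lset_def ops.span_scale)
lemma L_zero [simp]: "0 \<in> Lset" by (simp add: Lset_def ops.span_zero)

lemma N_W: "Nset \<subseteq> Wset" by (auto simp: N_iff W_smul)

lemma L_W: "Lset \<subseteq> Wset"
  unfolding Lset_def using CC_W N_W by (intro ops.span_minimal[OF _ W_subspace]) blast

lemma L_eq_W: "kev > 0 \<Longrightarrow> Lset = Wset"
  by (intro subset_antisym L_W subset_trans[OF W_CC L_CC])

section \<open>Simplicity: reduction to a multiplication operator\<close>

lemma Mx_inverse:
  assumes a: "a \<in> Grp D"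
  shows "\<exists>c. c \<noteq> 0 \<and> Mx (- a, 0) * Mx (a, 0) = c \<star> idop"
proof -
  have "(- a, 0) + (a, 0) = (0 :: 'f expo)" by (simp add: zero_prod_def)
  then have "Mx (- a, 0) * Mx (a, 0) = mult_coeff D (- a, 0) (a, 0) \<star> idop"
    using Mx_mult[OF x_B[OF G_uminus[OF a]] x_B[OF a]] by (simp add: Mx_zero)
  then show ?thesis using mult_coeff_nonzero[OF x_B[OF G_uminus[OF a]] x_B[OF a]] by blast
qed

lemma cad_diff_left: "cad \<kappa> (R - S) T = cad \<kappa> R T - cad \<kappa> S T"
  by (simp add: cad_def left_diff_distrib right_diff_distrib)

text \<open>The two reductions combined. After \<open>order_reduction\<close> and \<open>weight_reduction\<close> there is a weight vector \<open>v\<close> modulo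
  scalars in \<open>\<A> \<inter> U\<close>. For \<open>a \<noteq> 0\<close> it is \<open>x\<^sup>a\<close> up to a factor and a scalar. For \<open>a = 0\<close> it is a combination of \<open>1\<close> and the \<open>t\<^sub>p\<close>, and
  \<open>w\<close> is its component of the color of one \<open>t\<^sub>p\<close> that occurs, normalized.\<close>
lemma ideal_to_A:
  assumes U: "color_ideal L U" and L: "L \<subseteq> Wset" "\<And>x. x \<in> Bset \<Longrightarrow> Mx x \<in> L" "\<And>p. p \<in> {1..k} \<Longrightarrow> dl p \<in> L"
    and N: "Nset \<subseteq> U" "U \<noteq> Nset" and big: "\<And>x. \<exists>y\<in>Bset. y \<noteq> 0 \<and> y \<noteq> x"
  shows "(\<exists>a\<in>Grp D. a \<noteq> 0 \<and> Mx (a, 0) \<in> U) \<or>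
    (\<exists>w p. w \<in> Aset \<and> w \<in> U \<and> p \<in> {k1 D + 1..k} \<and> homg (tcol D p) w \<and> cad (dcol p) (dl p) w = idop \<and>
      (\<forall>q\<in>{1..k}. cad (dcol q) (dl q) w \<in> Nset))"
proof -
  note UL = idealD(2)[OF U]
  obtain T where T: "T \<in> U" "T \<notin> Nset" using N by blast
  have "\<exists>u\<in>Aset \<inter> U. u \<notin> Nset"
  proof (rule order_reduction[OF _ T _ big])
    show "T \<in> Wset" using T(1) UL L(1) by blast
    show "cad (xcol x) (Mx x) S \<in> U" if "x \<in> Bset" "S \<in> U" for x S
      by (rule idealD(4)[OF U L(2)[OF that(1)] hom_Mx that(2)])
  qed
  then obtain u where u: "u \<in> Aset \<inter> U" "u \<notin> Nset" by blast
  have "\<exists>v\<in>Aset \<inter> U. v \<notin> Nset \<and> (\<exists>a\<in>Grp D. \<forall>p\<in>{1..k}. wt p a v \<in> Nset)"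
  proof (rule weight_reduction[OF _ u N_zero])
    show "u \<in> Wset" using u(1) A_W by blast
    show "wt p a S \<in> Aset \<inter> U" if "p \<in> {1..k}" "a \<in> Grp D" "S \<in> Aset \<inter> U" for p a S
    proof -
      have "cad (dcol p) (dl p) S \<in> U" using that by (intro idealD(4)[OF U L(3)] hom_dl) auto
      then show ?thesis
        unfolding wt_def using that by (simp add: A_diff A_smul A_cad_dl ideal_diff[OF U] ideal_smul[OF U])
    qed
  qed
  then obtain v a where v: "v \<in> Aset \<inter> U" "v \<notin> Nset" "a \<in> Grp D"
    and v4: "\<And>p. p \<in> {1..k} \<Longrightarrow> wt p a v \<in> Nset" by blast
  let ?l = "Poly_Mapping.lookup (app v vac)" and ?K = "Poly_Mapping.keys (app v vac)"
  have vA: "v \<in> Aset" "v \<in> U" using v(1) by blast+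
  have sup: "z = 0 \<or> z = (a, 0) \<or> a = 0 \<and> (\<exists>p\<in>{k1 D + 1..k}. z = (0, un p))" if "z \<in> ?K" for z
    by (rule wt_support[OF vA(1) v(3) v4 that])
  show ?thesis
  proof (cases "a = 0")
    case False
    have sub: "?K \<subseteq> {0, (a, 0)}" using sup False by blast
    have ne: "(a, 0) \<noteq> (0 :: 'f expo)" using False by (simp add: zero_prod_def)
    have "v = (\<Sum>x\<in>{0, (a, 0)}. ?l x \<star> Mx x)"
      by (subst A_expand[OF vA(1)]) (rule sum.mono_neutral_left, use sub in \<open>auto simp: in_keys_iff\<close>)
    then have e: "v = ?l 0 \<star> idop + ?l (a, 0) \<star> Mx (a, 0)" using ne by (simp add: Mx_zero)
    have l: "?l (a, 0) \<noteq> 0"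
    proof
      assume "?l (a, 0) = 0"
      then have "v = ?l 0 \<star> idop" using e by simp
      then show False using v(2) N_smul_unit by metis
    qed
    have "v - ?l 0 \<star> idop \<in> U" using vA(2) N(1) by (intro ideal_diff[OF U]) auto
    moreover have "v - ?l 0 \<star> idop = ?l (a, 0) \<star> Mx (a, 0)" by (subst (1) e) simp
    ultimately have "Mx (a, 0) \<in> U" using ideal_smul_iff[OF U l] by simp
    then show ?thesis using v(3) False by blast
  next
    case True
    have "\<exists>p\<in>{k1 D + 1..k}. (0, un p) \<in> ?K"
    proof (rule ccontr)
      assume n: "\<not> ?thesis"
      then have sub: "?K \<subseteq> {0}" using sup True by (auto simp: zero_prod_def) 
      have "v = (\<Sum>x\<in>{0}. ?l x \<star> Mx x)"
        by (subst A_expand[OF vA(1)]) (rule sum.mono_neutral_left, use sub in \<open>auto simp: in_keys_iff\<close>)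
      then have "v = ?l 0 \<star> idop" by (simp add: Mx_zero)
      then show False using v(2) N_smul_unit by metis
    qed
    then obtain p where p: "p \<in> {k1 D + 1..k}" "(0, un p) \<in> ?K" by blast
    note pk = k_range[OF p(1)]
    define w where "w = cpt (tcol D p) v"
    have w: "w \<in> Aset" "w \<in> U" "homg (tcol D p) w"
      by (simp_all add: w_def A_comp vA idealD(3)[OF U vA(2)])
    have cw: "cad (dcol q) (dl q) w = cpt (dcol q + tcol D p) (cad (dcol q) (dl q) v)" if "q \<in> {1..k}" for q
      unfolding w_def by (rule comp_cad[OF hom_dl[OF that] W_graded[OF A_W[OF vA(1)]], symmetric])
    have vN: "\<exists>c. cad (dcol q) (dl q) v = c \<star> idop" if "q \<in> {1..k}" for q
      using v4[OF that] True by (simp add: wt_def N_iff)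
    have wN: "cad (dcol q) (dl q) w \<in> Nset" if q: "q \<in> {1..k}" for q
      using vN[OF q] cw[OF q] by (auto simp: comp_smul comp_hom[OF hom_unit])
    obtain c where c: "cad (dcol p) (dl p) v = c \<star> idop" using vN[OF pk] by blast
    have "app (dl p) (app v vac) = app (c \<star> idop) vac" using app_cad_dl_vac[OF vA(1), of p] c by simp
    then have "c = tau p (0, un p) * ?l (0, un p) + fst (0 :: 'f expo) p * ?l 0"
      using lookup_dl[OF A_keys[OF vA(1)] B_zero pk] by (simp add: lookup_unit_vac)
    then have c0: "c \<noteq> 0" using p(2) by (simp add: in_keys_iff)
    have cp: "cad (dcol p) (dl p) w = c \<star> idop"
      using cw[OF pk] c by (simp add: comp_smul comp_hom[OF hom_unit])
    have "cad (dcol p) (dl p) (inverse c \<star> w) = idop" using cp c0 by (simp add: cad_smul)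
    moreover have "cad (dcol q) (dl q) (inverse c \<star> w) \<in> Nset" if "q \<in> {1..k}" for q
      using wN[OF that] N_subspace by (simp add: cad_smul ops.subspace_scale)
    ultimately show ?thesis
      using w p(1) by (intro disjI2 exI[of _ "inverse c \<star> w"] exI[of _ p])
        (simp add: A_smul ideal_smul[OF U] hom_smul)
  qed
qed

text \<open>This is what fails for a single odd index, where \<open>\<A>\<close> is spanned by \<open>1\<close> and \<open>t\<^sub>1\<close>. Witnesses: \<open>x\<^sup>b\<close> and \<open>x\<^bsup>-b\<^esup>\<close>,
  or \<open>t\<^sub>1\<close> and \<open>t\<^sub>1\<^sup>2\<close>, or \<open>t\<^sub>1\<close> and \<open>t\<^sub>2\<close>; two nonzero exponents leave one that differs from \<open>x\<close>.\<close>
lemma big_basis: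
  assumes "kev > 0 \<or> k4 D > 1"
  shows "\<exists>y\<in>Bset. y \<noteq> 0 \<and> y \<noteq> x"
proof -
  have "\<exists>y\<in>Bset. \<exists>z\<in>Bset. y \<noteq> 0 \<and> z \<noteq> 0 \<and> y \<noteq> z"
  proof (cases "k1 D + k2 D > 0")
    case True
    then obtain b where b: "b \<in> Grp D" "b 1 \<noteq> 0" using G_nonzero_at[of 1] by auto
    have "(b, 0) \<noteq> (0 :: 'f expo)" "(- b, 0) \<noteq> (0 :: 'f expo)" using b(2) by (auto simp: zero_prod_def fun_eq_iff)
    moreover have "(b, 0 :: nat \<Rightarrow> nat) \<noteq> (- b, 0)"
    proof
      assume "(b, 0 :: nat \<Rightarrow> nat) = (- b, 0)"
      then have "b 1 = - b 1" by (metis fst_conv uminus_apply)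
      then show False using b(2) by simp
    qed
    ultimately show ?thesis using x_B[OF b(1)] x_B[OF G_uminus[OF b(1)]] by blast
  next
    case False
    have n0: "(0, un p) \<noteq> (0 :: 'f expo)" for p by (auto simp: zero_prod_def un_def fun_eq_iff)
    show ?thesis
    proof (cases "k3 D > 0")
      case True
      then have p: "1 \<in> {k1 D + 1..k}" using False by (simp add: ktot_def)
      have B2: "(0, un 1) + (0, un 1) \<in> Bset"
        unfolding B_add_iff[OF un_B[OF p] un_B[OF p]] using True by (simp add: un_def)
      have "snd ((0, un 1) + (0, un 1) :: 'f expo) 1 = 2" "snd ((0, un 1) :: 'f expo) 1 = 1" "snd (0 :: 'f expo) 1 = 0"
        by (simp_all add: un_def)
      then have "(0, un 1) + (0, un 1) \<noteq> (0 :: 'f expo)" "(0, un 1) \<noteq> ((0, un 1) + (0, un 1) :: 'f expo)"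
        by (metis zero_neq_numeral, metis numeral_eq_one_iff semiring_norm(85))
      then show ?thesis using un_B[OF p] B2 n0 by metis
    next
      case k3: False
      then have p: "1 \<in> {k1 D + 1..k}" "2 \<in> {k1 D + 1..k}" using False assms by (simp_all add: ktot_def)
      have "un 1 \<noteq> un 2"
      proof
        assume "un 1 = un 2"
        then have "un 1 1 = un 2 1" by simp
        then show False by (simp add: un_def)
      qed
      then have "(0, un 1) \<noteq> ((0, un 2) :: 'f expo)" by simp
      then show ?thesis using un_B[OF p(1)] un_B[OF p(2)] n0 by metis
    qed
  qed
  then show ?thesis by metis
qed

text \<open>Herstein's argument for associative rings, with color signs: the elements \<open>x\<close> with \<open>[x, \<W>] \<subseteq> U\<close>
  form a subring containing \<open>U\<close>; for \<open>u, v\<close> in \<open>U\<close> the identity \<open>[u, v r] = [u, v] r + v [u, r]\<close> puts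
  \<open>[u, v] \<W>\<close> into this subring, and then the two-sided ideal generated by \<open>[u, v]\<close>.\<close>
lemma herstein:
  assumes U: "color_ideal Wset U" and u: "u \<in> U" "homg \<kappa> u" and v: "v \<in> U" "homg \<mu> v"
    and s: "s \<in> Wset" "homg \<nu> s" "s * cad \<kappa> u v = idop"
  shows "CC \<subseteq> U"
proof -
  \<comment> \<open>The homogeneous part of the subring, one color at a time.\<close>
  define P where "P \<kappa> x \<longleftrightarrow> x \<in> Wset \<and> homg \<kappa> x \<and> (\<forall>z\<in>Wset. cad \<kappa> x z \<in> U)" for \<kappa> x
  have UW: "y \<in> Wset" if "y \<in> U" for y using that idealD(2)[OF U] by blast
  have PU: "P \<kappa> y" if "y \<in> U" "homg \<kappa> y" for \<kappa> y
    unfolding P_def using that UW by (simp add: ideal_skew[OF U that] W_graded W_comp)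
  have Pm: "P (\<kappa> + \<mu>) (x * y)" if x: "P \<kappa> x" and y: "P \<mu> y" for \<kappa> \<mu> x y
  proof -
    have xW: "x \<in> Wset" "homg \<kappa> x" "y \<in> Wset" "homg \<mu> y" using x y by (simp_all add: P_def)
    have "cad (\<kappa> + \<mu>) (x * y) z \<in> U" if z: "z \<in> Wset" for z
    proof -
      have 1: "cad \<kappa> x (y * z) = x * (y * z) - eps D \<kappa> \<mu> \<star> (y * (sig \<kappa> z * x))"
        by (simp add: cad_def sig_mult[OF W_graded[OF z]] sig_hom[OF xW(4)] mult.assoc)
      have 2: "cad \<mu> y (sig \<kappa> z * x) = y * (sig \<kappa> z * x) - eps D \<mu> \<kappa> \<star> (sig (\<kappa> + \<mu>) z * (x * y))"
        by (simp add: cad_def sig_mult[OF W_graded[OF xW(1)]] sig_hom[OF xW(2)] sig_sig mult.assoc add.commute)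
      have "cad (\<kappa> + \<mu>) (x * y) z = cad \<kappa> x (y * z) + eps D \<kappa> \<mu> \<star> cad \<mu> y (sig \<kappa> z * x)"
        unfolding 1 2 by (simp add: cad_def ops.scale_right_diff_distrib mult.assoc)
      moreover have "cad \<kappa> x (y * z) \<in> U" using x W_mult[OF xW(3) z] by (simp add: P_def)
      moreover have "cad \<mu> y (sig \<kappa> z * x) \<in> U" using y W_mult[OF W_sig[OF z] xW(1)] by (simp add: P_def)
      ultimately show ?thesis by (simp add: ideal_add[OF U] ideal_smul[OF U])
    qed
    then show ?thesis using hom_mult[OF xW(2,4)] W_mult[OF xW(1,3)] by (simp add: P_def)
  qed
  have Pd: "P \<kappa> (x - y)" if "P \<kappa> x" "P \<kappa> y" for \<kappa> x y
    using that by (simp add: P_def W_diff hom_diff cad_diff_left ideal_diff[OF U])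
  have Ps: "P \<kappa> (r \<star> x)" if "P \<kappa> x" for \<kappa> x r
    using that by (simp add: P_def W_smul hom_smul cad_smul_left ideal_smul[OF U])
  define w where "w = cad \<kappa> u v"
  have wW: "w \<in> Wset" "homg (\<kappa> + \<mu>) w" unfolding w_def using u v UW by (auto intro: W_cad hom_cad)
  \<comment> \<open>The right ideal generated by \<open>w = [u, v]\<close> lies in the subring,\<close>
  have Pw: "P (\<kappa> + \<mu> + \<nu>) (w * r)" if r: "r \<in> Wset" "homg \<nu> r" for \<nu> r
  proof -
    have 1: "P (\<kappa> + (\<mu> + \<nu>)) (cad \<kappa> u (v * r))"
    proof (rule PU)
      show "cad \<kappa> u (v * r) \<in> U" using PU[OF u] W_mult[OF UW[OF v(1)] r(1)] by (simp add: P_def)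
    qed (intro hom_cad hom_mult u v r)
    have "P (\<kappa> + \<nu>) (cad \<kappa> u r)"
      using PU[OF u] r by (intro PU hom_cad u) (simp_all add: P_def)
    then have 2: "P (\<mu> + (\<kappa> + \<nu>)) (v * cad \<kappa> u r)" by (rule Pm[OF PU[OF v]])
    have e: "\<mu> + (\<kappa> + \<nu>) = \<kappa> + (\<mu> + \<nu>)" by (simp add: add_ac)
    have "w * r = cad \<kappa> u (v * r) - eps D \<kappa> \<mu> \<star> (v * cad \<kappa> u r)"
      by (simp add: cad_mult[OF W_graded[OF r(1)]] sig_hom[OF v(2)] w_def)
    then show ?thesis using Pd[OF 1 Ps[OF 2[unfolded e]]] by (simp add: add.assoc)
  qed
  \<comment> \<open>and with it every \<open>r = s w r\<close>, a combination of \<open>[s, w r]\<close> and \<open>w r s\<close>.\<close>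
  have all: "P \<rho> r" if r: "r \<in> Wset" "homg \<rho> r" for \<rho> r
  proof -
    let ?d = "\<kappa> + \<mu> + \<rho>"
    have wr: "w * r \<in> Wset" "homg ?d (w * r)" using Pw[OF r] by (simp_all add: P_def)
    have "cad \<nu> s (w * r) = (- eps D \<nu> ?d) \<star> cad ?d (w * r) s" using cad_skew[OF s(2) wr(2)] by simp
    also have "\<dots> \<in> U" using Pw[OF r] s(1) by (intro ideal_smul[OF U]) (simp add: P_def)
    finally have 1: "P (\<nu> + ?d) (cad \<nu> s (w * r))" by (rule PU) (rule hom_cad[OF s(2) wr(2)])
    have e: "\<kappa> + \<mu> + (\<rho> + \<nu>) = \<nu> + ?d" by (simp add: add_ac)
    have 2: "P (\<nu> + ?d) (w * (r * s))"
      using Pw[OF W_mult[OF r(1) s(1)] hom_mult[OF r(2) s(2)]] unfolding e .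
    have "r = s * w * r" using s(3) unit_left[OF r(2)] by (simp add: w_def)
    also have "\<dots> = cad \<nu> s (w * r) - (- eps D \<nu> ?d) \<star> (w * (r * s))"
      by (simp add: cad_hom[OF wr(2)] mult.assoc)
    finally have r_eq: "r = cad \<nu> s (w * r) - (- eps D \<nu> ?d) \<star> (w * (r * s))" .
    have Pr: "P (\<nu> + ?d) r" by (subst r_eq) (rule Pd[OF 1 Ps[OF 2]])
    show ?thesis
    proof (cases "r = 0")
      case True
      then show ?thesis using PU[of 0 \<rho>] ops.subspace_0[OF idealD(1)[OF U]] by simp
    next
      case False
      have "homg (\<nu> + ?d) r" using Pr by (simp add: P_def)
      from hom_unique[OF this r(2) False] show ?thesis using Pr by (simp only:)
    qed
  qed
  show ?thesis
    unfolding CC_def using all by (intro ops.span_minimal[OF _ idealD(1)[OF U]]) (auto simp: P_def)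
qed

text \<open>It suffices to find the left invertible commutator that \<open>herstein\<close> asks for. From \<open>x\<^sup>a \<in> U\<close>, one obtains
  \<open>\<partial>\<^sub>p \<in> U\<close> with \<open>a\<^sub>p \<noteq> 0\<close>, and \<open>[\<partial>\<^sub>p, x\<^sup>a] = a\<^sub>p x\<^sup>a\<close> is invertible. From \<open>w\<close> with \<open>\<partial>\<^sub>p w = 1\<close>, the brackets \<open>[y \<partial>\<^sub>p, w] = y\<close> give
  \<open>\<A> \<subseteq> U\<close>; a second-order operator gives \<open>\<partial>\<^sub>q \<in> U\<close> for an even \<open>q\<close>, and some \<open>\<partial>\<^sub>q y\<close> is invertible.\<close>
lemma weyl_simple_even:
  assumes ev: "kev > 0" and U: "color_ideal Wset U" and N: "Nset \<subseteq> U" "U \<noteq> Nset"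
  shows "U = Wset"
proof -
  have UW: "y \<in> Wset" if "y \<in> U" for y using that idealD(2)[OF U] by blast
  have disj: "(\<exists>a\<in>Grp D. a \<noteq> 0 \<and> Mx (a, 0) \<in> U) \<or>
    (\<exists>w p. w \<in> Aset \<and> w \<in> U \<and> p \<in> {k1 D + 1..k} \<and> homg (tcol D p) w \<and> cad (dcol p) (dl p) w = idop \<and>
      (\<forall>q\<in>{1..k}. cad (dcol q) (dl q) w \<in> Nset))"
    by (rule ideal_to_A[OF U subset_refl W_Mx W_dl N]) (use big_basis ev in blast)+
  have "CC \<subseteq> U"
    using disj
  proof (elim disjE)
    assume "\<exists>a\<in>Grp D. a \<noteq> 0 \<and> Mx (a, 0) \<in> U"
    then obtain a where a: "a \<in> Grp D" "a \<noteq> 0" and XU: "Mx (a, 0) \<in> U" by blast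
    then obtain p where ap: "a p \<noteq> 0" by (auto simp: fun_eq_iff)
    have p: "p \<in> {1..k}" using G_out[OF a(1) ap] by (simp add: ktot_def)
    have t0: "tcol D p = 0" by (rule tcol_G[OF a(1) ap])
    define Xa Ya d where "Xa = Mx (a, 0)" and "Ya = Mx (- a, 0)" and "d = dl p"
    obtain m where m: "m \<noteq> 0" "Ya * Xa = m \<star> idop" using Mx_inverse[OF a(1)] unfolding Xa_def Ya_def by blast
    have d: "homg 0 d" "d \<in> Wset" using hom_dl[OF p] W_dl[OF p] by (simp_all add: d_def t0)
    have dX: "cad 0 d Xa = a p \<star> Xa" using cad_dl_x[OF a(1) p] by (simp add: d_def Xa_def t0)
    have Xa: "homg (xcol (a, 0)) Xa" "Xa \<in> graded_ops" using hom_Mx graded_ops_hom[OF hom_Mx] by (simp_all add: Xa_def)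
    have Ya: "homg (xcol (- a, 0)) Ya" using hom_Mx by (simp add: Ya_def)
    have YX: "cad (xcol (- a, 0)) Ya Xa = 0" unfolding Xa_def Ya_def by (intro cad_Mx_Mx x_B a G_uminus)
    \<comment> \<open>\<open>[x\<^sup>-\<^sup>a \<partial>\<^sup>2, x\<^sup>a]\<close> is a scalar multiple of \<open>2 a\<^sub>p \<partial> + a\<^sub>p\<^sup>2\<close>.\<close>
    have 1: "cad (0 + 0) (d * d) Xa = (2 * a p) \<star> (Xa * d) + (a p * a p) \<star> Xa"
    proof -
      have "d * Xa = Xa * d + a p \<star> Xa" using dX by (simp add: cad_hom[OF Xa(1)] algebra_simps)
      then show ?thesis
        unfolding cad_mult_left[OF d(1) Xa(2)] sig_0[OF Xa(2)] dX
        by (simp add: ops.scale_right_distrib) (simp add: ops.scale_left_distrib[symmetric] algebra_simps)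
    qed
    have "cad (xcol (- a, 0) + 0) (Ya * (d * d)) Xa = Ya * cad 0 (d * d) Xa"
      using cad_mult_left[OF hom_mult[OF d(1) d(1)] Xa(2), of "xcol (- a, 0)" Ya] YX by (simp add: sig_0[OF Xa(2)])
    also have "\<dots> = (2 * a p * m) \<star> d + (a p * a p * m) \<star> idop"
      using 1 m(2) unit_left[OF d(1)] by (simp add: distrib_left mult.assoc[symmetric])
    finally have e: "cad (xcol (- a, 0) + 0) (Ya * (d * d)) Xa = (2 * a p * m) \<star> d + (a p * a p * m) \<star> idop" .
    have "cad (xcol (- a, 0) + 0) (Ya * (d * d)) Xa \<in> U"
    proof (rule idealD(4)[OF U])
      show "Ya * (d * d) \<in> Wset" using d(2) by (simp add: Ya_def W_mult)
      show "homg (xcol (- a, 0) + 0) (Ya * (d * d))" using hom_mult[OF Ya hom_mult[OF d(1) d(1)]] by simp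
    qed (simp add: Xa_def XU)
    then have "(2 * a p * m) \<star> d + (a p * a p * m) \<star> idop - (a p * a p * m) \<star> idop \<in> U"
      unfolding e using N(1) by (intro ideal_diff[OF U]) auto
    then have dU: "d \<in> U" using ideal_smul_iff[OF U, of "2 * a p * m" d] ap m(1) by simp
    have "inverse (a p * m) \<star> Ya * cad 0 d Xa = (inverse (a p * m) * (a p * m)) \<star> idop"
      by (simp only: dX m(2) smul_mult_left smul_mult_right ops.scale_scale mult.assoc mult.left_commute)
    also have "inverse (a p * m) * (a p * m) = 1" using m(1) ap by (intro left_inverse) simp
    finally have "inverse (a p * m) \<star> Ya * cad 0 d Xa = idop" by (simp only: ops.scale_one)
    moreover have "inverse (a p * m) \<star> Ya \<in> Wset" by (simp add: Ya_def W_smul)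
    ultimately show "CC \<subseteq> U"
      by (intro herstein[OF U dU d(1) XU[folded Xa_def] Xa(1) _ hom_smul[OF Ya]])
  next
    assume "\<exists>w p. w \<in> Aset \<and> w \<in> U \<and> p \<in> {k1 D + 1..k} \<and> homg (tcol D p) w \<and> cad (dcol p) (dl p) w = idop \<and>
      (\<forall>q\<in>{1..k}. cad (dcol q) (dl q) w \<in> Nset)"
    then obtain w p where W: "w \<in> Aset \<and> w \<in> U \<and> p \<in> {k1 D + 1..k} \<and> homg (tcol D p) w \<and>
      cad (dcol p) (dl p) w = idop \<and> (\<forall>q\<in>{1..k}. cad (dcol q) (dl q) w \<in> Nset)" by (elim exE)
    have w: "w \<in> Aset" "w \<in> U" "homg (tcol D p) w" and p0: "p \<in> {k1 D + 1..k}"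
      and pw: "cad (dcol p) (dl p) w = idop" using W by simp_all
    have qw: "cad (dcol q) (dl q) w \<in> Nset" if "q \<in> {1..k}" for q using W that by (elim conjE) (rule bspec)
    note p = k_range[OF p0]
    note wg = W_graded[OF A_W[OF w(1)]]
    have MU: "Mx y \<in> U" if y: "y \<in> Bset" for y
    proof -
      have "cad (xcol y + dcol p) (Mx y * dl p) w = Mx y"
        unfolding cad_mult_left[OF hom_dl[OF p] wg] pw cad_Mx_A[OF y A_sig[OF w(1)]]
        by (simp add: unit_right[OF hom_Mx])
      moreover have "cad (xcol y + dcol p) (Mx y * dl p) w \<in> U"
        by (intro idealD(4)[OF U] W_mult W_Mx W_dl p hom_mult hom_Mx hom_dl w)
      ultimately show ?thesis by simp
    qed
    \<comment> \<open>\<open>[\<partial>\<^sub>p\<^sup>2, w] = 2 \<partial>\<^sub>p\<close> if \<open>p\<close> is even. If \<open>p\<close> is odd, the color of \<open>w\<close> is not that of \<open>t\<^sub>q\<close> for an even \<open>q\<close>; so the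
      scalar \<open>\<partial>\<^sub>q w\<close> vanishes, and \<open>[\<partial>\<^sub>q \<partial>\<^sub>p, w] = \<partial>\<^sub>q\<close>.\<close>
    have "\<exists>q\<in>{1..kev}. dl q \<in> U"
    proof (cases "p \<le> kev")
      case True
      have e1: "eps D (dcol p) (tcol D p) = 1" using eps_tcol_even[OF p True] by (simp add: eps_uminus_left)
      have "cad (dcol p + dcol p) (dl p * dl p) w = dl p + dl p"
        unfolding cad_mult_left[OF hom_dl[OF p] wg] sig_hom[OF w(3)] e1 ops.scale_one pw
        by (simp add: unit_right[OF hom_dl[OF p]] unit_left[OF hom_dl[OF p]])
      moreover have "cad (dcol p + dcol p) (dl p * dl p) w \<in> U"
        by (intro idealD(4)[OF U] W_mult W_dl p hom_mult hom_dl w)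
      moreover have "(2 :: 'f) \<star> dl p = dl p + dl p" using ops.scale_left_distrib[of 1 1 "dl p"] by simp
      ultimately have "(2 :: 'f) \<star> dl p \<in> U" by simp
      then have "dl p \<in> U" using ideal_smul_iff[OF U, of 2 "dl p"] by simp
      then show ?thesis using True p by auto
    next
      case False
      obtain q where qe: "q \<in> {1..kev}" using ev by (metis atLeastAtMost_iff le_refl less_eq_Suc_le One_nat_def)
      then have q: "q \<in> {1..k}" "q \<le> kev" by (simp_all add: ktot_def)
      have ne: "tcol D p \<noteq> tcol D q" using eps_tcol_odd[OF p False] eps_tcol_even[OF q] by auto
      obtain c where c: "cad (dcol q) (dl q) w = c \<star> idop" using qw[OF q(1)] by (auto simp: N_iff)
      have "homg (dcol q + tcol D p) (c \<star> idop)" using hom_cad[OF hom_dl[OF q(1)] w(3)] c by simp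
      then have "c \<star> idop = 0"
        using hom_unique[of "dcol q + tcol D p" "c \<star> idop" 0] hom_smul[OF hom_unit] ne by (auto simp: eq_neg_iff_add_eq_0)
      then have c0: "cad (dcol p) (dl p) w = idop" "cad (dcol q) (dl q) w = 0" using pw c by simp_all
      have "cad (dcol q + dcol p) (dl q * dl p) w = dl q"
        unfolding cad_mult_left[OF hom_dl[OF p] wg] c0 sig_hom[OF w(3)] cad_smul
        by (simp only: unit_right[OF hom_dl[OF q(1)]] ops.scale_zero_right mult_zero_left add_0_right)
      moreover have "cad (dcol q + dcol p) (dl q * dl p) w \<in> U"
        by (intro idealD(4)[OF U] W_mult W_dl p q(1) hom_mult hom_dl w)
      ultimately have "dl q \<in> U" by simp
      then show ?thesis using qe by (intro bexI[of _ q])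
    qed
    then obtain q where q: "q \<in> {1..kev}" "dl q \<in> U" by blast
    have qk: "q \<in> {1..k}" using q(1) by (simp add: ktot_def)
    have "\<exists>y s \<nu>. y \<in> Bset \<and> s \<in> Wset \<and> homg \<nu> s \<and> s * cad (dcol q) (dl q) (Mx y) = idop"
    proof (cases "q \<le> k1 D + k2 D")
      case True
      then obtain b where b: "b \<in> Grp D" "b q \<noteq> 0" using G_nonzero_at[of q] q(1) by auto
      obtain c where c: "c \<noteq> 0" "Mx (- b, 0) * Mx (b, 0) = c \<star> idop" using Mx_inverse[OF b(1)] by blast
      have "inverse (b q * c) \<star> Mx (- b, 0) * cad (dcol q) (dl q) (Mx (b, 0)) = (inverse (b q * c) * (b q * c)) \<star> idop"
        by (simp only: cad_dl_x[OF b(1) qk] c(2) smul_mult_left smul_mult_right ops.scale_scale mult.assoc mult.left_commute)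
      also have "inverse (b q * c) * (b q * c) = 1" using b(2) c(1) by (intro left_inverse) simp
      finally have "inverse (b q * c) \<star> Mx (- b, 0) * cad (dcol q) (dl q) (Mx (b, 0)) = idop"
        by (simp only: ops.scale_one)
      then show ?thesis
        using x_B[OF b(1)] W_smul[OF W_Mx] hom_smul[OF hom_Mx[of "(- b, 0)"], of "inverse (b q * c)"]
        by (intro exI[of _ "(b, 0)"] exI[of _ "inverse (b q * c) \<star> Mx (- b, 0)"] exI[of _ "xcol (- b, 0)"] conjI)
    next
      case False
      then have q': "q \<in> {k1 D + 1..k}" using qk by simp
      have "inverse (tau q (0, un q)) \<star> idop * cad (dcol q) (dl q) (tt q) = idop"
        by (simp add: cad_dl_tt[OF q' qk])
      then show ?thesis
        using un_B[OF q'] W_smul[OF unit_W] hom_smul[OF hom_unit, of "inverse (tau q (0, un q))"]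
        by (intro exI[of _ "(0, un q)"] exI[of _ "inverse (tau q (0, un q)) \<star> idop"] exI[of _ 0] conjI)
    qed
    then obtain y s \<nu> where "y \<in> Bset" "s \<in> Wset" "homg \<nu> s" "s * cad (dcol q) (dl q) (Mx y) = idop"
      by (elim exE conjE)
    then show "CC \<subseteq> U" by (intro herstein[OF U q(2) hom_dl[OF qk] MU hom_Mx])
  qed
  then show ?thesis using W_CC[OF ev] idealD(2)[OF U] by blast
qed


section \<open>Simplicity in the purely odd case\<close>

lemma odd_range: "kev = 0 \<Longrightarrow> p \<in> {1..k} \<Longrightarrow> p \<in> {k1 D + 1..k}" by simp

lemma odd_fst:
  assumes "kev = 0" "x \<in> Bset"
  shows "fst x = 0"
proof
  fix p
  have "fst x \<in> Grp D" using assms(2) by (simp add: Bset_def mem_Times_iff)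
  then show "fst x p = 0 p" using G_out[of "fst x" p] assms(1) by (cases "fst x p = 0") auto
qed

lemma cad_tt_dl_self:
  assumes p: "p \<in> {k1 D + 1..k}"
  obtains c where "c \<noteq> 0" "cad (tcol D p) (tt p) (dl p) = c \<star> idop"
proof
  show "cad (tcol D p) (tt p) (dl p) = (- eps D (tcol D p) (dcol p) * tau p (0, un p)) \<star> idop"
    using cad_tt_dl[OF p k_range[OF p]] by (simp only: if_True refl)
  show "- eps D (tcol D p) (dcol p) * tau p (0, un p) \<noteq> 0" using eps_nonzero by simp
qed

lemma cad_tt_dl_other:
  "p \<in> {k1 D + 1..k} \<Longrightarrow> q \<in> {1..k} \<Longrightarrow> q \<noteq> p \<Longrightarrow> cad (tcol D p) (tt p) (dl q) = 0"
  by (simp add: cad_tt_dl)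

lemma cad_tt_Mx: "p \<in> {k1 D + 1..k} \<Longrightarrow> y \<in> Bset \<Longrightarrow> cad (tcol D p) (tt p) (Mx y) = 0"
  using cad_Mx_Mx[OF un_B] xcol_un by simp

text \<open>\<open>[t\<^sub>p, \<partial>\<^sub>p T]\<close> is a nonzero multiple of \<open>T\<close>.\<close>
lemma kill_t:
  assumes p: "p \<in> {k1 D + 1..k}" and T: "T \<in> Wset" "cad (tcol D p) (tt p) T = 0"
  shows "T \<in> CC"
proof -
  obtain c where c: "c \<noteq> 0" "cad (tcol D p) (tt p) (dl p) = c \<star> idop" using cad_tt_dl_self[OF p] by blast
  have "cad (tcol D p) (tt p) (dl p * T) = c \<star> T"
    using graded_ops_unit(1)[OF W_graded[OF T(1)]] by (simp add: cad_mult[OF W_graded[OF T(1)]] T(2) c(2))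
  moreover have "cad (tcol D p) (tt p) (dl p * T) \<in> CC"
    by (intro CC_I W_Mx hom_tt p W_dl_left T k_range)
  ultimately show ?thesis using CC_smul_iff[OF c(1)] by simp
qed

text \<open>\<open>[\<partial>\<^sub>p, t\<^sub>p T]\<close> is a nonzero multiple of \<open>T\<close>.\<close>
lemma kill_d:
  assumes p: "p \<in> {k1 D + 1..k}" and T: "T \<in> Wset" "cad (dcol p) (dl p) T = 0"
  shows "T \<in> CC"
proof -
  have "cad (dcol p) (dl p) (tt p * T) = tau p (0, un p) \<star> T"
    using graded_ops_unit(1)[OF W_graded[OF T(1)]]
    by (simp add: cad_mult[OF W_graded[OF T(1)]] T(2) cad_dl_tt[OF p k_range[OF p]])
  moreover have "cad (dcol p) (dl p) (tt p * T) \<in> CC"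
    by (intro CC_I W_dl hom_dl k_range[OF p] W_Mx_left T)
  ultimately show ?thesis using CC_smul_iff[OF tau_nonzero] by simp
qed

lemma cad_tt_dpow:
  assumes p: "p \<in> {k1 D + 1..k}" and \<mu>: "\<mu> p = 0"
  shows "cad (tcol D p) (tt p) (dpow \<mu>) = 0"
proof -
  have e: "cad (tcol D p) (tt p) (epow (dl q) n) = 0" if q: "q \<in> {1..k}" "q \<noteq> p" for q n
  proof (induction n)
    case (Suc n)
    show ?case
      by (simp only: epow.simps cad_mult[OF graded_ops_hom[OF hom_dl[OF q(1)]]] Suc.IH
          cad_tt_dl_other[OF p q] mult_zero_left mult_zero_right add_0)
  qed (simp only: epow.simps cad_unit[OF hom_tt[OF p]])
  have "cad (tcol D p) (tt p) (dprod \<mu> ps) = 0" if "set ps \<subseteq> {1..k}" "distinct ps" for ps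
    using that
  proof (induction ps)
    case (Cons q ps)
    have "dprod \<mu> ps \<in> graded_ops" using hom_dprod[of ps \<mu>] Cons.prems graded_ops_hom by simp
    moreover have "cad (tcol D p) (tt p) (epow (dl q) (\<mu> q)) = 0"
    proof (cases "q = p")
      case True
      show ?thesis unfolding True \<mu> epow.simps by (rule cad_unit[OF hom_tt[OF p]])
    next
      case False
      then show ?thesis using Cons.prems by (intro e) auto
    qed
    moreover have "cad (tcol D p) (tt p) (dprod \<mu> ps) = 0"
      using Cons.IH Cons.prems by (simp del: zero_fun_apply)
    ultimately show ?case by (simp only: dprod_Cons cad_mult mult_zero_left mult_zero_right add_0)
  qed (simp only: dprod_Nil cad_unit[OF hom_tt[OF p]])
  moreover have "set [1..<k + 1] \<subseteq> {1..k}" by auto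
  ultimately show ?thesis unfolding dpow_def using distinct_upt by metis
qed

lemma cad_tt_Mx_mult:
  assumes p: "p \<in> {k1 D + 1..k}" and x: "x \<in> Bset" and T: "T \<in> graded_ops"
  shows "cad (tcol D p) (tt p) (Mx x * T) = eps D (tcol D p) (xcol x) \<star> (Mx x * cad (tcol D p) (tt p) T)"
  by (simp add: cad_mult[OF T] cad_tt_Mx[OF p x] sig_hom[OF hom_Mx])

lemma cad_tt_mono:
  "p \<in> {k1 D + 1..k} \<Longrightarrow> x \<in> Bset \<Longrightarrow> \<mu> p = 0 \<Longrightarrow> cad (tcol D p) (tt p) (mono x \<mu>) = 0"
  unfolding mono_def by (simp add: cad_tt_Mx_mult graded_ops_hom[OF hom_dpow] cad_tt_dpow)

lemma cad_dl_mono: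
  assumes "p \<in> {1..k}" "x \<in> Bset" "fst x = 0"
  shows "cad (dcol p) (dl p) (mono x \<mu>) = (tau p x * of_nat (snd x p)) \<star> mono (down p x) \<mu>"
  using wt_mono[OF assms(1,2), of \<mu>] assms(3) by (simp add: wt_def)

lemma nontop_CC:
  assumes ev: "kev = 0" and x: "x \<in> Bset" and \<mu>: "\<mu> \<in> Mset D" and p: "p \<in> {1..k}"
    and "snd x p = 0 \<or> \<mu> p = 0"
  shows "mono x \<mu> \<in> CC"
  using assms(5)
proof
  note p' = odd_range[OF ev p]
  show "mono x \<mu> \<in> CC" if "\<mu> p = 0" by (rule kill_t[OF p' W_mono[OF x \<mu>] cad_tt_mono[where \<mu> = \<mu>, OF p' x that]])
  show "mono x \<mu> \<in> CC" if "snd x p = 0"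
    by (rule kill_d[OF p' W_mono[OF x \<mu>]]) (simp add: cad_dl_mono[OF p x odd_fst[OF ev x]] that)
qed

definition topi :: "nat \<Rightarrow> nat" where "topi p = (if p \<in> {1..k} then 1 else 0)"

lemma topi_J: "kev = 0 \<Longrightarrow> topi \<in> Jset D" and topi_M: "kev = 0 \<Longrightarrow> topi \<in> Mset D"
  by (simp_all add: topi_def Jset_def Mset_def)

abbreviation topm where "topm \<equiv> mono (0, topi) topi"

text \<open>The top monomial is the only one in which no exponent vanishes. The subspace \<open>V\<close> will be the derived
  algebra and, in the proof of simplicity, an ideal.\<close>
lemma W_top_split:
  assumes ev: "kev = 0" and V: "ops.subspace V"
    and mV: "\<And>x \<mu> p. x \<in> Bset \<Longrightarrow> \<mu> \<in> Mset D \<Longrightarrow> p \<in> {1..k} \<Longrightarrow> snd x p = 0 \<or> \<mu> p = 0 \<Longrightarrow> mono x \<mu> \<in> V"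
    and T: "T \<in> Wset"
  shows "\<exists>S\<in>V. \<exists>r. T = S + r \<star> topm"
  using T unfolding Wset_def
proof (induction T rule: ops.span_induct_alt)
  case base
  show ?case using ops.subspace_0[OF V] by (intro bexI[of _ 0] exI[of _ 0]) simp_all
next
  case (step c T R)
  then obtain x \<mu> where T: "T = mono x \<mu>" and x: "x \<in> Bset" and \<mu>: "\<mu> \<in> Mset D" by blast
  obtain S r where R: "R = S + r \<star> topm" "S \<in> V" using step(2) by blast
  show ?case
  proof (cases "\<exists>p\<in>{1..k}. snd x p = 0 \<or> \<mu> p = 0")
    case True
    then have "mono x \<mu> \<in> V" using mV[OF x \<mu>] by blast
    then have "c \<star> T + S \<in> V" using V R(2) by (simp add: T ops.subspace_add ops.subspace_scale)
    moreover have "c \<star> T + R = (c \<star> T + S) + r \<star> topm" by (simp add: R add.assoc)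
    ultimately show ?thesis by blast
  next
    case False
    have xJ: "snd x \<in> Jset D" using x by (simp add: Bset_def mem_Times_iff)
    have "snd x p = topi p" for p
    proof (cases "p \<in> {1..k}")
      case True
      then have "snd x p \<noteq> 0" using False by auto
      moreover have "snd x p \<le> 1" using J_odd[OF xJ, of p] ev True by simp
      ultimately show ?thesis using True by (simp add: topi_def)
    next
      case False
      then have "snd x p = 0" using xJ by (simp add: Jset_def)
      then show ?thesis using False by (simp add: topi_def)
    qed
    moreover have "\<mu> p = topi p" for p
    proof (cases "p \<in> {1..k}")
      case True
      then have "\<mu> p \<noteq> 0" using False by auto
      moreover have "\<mu> p \<le> 1" using \<mu> ev True by (simp add: Mset_def)
      ultimately show ?thesis using True by (simp add: topi_def)
    qed (use \<mu> in \<open>simp add: topi_def Mset_def\<close>)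
    ultimately have "T = topm" using odd_fst[OF ev x] unfolding T by (metis ext prod.collapse)
    then have "c \<star> T + R = S + (c + r) \<star> topm" by (simp add: R ops.scale_left_distrib add_ac)
    then show ?thesis using R(2) by blast
  qed
qed

text \<open>The colors of the \<open>t\<^sub>p\<close> and the \<open>\<partial>\<^sub>p\<close> cancel. For \<open>k\<^sub>1 > 0\<close> the exponent is not in \<open>Jset\<close> and the operator is zero.\<close>
lemma topm_hom: "homg 0 topm"
proof (cases "k1 D = 0")
  case True
  have "(\<Sum>p = k1 D + 1..k. nmult (topi p) (tcol D p)) = (\<Sum>p = 1..k. nmult (topi p) (tcol D p))"
    using True by simp
  then have "mcol (0, topi) topi = 0" by (simp add: mcol_def xcol_def xcolor_def)
  then show ?thesis using hom_mono[of "(0, topi)" topi] by simp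
next
  case False
  then have "topi \<notin> Jset D" using k_pos by (auto simp: topi_def Jset_def ktot_def intro!: exI[of _ 1])
  then have "Mx (0, topi) = 0" by (intro Mx_out) (simp add: Bset_def)
  then show ?thesis by (simp add: mono_def)
qed

lemma Mx_CC:
  assumes ev: "kev = 0" and k2: "k4 D > 1" and x: "x \<in> Bset"
  shows "Mx x \<in> CC"
proof -
  have "mono x 0 \<in> CC" using k2 by (intro nontop_CC[OF ev x M_zero, of 1]) (simp_all add: ktot_def)
  then show ?thesis by (simp add: mono_def unit_right[OF hom_Mx])
qed

lemma other_index:
  assumes ev: "kev = 0" and k2: "k4 D > 1"
  obtains q where "q \<in> {1..k}" "q \<noteq> p"
proof -
  have "1 \<in> {1..k}" "2 \<in> {1..k}" using k2 by (simp_all add: ktot_def)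
  then show ?thesis using that[of 1] that[of 2] by (cases "p = 1") auto
qed

lemma dl_CC:
  assumes ev: "kev = 0" and k2: "k4 D > 1" and p: "p \<in> {1..k}"
  shows "dl p \<in> CC"
proof -
  obtain q where q: "q \<in> {1..k}" "q \<noteq> p" by (rule other_index[OF ev k2])
  show ?thesis by (rule kill_d[OF odd_range[OF ev q(1)] W_dl[OF p] cad_dl_dl[OF q(1) p]])
qed

lemma tt_dl_CC:
  assumes ev: "kev = 0" and k2: "k4 D > 1" and p: "p \<in> {1..k}" and q: "q \<in> {1..k}"
  shows "tt q * dl p \<in> CC"
proof -
  obtain r where r: "r \<in> {1..k}" "r \<noteq> p" by (rule other_index[OF ev k2])
  note r' = odd_range[OF ev r(1)] and q' = odd_range[OF ev q]
  have "cad (tcol D r) (tt r) (tt q * dl p) = 0"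
    using cad_tt_Mx_mult[OF r' un_B[OF q'] graded_ops_hom[OF hom_dl[OF p]]] cad_tt_dl_other[OF r' p] r(2) by simp
  then show ?thesis by (rule kill_t[OF r' W_Mx_left[OF W_dl[OF p]]])
qed

text \<open>As \<open>G = 0\<close>, only the second outcome of \<open>ideal_to_A\<close> is possible, and \<open>[t\<^sub>q \<partial>\<^sub>p, w] = t\<^sub>q\<close> lies in \<open>U\<close>. Bracketing \<open>t\<^sub>q\<close> with
  \<open>\<partial>\<^sub>q t\<^sub>p \<partial>\<^sub>p\<close>, which lies in \<open>Lset\<close> because a second index \<open>q\<close> exists, gives \<open>t\<^sub>p \<partial>\<^sub>p \<in> U\<close>. These operators act diagonally
  on the monomials, and together with the \<open>t\<^sub>p\<close> they put all of them except the top one into \<open>U\<close>.\<close>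
lemma weyl_simple_odd:
  assumes ev: "kev = 0" and k2: "k4 D > 1" and U: "color_ideal Lset U" and N: "Nset \<subseteq> U" "U \<noteq> Nset"
  shows "U = Lset"
proof -
  have CL: "T \<in> Lset" if "T \<in> CC" for T using that L_CC by blast
  have UW: "y \<in> Wset" if "y \<in> U" for y using that idealD(2)[OF U] L_W by blast
  have "(\<exists>a\<in>Grp D. a \<noteq> 0 \<and> Mx (a, 0) \<in> U) \<or>
    (\<exists>w p. w \<in> Aset \<and> w \<in> U \<and> p \<in> {k1 D + 1..k} \<and> homg (tcol D p) w \<and> cad (dcol p) (dl p) w = idop \<and>
      (\<forall>q\<in>{1..k}. cad (dcol q) (dl q) w \<in> Nset))"
    by (rule ideal_to_A[OF U L_W CL[OF Mx_CC[OF ev k2]] CL[OF dl_CC[OF ev k2]] N]) (use big_basis k2 in blast)+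
  moreover have "a = 0" if "a \<in> Grp D" for a using odd_fst[OF ev x_B[OF that]] by simp
  ultimately have "\<exists>w p. w \<in> Aset \<and> w \<in> U \<and> p \<in> {k1 D + 1..k} \<and> homg (tcol D p) w \<and> cad (dcol p) (dl p) w = idop \<and>
      (\<forall>q\<in>{1..k}. cad (dcol q) (dl q) w \<in> Nset)" by (elim disjE bexE conjE) simp_all
  then obtain w p where W: "w \<in> Aset \<and> w \<in> U \<and> p \<in> {k1 D + 1..k} \<and> homg (tcol D p) w \<and>
      cad (dcol p) (dl p) w = idop \<and> (\<forall>q\<in>{1..k}. cad (dcol q) (dl q) w \<in> Nset)" by (elim exE)
  have w: "w \<in> Aset" "w \<in> U" and p0: "p \<in> {k1 D + 1..k}"
    and pw: "cad (dcol p) (dl p) w = idop" using W by simp_all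
  note p = k_range[OF p0]
  note wg = W_graded[OF A_W[OF w(1)]]
  have tU: "tt q \<in> U" if q: "q \<in> {1..k}" for q
  proof -
    have y: "(0, un q) \<in> Bset" using un_B[OF odd_range[OF ev q]] .
    have "cad (xcol (0, un q) + dcol p) (tt q * dl p) w = tt q"
      unfolding cad_mult_left[OF hom_dl[OF p] wg] pw cad_Mx_A[OF y A_sig[OF w(1)]]
      by (simp add: unit_right[OF hom_Mx])
    moreover have "cad (xcol (0, un q) + dcol p) (tt q * dl p) w \<in> U"
      by (intro idealD(4)[OF U] CL tt_dl_CC[OF ev k2 p q] hom_mult hom_Mx hom_dl p w)
    ultimately show ?thesis by simp
  qed
  have h_hom: "homg (tcol D p + dcol p) (tt p * dl p)" if "p \<in> {1..k}" for p
    using that by (intro hom_mult hom_tt hom_dl odd_range[OF ev])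
  have hU: "tt p * dl p \<in> U" if p: "p \<in> {1..k}" for p
  proof -
    obtain q where q: "q \<in> {1..k}" "q \<noteq> p" by (rule other_index[OF ev k2])
    note p' = odd_range[OF ev p] and q' = odd_range[OF ev q(1)]
    let ?h = "tt p * dl p"
    have hW: "?h \<in> Wset" by (intro W_Mx_left W_dl p)
    have "cad (dcol q) (dl q) ?h = 0"
      using q(2) by (simp add: cad_mult[OF graded_ops_hom[OF hom_dl[OF p]]] cad_dl_tt[OF p' q(1)] cad_dl_dl[OF q(1) p])
    then have "cad (dcol q) (dl q) (dl q * ?h) = 0"
      by (simp add: cad_mult[OF W_graded[OF hW]] cad_dl_dl[OF q(1) q(1)])
    then have S: "dl q * ?h \<in> CC" by (rule kill_d[OF q' W_dl_left[OF hW q(1)]])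
    obtain c where c: "c \<noteq> 0" "cad (tcol D q) (tt q) (dl q) = c \<star> idop" using cad_tt_dl_self[OF q'] by blast
    have "cad (tcol D q) (tt q) ?h = 0"
      using cad_tt_Mx_mult[OF q' un_B[OF p'] graded_ops_hom[OF hom_dl[OF p]]] cad_tt_dl_other[OF q' p] q(2) by simp
    then have "cad (tcol D q) (tt q) (dl q * ?h) = c \<star> ?h"
      using graded_ops_unit(1)[OF W_graded[OF hW]] by (simp add: cad_mult[OF W_graded[OF hW]] c(2))
    moreover have "cad (tcol D q) (tt q) (dl q * ?h) \<in> U"
      by (rule ideal_skew_hom[OF U tU[OF q(1)] hom_tt[OF q'] CL[OF S] hom_mult[OF hom_dl[OF q(1)] h_hom[OF p]]])
    ultimately show ?thesis using ideal_smul_iff[OF U c(1)] by simp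
  qed
  \<comment> \<open>\<open>t\<^sub>p \<partial>\<^sub>p\<close> acts on a monomial by the difference of the \<open>p\<close>-th exponents of \<open>t\<close> and \<open>\<partial>\<close>.\<close>
  have cad_h: "cad (tcol D p + dcol p) (tt p * dl p) z =
      tt p * cad (dcol p) (dl p) z + eps D (dcol p) \<nu> \<star> (cad (tcol D p) (tt p) z * dl p)"
    if "p \<in> {1..k}" "homg \<nu> z" for p z \<nu>
    unfolding cad_mult_left[OF hom_dl[OF that(1)] graded_ops_hom[OF that(2)]] sig_hom[OF that(2)] cad_smul
    by simp
  \<comment> \<open>Monomials with \<open>t\<^sub>p\<close> but not \<open>\<partial>\<^sub>p\<close>, and with \<open>\<partial>\<^sub>p\<close> but not \<open>t\<^sub>p\<close>, are eigenvectors for nonzero eigenvalues.\<close>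
  have zA: "mono x \<mu> \<in> U" if x: "x \<in> Bset" and \<mu>: "\<mu> \<in> Mset D" and p: "p \<in> {1..k}"
      and xp: "snd x p > 0" and \<mu>p: "\<mu> p = 0" for x \<mu> p
  proof -
    note p' = odd_range[OF ev p]
    have "cad (tcol D p + dcol p) (tt p * dl p) (mono x \<mu>) =
        (tau p x * of_nat (snd x p)) \<star> (tt p * mono (down p x) \<mu>)"
      unfolding cad_h[OF p hom_mono] cad_tt_mono[where \<mu> = \<mu>, OF p' x \<mu>p] cad_dl_mono[OF p x odd_fst[OF ev x]] by simp
    also have "tt p * mono (down p x) \<mu> = mult_coeff D (0, un p) (down p x) \<star> mono x \<mu>"
      unfolding mono_def mult.assoc[symmetric] Mx_mult[OF un_B[OF p'] B_down[OF x]]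
      by (simp only: add.commute[of "(0, un p)"] down_un[OF xp, symmetric] smul_mult_left)
    finally have e: "cad (tcol D p + dcol p) (tt p * dl p) (mono x \<mu>) =
      (tau p x * of_nat (snd x p) * mult_coeff D (0, un p) (down p x)) \<star> mono x \<mu>" by (simp only: ops.scale_scale)
    have nz: "tau p x * of_nat (snd x p) * mult_coeff D (0, un p) (down p x) \<noteq> 0"
      using xp mult_coeff_nonzero[OF un_B[OF p'] B_down[OF x, of p]] by simp
    have "mono x \<mu> \<in> Lset" using nontop_CC[OF ev x \<mu> p] \<mu>p by (intro CL) simp
    from ideal_skew_hom[OF U hU[OF p] h_hom[OF p] this hom_mono] show ?thesis
      unfolding e using ideal_smul_iff[OF U nz] by simp
  qed
  have zB: "mono x \<mu> \<in> U" if x: "x \<in> Bset" and \<mu>: "\<mu> \<in> Mset D" and p: "p \<in> {1..k}"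
      and xp: "snd x p = 0" and \<mu>p: "\<mu> p = 1" for x \<mu> p
  proof -
    note p' = odd_range[OF ev p]
    let ?\<nu> = "dpow (\<mu>(p := 0))"
    have \<nu>g: "?\<nu> \<in> graded_ops" by (rule graded_ops_hom[OF hom_dpow])
    have "(\<mu>(p := 0))(p := Suc ((\<mu>(p := 0)) p)) = \<mu>" using \<mu>p by (simp add: fun_eq_iff)
    then obtain c where c: "c \<noteq> 0" "dl p * ?\<nu> = c \<star> dpow \<mu>" using dl_dpow[OF p, of "\<mu>(p := 0)"] by metis
    obtain d where d: "d \<noteq> 0" "cad (tcol D p) (tt p) (dl p) = d \<star> idop" using cad_tt_dl_self[OF p'] by blast
    obtain \<rho> where \<rho>: "homg \<rho> ?\<nu>" using hom_dpow by blast
    have "cad (tcol D p) (tt p) (dl p * ?\<nu>) = d \<star> ?\<nu>"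
      using graded_ops_unit(1)[OF \<nu>g] cad_tt_dpow[OF p', of "\<mu>(p := 0)"] by (simp add: cad_mult[OF \<nu>g] d(2))
    then have "c \<star> cad (tcol D p) (tt p) (dpow \<mu>) = d \<star> ?\<nu>" by (simp add: c(2) cad_smul)
    then have "inverse c \<star> (c \<star> cad (tcol D p) (tt p) (dpow \<mu>)) = inverse c \<star> (d \<star> ?\<nu>)" by simp
    then have td: "cad (tcol D p) (tt p) (dpow \<mu>) = (inverse c * d) \<star> ?\<nu>" using c(1) by simp
    have "dl p * ?\<nu> = eps D (dcol p) \<rho> \<star> (?\<nu> * dl p)"
      using cad_dl_dpow[OF p, of "\<mu>(p := 0)"] by (simp add: cad_hom[OF \<rho>])
    then have "eps D (dcol p) \<rho> \<star> (?\<nu> * dl p) = c \<star> dpow \<mu>" using c(2) by simp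
    then have "inverse (eps D (dcol p) \<rho>) \<star> (eps D (dcol p) \<rho> \<star> (?\<nu> * dl p)) = inverse (eps D (dcol p) \<rho>) \<star> (c \<star> dpow \<mu>)"
      by simp
    then have nd: "?\<nu> * dl p = (inverse (eps D (dcol p) \<rho>) * c) \<star> dpow \<mu>" using eps_nonzero by simp
    have 1: "cad (dcol p) (dl p) (mono x \<mu>) = 0" by (simp add: cad_dl_mono[OF p x odd_fst[OF ev x]] xp)
    have 2: "cad (tcol D p) (tt p) (mono x \<mu>) * dl p =
        (eps D (tcol D p) (xcol x) * (inverse c * d) * (inverse (eps D (dcol p) \<rho>) * c)) \<star> mono x \<mu>"
      unfolding mono_def cad_tt_Mx_mult[OF p' x graded_ops_hom[OF hom_dpow]] td
      by (simp add: mult.assoc nd)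
    have e: "cad (tcol D p + dcol p) (tt p * dl p) (mono x \<mu>) =
      (eps D (dcol p) (mcol x \<mu>) * (eps D (tcol D p) (xcol x) * (inverse c * d) * (inverse (eps D (dcol p) \<rho>) * c))) \<star> mono x \<mu>"
      unfolding cad_h[OF p hom_mono] 1 2 by simp
    have nz: "eps D (dcol p) (mcol x \<mu>) * (eps D (tcol D p) (xcol x) * (inverse c * d) * (inverse (eps D (dcol p) \<rho>) * c)) \<noteq> 0"
      using c d eps_nonzero by simp
    have "mono x \<mu> \<in> Lset" using nontop_CC[OF ev x \<mu> p] xp by (intro CL) simp
    from ideal_skew_hom[OF U hU[OF p] h_hom[OF p] this hom_mono] show ?thesis
      unfolding e using ideal_smul_iff[OF U nz] by simp
  qed
  \<comment> \<open>A monomial with neither is the bracket of \<open>t\<^sub>p\<close> with one of the second kind.\<close>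
  have zC: "mono x \<mu> \<in> U" if x: "x \<in> Bset" and \<mu>: "\<mu> \<in> Mset D" and p: "p \<in> {1..k}"
      and xp: "snd x p = 0" and \<mu>p: "\<mu> p = 0" for x \<mu> p
  proof -
    note p' = odd_range[OF ev p]
    have \<mu>1: "\<mu>(p := Suc (\<mu> p)) \<in> Mset D" using \<mu>p by (intro M_upd[OF \<mu> p]) simp
    obtain c where c: "c \<noteq> 0" "dl p * dpow \<mu> = c \<star> dpow (\<mu>(p := Suc (\<mu> p)))" using dl_dpow[OF p] by blast
    obtain d where d: "d \<noteq> 0" "cad (tcol D p) (tt p) (dl p) = d \<star> idop" using cad_tt_dl_self[OF p'] by blast
    have dg: "dpow \<mu> \<in> graded_ops" "dl p * dpow \<mu> \<in> graded_ops"
      by (rule graded_ops_hom[OF hom_dpow], rule graded_ops_hom[OF hom_mult[OF hom_dl[OF p] hom_dpow]])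
    have "mono x (\<mu>(p := Suc (\<mu> p))) \<in> U" using zB[OF x \<mu>1 p xp] \<mu>p by simp
    then have "Mx x * (dl p * dpow \<mu>) \<in> U" unfolding c(2) using ideal_smul[OF U] by (simp add: mono_def)
    then have "cad (tcol D p) (tt p) (Mx x * (dl p * dpow \<mu>)) \<in> U"
      by (intro idealD(4)[OF U] hom_tt p' CL Mx_CC[OF ev k2] un_B)
    moreover have "cad (tcol D p) (tt p) (Mx x * (dl p * dpow \<mu>)) = (eps D (tcol D p) (xcol x) * d) \<star> mono x \<mu>"
      unfolding cad_tt_Mx_mult[OF p' x dg(2)] cad_mult[OF dg(1)] d(2) cad_tt_dpow[where \<mu> = \<mu>, OF p' \<mu>p]
      using graded_ops_unit(1)[OF dg(1)] by (simp add: mono_def)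
    moreover have "eps D (tcol D p) (xcol x) * d \<noteq> 0" using d eps_nonzero by simp
    ultimately show ?thesis using ideal_smul_iff[OF U] by metis
  qed
  have mU: "mono x \<mu> \<in> U" if x: "x \<in> Bset" and \<mu>: "\<mu> \<in> Mset D" and p: "p \<in> {1..k}"
      and c: "snd x p = 0 \<or> \<mu> p = 0" for x \<mu> p
  proof -
    have "\<mu> p \<le> 1" using \<mu> p ev by (simp add: Mset_def)
    then show ?thesis
      using c zA[OF x \<mu> p] zB[OF x \<mu> p] zC[OF x \<mu> p] by (cases "\<mu> p = 0"; cases "snd x p = 0") auto
  qed
  have split: "\<exists>S\<in>U. \<exists>r. T = S + r \<star> topm" if "T \<in> Wset" for T
    by (rule W_top_split[OF ev idealD(1)[OF U] mU that])
  \<comment> \<open>The top monomial, should it lie in \<open>Lset\<close>, is no obstacle: \<open>Lset\<close> is generated by brackets, and the bracket of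
    the top monomial, which has color \<open>0\<close>, with itself vanishes.\<close>
  have "Lset \<subseteq> U"
  proof (cases "topm \<in> Lset")
    case False
    show ?thesis
    proof
      fix T assume T: "T \<in> Lset"
      then obtain S r where S: "S \<in> U" "T = S + r \<star> topm" using split L_W by blast
      have "T - S \<in> Lset" using T S(1) idealD(2)[OF U] by (intro L_diff) blast+
      then have "r \<star> topm \<in> Lset" using S(2) by simp
      then have "inverse r \<star> (r \<star> topm) \<in> Lset" by (rule L_smul)
      then have "r = 0" using False by (cases "r = 0") simp_all
      then show "T \<in> U" using S by simp
    qed
  next
    case True
    have WL: "T \<in> Lset" if "T \<in> Wset" for T
      using split[OF that] True idealD(2)[OF U] by (auto intro!: L_add L_smul)
    have "cad \<kappa> S T \<in> U" if S: "S \<in> Wset" "homg \<kappa> S" and T: "T \<in> Wset" for \<kappa> S T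
    proof -
      obtain u r where u: "u \<in> U" "S = u + r \<star> topm" using split[OF S(1)] by blast
      obtain u' r' where u': "u' \<in> U" "T = u' + r' \<star> topm" using split[OF T] by blast
      have "S = cpt \<kappa> u + r \<star> cpt \<kappa> topm"
        using S(2) u(2) by (simp add: hom_iff_comp comp_add comp_smul)
      then have "cad \<kappa> S topm = cad \<kappa> (cpt \<kappa> u) topm + r \<star> cad \<kappa> (cpt \<kappa> topm) topm"
        by (simp add: cad_add_left cad_smul_left)
      moreover have "cad \<kappa> (cpt \<kappa> topm) topm = 0"
        by (cases "\<kappa> = 0") (simp_all add: comp_hom[OF topm_hom] cad_hom[OF topm_hom])
      moreover have "cad \<kappa> (cpt \<kappa> u) topm \<in> U"
        by (rule ideal_skew_hom[OF U idealD(3)[OF U u(1)] hom_comp True topm_hom])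
      ultimately have "cad \<kappa> S topm \<in> U" by simp
      moreover have "cad \<kappa> S u' \<in> U" by (rule idealD(4)[OF U WL[OF S(1)] S(2) u'(1)])
      ultimately show ?thesis
        unfolding u'(2) by (simp add: cad_add cad_smul ideal_add[OF U] ideal_smul[OF U])
    qed
    then have "CC \<subseteq> U" unfolding CC_def by (intro ops.span_minimal[OF _ idealD(1)[OF U]]) blast
    then show ?thesis unfolding Lset_def using N(1) by (intro ops.span_minimal[OF _ idealD(1)[OF U]]) blast
  qed
  then show ?thesis using idealD(2)[OF U] by blast
qed

text \<open>Witnesses: \<open>[\<partial>\<^sub>1, x\<^sup>b] = b\<^sub>1 x\<^sup>b\<close> if \<open>G \<noteq> 0\<close>, and otherwise \<open>[\<partial>\<^sub>1, t\<^sub>1 \<partial>\<^sub>q]\<close>, a multiple of \<open>\<partial>\<^sub>q\<close>; the index \<open>q = 2\<close> keeps both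
  arguments in \<open>Lset\<close> if all indices are odd.\<close>
lemma weyl_nonabelian:
  assumes "kev > 0 \<or> k4 D > 1"
  shows "\<exists>\<kappa> S T \<mu>. S \<in> Lset \<and> homg \<kappa> S \<and> T \<in> Lset \<and> homg \<mu> T \<and> cad \<kappa> S T \<notin> Nset"
proof (cases "k1 D + k2 D > 0")
  case True
  then obtain b where b: "b \<in> Grp D" "b 1 \<noteq> 0" using G_nonzero_at[of 1] by auto
  have p: "1 \<in> {1..k}" using k_pos by simp
  have ne: "(b, 0) \<noteq> (0 :: 'f expo)" using b(2) by (auto simp: zero_prod_def)
  have "b 1 \<star> Mx (b, 0) \<notin> Nset"
    using N_Mx[OF x_B[OF b(1)] ne] ops.subspace_scale[OF N_subspace, of "b 1 \<star> Mx (b, 0)" "inverse (b 1)"] b(2) by auto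
  then have "cad (dcol 1) (dl 1) (Mx (b, 0)) \<notin> Nset" unfolding cad_dl_x[OF b(1) p] .
  moreover have "Lset = Wset" using True by (intro L_eq_W) simp
  then have "dl 1 \<in> Lset" "Mx (b, 0) \<in> Lset" using W_dl[OF p] by simp_all
  ultimately show ?thesis using hom_dl[OF p] hom_Mx by blast
next
  case False
  have p: "1 \<in> {1..k}" using assms False by (auto simp: ktot_def)
  then have p': "1 \<in> {k1 D + 1..k}" using False by simp
  define q :: nat where "q = (if kev > 0 then 1 else 2)"
  have q: "q \<in> {1..k}" using assms p by (auto simp: q_def ktot_def)
  have L: "dl 1 \<in> Lset" "tt 1 * dl q \<in> Lset"
  proof -
    show "dl 1 \<in> Lset"
      using L_eq_W W_dl[OF p] dl_CC[OF _ _ p] assms L_CC by (cases "kev > 0") auto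
    show "tt 1 * dl q \<in> Lset"
      using L_eq_W W_Mx_left[OF W_dl[OF q]] tt_dl_CC[OF _ _ q p] assms L_CC by (cases "kev > 0") auto
  qed
  have "cad (dcol 1) (dl 1) (tt 1 * dl q) = tau 1 (0, un 1) \<star> dl q"
    using unit_left[OF hom_dl[OF q]]
    by (simp only: cad_mult[OF graded_ops_hom[OF hom_dl[OF q]]] cad_dl_tt[OF p' p] cad_dl_dl[OF p q]) simp
  moreover have "tau 1 (0, un 1) \<star> dl q \<notin> Nset"
  proof
    assume "tau 1 (0, un 1) \<star> dl q \<in> Nset"
    then obtain c where c: "tau 1 (0, un 1) \<star> dl q = c \<star> idop" by (auto simp: N_iff)
    have q': "q \<in> {k1 D + 1..k}" using q False by simp
    have "cad (tcol D q) (tt q) (tau 1 (0, un 1) \<star> dl q) = 0"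
      unfolding c by (simp add: cad_smul cad_unit[OF hom_tt[OF q']])
    moreover obtain d where "d \<noteq> 0" "cad (tcol D q) (tt q) (dl q) = d \<star> idop" using cad_tt_dl_self[OF q'] by blast
    ultimately show False using idop_nonzero by (simp add: cad_smul)
  qed
  ultimately have "cad (dcol 1) (dl 1) (tt 1 * dl q) \<notin> Nset" by simp
  then show ?thesis
    using L hom_dl[OF p] hom_mult[OF hom_tt[OF p'] hom_dl[OF q]]
    by (intro exI[of _ "dcol 1"] exI[of _ "dl 1"] exI[of _ "tt 1 * dl q"] exI[of _ "tcol D 1 + dcol q"] conjI)
qed

end

section \<open>The Witt algebra\<close>

context weyl_char0
begin

text \<open>The Witt algebra \<open>\<A> \<otimes> \<D>\<close>, as a space of operators.\<close>
definition WT :: "('f expo, 'f) lop set" where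
  "WT = ops.span {Mx x * dl p |x p. x \<in> Bset \<and> p \<in> {1..k}}"

lemma WT_gen: "x \<in> Bset \<Longrightarrow> p \<in> {1..k} \<Longrightarrow> Mx x * dl p \<in> WT"
  unfolding WT_def by (rule ops.span_base) blast

lemma WT_add: "S \<in> WT \<Longrightarrow> T \<in> WT \<Longrightarrow> S + T \<in> WT" by (simp add: WT_def ops.span_add)
lemma WT_smul: "T \<in> WT \<Longrightarrow> r \<star> T \<in> WT" by (simp add: WT_def ops.span_scale)
lemma WT_zero [simp]: "0 \<in> WT" by (simp add: WT_def ops.span_zero)
lemma WT_subspace: "ops.subspace WT" by (simp add: WT_def)

lemma WT_W: "WT \<subseteq> Wset"
proof -
  have "{Mx x * dl p |x p. x \<in> Bset \<and> p \<in> {1..k}} \<subseteq> Wset"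
    using W_Mx_left[OF W_dl] by blast
  then show ?thesis unfolding WT_def by (rule ops.span_minimal[OF _ W_subspace])
qed

lemma hom_Mx_dl: "p \<in> {1..k} \<Longrightarrow> homg (xcol x + dcol p) (Mx x * dl p)"
  by (rule hom_mult[OF hom_Mx hom_dl])

lemma WT_induct [consumes 1, case_names zero step]:
  assumes "T \<in> WT" "P 0"
    "\<And>r x p T. x \<in> Bset \<Longrightarrow> p \<in> {1..k} \<Longrightarrow> T \<in> WT \<Longrightarrow> P T \<Longrightarrow> P (r \<star> (Mx x * dl p) + T)"
  shows "P T"
proof -
  have "P T \<and> T \<in> WT"
    using assms(1) unfolding WT_def
  proof (induction T rule: ops.span_induct_alt)
    case base
    then show ?case using assms(2) by (simp only: ops.span_zero simp_thms)
  next
    case (step c S T)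
    then obtain x p where x: "S = Mx x * dl p" "x \<in> Bset" "p \<in> {1..k}" by blast
    have T: "P T" "T \<in> WT" using step(2) unfolding WT_def by blast+
    have "P (c \<star> S + T)" unfolding x(1) by (rule assms(3)[OF x(2,3) T(2,1)])
    moreover have "c \<star> S + T \<in> WT" unfolding x(1) by (intro WT_add WT_smul WT_gen x T)
    ultimately show ?case unfolding WT_def by (rule conjI)
  qed
  then show ?thesis ..
qed

lemma A_dl_WT: "u \<in> Aset \<Longrightarrow> p \<in> {1..k} \<Longrightarrow> u * dl p \<in> WT"
  by (induction u rule: A_induct) (simp_all add: distrib_right WT_add WT_smul WT_gen)

lemma WT_comp: "T \<in> WT \<Longrightarrow> cpt \<kappa> T \<in> WT"
proof (induction T rule: WT_induct)
  case (step r x p T)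
  have "cpt \<kappa> (Mx x * dl p) = (if \<kappa> = xcol x + dcol p then Mx x * dl p else 0)"
    by (rule comp_hom[OF hom_Mx_dl[OF step(2)]])
  then have "cpt \<kappa> (Mx x * dl p) \<in> WT" using WT_gen[OF step(1,2)] by (cases "\<kappa> = xcol x + dcol p") simp_all
  then show ?case using step by (simp add: comp_add comp_smul WT_add WT_smul)
qed simp

text \<open>The second-order terms of \<open>[x \<partial>\<^sub>p, y \<partial>\<^sub>q]\<close> cancel.\<close>
lemma cad_Mx_dl_Mx_dl:
  assumes x: "x \<in> Bset" and p: "p \<in> {1..k}" and y: "y \<in> Bset" and q: "q \<in> {1..k}"
  shows "cad (xcol x + dcol p) (Mx x * dl p) (Mx y * dl q) = Mx x * cad (dcol p) (dl p) (Mx y) * dl q +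
    (eps D (dcol p) (xcol y + dcol q) * eps D (xcol x) (xcol y)) \<star> (Mx y * cad (xcol x) (Mx x) (dl q) * dl p)"
proof -
  note dg = graded_ops_hom[OF hom_dl[OF q]]
  have T: "Mx y * dl q \<in> graded_ops" by (rule graded_ops_hom[OF hom_Mx_dl[OF q]])
  have 1: "cad (dcol p) (dl p) (Mx y * dl q) = cad (dcol p) (dl p) (Mx y) * dl q"
    by (simp add: cad_mult[OF dg] cad_dl_dl[OF p q])
  have 2: "cad (xcol x) (Mx x) (Mx y * dl q) = eps D (xcol x) (xcol y) \<star> (Mx y * cad (xcol x) (Mx x) (dl q))"
    by (simp add: cad_mult[OF dg] cad_Mx_Mx[OF x y] sig_hom[OF hom_Mx])
  show ?thesis
    unfolding cad_mult_left[OF hom_dl[OF p] T] sig_hom[OF hom_Mx_dl[OF q]] cad_smul 1 2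
    by (simp add: mult.assoc)
qed

lemma WT_cad: "S \<in> WT \<Longrightarrow> homg \<kappa> S \<Longrightarrow> T \<in> WT \<Longrightarrow> cad \<kappa> S T \<in> WT"
proof -
  assume S: "S \<in> WT" "homg \<kappa> S" and T: "T \<in> WT"
  have gen: "cad (xcol x + dcol p) (Mx x * dl p) T \<in> WT" if x: "x \<in> Bset" and p: "p \<in> {1..k}" for x p
    using T
  proof (induction T rule: WT_induct)
    case (step r y q T)
    have a: "Mx x * cad (dcol p) (dl p) (Mx y) \<in> Aset" by (intro A_mult A_cad_dl A_Mx p)
    have b: "Mx y * cad (xcol x) (Mx x) (dl q) \<in> Aset"
      unfolding cad_Mx_dl[OF x step(2)] by (intro A_mult A_smul A_cad_dl A_Mx step(2))
    have "cad (xcol x + dcol p) (Mx x * dl p) (Mx y * dl q) \<in> WT"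
      unfolding cad_Mx_dl_Mx_dl[OF x p step(1,2)]
      by (intro WT_add WT_smul A_dl_WT a b p step(2))
    then show ?case using step by (simp only: cad_add cad_smul WT_add WT_smul)
  qed simp
  have "cad \<kappa> (cpt \<kappa> S) T \<in> WT"
    using S(1)
  proof (induction S rule: WT_induct)
    case (step r x p S)
    have "cpt \<kappa> (Mx x * dl p) = (if \<kappa> = xcol x + dcol p then Mx x * dl p else 0)"
      by (rule comp_hom[OF hom_Mx_dl[OF step(2)]])
    then have "cad \<kappa> (cpt \<kappa> (Mx x * dl p)) T \<in> WT"
      using gen[OF step(1,2)] by (cases "\<kappa> = xcol x + dcol p") simp_all
    then show ?case using step by (simp only: comp_add comp_smul cad_add_left cad_smul_left WT_add WT_smul)
  qed simp
  then show "cad \<kappa> S T \<in> WT" using S(2) by (simp only: hom_iff_comp)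
qed

lemma WT_repr: "T \<in> WT \<Longrightarrow> \<exists>u. (\<forall>q. u q \<in> Aset) \<and> T = (\<Sum>q = 1..k. u q * dl q)"
proof (induction T rule: WT_induct)
  case zero
  then show ?case by (intro exI[of _ "\<lambda>_. 0"]) simp
next
  case (step r x p T)
  then obtain u where u: "\<forall>q. u q \<in> Aset" "T = (\<Sum>q = 1..k. u q * dl q)" by blast
  have e: "(\<Sum>q = 1..k. (if q = p then r \<star> Mx x else 0) * dl q) = r \<star> (Mx x * dl p)"
  proof -
    have "(\<Sum>q = 1..k. (if q = p then r \<star> Mx x else 0) * dl q) = (\<Sum>q = 1..k. if q = p then r \<star> (Mx x * dl q) else 0)"
      by (intro sum.cong) auto
    then show ?thesis using step(2) by simp
  qed
  show ?case
  proof (intro exI conjI)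
    show "\<forall>q. (if q = p then r \<star> Mx x else 0) + u q \<in> Aset"
    proof
      fix q show "(if q = p then r \<star> Mx x else 0) + u q \<in> Aset"
        using A_add[OF A_smul[OF A_Mx[of x], of r] u(1)[rule_format, of q]] u(1)[rule_format, of q]
        by (cases "q = p") (simp_all only: if_True if_False add_0_left simp_thms)
    qed
    show "r \<star> (Mx x * dl p) + T = (\<Sum>q = 1..k. ((if q = p then r \<star> Mx x else 0) + u q) * dl q)"
      by (simp only: distrib_right sum.distrib e u(2))
  qed
qed

lemma app_dl_un_vac:
  assumes p: "p \<in> {k1 D + 1..k}" and q: "q \<in> {1..k}"
  shows "app (dl q) (bvec (0, un p)) = scale (if q = p then tau p (0, un p) else 0) vac"
proof -
  have "app (cad (dcol q) (dl q) (tt p)) vac = app (dl q) (app (tt p) vac)"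
    by (rule app_cad_dl_vac[OF A_Mx])
  then have "app (dl q) (bvec (0, un p)) = app ((if q = p then tau p (0, un p) else 0) \<star> idop) vac"
    unfolding app_Mx_vac[OF un_B[OF p]] cad_dl_tt[OF p q] by simp
  moreover have "app idop vac = vac" using app_Q[OF B_zero, of 0] by (simp only: idop_def xcol_zero eps_zero_left free_space.scale_one)
  ultimately show ?thesis by (simp only: app_smul)
qed

text \<open>The derivations \<open>\<partial>\<^sub>p\<close> are independent over \<open>\<A>\<close>: those with a variable \<open>t\<^sub>p\<close> of their own are detected
  by it, the others by the characters \<open>x\<^sup>b\<close>, because \<open>G\<close> spans.\<close>
lemma dl_independent:
  assumes w: "\<And>q. w q \<in> Aset" and z: "(\<Sum>q = 1..k. w q * dl q) = 0" and p: "p \<in> {1..k}"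
  shows "w p = 0"
proof -
  have hi: "w q = 0" if q: "q \<in> {k1 D + 1..k}" for q
  proof -
    have "app (\<Sum>r = 1..k. w r * dl r) (bvec (0, un q)) = (\<Sum>r = 1..k. if r = q then app (w r) (scale (tau q (0, un q)) vac) else 0)"
      unfolding app_sum_left app_times
      by (rule sum.cong[OF refl]) (simp only: app_dl_un_vac[OF q] app_scale if_distrib free_space.scale_zero_left split: if_split, simp)
    also have "\<dots> = scale (tau q (0, un q)) (app (w q) vac)" using q by (simp only: app_scale) simp
    finally have "scale (tau q (0, un q)) (app (w q) vac) = 0" using z by simp
    then have "app (w q) vac = app 0 vac" by simp
    from A_eqI[OF w A_zero this] show ?thesis .
  qed
  show ?thesis
  proof (cases "p \<le> k1 D + k2 D")
    case False
    then show ?thesis using hi p by simp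
  next
    case True
    show ?thesis
    proof (rule G_separates)
      show "p \<in> {1..k1 D + k2 D}" using True p by simp
      fix b assume b: "b \<in> Grp D"
      have dlb: "app (dl r) (bvec (b, 0)) = scale (b r) (bvec (b, 0))" for r
        using app_dl[OF x_B[OF b], of r] by simp
      let ?u = "\<Sum>q = 1..k1 D + k2 D. b q \<star> w q"
      have A: "?u \<in> Aset" unfolding Aset_def using w unfolding Aset_def by (intro ops.span_sum ops.span_scale) 
      have "app ?u (bvec (b, 0)) = (\<Sum>q = 1..k1 D + k2 D. app (w q * dl q) (bvec (b, 0)))"
        by (simp add: app_sum_left dlb app_scale)
      also have "\<dots> = (\<Sum>q = 1..k. app (w q * dl q) (bvec (b, 0)))"
      proof (rule sum.mono_neutral_left)
        show "\<forall>i\<in>{1..k} - {1..k1 D + k2 D}. app (w i * dl i) (bvec (b, 0)) = 0"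
          using hi by auto
      qed (auto simp: ktot_def)
      also have "\<dots> = app (\<Sum>q = 1..k. w q * dl q) (bvec (b, 0))" by (simp only: app_sum_left)
      also have "\<dots> = 0" unfolding z by simp
      finally have "app ?u (bvec (b, 0)) = 0" .
      then have "app (?u * Mx (b, 0)) vac = app 0 vac" by (simp add: app_Mx_vac[OF x_B[OF b]])
      then have m: "?u * Mx (b, 0) = 0" by (intro A_eqI A_mult A A_Mx A_zero)
      obtain c where c: "c \<noteq> 0" "Mx (b, 0) * Mx (- b, 0) = c \<star> idop"
        using Mx_inverse[OF G_uminus[OF b]] by auto
      have "c \<star> ?u = ?u * (Mx (b, 0) * Mx (- b, 0))"
        unfolding c(2) using graded_ops_unit(2)[OF W_graded[OF A_W[OF A]]] by simp
      also have "\<dots> = 0" unfolding mult.assoc[symmetric] m by simp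
      finally show "?u = 0" using c(1) by simp
    qed
  qed
qed

lemma wt_mult_dl:
  assumes "p \<in> {1..k}" "q \<in> {1..k}"
  shows "wt p a (u * dl q) = wt p a u * dl q"
  by (simp add: wt_def cad_mult[OF graded_ops_hom[OF hom_dl[OF assms(2)]]] cad_dl_dl[OF assms] left_diff_distrib)

lemma wt_sum: "wt p a (\<Sum>x\<in>S. g x) = (\<Sum>x\<in>S. wt p a (g x))"
  by (induction S rule: infinite_finite_induct) (simp_all add: wt_add)

lemma A_wt: "u \<in> Aset \<Longrightarrow> p \<in> {1..k} \<Longrightarrow> wt p a u \<in> Aset"
  by (simp add: wt_def A_diff A_smul A_cad_dl)

text \<open>By independence of the \<open>\<partial>\<^sub>q\<close> over \<open>\<A>\<close>, each coefficient of \<open>v\<close> is a weight vector of weight \<open>a\<close> in \<open>\<A>\<close>.\<close>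
lemma WT_weight_vector:
  assumes v: "v \<in> WT" and a: "a \<in> Grp D" and wt: "\<And>p. p \<in> {1..k} \<Longrightarrow> wt p a v = 0"
  shows "\<exists>c. v = Mx (a, 0) * (\<Sum>q = 1..k. c q \<star> dl q)"
proof -
  obtain u where u: "\<forall>q. u q \<in> Aset" "v = (\<Sum>q = 1..k. u q * dl q)" using WT_repr[OF v] by blast
  have "\<exists>c. u q = c \<star> Mx (a, 0)" if q: "q \<in> {1..k}" for q
  proof (rule wt_zero_weight[OF _ a])
    show "u q \<in> Aset" using u(1) by blast
    fix p assume p: "p \<in> {1..k}"
    have "(\<Sum>q = 1..k. wt p a (u q) * dl q) = wt p a v"
      unfolding u(2) wt_sum by (intro sum.cong refl) (simp only: wt_mult_dl[OF p])
    then have "(\<Sum>q = 1..k. wt p a (u q) * dl q) = 0" using wt[OF p] by simp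
    from dl_independent[OF A_wt[OF u(1)[rule_format] p] this q] show "wt p a (u q) = 0" .
  qed
  then obtain c where c: "\<And>q. q \<in> {1..k} \<Longrightarrow> u q = c q \<star> Mx (a, 0)" by metis
  have "v = (\<Sum>q = 1..k. Mx (a, 0) * (c q \<star> dl q))"
    unfolding u(2) by (intro sum.cong refl) (simp add: c)
  then have "v = Mx (a, 0) * (\<Sum>q = 1..k. c q \<star> dl q)" by (simp only: sum_distrib_left)
  then show ?thesis by blast
qed

text \<open>For opposite weights the bracket of \<open>x\<^sup>-\<^sup>b \<partial>\<^sub>p\<close> and \<open>x\<^sup>b t\<^sup>i \<partial>\<^sub>r\<close> is symmetric in \<open>p\<close> and \<open>r\<close>.\<close>
lemma opposite_weights:
  assumes b: "b \<in> Grp D" and y: "y \<in> Bset" "fst y = b" and p: "p \<in> {1..k}" "tcol D p = 0" "snd y p = 0"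
    and r: "r \<in> {1..k}"
  shows "cad (xcol (- b, 0) + dcol p) (Mx (- b, 0) * dl p) (Mx y * dl r) =
    Mx (- b, 0) * Mx y * (b p \<star> dl r + b r \<star> dl p)"
proof -
  note b' = x_B[OF G_uminus[OF b]]
  have 1: "cad (dcol p) (dl p) (Mx y) = b p \<star> Mx y"
    using cad_dl_Mx[OF p(1) y(1)] y(2) p(3) by simp
  have 2: "cad (xcol (- b, 0)) (Mx (- b, 0)) (dl r) = b r \<star> Mx (- b, 0)"
  proof -
    have "cad (xcol (- b, 0)) (Mx (- b, 0)) (dl r) = (eps D (xcol (- b, 0)) (dcol r) * b r) \<star> Mx (- b, 0)"
      unfolding cad_Mx_dl[OF b' r] cad_dl_x[OF G_uminus[OF b] r] by simp
    moreover have "eps D (xcol (- b, 0)) (dcol r) * b r = b r"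
      using tcol_G[OF b, of r] by (cases "b r = 0") simp_all
    ultimately show ?thesis by simp
  qed
  have 3: "Mx (- b, 0) * Mx y = eps D (xcol (- b, 0)) (xcol y) \<star> (Mx y * Mx (- b, 0))"
    by (rule Mx_comm[OF b' y(1)])
  have e: "eps D (dcol p) (xcol y + dcol r) = 1" using p(2) by simp
  show ?thesis
    unfolding cad_Mx_dl_Mx_dl[OF b' p(1) y(1) r] 1 2 e mult_1_left distrib_left
    by (simp add: 3 mult.commute)
qed

text \<open>The weight filtration gives \<open>x\<^sup>a \<delta>\<close> in \<open>U\<close>. The bracket with \<open>x\<^bsup>-a\<^esup> \<partial>\<^sub>p\<close> is a multiple of \<open>a\<^sub>p \<delta> + \<delta>(a) \<partial>\<^sub>p\<close>. If \<open>\<delta>(a) = 0\<close>,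
  a \<open>p\<close> with \<open>a\<^sub>p \<noteq> 0\<close> gives \<open>\<delta>\<close>; otherwise the combination of these elements with the coefficients of \<open>\<delta>\<close> is \<open>2 \<delta>(a) \<delta>\<close>.\<close>
lemma WT_ideal_nonzero_derivation:
  assumes U: "color_ideal WT U" and U0: "U \<noteq> {0}"
  obtains c \<kappa> where "homg \<kappa> (\<Sum>q = 1..k. c q \<star> dl q)" "(\<Sum>q = 1..k. c q \<star> dl q) \<in> U" "\<exists>q\<in>{1..k}. c q \<noteq> 0"
    "\<And>q. q \<in> {1..k} \<Longrightarrow> c q \<noteq> 0 \<Longrightarrow> dcol q = \<kappa>"
proof -
  have "0 \<in> U" using ops.subspace_0[OF idealD(1)[OF U]] .
  then obtain T where T: "T \<in> U" "T \<noteq> 0" using U0 by blast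
  have dWT: "dl p \<in> WT" if "p \<in> {1..k}" for p
    using WT_gen[OF B_zero that] unit_left[OF hom_dl[OF that]] by (simp add: Mx_zero)
  have "\<exists>v\<in>U. v \<notin> {0} \<and> (\<exists>a\<in>Grp D. \<forall>p\<in>{1..k}. wt p a v \<in> {0})"
  proof (rule weight_reduction[of T])
    show "T \<in> Wset" using T(1) idealD(2)[OF U] WT_W by blast
    show "wt p a S \<in> U" if "p \<in> {1..k}" "a \<in> Grp D" "S \<in> U" for p a S
      unfolding wt_def by (intro ideal_diff[OF U] ideal_smul[OF U] idealD(4)[OF U] dWT hom_dl that)
  qed (use T in simp_all)
  then obtain v a where v: "v \<in> U" "v \<noteq> 0" and a: "a \<in> Grp D" and wt: "\<And>p. p \<in> {1..k} \<Longrightarrow> wt p a v = 0"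
    by auto
  obtain c0 where c0: "v = Mx (a, 0) * (\<Sum>q = 1..k. c0 q \<star> dl q)"
    using WT_weight_vector[OF _ a wt] v(1) idealD(2)[OF U] by blast
  have "\<exists>q\<in>{1..k}. c0 q \<noteq> 0"
  proof (rule ccontr)
    assume "\<not> ?thesis"
    then have "(\<Sum>q = 1..k. c0 q \<star> dl q) = 0" by (intro sum.neutral) auto
    then show False using c0 v(2) by simp
  qed
  then obtain q0 where q0: "q0 \<in> {1..k}" "c0 q0 \<noteq> 0" by blast
  define \<kappa> where "\<kappa> = dcol q0"
  define c where "c q = (if dcol q = \<kappa> then c0 q else 0)" for q
  define \<delta> where "\<delta> = (\<Sum>q = 1..k. c q \<star> dl q)"
  have hterm: "homg \<kappa> (c q \<star> dl q)" if "q \<in> {1..k}" for q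
    using hom_smul[OF hom_dl[OF that], of "c q"] by (cases "dcol q = \<kappa>") (simp_all add: c_def)
  have h\<delta>: "homg \<kappa> \<delta>" unfolding \<delta>_def by (intro hom_sum hterm)
  have "cpt (xcol (a, 0) + \<kappa>) v = Mx (a, 0) * \<delta>"
  proof -
    have "cpt (xcol (a, 0) + \<kappa>) v = (\<Sum>q = 1..k. c0 q \<star> cpt (xcol (a, 0) + \<kappa>) (Mx (a, 0) * dl q))"
      unfolding c0 sum_distrib_left comp_sum smul_mult_right comp_smul ..
    also have "\<dots> = (\<Sum>q = 1..k. Mx (a, 0) * (c q \<star> dl q))"
      by (intro sum.cong refl) (auto simp: comp_hom[OF hom_Mx_dl] c_def)
    finally show ?thesis by (simp only: sum_distrib_left \<delta>_def)
  qed
  then have XU: "Mx (a, 0) * \<delta> \<in> U" using idealD(3)[OF U v(1), of "xcol (a, 0) + \<kappa>"] by simp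
  define da where "da = (\<Sum>q = 1..k. c q * a q)"
  note a' = G_uminus[OF a]
  obtain m where m: "m \<noteq> 0" "Mx (- a, 0) * Mx (a, 0) = m \<star> idop" using Mx_inverse[OF a] by blast
  \<comment> \<open>\<open>[x\<^sup>-\<^sup>a \<partial>\<^sub>p, x\<^sup>a \<delta>]\<close> is proportional to \<open>a\<^sub>p \<delta> + \<delta>(a) \<partial>\<^sub>p\<close>.\<close>
  have pU: "a p \<star> \<delta> + da \<star> dl p \<in> U" if p: "p \<in> {1..k}" "tcol D p = 0" for p
  proof -
    have "cad (xcol (- a, 0) + dcol p) (Mx (- a, 0) * dl p) (Mx (a, 0) * \<delta>) =
       (\<Sum>q = 1..k. c q \<star> cad (xcol (- a, 0) + dcol p) (Mx (- a, 0) * dl p) (Mx (a, 0) * dl q))"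
      unfolding \<delta>_def sum_distrib_left cad_sum smul_mult_right cad_smul ..
    also have "\<dots> = (\<Sum>q = 1..k. c q \<star> (m \<star> (a p \<star> dl q + a q \<star> dl p)))"
    proof (intro sum.cong refl)
      fix q assume q: "q \<in> {1..k}"
      have "idop * (a p \<star> dl q + a q \<star> dl p) = a p \<star> dl q + a q \<star> dl p"
        using unit_left[OF hom_dl[OF q]] unit_left[OF hom_dl[OF p(1)]] by (simp add: distrib_left)
      then show "c q \<star> cad (xcol (- a, 0) + dcol p) (Mx (- a, 0) * dl p) (Mx (a, 0) * dl q) =
          c q \<star> (m \<star> (a p \<star> dl q + a q \<star> dl p))"
        using opposite_weights[OF a x_B[OF a] _ p _ q] m(2) by simp
    qed
    also have "\<dots> = m \<star> (a p \<star> \<delta> + da \<star> dl p)"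
      unfolding \<delta>_def da_def ops.scale_sum_left ops.scale_sum_right ops.scale_right_distrib sum.distrib ops.scale_scale
      by (simp only: mult.commute mult.left_commute)
    finally have "cad (xcol (- a, 0) + dcol p) (Mx (- a, 0) * dl p) (Mx (a, 0) * \<delta>) = m \<star> (a p \<star> \<delta> + da \<star> dl p)" .
    moreover have "cad (xcol (- a, 0) + dcol p) (Mx (- a, 0) * dl p) (Mx (a, 0) * \<delta>) \<in> U"
      by (intro idealD(4)[OF U WT_gen[OF x_B[OF a'] p(1)] hom_Mx_dl[OF p(1)] XU])
    ultimately show ?thesis using ideal_smul_iff[OF U m(1)] by simp
  qed
  have "\<delta> \<in> U"
  proof (cases "a = 0")
    case True
    have "(a, 0) = (0 :: 'f expo)" using True by (simp add: zero_prod_def)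
    then show ?thesis using XU unit_left[OF h\<delta>] by (simp only: Mx_zero)
  next
    case False
    then obtain p where ap: "a p \<noteq> 0" by (auto simp: fun_eq_iff)
    have p: "p \<in> {1..k}" using G_out[OF a ap] by (simp add: ktot_def)
    show ?thesis
    proof (cases "da = 0")
      case True
      then show ?thesis using pU[OF p tcol_G[OF a ap]] ideal_smul_iff[OF U ap, of \<delta>] by simp
    next
      case da: False
      have "\<exists>q\<in>{1..k}. c q * a q \<noteq> 0"
      proof (rule ccontr)
        assume "\<not> ?thesis"
        then have "da = 0" unfolding da_def by (intro sum.neutral) simp
        then show False using da by simp
      qed
      then obtain q1 where q1: "c q1 * a q1 \<noteq> 0" by blast
      then have "tcol D q1 = 0" using tcol_G[OF a, of q1] by simp
      moreover have "dcol q1 = \<kappa>" using q1 by (cases "dcol q1 = \<kappa>") (simp_all add: c_def)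
      ultimately
      have \<kappa>0: "\<kappa> = 0" by simp
      have "(\<Sum>q = 1..k. c q \<star> (a q \<star> \<delta> + da \<star> dl q)) \<in> U"
      proof (rule ideal_sum[OF U])
        fix q assume q: "q \<in> {1..k}"
        show "c q \<star> (a q \<star> \<delta> + da \<star> dl q) \<in> U"
        proof (cases "dcol q = \<kappa>")
          case True
          then show ?thesis using pU[OF q] \<kappa>0 by (simp add: ideal_smul[OF U])
        next
          case False
          then show ?thesis using \<open>0 \<in> U\<close> by (simp add: c_def)
        qed
      qed
      moreover have "(\<Sum>q = 1..k. c q \<star> (a q \<star> \<delta> + da \<star> dl q)) = da \<star> \<delta> + da \<star> \<delta>"
      proof -
        have "(\<Sum>q = 1..k. c q \<star> (a q \<star> \<delta> + da \<star> dl q)) = (\<Sum>q = 1..k. (c q * a q) \<star> \<delta>) + da \<star> (\<Sum>q = 1..k. c q \<star> dl q)"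
          by (simp add: ops.scale_right_distrib sum.distrib ops.scale_sum_right mult.commute)
        then show ?thesis by (simp only: ops.scale_sum_left[symmetric] da_def[symmetric] \<delta>_def[symmetric])
      qed
      ultimately have "(da + da) \<star> \<delta> \<in> U" by (simp only: ops.scale_left_distrib)
      moreover have "da + da \<noteq> 0" using da by simp
      ultimately show ?thesis using ideal_smul_iff[OF U] by blast
    qed
  qed
  then show ?thesis
  proof (rule that[of \<kappa> c, folded \<delta>_def, OF h\<delta>])
    show "\<exists>q\<in>{1..k}. c q \<noteq> 0" using q0 by (intro bexI[of _ q0]) (simp_all add: c_def \<kappa>_def)
    fix q assume "c q \<noteq> 0"
    then show "dcol q = \<kappa>" by (cases "dcol q = \<kappa>") (simp_all add: c_def)
  qed
qed

lemma cad_dl_Mx_dl: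
  assumes "p \<in> {1..k}" "q \<in> {1..k}"
  shows "cad (dcol p) (dl p) (u * dl q) = cad (dcol p) (dl p) u * dl q"
  by (simp add: cad_mult[OF graded_ops_hom[OF hom_dl[OF assms(2)]]] cad_dl_dl[OF assms])

text \<open>If \<open>\<delta>\<close> involves some \<open>\<partial>\<^sub>p\<close> with a variable \<open>t\<^sub>p\<close>, then \<open>[\<delta>, t\<^sub>p \<partial>\<^sub>r]\<close> is a multiple of \<open>\<partial>\<^sub>r\<close>. Otherwise there is \<open>b\<close> in \<open>G\<close> with
  \<open>\<delta>(b) \<noteq> 0\<close>, so all \<open>x\<^sup>b \<partial>\<^sub>r\<close> lie in \<open>U\<close>, and \<open>opposite_weights\<close> gives \<open>b\<^sub>p \<partial>\<^sub>r + b\<^sub>r \<partial>\<^sub>p\<close>; the case \<open>r = p\<close> yields \<open>\<partial>\<^sub>p\<close>.\<close>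
lemma WT_ideal_derivations:
  assumes U: "color_ideal WT U" and U0: "U \<noteq> {0}" and r: "r \<in> {1..k}"
  shows "dl r \<in> U"
proof -
  obtain c \<kappa> where \<delta>: "homg \<kappa> (\<Sum>q = 1..k. c q \<star> dl q)" "(\<Sum>q = 1..k. c q \<star> dl q) \<in> U"
    and ex: "\<exists>q\<in>{1..k}. c q \<noteq> 0" and col: "\<And>q. q \<in> {1..k} \<Longrightarrow> c q \<noteq> 0 \<Longrightarrow> dcol q = \<kappa>"
    using WT_ideal_nonzero_derivation[OF U U0, of thesis] by simp
  let ?d = "\<Sum>q = 1..k. c q \<star> dl q"
  have cd: "cad \<kappa> ?d T = (\<Sum>q = 1..k. c q \<star> cad (dcol q) (dl q) T)" for T
    unfolding cad_sum_left cad_smul_left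
  proof (intro sum.cong refl)
    fix q assume q: "q \<in> {1..k}"
    show "c q \<star> cad \<kappa> (dl q) T = c q \<star> cad (dcol q) (dl q) T"
      using col[OF q] by (cases "c q = 0") simp_all
  qed
  have dU: "cad \<kappa> ?d (Mx y * dl r) \<in> U" if "y \<in> Bset" "r \<in> {1..k}" for y r
    by (rule ideal_skew_hom[OF U \<delta>(2,1) WT_gen[OF that] hom_Mx_dl[OF that(2)]])
  show ?thesis
  proof (cases "\<exists>p\<in>{k1 D + 1..k}. c p \<noteq> 0")
    case True
    then obtain p where p: "p \<in> {k1 D + 1..k}" "c p \<noteq> 0" by blast
    have "cad \<kappa> ?d (tt p * dl r) = (\<Sum>q = 1..k. if q = p then (c q * tau p (0, un p)) \<star> dl r else 0)"
      unfolding cd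
    proof (intro sum.cong refl)
      fix q assume q: "q \<in> {1..k}"
      show "c q \<star> cad (dcol q) (dl q) (tt p * dl r) = (if q = p then (c q * tau p (0, un p)) \<star> dl r else 0)"
        using unit_left[OF hom_dl[OF r]] unfolding cad_dl_Mx_dl[OF q r] cad_dl_tt[OF p(1) q] by simp
    qed
    also have "\<dots> = (c p * tau p (0, un p)) \<star> dl r" using p(1) by simp
    finally have "(c p * tau p (0, un p)) \<star> dl r \<in> U" using dU[OF un_B[OF p(1)] r] by simp
    then show ?thesis using ideal_smul_iff[OF U, of "c p * tau p (0, un p)"] p(2) by simp
  next
    case False
    then obtain p0 where p0: "p0 \<in> {1..k1 D + k2 D}" "c p0 \<noteq> 0" using ex by force
    have sum_k: "(\<Sum>q = 1..k. c q * b q) = (\<Sum>q = 1..k1 D + k2 D. c q * b q)" for b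
      using False by (intro sum.mono_neutral_right) (auto simp: ktot_def)
    obtain b where b: "b \<in> Grp D" "(\<Sum>q = 1..k1 D + k2 D. c q * b q) \<noteq> 0"
      using G_separates_scalar[of c p0, OF p0(2,1)] by blast
    have bU: "Mx (b, 0) * dl r \<in> U" if r: "r \<in> {1..k}" for r
    proof -
      have "cad \<kappa> ?d (Mx (b, 0) * dl r) = (\<Sum>q = 1..k. (c q * b q) \<star> (Mx (b, 0) * dl r))"
        unfolding cd by (intro sum.cong refl) (simp add: cad_dl_Mx_dl[OF _ r] cad_dl_x[OF b(1)])
      also have "\<dots> = (\<Sum>q = 1..k1 D + k2 D. c q * b q) \<star> (Mx (b, 0) * dl r)"
        unfolding ops.scale_sum_left[symmetric] sum_k ..
      finally show ?thesis using dU[OF x_B[OF b(1)] r] ideal_smul_iff[OF U b(2)] by simp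
    qed
    have "\<exists>p. b p \<noteq> 0"
    proof (rule ccontr)
      assume "\<not> ?thesis"
      then show False using b(2) by simp
    qed
    then obtain p where bp: "b p \<noteq> 0" by blast
    have p: "p \<in> {1..k}" using G_out[OF b(1) bp] by (simp add: ktot_def)
    obtain m where m: "m \<noteq> 0" "Mx (- b, 0) * Mx (b, 0) = m \<star> idop" using Mx_inverse[OF b(1)] by blast
    have s: "b p \<star> dl r + b r \<star> dl p \<in> U" if r: "r \<in> {1..k}" for r
    proof -
      have "idop * (b p \<star> dl r + b r \<star> dl p) = b p \<star> dl r + b r \<star> dl p"
        using unit_left[OF hom_dl[OF r]] unit_left[OF hom_dl[OF p]] by (simp add: distrib_left)
      then have "cad (xcol (- b, 0) + dcol p) (Mx (- b, 0) * dl p) (Mx (b, 0) * dl r) = m \<star> (b p \<star> dl r + b r \<star> dl p)"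
        using opposite_weights[OF b(1) x_B[OF b(1)] _ p tcol_G[OF b(1) bp] _ r] m(2) by simp
      moreover have "cad (xcol (- b, 0) + dcol p) (Mx (- b, 0) * dl p) (Mx (b, 0) * dl r) \<in> U"
        by (intro idealD(4)[OF U WT_gen[OF x_B[OF G_uminus[OF b(1)]] p] hom_Mx_dl[OF p] bU[OF r]])
      ultimately show ?thesis using ideal_smul_iff[OF U m(1)] by simp
    qed
    have "(b p + b p) \<star> dl p \<in> U" using s[OF p] by (simp only: ops.scale_left_distrib)
    moreover have "b p + b p \<noteq> 0" using bp by simp
    ultimately have "dl p \<in> U" using ideal_smul_iff[OF U] by blast
    then have "b p \<star> dl r + b r \<star> dl p - b r \<star> dl p \<in> U" using s[OF r] by (intro ideal_diff[OF U] ideal_smul[OF U])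
    then show ?thesis using ideal_smul_iff[OF U bp] by simp
  qed
qed

text \<open>Once all \<open>\<partial>\<^sub>p\<close> lie in \<open>U\<close>, so does every \<open>y \<partial>\<^sub>r\<close> with \<open>y\<close> of nonzero weight, and every \<open>y \<partial>\<^sub>r\<close> with \<open>y\<close> of weight zero that is
  a derivative of a basis element. The exceptions have top degree in \<open>t\<close> and occur only if there is
  no even variable; they are reached by \<open>opposite_weights\<close> if \<open>G \<noteq> 0\<close>, and otherwise by \<open>t\<^sub>p \<partial>\<^sub>p \<in> U\<close>, for which a second odd index is needed.\<close>
lemma witt_simple:
  assumes big: "kev > 0 \<or> k4 D > 1" and U: "color_ideal WT U" and U0: "U \<noteq> {0}"
  shows "U = WT"
proof -
  note dU = WT_ideal_derivations[OF U U0]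
  have dWT: "dl p \<in> WT" if "p \<in> {1..k}" for p
    using dU[OF that] idealD(2)[OF U] by blast
  \<comment> \<open>Weights: \<open>x\<^sup>a t\<^sup>i \<partial>\<^sub>r\<close> with \<open>a\<^sub>p \<noteq> 0\<close>, by induction on the exponent of \<open>t\<^sub>p\<close>.\<close>
  have weight: "snd x p \<le> n \<Longrightarrow> x \<in> Bset \<Longrightarrow> fst x p \<noteq> 0 \<Longrightarrow> Mx x * dl r \<in> U"
    if r: "r \<in> {1..k}" for n x p r
  proof (induction n arbitrary: x)
    case 0
    then have f: "fst x \<in> Grp D" by (simp add: Bset_def mem_Times_iff)
    have p: "p \<in> {1..k}" using G_out[OF f 0(3)] by (simp add: ktot_def)
    have "cad (dcol p) (dl p) (Mx x * dl r) = fst x p \<star> (Mx x * dl r)"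
      using 0 by (simp add: cad_dl_Mx_dl[OF p r] cad_dl_Mx[OF p])
    moreover have "cad (dcol p) (dl p) (Mx x * dl r) \<in> U"
      by (rule ideal_skew_hom[OF U dU[OF p] hom_dl[OF p] WT_gen[OF 0(2) r] hom_Mx_dl[OF r]])
    ultimately show ?case using ideal_smul_iff[OF U 0(3)] by simp
  next
    case (Suc n)
    then have f: "fst x \<in> Grp D" by (simp add: Bset_def mem_Times_iff)
    have p: "p \<in> {1..k}" using G_out[OF f Suc.prems(3)] by (simp add: ktot_def)
    have "Mx (down p x) * dl r \<in> U"
      using Suc.prems by (intro Suc.IH B_down) (simp_all add: down_def)
    moreover have "cad (dcol p) (dl p) (Mx x * dl r) \<in> U"
      by (rule ideal_skew_hom[OF U dU[OF p] hom_dl[OF p] WT_gen[OF Suc.prems(2) r] hom_Mx_dl[OF r]])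
    moreover have "fst x p \<star> (Mx x * dl r) = cad (dcol p) (dl p) (Mx x * dl r) -
        (tau p x * of_nat (snd x p)) \<star> (Mx (down p x) * dl r)"
      by (simp add: cad_dl_Mx_dl[OF p r] cad_dl_Mx[OF p Suc.prems(2)] distrib_right)
    ultimately have "fst x p \<star> (Mx x * dl r) \<in> U" by (simp only: ideal_diff[OF U] ideal_smul[OF U])
    then show ?case using ideal_smul_iff[OF U Suc.prems(3)] by simp
  qed
  have lift: "Mx x * dl r \<in> U" if r: "r \<in> {1..k}" and x: "x \<in> Bset" "fst x p = 0"
      and p: "p \<in> {k1 D + 1..k}" "x + (0, un p) \<in> Bset" for x p r
  proof -
    note p' = k_range[OF p(1)]
    have "cad (dcol p) (dl p) (Mx (x + (0, un p)) * dl r) = (tau p (x + (0, un p)) * of_nat (Suc (snd x p))) \<star> (Mx x * dl r)"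
      unfolding cad_dl_Mx_dl[OF p' r] cad_dl_Mx[OF p' p(2)] down_add_un using x(2) by simp
    moreover have "cad (dcol p) (dl p) (Mx (x + (0, un p)) * dl r) \<in> U"
      by (rule ideal_skew_hom[OF U dU[OF p'] hom_dl[OF p'] WT_gen[OF p(2) r] hom_Mx_dl[OF r]])
    moreover have "tau p (x + (0, un p)) * of_nat (Suc (snd x p)) \<noteq> 0" by (simp del: of_nat_Suc)
    ultimately show ?thesis using ideal_smul_iff[OF U] by metis
  qed
  have gen: "Mx x * dl r \<in> U" if x: "x \<in> Bset" and r: "r \<in> {1..k}" for x r
  proof (cases "fst x = 0")
    case False
    then obtain p where "fst x p \<noteq> 0" by (auto simp: fun_eq_iff)
    then show ?thesis using weight[OF r order_refl x] by blast
  next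
    case f0: True
    show ?thesis
    proof (cases "\<exists>p\<in>{k1 D + 1..k}. x + (0, un p) \<in> Bset")
      case True
      then obtain p where "p \<in> {k1 D + 1..k}" "x + (0, un p) \<in> Bset" by blast
      then show ?thesis using lift[OF r x] f0 by simp
    next
      case top: False
      have top1: "p > kev \<and> snd x p = 1" if p: "p \<in> {k1 D + 1..k}" for p
      proof -
        have "x + (0, un p) \<notin> Bset" using top p by blast
        then obtain q where q: "q > kev" "\<not> snd x q + snd (0 :: nat \<Rightarrow> 'f, un p) q \<le> 1"
          unfolding B_add_iff[OF x un_B[OF p]] by (meson not_le)
        have "snd x q \<le> 1" using x J_odd[of "snd x" q] q(1) by (simp add: Bset_def mem_Times_iff)
        then have "q = p" "snd x p = 1" using q by (auto simp: un_def split: if_splits)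
        then show ?thesis using q(1) by simp
      qed
      show ?thesis
      proof (cases "k1 D + k2 D > 0")
        case True
        then obtain b where b: "b \<in> Grp D" "b 1 \<noteq> 0" using G_nonzero_at[of 1] by auto
        define p :: nat where "p = 1"
        have bp: "b p \<noteq> 0" using b(2) by (simp add: p_def)
        have p: "p \<in> {1..k}" using G_out[OF b(1) bp] by (simp add: ktot_def)
        have "\<not> p > kev" using G_out[OF b(1) bp] by simp
        then have "p \<notin> {k1 D + 1..k}" using top1 by blast
        then have sp: "snd x p = 0" using B_range[OF x, of p] by (cases "snd x p = 0") auto
        define y where "y = (b, 0) + x"
        have y: "y \<in> Bset"
          unfolding y_def using x x_B[OF b(1)] by (subst B_add_J) (simp_all add: Bset_def mem_Times_iff)
        have fy: "fst y = b" "snd y p = 0" using f0 sp by (simp_all add: y_def)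
        have yU: "Mx y * dl r \<in> U" if "r \<in> {1..k}" for r
          using weight[OF that order_refl y, of p] fy bp by simp
        have xy: "(- b, 0) + y = x" by (simp add: y_def add.assoc[symmetric] zero_prod_def[symmetric])
        define m where "m = mult_coeff D (- b, 0) y"
        have m: "m \<noteq> 0" "Mx (- b, 0) * Mx y = m \<star> Mx x"
          using mult_coeff_nonzero[OF x_B[OF G_uminus[OF b(1)]] y] Mx_mult[OF x_B[OF G_uminus[OF b(1)]] y]
          unfolding xy m_def by simp_all
        have s: "b p \<star> (Mx x * dl r) + b r \<star> (Mx x * dl p) \<in> U" if r: "r \<in> {1..k}" for r
        proof -
          have "cad (xcol (- b, 0) + dcol p) (Mx (- b, 0) * dl p) (Mx y * dl r) =
              m \<star> (b p \<star> (Mx x * dl r) + b r \<star> (Mx x * dl p))"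
            using opposite_weights[OF b(1) y fy(1) p tcol_G[OF b(1) bp] fy(2) r] m(2)
            by (simp add: distrib_left ops.scale_right_distrib mult.commute)
          moreover have "cad (xcol (- b, 0) + dcol p) (Mx (- b, 0) * dl p) (Mx y * dl r) \<in> U"
            by (intro idealD(4)[OF U WT_gen[OF x_B[OF G_uminus[OF b(1)]] p] hom_Mx_dl[OF p] yU[OF r]])
          ultimately show ?thesis using ideal_smul_iff[OF U m(1)] by simp
        qed
        have "(b p + b p) \<star> (Mx x * dl p) \<in> U" using s[OF p] by (simp only: ops.scale_left_distrib)
        moreover have "b p + b p \<noteq> 0" using bp by simp
        ultimately have "Mx x * dl p \<in> U" using ideal_smul_iff[OF U] by blast
        then have "b p \<star> (Mx x * dl r) + b r \<star> (Mx x * dl p) - b r \<star> (Mx x * dl p) \<in> U"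
          using s[OF r] by (intro ideal_diff[OF U] ideal_smul[OF U])
        then show ?thesis using ideal_smul_iff[OF U bp] by simp
      next
        case False
        have k3: "k3 D = 0"
        proof (rule ccontr)
          assume "k3 D \<noteq> 0"
          then have "k1 D + 1 \<in> {k1 D + 1..k}" using False by (simp add: ktot_def)
          from top1[OF this] show False using False \<open>k3 D \<noteq> 0\<close> by simp
        qed
        then have ev: "kev = 0" using False by simp
        then have k4: "k4 D > 1" using big by simp
        obtain p where p: "p \<in> {1..k}" "p \<noteq> r" by (rule other_index[OF ev k4])
        note p' = odd_range[OF ev p(1)]
        have hU: "tt p * dl p \<in> U"
        proof (rule lift[OF p(1) un_B[OF p'] _ odd_range[OF ev r]])
          show "(0, un p) + (0, un r) \<in> Bset"
            unfolding B_add_iff[OF un_B[OF p'] un_B[OF odd_range[OF ev r]]] using p(2) by (simp add: un_def)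
        qed simp
        have xp: "snd x p > 0" using top1[OF p'] by simp
        note dg = graded_ops_hom[OF hom_dl[OF r]]
        have "cad (xcol (0, un p) + dcol p) (tt p * dl p) (Mx x * dl r) =
           tt p * cad (dcol p) (dl p) (Mx x) * dl r"
          unfolding cad_Mx_dl_Mx_dl[OF un_B[OF p'] p(1) x r]
          using cad_tt_dl_other[OF p' r] p(2) by (simp add: xcol_un[OF p'])
        also have "\<dots> = (tau p x * of_nat (snd x p)) \<star> (tt p * Mx (down p x) * dl r)"
          using f0 by (simp add: cad_dl_Mx[OF p(1) x])
        also have "tt p * Mx (down p x) = mult_coeff D (0, un p) (down p x) \<star> Mx x"
          unfolding Mx_mult[OF un_B[OF p'] B_down[OF x]]
          by (simp only: add.commute[of "(0, un p)"] down_un[OF xp, symmetric])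
        finally have e: "cad (xcol (0, un p) + dcol p) (tt p * dl p) (Mx x * dl r) =
          (tau p x * of_nat (snd x p) * mult_coeff D (0, un p) (down p x)) \<star> (Mx x * dl r)"
          by (simp only: smul_mult_left ops.scale_scale mult.assoc)
        have nz: "tau p x * of_nat (snd x p) * mult_coeff D (0, un p) (down p x) \<noteq> 0"
          using xp mult_coeff_nonzero[OF un_B[OF p'] B_down[OF x, of p]] by simp
        from ideal_skew_hom[OF U hU hom_Mx_dl[OF p(1)] WT_gen[OF x r] hom_Mx_dl[OF r]] show ?thesis
          unfolding e using ideal_smul_iff[OF U nz] by simp
      qed
    qed
  qed
  have "WT \<subseteq> U"
    unfolding WT_def using gen by (intro ops.span_minimal[OF _ idealD(1)[OF U]]) auto
  then show ?thesis using idealD(2)[OF U] by blast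
qed

lemma witt_nonabelian:
  assumes "kev > 0 \<or> k4 D > 1"
  shows "\<exists>\<kappa> S T \<mu>. S \<in> WT \<and> homg \<kappa> S \<and> T \<in> WT \<and> homg \<mu> T \<and> cad \<kappa> S T \<noteq> 0"
proof -
  have p: "1 \<in> {1..k}" using k_pos by simp
  have dWT: "dl p \<in> WT" if "p \<in> {1..k}" for p
    using WT_gen[OF B_zero that] unit_left[OF hom_dl[OF that]] by (simp add: Mx_zero)
  have "\<exists>x\<in>Bset. \<exists>p\<in>{1..k}. cad (dcol p) (dl p) (Mx x) * dl p \<noteq> 0"
  proof (cases "k1 D + k2 D > 0")
    case True
    then obtain b where b: "b \<in> Grp D" "b 1 \<noteq> 0" using G_nonzero_at[of 1] by auto
    have "dl 1 \<noteq> 0"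
    proof
      assume "dl 1 = 0"
      then have "b 1 \<star> Mx (b, 0) = 0" using cad_dl_x[OF b(1) p] by simp
      then have "Mx (b, 0) = 0" using b(2) by simp
      then show False using Mx_inverse[OF b(1)] idop_nonzero by auto
    qed
    moreover have "dl 1 = 0" if "b 1 \<star> (Mx (b, 0) * dl 1) = 0"
    proof -
      obtain c where c: "c \<noteq> 0" "Mx (- b, 0) * Mx (b, 0) = c \<star> idop" using Mx_inverse[OF b(1)] by blast
      have "Mx (b, 0) * dl 1 = 0" using that b(2) by simp
      then have "(Mx (- b, 0) * Mx (b, 0)) * dl 1 = 0" by (simp only: mult.assoc mult_zero_right)
      then have "c \<star> dl 1 = 0" unfolding c(2) using unit_left[OF hom_dl[OF p]] by (simp only: smul_mult_left)
      then show ?thesis using c(1) by simp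
    qed
    ultimately have "b 1 \<star> (Mx (b, 0) * dl 1) \<noteq> 0" by blast
    then show ?thesis
      using x_B[OF b(1)] p by (intro bexI[of _ "(b, 0)"] bexI[of _ 1]) (simp_all only: cad_dl_x[OF b(1) p] smul_mult_left not_False_eq_True)
  next
    case False
    then have p': "1 \<in> {k1 D + 1..k}" using p by simp
    have "cad (dcol 1) (dl 1) (tt 1) * dl 1 = tau 1 (0, un 1) \<star> dl 1"
      using unit_left[OF hom_dl[OF p]] by (simp only: cad_dl_tt[OF p' p] smul_mult_left if_True refl)
    moreover have "dl 1 \<noteq> 0"
    proof
      assume "dl 1 = 0"
      then have "cad (dcol 1) (dl 1) (tt 1) = 0" by simp
      then show False using cad_dl_tt[OF p' p] idop_nonzero by simp
    qed
    ultimately show ?thesis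
      using un_B[OF p'] p by (intro bexI[of _ "(0, un 1)"] bexI[of _ 1]) simp_all
  qed
  then obtain x p where x: "x \<in> Bset" and p: "p \<in> {1..k}" and ne: "cad (dcol p) (dl p) (Mx x) * dl p \<noteq> 0" by blast
  show ?thesis
    using dWT[OF p] hom_dl[OF p] WT_gen[OF x p] hom_Mx_dl[OF p, of x] ne[folded cad_dl_Mx_dl[OF p p]]
    by (intro exI[of _ "dcol p"] exI[of _ "dl p"] exI[of _ "Mx x * dl p"] exI[of _ "xcol x + dcol p"] conjI)
qed

end

section \<open>Record structures presented by subspaces of a vector space\<close>

lemma ring_of_type_algebra_sel:
  "carrier ring_of_type_algebra = UNIV" "a \<oplus>\<^bsub>ring_of_type_algebra\<^esub> b = a + b"
  "a \<otimes>\<^bsub>ring_of_type_algebra\<^esub> b = a * b" "\<one>\<^bsub>ring_of_type_algebra\<^esub> = 1"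
  by (simp_all add: ring_of_type_algebra_def)

text \<open>A linear map from a subspace \<open>C\<close> to the record \<open>M\<close>. Spans in \<open>M\<close> can be computed in \<open>C\<close> as soon as \<open>\<Phi>\<close> respects the
  operations, without module axioms for \<open>M\<close>; this is applied to the endomorphisms of \<open>\<A>\<close>.\<close>
locale linear_map_into = vector_space scl
  for scl :: "'f::field \<Rightarrow> 'v::ab_group_add \<Rightarrow> 'v" +
  fixes C :: "'v set" and \<Phi> :: "'v \<Rightarrow> 'w" and M :: "('f, 'w, 'm) module_scheme"
  assumes C_subspace: "subspace C"
    and map_carrier: "x \<in> C \<Longrightarrow> \<Phi> x \<in> carrier M"
    and map_add: "x \<in> C \<Longrightarrow> y \<in> C \<Longrightarrow> \<Phi> x \<oplus>\<^bsub>M\<^esub> \<Phi> y = \<Phi> (x + y)"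
    and map_scale: "x \<in> C \<Longrightarrow> r \<odot>\<^bsub>M\<^esub> \<Phi> x = \<Phi> (scl r x)"
    and map_zero: "\<zero>\<^bsub>M\<^esub> = \<Phi> 0"
    and map_neg: "x \<in> C \<Longrightarrow> \<ominus>\<^bsub>M\<^esub> \<Phi> x = \<Phi> (- x)"
begin

lemma subspace_image:
  assumes "subspace K" "K \<subseteq> C"
  shows "subspace_of M (\<Phi> ` K)"
proof -
  have "inv\<^bsub>add_monoid M\<^esub> (\<Phi> x) = \<Phi> (- x)" if "x \<in> K" for x
    using map_neg[of x] that assms(2) by (auto simp: a_inv_def)
  moreover have "\<Phi> x \<oplus>\<^bsub>M\<^esub> \<Phi> y = \<Phi> (x + y)" "r \<odot>\<^bsub>M\<^esub> \<Phi> x = \<Phi> (scl r x)" if "x \<in> K" "y \<in> K" for x y r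
    using map_add map_scale that assms(2) by blast+
  ultimately show ?thesis
    using assms subspace_add[OF assms(1)] subspace_0[OF assms(1)] subspace_neg[OF assms(1)] subspace_scale[OF assms(1)]
    by unfold_locales (auto simp: map_zero map_carrier ring_of_type_algebra_sel)
qed

lemma subspace_preimage:
  assumes "subspace_of M U"
  shows "subspace {x \<in> C. \<Phi> x \<in> U}"
proof -
  interpret U: submodule U "ring_of_type_algebra :: 'f ring" M by (rule assms)
  have "\<Phi> (x + y) \<in> U" if "x \<in> C" "y \<in> C" "\<Phi> x \<in> U" "\<Phi> y \<in> U" for x y
    using U.m_closed[OF that(3,4)] map_add[OF that(1,2)] by simp
  moreover have "\<Phi> (scl r x) \<in> U" if "x \<in> C" "\<Phi> x \<in> U" for r x
    using U.smult_closed[OF _ that(2), of r] map_scale[OF that(1)] by (simp add: ring_of_type_algebra_sel)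
  moreover have "\<Phi> 0 \<in> U" using U.one_closed by (simp add: map_zero)
  ultimately show ?thesis
    using subspace_add[OF C_subspace] subspace_0[OF C_subspace] subspace_scale[OF C_subspace]
    by (intro subspaceI) auto
qed

lemma span_in_image:
  assumes "S \<subseteq> C"
  shows "span_in M (\<Phi> ` S) = \<Phi> ` span S"
proof
  have SC: "span S \<subseteq> C" by (rule span_minimal[OF assms C_subspace])
  show "span_in M (\<Phi> ` S) \<subseteq> \<Phi> ` span S"
    unfolding span_in_def
    by (rule hull_minimal) (auto intro: span_base subspace_image[OF subspace_span SC])
  have "\<Phi> ` span S \<subseteq> U" if U: "\<Phi> ` S \<subseteq> U" "subspace_of M U" for U
    using span_minimal[OF _ subspace_preimage[OF U(2)], of S] U(1) assms by blast
  then show "\<Phi> ` span S \<subseteq> span_in M (\<Phi> ` S)"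
    unfolding span_in_def hull_def by blast
qed

end

text \<open>The record \<open>M\<close> is the graded space \<open>C / N\<close>, where \<open>\<Phi>\<close> is the quotient map and \<open>cp \<kappa>\<close> the projection onto the component
  of color \<open>\<kappa>\<close>. All axioms of graded modules follow, and the product of \<open>M\<close> is left open.\<close>
locale presentation = vector_space scl
  for scl :: "'f::field \<Rightarrow> 'v::ab_group_add \<Rightarrow> 'v" +
  fixes cp :: "'g::ab_group_add \<Rightarrow> 'v \<Rightarrow> 'v"
    and C N :: "'v set" and \<Phi> :: "'v \<Rightarrow> 'w" and M :: "('f, 'g, 'w) graded_algebra"
  assumes cp_add: "cp \<kappa> (x + y) = cp \<kappa> x + cp \<kappa> y"
    and cp_scale: "cp \<kappa> (scl r x) = scl r (cp \<kappa> x)"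
    and cp_cp: "cp \<kappa> (cp \<mu> x) = (if \<kappa> = \<mu> then cp \<mu> x else 0)"
    and cp_C: "x \<in> C \<Longrightarrow> cp \<kappa> x \<in> C"
    and cp_N: "x \<in> N \<Longrightarrow> cp \<kappa> x \<in> N"
    and finite_cp: "x \<in> C \<Longrightarrow> finite {\<kappa>. cp \<kappa> x \<noteq> 0}"
    and sum_cp: "x \<in> C \<Longrightarrow> x = (\<Sum>\<kappa> | cp \<kappa> x \<noteq> 0. cp \<kappa> x)"
    and sub_C: "subspace C" and sub_N: "subspace N" and N_C: "N \<subseteq> C"
    and carrier_eq: "carrier M = \<Phi> ` C"
    and eq_iff: "x \<in> C \<Longrightarrow> y \<in> C \<Longrightarrow> \<Phi> x = \<Phi> y \<longleftrightarrow> x - y \<in> N"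
    and pres_add: "x \<in> C \<Longrightarrow> y \<in> C \<Longrightarrow> \<Phi> x \<oplus>\<^bsub>M\<^esub> \<Phi> y = \<Phi> (x + y)"
    and pres_scale: "x \<in> C \<Longrightarrow> r \<odot>\<^bsub>M\<^esub> \<Phi> x = \<Phi> (scl r x)"
    and pres_zero: "\<zero>\<^bsub>M\<^esub> = \<Phi> 0"
    and pres_homog: "homog M \<kappa> = \<Phi> ` {x \<in> C. cp \<kappa> x = x}"
begin

lemma cp_zero [simp]: "cp \<kappa> 0 = 0" using cp_scale[of \<kappa> 0 0] by simp
lemma cp_diff: "cp \<kappa> (x - y) = cp \<kappa> x - cp \<kappa> y" using cp_add[of \<kappa> "x - y" y] by simp
lemma cp_sum: "cp \<kappa> (\<Sum>x\<in>S. g x) = (\<Sum>x\<in>S. cp \<kappa> (g x))"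
  by (induction S rule: infinite_finite_induct) (auto simp: cp_add)

lemmas C_add = subspace_add[OF sub_C] and C_diff = subspace_diff[OF sub_C]
  and C_0 [simp] = subspace_0[OF sub_C] and C_neg = subspace_neg[OF sub_C]
  and C_scale = subspace_scale[OF sub_C] and C_sum = subspace_sum[OF sub_C]

lemma pres_zero_iff: "x \<in> C \<Longrightarrow> \<Phi> x = \<zero>\<^bsub>M\<^esub> \<longleftrightarrow> x \<in> N"
  using eq_iff[of x 0] by (simp add: pres_zero)

lemma pres_abelian_group: "abelian_group M"
proof (rule abelian_groupI)
  fix w assume "w \<in> carrier M"
  then obtain x where x: "x \<in> C" "w = \<Phi> x" by (auto simp: carrier_eq)
  show "\<exists>y\<in>carrier M. y \<oplus>\<^bsub>M\<^esub> w = \<zero>\<^bsub>M\<^esub>"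
    using x C_neg by (intro bexI[of _ "\<Phi> (- x)"]) (auto simp: carrier_eq pres_add pres_zero)
qed (auto simp: carrier_eq pres_add pres_zero C_add ac_simps)

sublocale ag: abelian_group M by (rule pres_abelian_group)

lemma pres_neg: "x \<in> C \<Longrightarrow> \<ominus>\<^bsub>M\<^esub> \<Phi> x = \<Phi> (- x)"
proof -
  assume x: "x \<in> C"
  then have "\<Phi> (- x) \<oplus>\<^bsub>M\<^esub> \<Phi> x = \<zero>\<^bsub>M\<^esub>" by (simp add: pres_add C_neg pres_zero)
  then show ?thesis using x by (intro ag.minus_equality) (auto simp: carrier_eq C_neg)
qed

lemma pres_minus: "x \<in> C \<Longrightarrow> y \<in> C \<Longrightarrow> \<Phi> x \<ominus>\<^bsub>M\<^esub> \<Phi> y = \<Phi> (x - y)"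
  by (simp add: a_minus_def pres_neg pres_add C_neg)

sublocale lin: linear_map_into scl C \<Phi> M
  by unfold_locales (auto simp: sub_C carrier_eq pres_add pres_scale pres_zero[symmetric] pres_neg)

lemma pres_module: "Module.module (ring_of_type_algebra :: 'f ring) M"
proof (rule Module.moduleI[OF cring_from_type_algebra pres_abelian_group])
qed (auto simp: carrier_eq ring_of_type_algebra_sel pres_scale pres_add C_scale C_add
      scale_left_distrib scale_right_distrib)

lemma pres_finsum:
  assumes "finite A" "\<And>x. x \<in> A \<Longrightarrow> g x \<in> C"
  shows "(\<Oplus>\<^bsub>M\<^esub>x\<in>A. \<Phi> (g x)) = \<Phi> (\<Sum>x\<in>A. g x)"
  using assms
proof (induction A rule: finite_induct)
  case empty
  then show ?case by (simp add: pres_zero)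
next
  case (insert x A)
  have "(\<lambda>x. \<Phi> (g x)) \<in> A \<rightarrow> carrier M" using insert by (auto simp: carrier_eq)
  then show ?case using insert by (simp add: ag.finsum_insert carrier_eq pres_add C_sum)
qed

lemma pres_sum_nonzero:
  assumes "finite A" "\<And>x. x \<in> A \<Longrightarrow> g x \<in> C" "\<And>x. x \<notin> A \<Longrightarrow> g x = 0"
  shows "(\<Oplus>\<^bsub>M\<^esub>x\<in>{x. \<Phi> (g x) \<noteq> \<zero>\<^bsub>M\<^esub>}. \<Phi> (g x)) = \<Phi> (\<Sum>x\<in>A. g x)"
proof -
  let ?B = "{x. \<Phi> (g x) \<noteq> \<zero>\<^bsub>M\<^esub>}"
  have B: "?B \<subseteq> A"
  proof
    fix x assume "x \<in> ?B"
    then show "x \<in> A" using assms(3)[of x] by (cases "x \<in> A") (simp_all add: pres_zero)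
  qed
  have "(\<Sum>x\<in>A. g x) = (\<Sum>x\<in>A - ?B. g x) + (\<Sum>x\<in>?B. g x)"
    by (rule sum.subset_diff[OF B assms(1)])
  moreover have "(\<Sum>x\<in>A - ?B. g x) \<in> N"
    using assms(2) by (intro subspace_sum[OF sub_N]) (auto simp: pres_zero_iff)
  ultimately have "(\<Sum>x\<in>A. g x) - (\<Sum>x\<in>?B. g x) \<in> N" by simp
  then have "\<Phi> (\<Sum>x\<in>A. g x) = \<Phi> (\<Sum>x\<in>?B. g x)"
    using B assms(2) by (subst eq_iff) (auto intro!: C_sum)
  then show ?thesis
    using B assms(2) by (subst pres_finsum) (auto intro: finite_subset[OF B assms(1)])
qed

text \<open>Lift a second decomposition to homogeneous elements of \<open>C\<close>; their sum differs from \<open>x\<close> by an element of \<open>N\<close>,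
  and the projections map \<open>N\<close> into itself.\<close>
lemma color_decomp_iff:
  assumes x: "x \<in> C"
  shows "color_decomp M (\<Phi> x) c \<longleftrightarrow> c = (\<lambda>\<kappa>. \<Phi> (cp \<kappa> x))"
proof
  assume "color_decomp M (\<Phi> x) c"
  then have c: "c \<kappa> \<in> homog M \<kappa>" "finite {\<kappa>. c \<kappa> \<noteq> \<zero>\<^bsub>M\<^esub>}"
      "\<Phi> x = (\<Oplus>\<^bsub>M\<^esub>\<kappa>\<in>{\<kappa>. c \<kappa> \<noteq> \<zero>\<^bsub>M\<^esub>}. c \<kappa>)" for \<kappa>
    by (auto simp: color_decomp_def)
  have "\<exists>y. y \<in> C \<and> cp \<kappa> y = y \<and> c \<kappa> = \<Phi> y" for \<kappa>
    using c(1)[of \<kappa>] by (auto simp: pres_homog)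
  then obtain y0 where y0: "\<And>\<kappa>. y0 \<kappa> \<in> C \<and> cp \<kappa> (y0 \<kappa>) = y0 \<kappa> \<and> c \<kappa> = \<Phi> (y0 \<kappa>)" by metis
  define y where "y \<kappa> = (if c \<kappa> = \<zero>\<^bsub>M\<^esub> then 0 else y0 \<kappa>)" for \<kappa>
  have y: "y \<kappa> \<in> C" "cp \<kappa> (y \<kappa>) = y \<kappa>" "c \<kappa> = \<Phi> (y \<kappa>)" for \<kappa>
    using y0[of \<kappa>] by (auto simp: y_def pres_zero)
  let ?A = "{\<kappa>. c \<kappa> \<noteq> \<zero>\<^bsub>M\<^esub>}"
  have "\<Phi> x = \<Phi> (\<Sum>\<kappa>\<in>?A. y \<kappa>)"
    unfolding c(3) pres_finsum[OF c(2) y(1), symmetric] y(3)[symmetric] ..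
  then have d: "x - (\<Sum>\<kappa>\<in>?A. y \<kappa>) \<in> N" using x y(1) by (subst eq_iff[symmetric]) (auto intro: C_sum)
  have "c \<mu> = \<Phi> (cp \<mu> x)" for \<mu>
  proof -
    have "cp \<mu> (y \<kappa>) = (if \<mu> = \<kappa> then y \<kappa> else 0)" for \<kappa>
      using cp_cp[of \<mu> \<kappa> "y \<kappa>"] y(2)[of \<kappa>] by auto
    then have "cp \<mu> (\<Sum>\<kappa>\<in>?A. y \<kappa>) = (if \<mu> \<in> ?A then y \<mu> else 0)"
      using c(2) by (simp add: cp_sum)
    also have "\<dots> = y \<mu>" by (simp add: y_def)
    finally have "cp \<mu> x - y \<mu> \<in> N" using cp_N[OF d, of \<mu>] by (simp add: cp_diff)
    then show ?thesis using eq_iff[OF cp_C[OF x, of \<mu>] y(1)[of \<mu>]] y(3)[of \<mu>] by simp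
  qed
  then show "c = (\<lambda>\<kappa>. \<Phi> (cp \<kappa> x))" by (simp add: fun_eq_iff)
next
  assume c: "c = (\<lambda>\<kappa>. \<Phi> (cp \<kappa> x))"
  have "finite {\<kappa>. c \<kappa> \<noteq> \<zero>\<^bsub>M\<^esub>}"
    by (rule finite_subset[OF _ finite_cp[OF x]]) (auto simp: c pres_zero)
  moreover have "(\<Oplus>\<^bsub>M\<^esub>\<kappa>\<in>{\<kappa>. c \<kappa> \<noteq> \<zero>\<^bsub>M\<^esub>}. c \<kappa>) = \<Phi> x"
    unfolding c using x by (subst pres_sum_nonzero[OF finite_cp[OF x]]) (auto simp: cp_C sum_cp[symmetric])
  ultimately show "color_decomp M (\<Phi> x) c"
    using x by (auto simp: color_decomp_def c pres_homog cp_C cp_cp)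
qed

lemma color_component_eq: "x \<in> C \<Longrightarrow> color_component M (\<Phi> x) = (\<lambda>\<kappa>. \<Phi> (cp \<kappa> x))"
  by (simp add: color_component_def color_decomp_iff)

lemma pres_graded_space: "graded_space M"
proof -
  have "subspace_of M (homog M \<kappa>)" for \<kappa>
    unfolding pres_homog
    by (rule lin.subspace_image, rule subspaceI) (auto simp: C_add C_scale cp_add cp_scale)
  moreover have "\<exists>!c. color_decomp M w c" if "w \<in> carrier M" for w
    using that by (auto simp: carrier_eq color_decomp_iff)
  ultimately show ?thesis
    by (intro graded_space.intro pres_module graded_space_axioms.intro)
qed

text \<open>\<open>N \<subseteq> K\<close> is needed for the grading: an element of \<open>\<Phi> ` K\<close> that is homogeneous has a homogeneous preimage in \<open>C\<close>, and
  this preimage then lies in \<open>K\<close>.\<close>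
lemma presentation_restrict:
  assumes K: "subspace K" "K \<subseteq> C" "N \<subseteq> K" "\<And>x \<kappa>. x \<in> K \<Longrightarrow> cp \<kappa> x \<in> K"
  shows "presentation scl cp K N \<Phi> (restrict_algebra M (\<Phi> ` K))"
proof -
  have "\<Phi> ` {x \<in> C. cp \<kappa> x = x} \<inter> \<Phi> ` K = \<Phi> ` {x \<in> K. cp \<kappa> x = x}" for \<kappa>
  proof -
    have "x \<in> K" if "x \<in> C" "y \<in> K" "\<Phi> x = \<Phi> y" for x y
    proof -
      have "x - y \<in> K" using that eq_iff[of x y] K(2,3) by auto
      then have "(x - y) + y \<in> K" by (rule subspace_add[OF K(1) _ that(2)])
      then show ?thesis by simp
    qed
    then show ?thesis using K(2) by auto
  qed
  moreover have xC: "x \<in> C" if "x \<in> K" for x using K(2) that by blast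
  ultimately show ?thesis
    using K pres_homog
    by unfold_locales
      (simp_all add: cp_add cp_scale cp_cp cp_N finite_cp sum_cp[symmetric] sub_N restrict_algebra_def
        eq_iff pres_add pres_scale pres_zero)
qed

lemma coset_eq:
  assumes K: "subspace K" "K \<subseteq> C" and x: "x \<in> C"
  shows "\<Phi> ` K +>\<^bsub>M\<^esub> \<Phi> x = \<Phi> ` {y \<in> C. y - x \<in> K}"
proof -
  have "\<Phi> ` K +>\<^bsub>M\<^esub> \<Phi> x = \<Phi> ` ((\<lambda>n. n + x) ` K)"
    using K(2) x by (auto simp: a_r_coset_def r_coset_def pres_add subset_iff)
  moreover have "(\<lambda>n. n + x) ` K = {y \<in> C. y - x \<in> K}"
    using K(2) x by (auto intro: C_add image_eqI[of _ _ "_ - x"])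
  ultimately show ?thesis by simp
qed

lemma coset_eq_iff:
  assumes K: "subspace K" "N \<subseteq> K" "K \<subseteq> C" and x: "x \<in> C" and y: "y \<in> C"
  shows "\<Phi> ` K +>\<^bsub>M\<^esub> \<Phi> x = \<Phi> ` K +>\<^bsub>M\<^esub> \<Phi> y \<longleftrightarrow> x - y \<in> K"
proof
  assume "\<Phi> ` K +>\<^bsub>M\<^esub> \<Phi> x = \<Phi> ` K +>\<^bsub>M\<^esub> \<Phi> y"
  then have "\<Phi> x \<in> \<Phi> ` {z \<in> C. z - y \<in> K}"
    unfolding coset_eq[OF K(1,3) x] coset_eq[OF K(1,3) y] using x subspace_0[OF K(1)] by force
  then obtain z where z: "z \<in> C" "z - y \<in> K" "\<Phi> x = \<Phi> z" by auto
  have "(x - z) + (z - y) \<in> K"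
    using z K(2) eq_iff[OF x z(1)] by (intro subspace_add[OF K(1)]) auto
  then show "x - y \<in> K" by simp
next
  assume d: "x - y \<in> K"
  have "z - x \<in> K \<longleftrightarrow> z - y \<in> K" for z
    using subspace_add[OF K(1) _ d, of "z - x"] subspace_diff[OF K(1) _ d, of "z - y"] by auto
  then show "\<Phi> ` K +>\<^bsub>M\<^esub> \<Phi> x = \<Phi> ` K +>\<^bsub>M\<^esub> \<Phi> y"
    unfolding coset_eq[OF K(1,3) x] coset_eq[OF K(1,3) y] by simp
qed

lemma presentation_quotient:
  assumes K: "subspace K" "N \<subseteq> K" "K \<subseteq> C" "\<And>x \<kappa>. x \<in> K \<Longrightarrow> cp \<kappa> x \<in> K"
  shows "presentation scl cp C K (\<lambda>x. \<Phi> ` K +>\<^bsub>M\<^esub> \<Phi> x) (quotient_algebra M (\<Phi> ` K))"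
proof -
  let ?q = "\<lambda>x. \<Phi> ` K +>\<^bsub>M\<^esub> \<Phi> x"
  note qe = coset_eq[OF K(1,3)]
  have K0: "0 \<in> K" by (rule subspace_0[OF K(1)])
  have add: "set_add M (?q x) (?q y) = ?q (x + y)" if x: "x \<in> C" and y: "y \<in> C" for x y
  proof -
    have "set_add M (?q x) (?q y) = \<Phi> ` {z \<in> C. z - (x + y) \<in> K}" (is "?L = ?R")
    proof
      show "?L \<subseteq> ?R"
      proof
        fix w assume "w \<in> ?L"
        then obtain u v where u: "u \<in> C" "u - x \<in> K" "v \<in> C" "v - y \<in> K" "w = \<Phi> u \<oplus>\<^bsub>M\<^esub> \<Phi> v"
          unfolding set_add_def set_mult_def qe[OF x] qe[OF y] by auto
        have "(u - x) + (v - y) \<in> K" by (rule subspace_add[OF K(1) u(2,4)])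
        then have "(u + v) - (x + y) \<in> K" by (simp add: algebra_simps)
        then show "w \<in> ?R" using u by (auto simp: pres_add C_add)
      qed
      show "?R \<subseteq> ?L"
      proof
        fix w assume "w \<in> ?R"
        then obtain z where z: "z \<in> C" "z - (x + y) \<in> K" "w = \<Phi> z" by auto
          have "w = \<Phi> (z - y) \<oplus>\<^bsub>M\<^esub> \<Phi> y"
            using y z by (simp add: pres_add C_diff)
          moreover have "\<Phi> (z - y) \<in> ?q x" "\<Phi> y \<in> ?q y"
            unfolding qe[OF x] qe[OF y] using y z K0 C_diff[OF z(1) y]
            by (auto simp: algebra_simps)
          ultimately show "w \<in> ?L" unfolding set_add_def set_mult_def by auto
      qed
    qed
    then show ?thesis unfolding qe[OF C_add[OF x y]] .
  qed
  have scale: "(\<Union>w\<in>?q x. \<Phi> ` K +>\<^bsub>M\<^esub> (r \<odot>\<^bsub>M\<^esub> w)) = ?q (scl r x)" if x: "x \<in> C" for x r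
  proof -
    have "\<Phi> ` K +>\<^bsub>M\<^esub> (r \<odot>\<^bsub>M\<^esub> w) = ?q (scl r x)" if w: "w \<in> ?q x" for w
    proof -
      obtain u where u: "u \<in> C" "u - x \<in> K" "w = \<Phi> u" using w unfolding qe[OF x] by auto
      have "scl r u - scl r x \<in> K" using subspace_scale[OF K(1) u(2), of r] by (simp add: scale_right_diff_distrib)
      then show ?thesis
        unfolding u(3) pres_scale[OF u(1)] by (subst coset_eq_iff[OF K(1-3) C_scale C_scale]) (simp_all add: u x)
    qed
    moreover have "\<Phi> x \<in> ?q x" unfolding qe[OF x] using x K0 by auto
    ultimately show ?thesis by blast
  qed
  have zero: "\<Phi> ` K = ?q 0"
    using K(3) by (subst qe) auto
  have "a_rcosets\<^bsub>M\<^esub> (\<Phi> ` K) = (\<lambda>w. \<Phi> ` K +>\<^bsub>M\<^esub> w) ` carrier M"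
    by (auto simp: A_RCOSETS_def RCOSETS_def a_r_coset_def)
  then have carr: "a_rcosets\<^bsub>M\<^esub> (\<Phi> ` K) = ?q ` C" unfolding carrier_eq image_image .
  show ?thesis
    unfolding quotient_algebra_def carr
    using K add scale zero coset_eq_iff[OF K(1-3)]
    by unfold_locales
      (auto simp: cp_add cp_scale cp_cp cp_C finite_cp sum_cp[symmetric] sub_C pres_homog)
qed

lemma pres_color_graded_algebra:
  assumes mult: "\<And>x y. x \<in> C \<Longrightarrow> y \<in> C \<Longrightarrow> \<Phi> x \<otimes>\<^bsub>M\<^esub> \<Phi> y = \<Phi> (br x y)"
    and closed: "\<And>x y. x \<in> C \<Longrightarrow> y \<in> C \<Longrightarrow> br x y \<in> C"
    and add: "\<And>x y z. x \<in> C \<Longrightarrow> y \<in> C \<Longrightarrow> z \<in> C \<Longrightarrow> br (x + y) z = br x z + br y z"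
      "\<And>x y z. x \<in> C \<Longrightarrow> y \<in> C \<Longrightarrow> z \<in> C \<Longrightarrow> br z (x + y) = br z x + br z y"
    and scale: "\<And>r x y. x \<in> C \<Longrightarrow> y \<in> C \<Longrightarrow> br (scl r x) y = scl r (br x y)"
      "\<And>r x y. x \<in> C \<Longrightarrow> y \<in> C \<Longrightarrow> br x (scl r y) = scl r (br x y)"
    and hom: "\<And>\<kappa> \<mu> x y. x \<in> C \<Longrightarrow> y \<in> C \<Longrightarrow> cp \<kappa> x = x \<Longrightarrow> cp \<mu> y = y \<Longrightarrow> cp (\<kappa> + \<mu>) (br x y) = br x y"
  shows "color_graded_algebra M"
  using pres_graded_space
proof (rule color_graded_algebra.intro, unfold_locales)
  fix x y \<kappa> \<mu> assume "x \<in> homog M \<kappa>" "y \<in> homog M \<mu>"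
  then show "x \<otimes>\<^bsub>M\<^esub> y \<in> homog M (\<kappa> + \<mu>)"
    by (auto simp: pres_homog mult intro!: imageI closed hom)
qed (auto simp: carrier_eq mult pres_add pres_scale C_add C_scale closed add scale)

end

section \<open>The bracket on graded operators\<close>

context weyl_char0
begin

text \<open>The bilinear extension of \<open>cad\<close> in its first argument.\<close>
definition br :: "('f expo, 'f) lop \<Rightarrow> ('f expo, 'f) lop \<Rightarrow> ('f expo, 'f) lop" where
  "br S T = (\<Sum>\<kappa> | cpt \<kappa> S \<noteq> 0. cad \<kappa> (cpt \<kappa> S) T)"

lemma finite_cpt: "T \<in> graded_ops \<Longrightarrow> finite {\<kappa>. cpt \<kappa> T \<noteq> 0}"
  and sum_cpt: "T \<in> graded_ops \<Longrightarrow> (\<Sum>\<kappa> | cpt \<kappa> T \<noteq> 0. cpt \<kappa> T) = T"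
  using graded_ops_decomp by auto

lemma graded_subspace: "ops.subspace graded_ops" by (simp add: graded_ops_def)
lemma br_superset: "finite K \<Longrightarrow> {\<kappa>. cpt \<kappa> S \<noteq> 0} \<subseteq> K \<Longrightarrow> br S T = (\<Sum>\<kappa>\<in>K. cad \<kappa> (cpt \<kappa> S) T)"
  unfolding br_def by (rule sum.mono_neutral_left) auto

lemma br_add_left:
  assumes "S \<in> graded_ops" "R \<in> graded_ops"
  shows "br (S + R) T = br S T + br R T"
proof -
  let ?K = "{\<kappa>. cpt \<kappa> S \<noteq> 0} \<union> {\<kappa>. cpt \<kappa> R \<noteq> 0}"
  have K: "finite ?K" using assms by (simp add: finite_cpt)
  have "br (S + R) T = (\<Sum>\<kappa>\<in>?K. cad \<kappa> (cpt \<kappa> (S + R)) T)"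
    by (rule br_superset[OF K]) (auto simp: comp_add)
  moreover have "br S T = (\<Sum>\<kappa>\<in>?K. cad \<kappa> (cpt \<kappa> S) T)" "br R T = (\<Sum>\<kappa>\<in>?K. cad \<kappa> (cpt \<kappa> R) T)"
    by (rule br_superset[OF K]; auto)+
  ultimately show ?thesis by (simp add: comp_add cad_add_left sum.distrib)
qed

lemma br_add_right: "br S (T + R) = br S T + br S R" by (simp add: br_def cad_add sum.distrib)
lemma br_smul_right: "br S (r \<star> T) = r \<star> br S T" by (simp add: br_def cad_smul ops.scale_sum_right)

lemma br_smul_left: "S \<in> graded_ops \<Longrightarrow> br (r \<star> S) T = r \<star> br S T"
  by (subst br_superset[OF finite_cpt[of S]])
    (auto simp: comp_smul cad_smul_left ops.scale_sum_right br_def)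

lemma br_hom: "homg \<kappa> S \<Longrightarrow> br S T = cad \<kappa> S T"
  by (subst br_superset[of "{\<kappa>}"]) (auto simp: comp_hom)

lemma br_closed:
  assumes K: "ops.subspace K" "\<And>\<kappa>. cpt \<kappa> S \<in> K'" "\<And>\<kappa> R. R \<in> K' \<Longrightarrow> homg \<kappa> R \<Longrightarrow> cad \<kappa> R T \<in> K"
  shows "br S T \<in> K"
  unfolding br_def by (intro ops.subspace_sum[OF K(1)] K(3) K(2) hom_comp)

lemma br_unit_left: "S \<in> Nset \<Longrightarrow> T \<in> graded_ops \<Longrightarrow> br S T = 0"
proof -
  assume S: "S \<in> Nset" and T: "T \<in> graded_ops"
  obtain r where r: "S = r \<star> idop" using S by (auto simp: N_iff)
  have "br S T = cad 0 S T" unfolding r by (intro br_hom hom_smul hom_unit)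
  also have "\<dots> = 0" unfolding r using graded_ops_unit[OF T] sig_0[OF T] by (simp add: cad_def)
  finally show ?thesis .
qed

lemma br_unit_right: "T \<in> Nset \<Longrightarrow> br S T = 0"
  by (auto simp: N_iff br_def cad_smul cad_unit)

lemma CC_br: "CC = ops.span {br S T |S T. S \<in> Wset \<and> T \<in> Wset}"
proof -
  have 1: "cad \<kappa> S T \<in> {br S T |S T. S \<in> Wset \<and> T \<in> Wset}" if "S \<in> Wset" "homg \<kappa> S" "T \<in> Wset" for \<kappa> S T
    using that br_hom[OF that(2), of T] by (intro CollectI exI[of _ S] exI[of _ T]) simp
  have 2: "br S T \<in> CC" if "S \<in> Wset" "T \<in> Wset" for S T
    by (rule br_closed[of CC _ Wset]) (use that in \<open>auto simp: CC_def[symmetric] W_comp CC_I\<close>, simp add: CC_def)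
  show ?thesis
  proof
    show "CC \<subseteq> ops.span {br S T |S T. S \<in> Wset \<and> T \<in> Wset}"
      unfolding CC_def using 1 by (intro ops.span_mono) blast
    show "ops.span {br S T |S T. S \<in> Wset \<and> T \<in> Wset} \<subseteq> CC"
      using 2 by (intro ops.span_minimal) (auto simp: CC_def)
  qed
qed

section \<open>Transfer to the record structures\<close>

text \<open>The preimage in \<open>C\<close> of an ideal of \<open>M\<close> is a color ideal containing \<open>N\<close>; the color components of \<open>M\<close> are the images
  of those of \<open>C\<close>.\<close>
lemma weyl_transfer:
  assumes pres: "presentation (\<star>) cpt C N \<Phi> M" and C: "C \<subseteq> graded_ops"
    and mult: "\<And>S T. S \<in> C \<Longrightarrow> T \<in> C \<Longrightarrow> \<Phi> S \<otimes>\<^bsub>M\<^esub> \<Phi> T = \<Phi> (br S T)"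
    and closed: "\<And>\<kappa> S T. S \<in> C \<Longrightarrow> homg \<kappa> S \<Longrightarrow> T \<in> C \<Longrightarrow> cad \<kappa> S T \<in> C"
  shows "lie_color_algebra (eps D) M"
    and "(\<And>U. color_ideal C U \<Longrightarrow> N \<subseteq> U \<Longrightarrow> U \<noteq> N \<Longrightarrow> U = C) \<Longrightarrow>
      (\<exists>\<kappa> S T \<mu>. S \<in> C \<and> homg \<kappa> S \<and> T \<in> C \<and> homg \<mu> T \<and> cad \<kappa> S T \<notin> N) \<Longrightarrow>
      simple_lie_color_algebra (eps D) M"
proof -
  interpret pr: presentation "(\<star>)" cpt C N \<Phi> M by (rule pres)
  have br_C: "br S T \<in> C" if "S \<in> C" "T \<in> C" for S T
    by (rule br_closed[OF pr.sub_C, of _ C]) (use that in \<open>auto intro: pr.cp_C closed\<close>)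
  have gr: "S \<in> graded_ops" if "S \<in> C" for S using C that by blast
  have cga: "color_graded_algebra M"
    by (rule pr.pres_color_graded_algebra[where br = br])
      (auto simp: mult br_C br_add_left br_add_right br_smul_left br_smul_right gr br_hom
         hom_iff_comp[symmetric] hom_cad)
  show lie: "lie_color_algebra (eps D) M"
    using bichar cga
  proof (rule lie_color_algebra.intro, unfold_locales)
    fix a b \<alpha> \<beta> assume "a \<in> homog M \<alpha>" "b \<in> homog M \<beta>"
    then obtain S T where S: "S \<in> C" "homg \<alpha> S" "a = \<Phi> S" and T: "T \<in> C" "homg \<beta> T" "b = \<Phi> T"
      by (auto simp: pr.pres_homog hom_iff_comp)
    have "\<Phi> S \<otimes>\<^bsub>M\<^esub> \<Phi> T = \<Phi> (- (eps D \<alpha> \<beta> \<star> cad \<beta> T S))"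
      using cad_skew[OF S(2) T(2)] S T by (simp add: mult br_hom)
    then show "a \<otimes>\<^bsub>M\<^esub> b = \<ominus>\<^bsub>M\<^esub> (eps D \<alpha> \<beta> \<odot>\<^bsub>M\<^esub> (b \<otimes>\<^bsub>M\<^esub> a))"
      using S T by (simp add: mult br_hom pr.pres_scale pr.pres_neg closed pr.C_scale)
    fix c \<gamma> assume "c \<in> homog M \<gamma>"
    then obtain R where R: "R \<in> C" "homg \<gamma> R" "c = \<Phi> R"
      by (auto simp: pr.pres_homog hom_iff_comp)
    have "\<Phi> (cad \<alpha> S (cad \<beta> T R)) = \<Phi> (cad (\<alpha> + \<beta>) (cad \<alpha> S T) R + eps D \<alpha> \<beta> \<star> cad \<beta> T (cad \<alpha> S R))"
      using cad_jacobi[OF S(2) T(2) gr[OF R(1)]] by simp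
    then show "a \<otimes>\<^bsub>M\<^esub> (b \<otimes>\<^bsub>M\<^esub> c) = ((a \<otimes>\<^bsub>M\<^esub> b) \<otimes>\<^bsub>M\<^esub> c) \<oplus>\<^bsub>M\<^esub> (eps D \<alpha> \<beta> \<odot>\<^bsub>M\<^esub> (b \<otimes>\<^bsub>M\<^esub> (a \<otimes>\<^bsub>M\<^esub> c)))"
      using S T R hom_cad[OF S(2) T(2)]
      by (simp add: mult br_hom closed pr.pres_scale pr.pres_add pr.C_scale)
  qed
  assume simple: "\<And>U. color_ideal C U \<Longrightarrow> N \<subseteq> U \<Longrightarrow> U \<noteq> N \<Longrightarrow> U = C"
  assume "\<exists>\<kappa> S T \<mu>. S \<in> C \<and> homg \<kappa> S \<and> T \<in> C \<and> homg \<mu> T \<and> cad \<kappa> S T \<notin> N"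
  then obtain \<kappa> S T where S: "S \<in> C" "homg \<kappa> S" "T \<in> C" "cad \<kappa> S T \<notin> N" by blast
  have "\<Phi> S \<otimes>\<^bsub>M\<^esub> \<Phi> T \<noteq> \<zero>\<^bsub>M\<^esub>"
    using S by (simp add: mult br_hom pr.pres_zero_iff closed)
  then have nonab: "\<exists>x\<in>carrier M. \<exists>y\<in>carrier M. x \<otimes>\<^bsub>M\<^esub> y \<noteq> \<zero>\<^bsub>M\<^esub>"
    using S by (auto simp: pr.carrier_eq)
  have "V = {\<zero>\<^bsub>M\<^esub>} \<or> V = carrier M" if V: "lie_color_ideal M V" for V
  proof -
    have V1: "subspace_of M V" and V2: "\<And>x \<kappa>. x \<in> V \<Longrightarrow> color_component M x \<kappa> \<in> V"
      and V3: "\<And>x u. x \<in> carrier M \<Longrightarrow> u \<in> V \<Longrightarrow> x \<otimes>\<^bsub>M\<^esub> u \<in> V"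
      using V by (auto simp: lie_color_ideal_def graded_subspace_def)
    interpret V: submodule V "ring_of_type_algebra :: 'f ring" M by (rule V1)
    define U where "U = {x \<in> C. \<Phi> x \<in> V}"
    have VU: "V = \<Phi> ` U" using V.subset by (auto simp: U_def pr.carrier_eq)
    have "color_ideal C U"
      unfolding color_ideal_def
    proof (intro conjI ballI allI impI)
      show "ops.subspace U" unfolding U_def by (rule pr.lin.subspace_preimage[OF V1])
      show "U \<subseteq> C" by (auto simp: U_def)
      fix T assume T: "T \<in> U"
      then show "cpt \<kappa> T \<in> U" for \<kappa>
        using V2[of "\<Phi> T" \<kappa>] by (simp add: U_def pr.color_component_eq pr.cp_C)
    next
      fix \<kappa> S T assume "S \<in> C" "homg \<kappa> S" "T \<in> U"
      then show "cad \<kappa> S T \<in> U"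
        using V3[of "\<Phi> S" "\<Phi> T"] by (simp add: U_def pr.carrier_eq mult br_hom closed)
    qed
    moreover have "N \<subseteq> U"
    proof
      fix n assume n: "n \<in> N"
      then have "n \<in> C" using pr.N_C by blast
      moreover have "\<Phi> n = \<zero>\<^bsub>M\<^esub>" using pr.pres_zero_iff[OF \<open>n \<in> C\<close>] n by simp
      ultimately show "n \<in> U" using V.one_closed by (simp add: U_def)
    qed
    ultimately consider "U = N" | "U = C" using simple by blast
    then show ?thesis
    proof cases
      case 1
      have "\<Phi> n = \<zero>\<^bsub>M\<^esub>" if "n \<in> N" for n using pr.pres_zero_iff[of n] that pr.N_C by blast
      then have "V = {\<zero>\<^bsub>M\<^esub>}" using V.one_closed unfolding VU 1 by auto
      then show ?thesis ..
    next
      case 2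
      then show ?thesis by (simp add: VU pr.carrier_eq)
    qed
  qed
  then show "simple_lie_color_algebra (eps D) M"
    using lie nonab by (simp add: simple_lie_color_algebra_def)
qed

section \<open>The algebras of generalized Weyl and Witt type\<close>

abbreviation (input) "A \<equiv> A_alg D"

text \<open>The operators of the typed ring as elements of \<open>End_A D\<close>, where functions are undefined off the carrier.\<close>
definition rep :: "('f expo, 'f) lop \<Rightarrow> 'f oper" where
  "rep T = (\<lambda>u\<in>carrier (A_alg D). app T u)"

lemma A_sel:
  "carrier A = {u. Poly_Mapping.keys u \<subseteq> Bset}" "u \<oplus>\<^bsub>A\<^esub> v = u + v" "r \<odot>\<^bsub>A\<^esub> u = scale r u"
  "\<zero>\<^bsub>A\<^esub> = 0" "u \<otimes>\<^bsub>A\<^esub> v = A_mult D u v"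
  by (simp_all add: A_alg_def Bset_def)

lemma A_closed:
  "u \<in> carrier A \<Longrightarrow> v \<in> carrier A \<Longrightarrow> u + v \<in> carrier A"
  "u \<in> carrier A \<Longrightarrow> scale r u \<in> carrier A" "0 \<in> carrier A"
  using keys_add[of u v] keys_scale_subset[of r u] by (auto simp: A_sel)

lemma bvec_carrier: "bvec y \<in> carrier A"
  by (cases "y \<in> Bset") (simp_all add: A_sel bvec_in bvec_out)

lemma app_carrier:
  assumes T: "T \<in> graded_ops" and u: "u \<in> carrier A"
  shows "app T u \<in> carrier A"
proof -
  have "scale (Poly_Mapping.lookup u x) (app T (Poly_Mapping.single x 1)) \<in> carrier A" if "x \<in> Poly_Mapping.keys u" for x
  proof (rule A_closed(2))
    have "x \<in> Bset" using u that by (auto simp: A_sel)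
    then show "app T (Poly_Mapping.single x 1) \<in> carrier A"
      using graded_ops_keys[OF T, of x] by (simp add: A_sel bvec_in)
  qed
  then have "(\<Sum>x\<in>K. scale (Poly_Mapping.lookup u x) (app T (Poly_Mapping.single x 1))) \<in> carrier A"
    if "K \<subseteq> Poly_Mapping.keys u" for K
    using that by (induction K rule: infinite_finite_induct) (auto simp: A_closed)
  from this[OF order_refl] show ?thesis by (simp add: app_expand[symmetric])
qed

lemma rep_app: "u \<in> carrier A \<Longrightarrow> rep T u = app T u" by (simp add: rep_def)

lemma rep_carrier: "T \<in> graded_ops \<Longrightarrow> rep T \<in> carrier (End_A D)"
  by (auto simp: end_alg_def rep_def app_carrier A_closed A_sel(2,3) app_add app_scale)

lemma rep_times: "T \<in> graded_ops \<Longrightarrow> rep S \<otimes>\<^bsub>End_A D\<^esub> rep T = rep (S * T)"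
  by (auto simp: end_alg_def rep_def compose_def fun_eq_iff app_carrier)

lemma rep_add: "rep S \<oplus>\<^bsub>End_A D\<^esub> rep T = rep (S + T)"
  by (auto simp: end_alg_def rep_def fun_eq_iff A_sel(2))

lemma rep_smul: "r \<odot>\<^bsub>End_A D\<^esub> rep T = rep (r \<star> T)"
  by (auto simp: end_alg_def rep_def fun_eq_iff A_sel(3))

lemma rep_zero: "\<zero>\<^bsub>End_A D\<^esub> = rep 0"
  by (auto simp: end_alg_def rep_def fun_eq_iff A_sel(4))

lemma unit_carrier: "u \<in> carrier A \<Longrightarrow> app idop u = u"
proof -
  assume u: "u \<in> carrier A"
  have "app idop (Poly_Mapping.single x 1) = Poly_Mapping.single x 1" if "x \<in> Poly_Mapping.keys u" for x
  proof -
    have "x \<in> Bset" using u that by (auto simp: A_sel)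
    then show ?thesis by (simp add: idop_def Q_def)
  qed
  then have "app idop u = (\<Sum>x\<in>Poly_Mapping.keys u. scale (Poly_Mapping.lookup u x) (Poly_Mapping.single x 1))"
    by (subst app_expand) (intro sum.cong refl, simp)
  then show ?thesis by (simp add: sum_single_coeffs[symmetric])
qed

lemma rep_one: "\<one>\<^bsub>End_A D\<^esub> = rep idop"
  by (auto simp: end_alg_def rep_def fun_eq_iff unit_carrier)

lemma rep_inj: "S \<in> graded_ops \<Longrightarrow> T \<in> graded_ops \<Longrightarrow> rep S = rep T \<longleftrightarrow> S = T"
  using graded_ops_eqI[of S T] rep_app[OF bvec_carrier] by metis

lemma rep_neg: "T \<in> graded_ops \<Longrightarrow> \<ominus>\<^bsub>End_A D\<^esub> rep T = rep (- T)"
proof -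
  assume T: "T \<in> graded_ops"
  have nT: "- T \<in> graded_ops" using T by (rule ops.subspace_neg[OF graded_subspace])
  have "S = rep (- T)" if S: "S \<in> carrier (End_A D)" "rep T \<oplus>\<^bsub>End_A D\<^esub> S = \<zero>\<^bsub>End_A D\<^esub>" for S
  proof
    fix u show "S u = rep (- T) u"
    proof (cases "u \<in> carrier A")
      case True
      then have "app T u + S u = 0" using fun_cong[OF S(2), of u] by (simp add: end_alg_def A_sel(2,4) rep_app)
      then show ?thesis using True by (simp add: rep_app eq_neg_iff_add_eq_0 add.commute)
    next
      case False
      then show ?thesis using S(1) by (auto simp: end_alg_def rep_def PiE_def extensional_def)
    qed
  qed
  then show ?thesis
    unfolding a_inv_def m_inv_def
    by (intro the_equality) (auto simp: rep_add rep_zero rep_carrier[OF nT])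
qed

lemma rep_linear: "linear_map_into (\<star>) graded_ops rep (End_A D)"
  by unfold_locales (simp_all add: graded_subspace rep_carrier rep_add rep_smul rep_zero rep_neg)

subsection \<open>The generators\<close>

lemma rep_Mx: "(a, i) \<in> Bset \<Longrightarrow> x_op D a i = rep (Mx (a, i))"
proof -
  assume B: "(a, i) \<in> Bset"
  have "A_mult D (xmon D a i) u = app (Mx (a, i)) u" if u: "u \<in> carrier A" for u
  proof -
    have x: "xmon D a i = Poly_Mapping.single (a, i) 1" using B by (auto simp: xmon_def Bset_def)
    have "app (Mx (a, i)) u = (\<Sum>y\<in>Poly_Mapping.keys u. scale (Poly_Mapping.lookup u y)
        (scale (mult_coeff D (a, i) y) (bvec ((a, i) + y))))"
      unfolding Mx_def app_of_cols using u B by (intro sum.cong refl) (auto simp: A_sel)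
    moreover have "A_mult D (xmon D a i) u = (\<Sum>y\<in>Poly_Mapping.keys u. scale (Poly_Mapping.lookup u y)
        (scale (mult_coeff D (a, i) y) (bvec ((a, i) + y))))"
      unfolding A_mult_def x by (auto simp: bvec_def intro!: sum.cong)
    ultimately show ?thesis by simp
  qed
  then show ?thesis by (auto simp: x_op_def rep_def fun_eq_iff A_sel(5))
qed

lemma rep_dl: "del_op D p = rep (dl p)"
proof -
  have "deriv D p u = app (dl p) u" if u: "u \<in> carrier A" for u
    unfolding dl_def app_of_cols deriv_def using u by (intro sum.cong refl) (auto simp: A_sel)
  then show ?thesis by (auto simp: del_op_def rep_def fun_eq_iff)
qed

lemma rep_epow: "T \<in> graded_ops \<Longrightarrow> rep T [^]\<^bsub>End_A D\<^esub> n = rep (epow T n)"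
  by (induction n) (simp_all add: nat_pow_def rep_one rep_times)

lemma rep_dpow: "del_pow D \<mu> = rep (dpow \<mu>)"
proof -
  have gr: "dprod \<mu> ps \<in> graded_ops" if "set ps \<subseteq> {1..k}" "distinct ps" for ps
    using hom_dprod[OF that] by (rule graded_ops_hom)
  have "foldr (\<lambda>p T. (del_op D p [^]\<^bsub>End_A D\<^esub> \<mu> p) \<otimes>\<^bsub>End_A D\<^esub> T) ps \<one>\<^bsub>End_A D\<^esub> = rep (dprod \<mu> ps)"
    if "set ps \<subseteq> {1..k}" "distinct ps" for ps
    using that
  proof (induction ps)
    case (Cons p ps)
    then have "dl p \<in> graded_ops" by (intro graded_ops_hom[OF hom_dl]) simp
    then show ?case using Cons gr[of ps] by (simp add: rep_dl rep_epow rep_times)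
  qed (simp add: rep_one)
  from this[of "[1..<k + 1]"] show ?thesis unfolding del_pow_def dpow_def by fastforce
qed

lemma rep_mono: "(a, i) \<in> Bset \<Longrightarrow> weyl_mon D a i \<mu> = rep (mono (a, i) \<mu>)"
  by (simp add: weyl_mon_def rep_Mx rep_dpow mono_def rep_times[OF graded_ops_hom[OF hom_dpow]])

lemma weyl_color_mcol: "weyl_color D a i \<mu> = mcol (a, i) \<mu>"
  by (simp add: weyl_color_def mcol_def xcol_def)

end

context presentation
begin

lemma presentation_update_mult: "presentation scl cp C N \<Phi> (M\<lparr>monoid.mult := f\<rparr>)"
  by unfold_locales
    (simp_all add: cp_add cp_scale cp_cp cp_C cp_N finite_cp sum_cp[symmetric] sub_C sub_N N_C carrier_eq
      eq_iff pres_add pres_scale pres_zero pres_homog)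

end

context weyl_char0
begin

lemma weyl_mon_image:
  "{weyl_mon D a i \<mu> |a i \<mu>. a \<in> Grp D \<and> i \<in> Jset D \<and> \<mu> \<in> Mset D \<and> P (weyl_color D a i \<mu>)} =
   rep ` {mono x \<mu> |x \<mu>. x \<in> Bset \<and> \<mu> \<in> Mset D \<and> P (mcol x \<mu>)}" (is "?L = ?R")
proof
  show "?L \<subseteq> ?R"
  proof
    fix w assume "w \<in> ?L"
    then obtain a i \<mu> where h: "w = weyl_mon D a i \<mu>" "a \<in> Grp D" "i \<in> Jset D" "\<mu> \<in> Mset D" "P (weyl_color D a i \<mu>)"
      by (elim CollectE exE conjE)
    then have B: "(a, i) \<in> Bset" by (simp add: Bset_def)
    show "w \<in> ?R"
      unfolding h(1) rep_mono[OF B]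
      using B h(4,5) by (intro imageI CollectI exI[of _ "(a, i)"] exI[of _ \<mu>] conjI) (simp_all add: weyl_color_mcol)
  qed
  show "?R \<subseteq> ?L"
  proof
    fix w assume "w \<in> ?R"
    then obtain x \<mu> where h: "w = rep (mono x \<mu>)" "x \<in> Bset" "\<mu> \<in> Mset D" "P (mcol x \<mu>)"
      by (elim imageE CollectE exE conjE) simp
    obtain a i where x: "x = (a, i)" by (cases x) 
    have "a \<in> Grp D" "i \<in> Jset D" using h(2) by (simp_all add: x Bset_def)
    then show "w \<in> ?L"
      using h rep_mono[of a i \<mu>]
      by (intro CollectI exI[of _ a] exI[of _ i] exI[of _ \<mu>] conjI) (simp_all add: weyl_color_mcol x)
  qed
qed

interpretation rl: linear_map_into "(\<star>)" graded_ops rep "End_A D" by (rule rep_linear)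

lemma weyl_assoc_carrier: "carrier (weyl_assoc D) = rep ` Wset"
proof -
  have "{mono x \<mu> |x \<mu>. x \<in> Bset \<and> \<mu> \<in> Mset D} \<subseteq> graded_ops"
    using W_mono W_graded by blast
  from rl.span_in_image[OF this] show ?thesis
    using weyl_mon_image[where P = "\<lambda>_. True"] by (simp add: weyl_assoc_def Wset_def)
qed

lemma weyl_assoc_homog: "homog (weyl_assoc D) \<kappa> = rep ` {T \<in> Wset. cpt \<kappa> T = T}"
proof -
  have "{mono x \<mu> |x \<mu>. x \<in> Bset \<and> \<mu> \<in> Mset D \<and> mcol x \<mu> = \<kappa>} \<subseteq> graded_ops"
    using W_mono W_graded by blast
  from rl.span_in_image[OF this] show ?thesis
    using weyl_mon_image[where P = "\<lambda>\<mu>. \<mu> = \<kappa>"] by (simp add: weyl_assoc_def W_homog_span[symmetric] hom_iff_comp)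
qed

lemma weyl_assoc_presentation: "presentation (\<star>) cpt Wset {0} rep (weyl_assoc D)"
proof unfold_locales
  show "carrier (weyl_assoc D) = rep ` Wset" by (rule weyl_assoc_carrier)
  show "homog (weyl_assoc D) \<kappa> = rep ` {T \<in> Wset. cpt \<kappa> T = T}" for \<kappa> by (rule weyl_assoc_homog)
qed (simp_all add: comp_add comp_smul comp_comp W_comp finite_cpt sum_cpt W_graded W_subspace
       ops.subspace_single_0 rep_inj rep_add rep_smul rep_zero weyl_assoc_def)

lemma weyl_lie_presentation: "presentation (\<star>) cpt Wset {0} rep (weyl_lie D)"
  unfolding weyl_lie_def commutator_algebra_def
  by (rule presentation.presentation_update_mult[OF weyl_assoc_presentation])

lemma weyl_lie_mult:
  assumes S: "S \<in> Wset" and T: "T \<in> Wset"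
  shows "rep S \<otimes>\<^bsub>weyl_lie D\<^esub> rep T = rep (br S T)"
proof -
  interpret p: presentation "(\<star>)" cpt Wset "{0}" rep "weyl_assoc D" by (rule weyl_assoc_presentation)
  let ?M = "weyl_assoc D"
  have supp: "{\<kappa>. rep (cpt \<kappa> R) \<noteq> \<zero>\<^bsub>?M\<^esub>} = {\<kappa>. cpt \<kappa> R \<noteq> 0}" if "R \<in> Wset" for R
    using p.pres_zero_iff[OF W_comp[OF that]] by simp
  have t: "(rep (cpt \<kappa> S) \<otimes>\<^bsub>?M\<^esub> rep (cpt \<mu> T)) \<ominus>\<^bsub>?M\<^esub> (eps D \<kappa> \<mu> \<odot>\<^bsub>?M\<^esub> (rep (cpt \<mu> T) \<otimes>\<^bsub>?M\<^esub> rep (cpt \<kappa> S)))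
      = rep (cad \<kappa> (cpt \<kappa> S) (cpt \<mu> T))" for \<kappa> \<mu>
  proof -
    have m: "rep R \<otimes>\<^bsub>?M\<^esub> rep R' = rep (R * R')" if "R' \<in> Wset" for R R'
      using rep_times[OF W_graded[OF that]] by (simp add: weyl_assoc_def)
    show ?thesis
      by (simp add: m W_comp S T p.pres_scale p.pres_minus W_mult W_smul cad_hom[OF hom_comp])
  qed
  have inner: "(\<Oplus>\<^bsub>?M\<^esub>\<mu>\<in>{\<mu>. cpt \<mu> T \<noteq> 0}. rep (cad \<kappa> (cpt \<kappa> S) (cpt \<mu> T))) = rep (cad \<kappa> (cpt \<kappa> S) T)" for \<kappa>
    using sum_cpt[OF W_graded[OF T]]
    by (subst p.pres_finsum) (simp_all add: finite_cpt W_graded T W_cad W_comp S cad_sum[symmetric])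
  have "color_commutator (eps D) ?M (rep S) (rep T) =
      (\<Oplus>\<^bsub>?M\<^esub>\<kappa>\<in>{\<kappa>. cpt \<kappa> S \<noteq> 0}. rep (cad \<kappa> (cpt \<kappa> S) T))"
    unfolding color_commutator_def Let_def p.color_component_eq[OF S] p.color_component_eq[OF T]
      supp[OF S] supp[OF T] t inner ..
  also have "\<dots> = rep (br S T)"
    unfolding br_def by (subst p.pres_finsum) (simp_all add: finite_cpt W_graded T W_cad W_comp S)
  finally show ?thesis by (simp add: weyl_lie_def commutator_algebra_def)
qed

subsection \<open>The Witt algebra\<close>

lemma witt_presentation: "presentation (\<star>) cpt WT {0} rep (witt_lie D)"
proof -
  interpret p: presentation "(\<star>)" cpt Wset "{0}" rep "weyl_lie D" by (rule weyl_lie_presentation)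
  have "{x_op D a i \<otimes>\<^bsub>End_A D\<^esub> del_op D p |a i p. a \<in> Grp D \<and> i \<in> Jset D \<and> p \<in> {1..k}} =
      rep ` {Mx x * dl p |x p. x \<in> Bset \<and> p \<in> {1..k}}" (is "?L = ?R")
  proof
    have e: "x_op D a i \<otimes>\<^bsub>End_A D\<^esub> del_op D p = rep (Mx (a, i) * dl p)" if "(a, i) \<in> Bset" "p \<in> {1..k}" for a i p
      using rep_times[OF graded_ops_hom[OF hom_dl[OF that(2)]]] by (simp add: rep_Mx[OF that(1)] rep_dl)
    show "?L \<subseteq> ?R"
    proof
      fix w assume "w \<in> ?L"
      then obtain a i p where h: "w = x_op D a i \<otimes>\<^bsub>End_A D\<^esub> del_op D p" "a \<in> Grp D" "i \<in> Jset D" "p \<in> {1..k}"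
        by (elim CollectE exE conjE)
      then have B: "(a, i) \<in> Bset" by (simp add: Bset_def)
      show "w \<in> ?R"
        unfolding h(1) e[OF B h(4)] using B h(4) by blast
    qed
    show "?R \<subseteq> ?L"
    proof
      fix w assume "w \<in> ?R"
      then obtain x p where h: "w = rep (Mx x * dl p)" "x \<in> Bset" "p \<in> {1..k}"
        by (elim imageE CollectE exE conjE) simp
      obtain a i where x: "x = (a, i)" by (cases x)
      have "a \<in> Grp D" "i \<in> Jset D" using h(2) by (simp_all add: x Bset_def)
      then show "w \<in> ?L"
        using h e[of a i p]
        by (intro CollectI exI[of _ a] exI[of _ i] exI[of _ p] conjI) (simp_all add: x)
    qed
  qed
  moreover have "{Mx x * dl p |x p. x \<in> Bset \<and> p \<in> {1..k}} \<subseteq> Wset"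
    using WT_gen WT_W by blast
  ultimately have "witt_lie D = restrict_algebra (weyl_lie D) (rep ` WT)"
    using p.lin.span_in_image by (simp add: witt_lie_def WT_def)
  then show ?thesis
    using p.presentation_restrict[OF WT_subspace WT_W] by (simp add: WT_comp)
qed

lemma witt_mult: "S \<in> WT \<Longrightarrow> T \<in> WT \<Longrightarrow> rep S \<otimes>\<^bsub>witt_lie D\<^esub> rep T = rep (br S T)"
  using weyl_lie_mult[of S T] WT_W by (auto simp: witt_lie_def restrict_algebra_def)

theorem witt_lie_simple:
  assumes big: "kev > 0 \<or> k4 D > 1"
  shows "simple_lie_color_algebra (eps D) (witt_lie D)"
proof (rule weyl_transfer(2)[OF witt_presentation])
  show "WT \<subseteq> graded_ops" using WT_W W_subset_graded by blast
  show "\<exists>\<kappa> S T \<mu>. S \<in> WT \<and> homg \<kappa> S \<and> T \<in> WT \<and> homg \<mu> T \<and> cad \<kappa> S T \<notin> {0}"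
    using witt_nonabelian[OF big] by simp
qed (use witt_mult WT_cad witt_simple[OF big] in blast)+

subsection \<open>The quotient by the scalars and its derived algebra\<close>

definition rept :: "('f expo, 'f) lop \<Rightarrow> 'f oper set" where
  "rept T = scalars D +>\<^bsub>weyl_lie D\<^esub> rep T"

lemma scalars_eq: "scalars D = rep ` Nset"
  by (auto simp: scalars_def Nset_def rep_one rep_smul)

lemma N_comp: "T \<in> Nset \<Longrightarrow> cpt \<kappa> T \<in> Nset"
  by (auto simp: N_iff comp_smul comp_hom[OF hom_unit] intro: exI[of _ 0])

lemma tilde_presentation: "presentation (\<star>) cpt Wset Nset rept (weyl_tilde D)"
proof -
  interpret p: presentation "(\<star>)" cpt Wset "{0}" rep "weyl_lie D" by (rule weyl_lie_presentation)
  have "{0} \<subseteq> Nset" using ops.subspace_0[OF N_subspace] by simp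
  from p.presentation_quotient[OF N_subspace this N_W N_comp] show ?thesis
    by (simp add: rept_def[abs_def] scalars_eq weyl_tilde_def)
qed

text \<open>Changing the representatives by scalars does not change the bracket, since scalars are central.\<close>
lemma tilde_mult:
  assumes S: "S \<in> Wset" and T: "T \<in> Wset"
  shows "rept S \<otimes>\<^bsub>weyl_tilde D\<^esub> rept T = rept (br S T)"
proof -
  interpret p: presentation "(\<star>)" cpt Wset "{0}" rep "weyl_lie D" by (rule weyl_lie_presentation)
  have q: "rept R = rep ` {R' \<in> Wset. R' - R \<in> Nset}" if "R \<in> Wset" for R
    unfolding rept_def scalars_eq by (rule p.coset_eq[OF N_subspace N_W that])
  have "scalars D +>\<^bsub>weyl_lie D\<^esub> (a \<otimes>\<^bsub>weyl_lie D\<^esub> b) = rept (br S T)" if ab: "a \<in> rept S" "b \<in> rept T" for a b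
  proof -
    obtain S' where S': "S' \<in> Wset" "S' - S \<in> Nset" "a = rep S'" using ab(1) unfolding q[OF S] by blast
    obtain T' where T': "T' \<in> Wset" "T' - T \<in> Nset" "b = rep T'" using ab(2) unfolding q[OF T] by blast
    have "br S' T' = br S T' + br (S' - S) T'"
      using br_add_left[OF W_graded[OF S] W_graded[OF W_diff[OF S'(1) S]], of T'] by simp
    also have "\<dots> = br S T'" using br_unit_left[OF S'(2) W_graded[OF T'(1)]] by simp
    also have "\<dots> = br S T + br S (T' - T)" using br_add_right[of S T "T' - T"] by simp
    also have "\<dots> = br S T" using br_unit_right[OF T'(2)] by simp
    finally show ?thesis using weyl_lie_mult[OF S'(1) T'(1)] by (simp add: S'(3) T'(3) rept_def)
  qed
  moreover have "rep S \<in> rept S" "rep T \<in> rept T"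
    unfolding q[OF S] q[OF T] using S T ops.subspace_0[OF N_subspace] by auto
  ultimately have "(\<Union>a\<in>rept S. \<Union>b\<in>rept T. scalars D +>\<^bsub>weyl_lie D\<^esub> (a \<otimes>\<^bsub>weyl_lie D\<^esub> b)) = rept (br S T)"
    by blast
  then show ?thesis by (simp add: weyl_tilde_def quotient_algebra_def rcoset_mult_def)
qed

lemma L_split: "T \<in> Lset \<Longrightarrow> \<exists>S\<in>CC. T - S \<in> Nset"
proof -
  assume "T \<in> Lset"
  then obtain S R where "T = S + R" "S \<in> ops.span CC" "R \<in> ops.span Nset"
    unfolding Lset_def ops.span_Un by blast
  moreover have "ops.span CC = CC" "ops.span Nset = Nset"
    using N_subspace by (simp_all add: CC_def)
  ultimately show ?thesis by (intro bexI[of _ S]) simp_all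
qed

lemma rept_L: "rept ` CC = rept ` Lset"
proof -
  interpret p: presentation "(\<star>)" cpt Wset Nset rept "weyl_tilde D" by (rule tilde_presentation)
  have "rept T \<in> rept ` CC" if T: "T \<in> Lset" for T
  proof -
    obtain S where S: "S \<in> CC" "T - S \<in> Nset" using L_split[OF T] by blast
    then have "rept T = rept S" using T L_W CC_W by (subst p.eq_iff) auto
    then show ?thesis using S(1) by blast
  qed
  then show ?thesis using L_CC by blast
qed

text \<open>Brackets of cosets are cosets of brackets, and modulo scalars \<open>CC\<close> and \<open>Lset\<close> have the same image.\<close>
lemma weyl_bar_eq: "weyl_bar D = restrict_algebra (weyl_tilde D) (rept ` Lset)"
proof -
  interpret p: presentation "(\<star>)" cpt Wset Nset rept "weyl_tilde D" by (rule tilde_presentation)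
  have "{x \<otimes>\<^bsub>weyl_tilde D\<^esub> y |x y. x \<in> carrier (weyl_tilde D) \<and> y \<in> carrier (weyl_tilde D)} =
     rept ` {br S T |S T. S \<in> Wset \<and> T \<in> Wset}" (is "?L = ?R")
  proof
    show "?L \<subseteq> ?R"
    proof
      fix w assume "w \<in> ?L"
      then obtain S T where "S \<in> Wset" "T \<in> Wset" "w = rept S \<otimes>\<^bsub>weyl_tilde D\<^esub> rept T"
        unfolding p.carrier_eq by blast
      then show "w \<in> ?R"
        by (intro image_eqI[of _ _ "br S T"] CollectI exI[of _ S] exI[of _ T]) (simp_all add: tilde_mult)
    qed
    show "?R \<subseteq> ?L"
    proof
      fix w assume "w \<in> ?R"
      then obtain S T where "S \<in> Wset" "T \<in> Wset" "w = rept (br S T)" by blast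
      then show "w \<in> ?L"
        by (intro CollectI exI[of _ "rept S"] exI[of _ "rept T"]) (simp add: tilde_mult p.carrier_eq)
    qed
  qed
  note products = this
  have "{br S T |S T. S \<in> Wset \<and> T \<in> Wset} \<subseteq> Wset"
    by (rule subset_trans[OF ops.span_superset CC_W[unfolded CC_br]])
  from p.lin.span_in_image[OF this] show ?thesis
    unfolding weyl_bar_def derived_algebra_def products CC_br[symmetric] rept_L by (rule arg_cong)
qed

lemma CC_comp: "T \<in> CC \<Longrightarrow> cpt \<kappa> T \<in> CC"
  unfolding CC_def
proof (induction T rule: ops.span_induct_alt)
  case (step c S T)
  then obtain \<mu> R R' where R: "S = cad \<mu> R R'" "R \<in> Wset" "homg \<mu> R" "R' \<in> Wset" by blast
  have "cpt \<kappa> S \<in> CC" 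
    using comp_cad[OF R(3) W_graded[OF R(4)], of "\<kappa> - \<mu>"] CC_I[OF R(2,3) W_comp[OF R(4)], of "\<kappa> - \<mu>"]
    by (simp add: R(1))
  then show ?case using step(2) unfolding comp_add comp_smul by (fold CC_def) (intro CC_add CC_smul)
qed (simp only: comp_zero ops.span_zero)

lemma L_comp: "T \<in> Lset \<Longrightarrow> cpt \<kappa> T \<in> Lset"
  unfolding Lset_def
proof (induction T rule: ops.span_induct_alt)
  case (step c S T)
  have "cpt \<kappa> S \<in> Lset"
  proof (cases "S \<in> Nset")
    case True
    then show ?thesis using N_comp L_N by blast
  next
    case False
    then have "S \<in> CC" using step(1) by blast
    then show ?thesis using CC_comp L_CC by blast
  qed
  then show ?case using step(2) unfolding comp_add comp_smul by (fold Lset_def) (intro L_add L_smul)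
qed (simp only: comp_zero ops.span_zero)

lemma bar_presentation: "presentation (\<star>) cpt Lset Nset rept (weyl_bar D)"
proof -
  interpret p: presentation "(\<star>)" cpt Wset Nset rept "weyl_tilde D" by (rule tilde_presentation)
  have "ops.subspace Lset" by (simp add: Lset_def)
  from p.presentation_restrict[OF this L_W L_N L_comp] show ?thesis
    by (simp add: weyl_bar_eq)
qed

lemma bar_mult: "S \<in> Lset \<Longrightarrow> T \<in> Lset \<Longrightarrow> rept S \<otimes>\<^bsub>weyl_bar D\<^esub> rept T = rept (br S T)"
  using tilde_mult[of S T] L_W by (auto simp: weyl_bar_eq restrict_algebra_def)

theorem weyl_bar_simple:
  assumes big: "kev > 0 \<or> k4 D > 1"
  shows "simple_lie_color_algebra (eps D) (weyl_bar D)"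
proof (rule weyl_transfer(2)[OF bar_presentation])
  show "Lset \<subseteq> graded_ops" using L_W W_subset_graded by blast
  show "cad \<kappa> S T \<in> Lset" if "S \<in> Lset" "homg \<kappa> S" "T \<in> Lset" for \<kappa> S T
    using CC_I[of S \<kappa> T] that L_W L_CC by blast
  show "U = Lset" if U: "color_ideal Lset U" "Nset \<subseteq> U" "U \<noteq> Nset" for U
  proof (cases "kev > 0")
    case True
    then show ?thesis using weyl_simple_even[OF True _ U(2,3)] U(1) by (simp add: L_eq_W)
  next
    case False
    then show ?thesis using weyl_simple_odd[OF _ _ U] big by simp
  qed
qed (use bar_mult weyl_nonabelian[OF big] in blast)+

theorem weyl_bar_carrier_even: "kev > 0 \<Longrightarrow> carrier (weyl_bar D) = carrier (weyl_tilde D)"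
  using presentation.carrier_eq[OF bar_presentation] presentation.carrier_eq[OF tilde_presentation]
  by (simp add: L_eq_W)

lemma Greatest_topi:
  assumes "kev = 0"
  shows "(GREATEST n. n \<in> Jset D) = topi" "(GREATEST l. l \<in> Mset D) = topi"
proof -
  have J: "n \<le> topi" if "n \<in> Jset D" for n
    using that assms by (auto simp: Jset_def topi_def le_fun_def)
  have M: "l \<le> topi" if "l \<in> Mset D" for l
    using that assms by (auto simp: Mset_def topi_def le_fun_def)
  show "(GREATEST n. n \<in> Jset D) = topi" using topi_J[OF assms] J by (rule Greatest_equality)
  show "(GREATEST l. l \<in> Mset D) = topi" using topi_M[OF assms] M by (rule Greatest_equality)
qed

theorem weyl_tilde_carrier_odd:
  assumes ev: "kev = 0"
  shows "carrier (weyl_tilde D) = carrier (weyl_bar D) <+>\<^bsub>weyl_tilde D\<^esub>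
     {r \<odot>\<^bsub>weyl_tilde D\<^esub> (scalars D +>\<^bsub>weyl_lie D\<^esub>
        weyl_mon D 0 (GREATEST n. n \<in> Jset D) (GREATEST l. l \<in> Mset D)) |r. True}"
proof -
  interpret p: presentation "(\<star>)" cpt Wset Nset rept "weyl_tilde D" by (rule tilde_presentation)
  have B: "(0, topi) \<in> Bset" using topi_J[OF ev] G_zero by (simp add: Bset_def)
  have W: "topm \<in> Wset" by (rule W_mono[OF B topi_M[OF ev]])
  have sc: "{r \<odot>\<^bsub>weyl_tilde D\<^esub> rept topm |r. True} = {rept (r \<star> topm) |r. True}"
    by (simp add: p.pres_scale[OF W])
  have "rept ` Wset = rept ` Lset <+>\<^bsub>weyl_tilde D\<^esub> {rept (r \<star> topm) |r. True}" (is "_ = ?R")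
  proof
    show "rept ` Wset \<subseteq> ?R"
    proof
      fix w assume "w \<in> rept ` Wset"
      then obtain T where T: "T \<in> Wset" "w = rept T" by blast
      have "\<exists>S\<in>Lset. \<exists>r. T = S + r \<star> topm"
        by (rule W_top_split[OF ev _ _ T(1)]) (use nontop_CC[OF ev] L_CC in \<open>auto simp: Lset_def\<close>)
      then obtain S r where S: "S \<in> Lset" "T = S + r \<star> topm" by blast
      have "w = rept S \<oplus>\<^bsub>weyl_tilde D\<^esub> rept (r \<star> topm)"
        using S L_W W_smul[OF W] by (subst p.pres_add) (auto simp: T(2))
      then show "w \<in> ?R" using S(1) unfolding set_add_def set_mult_def by auto
    qed
    show "?R \<subseteq> rept ` Wset"
    proof
      fix w assume "w \<in> ?R"
      then obtain S r where S: "S \<in> Lset" "w = rept S \<oplus>\<^bsub>weyl_tilde D\<^esub> rept (r \<star> topm)"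
        unfolding set_add_def set_mult_def by auto
      have "S \<in> Wset" using S(1) L_W by blast
      then show "w \<in> rept ` Wset" unfolding S(2) p.pres_add[OF \<open>S \<in> Wset\<close> W_smul[OF W]] by (intro imageI W_add W_smul W)
    qed
  qed
  then show ?thesis
    unfolding Greatest_topi[OF ev] rep_mono[OF B] rept_def[symmetric] sc
      presentation.carrier_eq[OF bar_presentation] p.carrier_eq .
qed

end

theorem theorem3p1:
  fixes D :: "('f::{alg_closed_field, field_char_0}, 'g::ab_group_add) weyl_data"
  assumes "weyl_setup D"
  shows "(k1 D + k2 D + k3 D > 0 \<or> k4 D > 1 \<longrightarrow>
            simple_lie_color_algebra (eps D) (weyl_bar D) \<and>
            simple_lie_color_algebra (eps D) (witt_lie D)) \<and>
         (k1 D + k2 D + k3 D > 0 \<longrightarrow>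
            carrier (weyl_bar D) = carrier (weyl_tilde D)) \<and>
         (k1 D + k2 D + k3 D = 0 \<longrightarrow>
            carrier (weyl_tilde D) =
              carrier (weyl_bar D) <+>\<^bsub>weyl_tilde D\<^esub>
              {r \<odot>\<^bsub>weyl_tilde D\<^esub>
                 (scalars D +>\<^bsub>weyl_lie D\<^esub>
                    weyl_mon D 0 (GREATEST n. n \<in> Jset D) (GREATEST l. l \<in> Mset D)) |r. True})"
proof -
  interpret weyl_char0 D using assms by (rule weyl_char0.intro)
  show ?thesis
    using weyl_bar_simple witt_lie_simple weyl_bar_carrier_even weyl_tilde_carrier_odd by blast
qed

end
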